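(* Let the dimension be $n=2$, let $k\ge1$ be an integer, let $m\ge 0$ be an integer and let $\alpha\in[-m-1,-m)$ (so $\alpha<0$). Define on $(-\infty,\pi)$ $$F(\Theta)=\begin{cases}\lambda_k(\Theta,\alpha/\sinh|\Theta|)\,4\tanh^2(\Theta/2), & \Theta<0,\\ \lambda_k(\mathbb{D},\alpha), & \Theta=0,\\ \lambda_k(\Theta,\alpha/\sin\Theta)\,4\tan^2(\Theta/2), & 0<\Theta<\pi,\end{cases}$$ $$G(\Theta)=\begin{cases}\lambda_k(\Theta,\alpha/\sinh|\Theta|)\,\sinh^2(\Theta), & \Theta<0,\\ \lambda_k(\mathbb{D},\alpha), & \Theta=0,\\ \lambda_k(\Theta,\alpha/\sin\Theta)\,\sin^2(\Theta), & 0<\Theta<\pi.\end{cases}$$ (i) If $k\le 2m+1$, then $F$ is negative, continuous and strictly decreasing on $(-\infty,\pi)$, with $F(\Theta)\to0$ as $\Theta\to-\infty$ and $F(\Theta)\to-\infty$ as $\Theta\to\pi$. If $k\in\{2m+2,2m+3\}$ and $\alpha=-m-1$, then the $k$-th eigenvalue ($\lambda_k(\Theta,\alpha/\sinh|\Theta|)$, $\lambda_k(\mathbb{D},\alpha)$, $\lambda_k(\Theta,\alpha/\sin\Theta)$ for $\Theta<0$, $\Theta=0$, $\Theta>0$ respectively) is $0$ for all $\Theta$, and $F$ is identically zero. In all remaining cases the $k$-th eigenvalue is positive for all $\Theta$, and $F$ is continuous and strictly increasing on $(-\infty,\pi)$ with $F(\Theta)\to 0$ as $\Theta\to-\infty$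 and $F(\Theta)\to\infty$ as $\Theta\to\pi$. (ii) If $k\le 2m+1$, then $G$ is negative, continuous and strictly increasing on $(-\infty,\pi)$, with $G(\Theta)\to-\infty$ as $\Theta\to-\infty$ and $G(\Theta)\to\lambda_k^{\mathrm{ext}}(\mathbb{D},\alpha)$ as $\Theta\to\pi$. If $k\in\{2m+2,2m+3\}$ and $\alpha=-m-1$, then the $k$-th eigenvalue is $0$ for all $\Theta$, and $G$ is identically zero. In all remaining cases the $k$-th eigenvalue is positive for all $\Theta$, and $G$ is continuous and strictly decreasing on $(-\infty,\pi)$ with $G(\Theta)\to\infty$ as $\Theta\to-\infty$ and $G(\Theta)\to0$ as $\Theta\to\pi$.
   Context: For $0<\Theta<\pi$, $C(\Theta)$ denotes the spherical cap of aperture $\Theta$ in the unit sphere $\mathbb{S}^2$ (curvature $1$), i.e. the open geodesic disk of radius $\Theta$ about the north pole. For $\Theta<0$, $C(\Theta)$ denotes an open geodesic disk of radius $|\Theta|$ in the hyperbolic plane $\mathbb{H}^2$ (curvature $-1$). For $\beta\in\mathbb{R}$, $\lambda_1(\Theta,\beta)<\lambda_2(\Theta,\beta)\le\lambda_3(\Theta,\beta)\le\cdots\to\infty$ are the eigenvalues, counted with multiplicity, of the Robin problem $-\Delta u=\lambda u$ in $C(\Theta)$, $\partial u/\partial n+\beta u=0$ on $\partial C(\Theta)$, where $\Delta$ is the Laplace--Beltrami operator of $\mathbb{S}^2$ (if $\Theta>0$) or $\mathbb{H}^2$ (if $\Theta<0$) and $\partial/\partial n$ is the outer unit normal derivative.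 Equivalently, $$\lambda_k(\Theta,\beta)=\min_{\mathcal{L}}\max_{0\ne u\in\mathcal{L}}\frac{\int_{C(\Theta)}|\nabla u|^2\,dA+\beta\int_{\partial C(\Theta)}|u|^2\,dS}{\int_{C(\Theta)}|u|^2\,dA},$$ where $\mathcal{L}$ ranges over $k$-dimensional subspaces of $H^1(C(\Theta))$. $\mathbb{D}\subset\mathbb{R}^2$ is the Euclidean unit disk and $\lambda_k(\mathbb{D},\alpha)$ is its $k$-th Robin eigenvalue (Euclidean Laplacian, same boundary condition with parameter $\alpha$). Exterior Robin problem: $-\Delta u=\lambda u$ in $\mathbb{R}^2\setminus\mathbb{D}$, $\partial_\nu u-\alpha u=0$ on $\partial\mathbb{D}$, where $\nu$ is the unit normal pointing into $\mathbb{R}^2\setminus\mathbb{D}$; it is the self-adjoint operator on $L^2(\mathbb{R}^2\setminus\mathbb{D})$ with quadratic form $\int_{\mathbb{R}^2\setminus\mathbb{D}}|\nabla f|^2\,dA+\alpha\int_{\partial\mathbb{D}}|f|^2\,dS$ on $H^1(\mathbb{R}^2\setminus\mathbb{D})$. Its essential spectrum is $[0,\infty)$, and its negative spectrum consists of discrete eigenvalues. $\lambda_k^{\mathrm{ext}}(\mathbb{D},\alpha)$ denotes the $k$-th negative eigenvalue, in increasing order with multiplicity; when at least $k$ negative eigenvalues exist, it equals $$\min_{\mathcal{L}}\max_{0\ne f\in\mathcal{L}}\frac{\int_{\mathbb{R}^2\setminus\mathbb{D}}|\nabla f|^2\,dA+\alpha\int_{\partial\mathbb{D}}|f|^2\,dS}{\int_{\mathbb{R}^2\setminus\mathbb{D}}|f|^2\,dA}$$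 over $k$-dimensional subspaces $\mathcal{L}$ of $H^1(\mathbb{R}^2\setminus\mathbb{D})$. *)

theory Defs
  imports "HOL-Analysis.Analysis"
begin

text \<open>
  A Riemannian metric on a coordinate domain in the plane is a field \<open>g\<close> of symmetric positive
  definite matrices \<open>(g\<^sub>i\<^sub>j)\<close>. Values of \<open>g\<close> outside the domain under consideration are irrelevant.
  A differential \<open>du\<close> is represented by its vector of partial derivatives, so
  \<open>\<langle>\<nabla>u, \<nabla>v\<rangle> = g\<^sup>i\<^sup>j \<partial>\<^sub>iu \<partial>\<^sub>jv\<close> is \<open>cometric g x (Du x) (Dv x)\<close>, where \<open>g\<^sup>i\<^sup>j\<close> is the inverse matrix.
\<close>

definition cometric :: "(real^2 \<Rightarrow> real^2^2) \<Rightarrow> real^2 \<Rightarrow> real^2 \<Rightarrow> real^2 \<Rightarrow> real" where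
  "cometric g x D E = D \<bullet> (matrix_inv (g x) *v E)"

definition area_measure :: "(real^2 \<Rightarrow> real^2^2) \<Rightarrow> (real^2) set \<Rightarrow> (real^2) measure" where
  "area_measure g U = density (restrict_space lborel U) (\<lambda>x. ennreal (sqrt (det (g x))))"

definition circle_curve :: "real \<Rightarrow> real \<Rightarrow> real^2" where
  "circle_curve \<rho> t = vector [\<rho> * cos t, \<rho> * sin t]"

text \<open>Riemannian arclength on the coordinate circle of Euclidean radius \<open>\<rho>\<close> about the origin.\<close>

definition length_measure :: "(real^2 \<Rightarrow> real^2^2) \<Rightarrow> real \<Rightarrow> (real^2) measure" where
  "length_measure g \<rho> =
     distr
       (density (restrict_space lborel {0..<2*pi})
         (\<lambda>t. let v = vector_derivative (circle_curve \<rho>) (at t)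
              in ennreal (sqrt (v \<bullet> (g (circle_curve \<rho> t) *v v)))))
       borel (circle_curve \<rho>)"

definition C1_compact_support :: "(real^2 \<Rightarrow> real) \<Rightarrow> (real^2 \<Rightarrow> real^2) \<Rightarrow> bool" where
  "C1_compact_support \<phi> D\<phi> \<longleftrightarrow>
     (\<forall>x. GDERIV \<phi> x :> D\<phi> x) \<and> continuous_on UNIV D\<phi> \<and> bounded {x. \<phi> x \<noteq> 0}"

text \<open>
  \<open>H1 g U \<rho> u Du Tu\<close>: the function \<open>u\<close> belongs to \<open>H\<^sup>1(U)\<close>, with weak differential \<open>Du\<close> and
  trace \<open>Tu\<close> on the boundary of \<open>U\<close>, which is the circle of radius \<open>\<rho>\<close>. Here \<open>H\<^sup>1(U)\<close> is the
  closure in the \<open>H\<^sup>1\<close> norm of the functions that are continuously differentiable up to the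
  boundary (and of bounded support, if \<open>U\<close> is unbounded), and the trace is the continuous
  extension of restriction to the boundary. By the trace inequality, convergence in the \<open>H\<^sup>1\<close> norm
  forces the boundary values to converge, so asking for \<open>Tu\<close> does not make the space smaller.
\<close>

definition H1 ::
  "(real^2 \<Rightarrow> real^2^2) \<Rightarrow> (real^2) set \<Rightarrow> real \<Rightarrow>
     (real^2 \<Rightarrow> real) \<Rightarrow> (real^2 \<Rightarrow> real^2) \<Rightarrow> (real^2 \<Rightarrow> real) \<Rightarrow> bool" where
  "H1 g U \<rho> u Du Tu \<longleftrightarrow>
     u \<in> borel_measurable (area_measure g U) \<and>
     Du \<in> borel_measurable (area_measure g U) \<and>
     Tu \<in> borel_measurable (length_measure g \<rho>) \<and>
     (\<exists>\<phi> D\<phi>.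
        (\<forall>n::nat. C1_compact_support (\<phi> n) (D\<phi> n)) \<and>
        (\<lambda>n. \<integral>\<^sup>+x. ennreal ((\<phi> n x - u x)\<^sup>2) \<partial>area_measure g U) \<longlonglongrightarrow> 0 \<and>
        (\<lambda>n. \<integral>\<^sup>+x. ennreal (cometric g x (D\<phi> n x - Du x) (D\<phi> n x - Du x)) \<partial>area_measure g U)
          \<longlonglongrightarrow> 0 \<and>
        (\<lambda>n. \<integral>\<^sup>+x. ennreal ((\<phi> n x - Tu x)\<^sup>2) \<partial>length_measure g \<rho>) \<longlonglongrightarrow> 0)"

text \<open>
  Eigenfunctions of \<open>-\<Delta>u = \<lambda>u\<close> in \<open>U\<close>, \<open>\<partial>u/\<partial>n + \<beta>u = 0\<close> on the boundary (\<open>n\<close> the normal pointing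
  out of \<open>U\<close>), in the weak formulation; equivalently, eigenfunctions of the self-adjoint operator
  with quadratic form \<open>\<integral>\<^sub>U |\<nabla>u|\<^sup>2 dA + \<beta> \<integral>\<^sub>\<partial>\<^sub>U u\<^sup>2 dS\<close> on \<open>H\<^sup>1(U)\<close>.
\<close>

definition robin_eigenfunction ::
  "(real^2 \<Rightarrow> real^2^2) \<Rightarrow> (real^2) set \<Rightarrow> real \<Rightarrow> real \<Rightarrow> real \<Rightarrow> (real^2 \<Rightarrow> real) \<Rightarrow> bool" where
  "robin_eigenfunction g U \<rho> \<beta> \<mu> u \<longleftrightarrow>
     \<not> (AE x in area_measure g U. u x = 0) \<and>
     (\<exists>Du Tu. H1 g U \<rho> u Du Tu \<and>
        (\<forall>v Dv Tv. H1 g U \<rho> v Dv Tv \<longrightarrow>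
           (\<integral>x. cometric g x (Du x) (Dv x) \<partial>area_measure g U)
             + \<beta> * (\<integral>x. Tu x * Tv x \<partial>length_measure g \<rho>)
           = \<mu> * (\<integral>x. u x * v x \<partial>area_measure g U)))"

text \<open>
  There are at least \<open>k\<close> eigenvalues in \<open>S\<close>, counted with multiplicity: linear independence is
  understood modulo equality almost everywhere, and eigenfunctions for different eigenvalues are
  automatically independent.
\<close>

definition robin_count_ge ::
  "(real^2 \<Rightarrow> real^2^2) \<Rightarrow> (real^2) set \<Rightarrow> real \<Rightarrow> real \<Rightarrow> real set \<Rightarrow> nat \<Rightarrow> bool" where
  "robin_count_ge g U \<rho> \<beta> S k \<longleftrightarrow>
     (\<exists>(\<mu> :: nat \<Rightarrow> real) u.
        (\<forall>i<k. \<mu> i \<in> S \<and> robin_eigenfunction g U \<rho> \<beta> (\<mu> i) (u i)) \<and>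
        (\<forall>c :: nat \<Rightarrow> real.
           (AE x in area_measure g U. (\<Sum>i<k. c i * u i x) = 0) \<longrightarrow> (\<forall>i<k. c i = 0)))"

text \<open>The \<open>k\<close>-th eigenvalue, numbered from \<open>k = 1\<close> in increasing order with multiplicity.\<close>

definition robin_eigenvalue ::
  "(real^2 \<Rightarrow> real^2^2) \<Rightarrow> (real^2) set \<Rightarrow> real \<Rightarrow> nat \<Rightarrow> real \<Rightarrow> real" where
  "robin_eigenvalue g U \<rho> k \<beta> = (LEAST \<mu>. robin_count_ge g U \<rho> \<beta> {..\<mu>} k)"

definition robin_negative_eigenvalue ::
  "(real^2 \<Rightarrow> real^2^2) \<Rightarrow> (real^2) set \<Rightarrow> real \<Rightarrow> nat \<Rightarrow> real \<Rightarrow> real" where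
  "robin_negative_eigenvalue g U \<rho> k \<beta> = (LEAST \<mu>. robin_count_ge g U \<rho> \<beta> ({..\<mu>} \<inter> {..<0}) k)"

text \<open>
  Inverse stereographic projection from the south pole onto the unit sphere; the origin goes to
  the north pole \<open>axis 3 1\<close>. The metric below is the one induced from Euclidean 3-space.
\<close>

definition stereo :: "real^2 \<Rightarrow> real^3" where
  "stereo x = (1 / (1 + (norm x)\<^sup>2)) *\<^sub>R vector [2 * x$1, 2 * x$2, 1 - (norm x)\<^sup>2]"

definition sphere_metric :: "real^2 \<Rightarrow> real^2^2" where
  "sphere_metric x =
     (\<chi> i j. frechet_derivative stereo (at x) (axis i 1)
             \<bullet> frechet_derivative stereo (at x) (axis j 1))"

text \<open>The spherical distance of unit vectors \<open>p\<close>, \<open>q\<close> is \<open>arccos (p \<bullet> q)\<close>.\<close>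

definition spherical_cap :: "real \<Rightarrow> (real^2) set" where
  "spherical_cap \<Theta> = {x. arccos (stereo x \<bullet> axis 3 1) < \<Theta>}"

text \<open>The Poincare disk model of the hyperbolic plane of curvature \<open>-1\<close>.\<close>

definition hyperbolic_metric :: "real^2 \<Rightarrow> real^2^2" where
  "hyperbolic_metric x = mat ((2 / (1 - (norm x)\<^sup>2))\<^sup>2)"

text \<open>The hyperbolic distance of \<open>x\<close> from the origin is \<open>2 * artanh (norm x)\<close>.\<close>

definition hyperbolic_disk :: "real \<Rightarrow> (real^2) set" where
  "hyperbolic_disk r = {x. norm x < 1 \<and> 2 * artanh (norm x) < r}"

text \<open>
  \<open>\<lambda>\<^sub>k(\<Theta>, \<beta>)\<close>. In these charts the circles of geodesic radius \<open>r\<close> about the origin have Euclidean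
  radius \<open>tan (r/2)\<close> on the sphere and \<open>tanh (r/2)\<close> in the hyperbolic plane. The value at
  \<open>\<Theta> = 0\<close> has no meaning.
\<close>

definition lambda_cap :: "nat \<Rightarrow> real \<Rightarrow> real \<Rightarrow> real" where
  "lambda_cap k \<Theta> \<beta> =
     (if \<Theta> > 0
      then robin_eigenvalue sphere_metric (spherical_cap \<Theta>) (tan (\<Theta>/2)) k \<beta>
      else robin_eigenvalue hyperbolic_metric (hyperbolic_disk \<bar>\<Theta>\<bar>) (tanh (\<bar>\<Theta>\<bar>/2)) k \<beta>)"

definition flat_metric :: "real^2 \<Rightarrow> real^2^2" where
  "flat_metric x = mat 1"

definition lambda_disk :: "nat \<Rightarrow> real \<Rightarrow> real" where
  "lambda_disk k \<alpha> = robin_eigenvalue flat_metric (ball 0 1) 1 k \<alpha>"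

text \<open>
  The normal pointing out of the exterior domain points into the disk, so \<open>\<partial>\<^sub>\<nu>u - \<alpha>u = 0\<close> is the
  Robin condition with parameter \<open>\<alpha>\<close>.
\<close>

definition lambda_ext :: "nat \<Rightarrow> real \<Rightarrow> real" where
  "lambda_ext k \<alpha> = robin_negative_eigenvalue flat_metric (- cball 0 1) 1 k \<alpha>"

definition scaled_lambda :: "nat \<Rightarrow> real \<Rightarrow> real \<Rightarrow> real" where
  "scaled_lambda k \<alpha> \<Theta> =
     (if \<Theta> < 0 then lambda_cap k \<Theta> (\<alpha> / sinh \<bar>\<Theta>\<bar>)
      else if \<Theta> = 0 then lambda_disk k \<alpha>
      else lambda_cap k \<Theta> (\<alpha> / sin \<Theta>))"

definition F_fun :: "nat \<Rightarrow> real \<Rightarrow> real \<Rightarrow> real" where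
  "F_fun k \<alpha> \<Theta> =
     (if \<Theta> < 0 then lambda_cap k \<Theta> (\<alpha> / sinh \<bar>\<Theta>\<bar>) * (4 * (tanh (\<Theta>/2))\<^sup>2)
      else if \<Theta> = 0 then lambda_disk k \<alpha>
      else lambda_cap k \<Theta> (\<alpha> / sin \<Theta>) * (4 * (tan (\<Theta>/2))\<^sup>2))"

definition G_fun :: "nat \<Rightarrow> real \<Rightarrow> real \<Rightarrow> real" where
  "G_fun k \<alpha> \<Theta> =
     (if \<Theta> < 0 then lambda_cap k \<Theta> (\<alpha> / sinh \<bar>\<Theta>\<bar>) * (sinh \<Theta>)\<^sup>2
      else if \<Theta> = 0 then lambda_disk k \<alpha>
      else lambda_cap k \<Theta> (\<alpha> / sin \<Theta>) * (sin \<Theta>)\<^sup>2)"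

end

theory Submission
 imports Defs "HOL-Library.Function_Algebras" "HOL-Real_Asymp.Real_Asymp"
begin

text \<open>
 The Dirichlet integral is conformally invariant. In a conformal chart, scaled so that the boundary is the
 unit circle, each cap and each hyperbolic disk therefore becomes the Euclidean unit disk with the same
 boundary term \<open>\<alpha> \<integral>u\<^sup>2\<close>, and only the mass changes: its density is a multiple of \<open>(1 + s |z|\<^sup>2)\<close> to the power
 \<open>-2\<close>, where \<open>s\<close> is \<open>tan\<^sup>2(\<Theta>/2)\<close> or \<open>-tanh\<^sup>2(\<Theta>/2)\<close>. So \<open>F\<close> is the \<open>k\<close>-th eigenvalue \<open>f(s)\<close> for this density
 and \<open>G = f(s)/(1 + s)\<^sup>2\<close>. The density decreases in \<open>s\<close>, while \<open>(1 + s)\<^sup>2\<close> times the density increases; by the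
 min-max principle \<open>F\<close> and \<open>G\<close> are strictly monotone in opposite directions, and the two bounds together
 force continuity. The sign is decided by the Steklov eigenvalues \<open>0, 1, 1, 2, 2, \<dots>\<close> of the disk. As \<open>s\<close>
 tends to infinity, the density of \<open>G\<close> tends to \<open>|z|\<close> to the power \<open>-4\<close>, the Jacobian of the inversion
 \<open>z/|z|\<^sup>2\<close>; hence the exterior problem in the limit. For the remaining limits the quotients are estimated
 on harmonic functions from above and, through Steklov's inequality, on their complement from below.
\<close>

text \<open>Eigenvalues are defined by counting independent weak eigenfunctions, so the min-max
  principle has to be derived. This is done abstractly, by successive minimisation, for a boundary
  form that is compact relative to the energy; compactness of the mass enters only at nonnegative
  levels. One argument thus covers the bounded domains and the negative spectrum of the exterior
  domain. Membership in \<open>H1\<close> is a statement about approximating sequences; inequalities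
  are therefore proved for smooth functions and extended by density. The trace and mass estimates on
  the disk all come from the divergence theorem for fields \<open>a(|z|^2) u^2 z\<close> with a
  radial multiplier \<open>a\<close> chosen for the purpose. Compactness rests on Steklov's
  inequality, which reduces traces to finitely many Fourier coefficients; the mass is reduced to
  traces on concentric circles. The obstacle in the exterior limit is the origin, the image of
  infinity: the limiting density is not integrable there. Cutoff functions remove a neighbourhood of
  it, and a logarithmic one does so at arbitrarily small energy, because a point of the plane has
  zero capacity.\<close>

abbreviation smul :: "real => 'a::real_vector => 'a" (infixr "\<cdot>" 75) where "c \<cdot> x \<equiv> c *\<^sub>R x"
abbreviation converges :: "(nat => 'a::topological_space) => 'a => bool" (infix "---->" 60) where "X ----> L \<equiv> X \<longlonglongrightarrow> L"
abbreviation "meas M \<equiv> measurable M borel"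
abbreviation "cc \<equiv> circle_curve"
abbreviation "C1c \<equiv> C1_compact_support"
abbreviation I01 :: "(real => real) => real" where "I01 f \<equiv> \<integral>r. f r * indicator {0..1} r \<partial>lborel"

section \<open>Eigenvalues of a form that is compact relative to its energy\<close>

text \<open>Gaussian elimination. In a trial space of dimension \<open>k\<close> it finds a vector
  orthogonal to fewer than \<open>k\<close> prescribed ones, which gives the lower bounds in the
  min-max principle.\<close>

lemma underdetermined_system:
 fixes a :: "nat => 'i => real"
 assumes "finite I" "j < card I"
 shows "\<exists>c. (\<exists>i\<in>I. c i ~= 0) \<and> (\<forall>p<j. (\<Sum>i\<in>I. c i * a p i) = 0)"
 using assms
proof (induction j arbitrary: I a)
 case 0
 then obtain i where "i \<in> I" by (metis card.empty ex_in_conv less_nat_zero_code)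
 then show ?case by (intro exI[of _ "%_. 1"]) auto
next
 case (Suc j)
 show ?case
 proof (cases "\<forall>i\<in>I. a j i = 0")
  case True
  from Suc.IH[of I a] Suc.prems obtain c where
   c: "\<exists>i\<in>I. c i ~= 0" "\<forall>p<j. (\<Sum>i\<in>I. c i * a p i) = 0" by auto
  with True show ?thesis
   by (intro exI[of _ c]) (auto simp: less_Suc_eq)
 next
  case False
  then obtain i0 where i0: "i0 \<in> I" "a j i0 ~= 0" by blast
  define I' where "I' = I - {i0}"
  \<comment> \<open>\<open>b\<close> is the system after equation \<open>j\<close> has been used to
    eliminate the unknown \<open>i0\<close>; the vector \<open>d\<close> below restores that
    unknown.\<close>
  define b where "b p i = a p i - a p i0 * a j i / a j i0" for p i
  have "finite I'" "j < card I'" using Suc.prems i0 by (auto simp: I'_def)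
  from Suc.IH[OF this, of b] obtain c where
   c: "\<exists>i\<in>I'. c i ~= 0" "\<forall>p<j. (\<Sum>i\<in>I'. c i * b p i) = 0" by auto
  define d where "d = c(i0 := - (\<Sum>i\<in>I'. c i * a j i) / a j i0)"
  have split: "(\<Sum>i\<in>I. d i * a p i) = d i0 * a p i0 + (\<Sum>i\<in>I'. c i * a p i)" for p
  proof -
   have "(\<Sum>i\<in>I. d i * a p i) = d i0 * a p i0 + (\<Sum>i\<in>I'. d i * a p i)"
    unfolding I'_def using Suc.prems i0 by (simp add: sum.remove)
   also have "(\<Sum>i\<in>I'. d i * a p i) = (\<Sum>i\<in>I'. c i * a p i)"
    by (rule sum.cong) (auto simp: d_def I'_def)
   finally show ?thesis .
  qed
  have "(\<Sum>i\<in>I. d i * a p i) = 0" if "p < Suc j" for p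
  proof (cases "p = j")
   case True
   then show ?thesis using split[of j] i0 by (simp add: d_def)
  next
   case False
   with that have "p < j" by simp
   with c(2) have "0 = (\<Sum>i\<in>I'. c i * b p i)" by simp
   also have "... = (\<Sum>i\<in>I'. c i * a p i - (a p i0 / a j i0) * (c i * a j i))"
    by (rule sum.cong) (auto simp: b_def algebra_simps)
   also have "... = (\<Sum>i\<in>I'. c i * a p i) - (a p i0 / a j i0) * (\<Sum>i\<in>I'. c i * a j i)"
    by (simp add: sum_subtractf sum_distrib_left)
   finally show ?thesis using split[of p] by (simp add: d_def)
  qed
  moreover have "\<exists>i\<in>I. d i ~= 0" using c(1) by (auto simp: d_def I'_def)
  ultimately show ?thesis by blast
 qed
qed

text \<open>Bilinearity is required on a carrier only: the forms used later are integrals, which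
  take the value 0 on functions that are not integrable and so are not additive on the whole
  type.\<close>

definition symbil :: "'v::real_vector set => ('v => 'v => real) => bool" where
 "symbil V q \<longleftrightarrow> (\<forall>x\<in>V. \<forall>y\<in>V. q x y = q y x) \<and>
   (\<forall>x\<in>V. \<forall>y\<in>V. \<forall>z\<in>V. q (x + y) z = q x z + q y z) \<and>
   (\<forall>c. \<forall>x\<in>V. \<forall>y\<in>V. q (c \<cdot> x) y = c * q x y)"

definition psd :: "'v::real_vector set => ('v => 'v => real) => bool" where
 "psd V q \<longleftrightarrow> symbil V q \<and> (\<forall>x\<in>V. 0 <= q x x)"

lemma psd_symbil: "psd V q ==> symbil V q" and psd_nonneg: "psd V q ==> x \<in> V ==> 0 <= q x x"
 by (auto simp: psd_def)

lemma symbil_subset: "symbil V q ==> W \<subseteq> V ==> symbil W q"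
 unfolding symbil_def by blast

lemma symbil_sym: "symbil V q ==> x \<in> V ==> y \<in> V ==> q x y = q y x"
 and symbil_add: "symbil V q ==> x \<in> V ==> y \<in> V ==> z \<in> V ==> q (x + y) z = q x z + q y z"
 and symbil_scale: "symbil V q ==> x \<in> V ==> y \<in> V ==> q (c \<cdot> x) y = c * q x y"
 by (auto simp: symbil_def)

lemma symbil_lincomb:
 assumes "symbil V p" "symbil V q"
 shows "symbil V (%x y. a * p x y + b * q x y)"
 using assms by (auto simp: symbil_def algebra_simps)

lemma psd_lincomb:
 assumes "psd V p" "psd V q" "a >= 0" "b >= 0"
 shows "psd V (%x y. a * p x y + b * q x y)"
 using assms by (auto simp: psd_def intro!: symbil_lincomb)

lemma psd_sum:
 assumes "psd V p" "psd V q" shows "psd V (%x y. p x y + q x y)"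
 using psd_lincomb[OF assms, of 1 1] by simp

context
 fixes V :: "'v::real_vector set" and q :: "'v => 'v => real"
 assumes V: "subspace V" and q: "symbil V q"
begin

lemma symbil_diff:
 assumes "x \<in> V" "y \<in> V" "z \<in> V" shows "q (x - y) z = q x z - q y z"
proof -
 have "q (x + (-1) \<cdot> y) z = q x z + (-1) * q y z"
  using assms V q by (simp only: symbil_add symbil_scale subspace_scale)
 then show ?thesis by simp
qed

lemma symbil_add2: assumes "x \<in> V" "y \<in> V" "z \<in> V" shows "q z (x + y) = q z x + q z y"
 using assms V q symbil_add[OF q, of x y z] symbil_sym[OF q] by (metis subspace_add)

lemma symbil_diff2: assumes "x \<in> V" "y \<in> V" "z \<in> V" shows "q z (x - y) = q z x - q z y"
 using assms V q symbil_diff[of x y z] symbil_sym[OF q] by (metis subspace_diff)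

lemma symbil_scale2: assumes "x \<in> V" "z \<in> V" shows "q z (c \<cdot> x) = c * q z x"
 using assms V q symbil_scale[OF q, of x z] symbil_sym[OF q] by (metis subspace_scale)

lemma symbil_zero: "x \<in> V ==> q 0 x = 0"
 using symbil_scale[OF q, of x x 0] by simp

lemma symbil_sum:
 assumes "!!i. i \<in> I ==> x i \<in> V" "y \<in> V"
 shows "q (\<Sum>i\<in>I. c i \<cdot> x i) y = (\<Sum>i\<in>I. c i * q (x i) y)"
 using assms
proof (induction I rule: infinite_finite_induct)
 case (insert i I)
 have "(\<Sum>i\<in>I. c i \<cdot> x i) \<in> V" using V insert by (auto intro!: subspace_sum subspace_scale)
 then show ?case using insert V by (simp add: symbil_add[OF q] symbil_scale[OF q] subspace_scale)
qed (auto simp: symbil_zero)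

lemma symbil_sum2:
 assumes "!!i. i \<in> I ==> x i \<in> V" "y \<in> V"
 shows "q y (\<Sum>i\<in>I. c i \<cdot> x i) = (\<Sum>i\<in>I. c i * q y (x i))"
proof -
 have "(\<Sum>i\<in>I. c i \<cdot> x i) \<in> V" using V assms by (auto intro!: subspace_sum subspace_scale)
 then have "q y (\<Sum>i\<in>I. c i \<cdot> x i) = q (\<Sum>i\<in>I. c i \<cdot> x i) y"
  using assms symbil_sym[OF q] by blast
 also have "... = (\<Sum>i\<in>I. c i * q (x i) y)" by (rule symbil_sum[OF assms])
 also have "... = (\<Sum>i\<in>I. c i * q y (x i))"
  using assms symbil_sym[OF q] by (intro sum.cong) auto
 finally show ?thesis .
qed

lemma symbil_diff_sq:
 assumes "x \<in> V" "y \<in> V" shows "q (x - y) (x - y) = q x x - 2 * q x y + q y y"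
 using assms V by (simp add: symbil_diff symbil_diff2 subspace_diff symbil_sym[OF q, of y x])

lemma symbil_add_sq:
 assumes "x \<in> V" "y \<in> V" shows "q (x + y) (x + y) = q x x + 2 * q x y + q y y"
 using assms V by (simp add: symbil_add[OF q] symbil_add2 subspace_add symbil_sym[OF q, of y x])

lemma symbil_scale_sq: "x \<in> V ==> q (c \<cdot> x) (c \<cdot> x) = c^2 * q x x"
 using V by (simp add: symbil_scale[OF q] symbil_scale2 subspace_scale power2_eq_square)

end

lemma psd_Cauchy_Schwarz:
 assumes V: "subspace V" and q: "psd V q" and x: "x \<in> V" and y: "y \<in> V"
 shows "(q x y)^2 <= q x x * q y y"
proof -
 note s = psd_symbil[OF q]
 have *: "0 <= q x x + 2 * t * q x y + t^2 * q y y" for t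
 proof -
  have "0 <= q (x + t \<cdot> y) (x + t \<cdot> y)"
   using V x y by (intro psd_nonneg[OF q]) (auto intro: subspace_add subspace_scale)
  moreover have ty: "t \<cdot> y \<in> V" using V y by (simp add: subspace_scale)
  ultimately show ?thesis
   using symbil_add_sq[OF V s x ty] symbil_scale_sq[OF V s y, of t] symbil_scale2[OF V s y x, of t] by simp
 qed
 show ?thesis
 \<comment> \<open>If \<open>q y y = 0\<close>, the quadratic polynomial in \<open>t\<close> is
   affine and nonnegative everywhere, so its slope vanishes. Otherwise its minimiser is
   inserted.\<close>
 proof (cases "q y y = 0")
  case True
  have "q x y = 0"
  proof (rule ccontr)
   assume "q x y ~= 0"
   then show False using *[of "- (q x x + 1) / (2 * q x y)"] True by (simp add: field_simps)
  qed
  then show ?thesis using True by simp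
 next
  case False
  then have "q y y > 0" using psd_nonneg[OF q y] by linarith
  then show ?thesis using *[of "- q x y / q y y"]
   by (simp add: power2_eq_square field_simps)
 qed
qed

lemma psd_diff_bound:
 assumes V: "subspace V" and q: "psd V q" and x: "x \<in> V" and y: "y \<in> V"
 shows "q (x - y) (x - y) <= 2 * q x x + 2 * q y y"
  and "q (x + y) (x + y) <= 2 * q x x + 2 * q y y"
proof -
 note s = psd_symbil[OF q]
 have "0 <= q (x + y) (x + y)" "0 <= q (x - y) (x - y)"
  using V x y by (auto intro!: psd_nonneg[OF q] subspace_add subspace_diff)
 then show "q (x - y) (x - y) <= 2 * q x x + 2 * q y y" "q (x + y) (x + y) <= 2 * q x x + 2 * q y y"
  using x y by (auto simp: symbil_add_sq[OF V s] symbil_diff_sq[OF V s])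
qed

lemma psd_tendsto:
 assumes V: "subspace V" and q: "psd V q" and x: "!!n. x n \<in> V" "z \<in> V"
  and lim: "(%n. q (x n - z) (x n - z)) ----> 0"
 shows "y \<in> V ==> (%n. q (x n) y) ----> q z y" and "(%n. q (x n) (x n)) ----> q z z"
proof -
 note s = psd_symbil[OF q]
 have d: "x n - z \<in> V" for n using V x by (simp add: subspace_diff)
 have 1: "(%n. q (x n) y) ----> q z y" if y: "y \<in> V" for y
 proof -
  have "(%n. sqrt (q (x n - z) (x n - z)) * sqrt (q y y)) ----> sqrt 0 * sqrt (q y y)"
   by (intro tendsto_intros lim)
  then have l: "(%n. sqrt (q (x n - z) (x n - z)) * sqrt (q y y)) ----> 0" by simp
  have "(%n. q (x n - z) y) ----> 0"
  proof (rule tendsto_rabs_zero_cancel, rule tendsto_sandwich[OF _ _ tendsto_const l])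
   show "\<forall>\<^sub>F n in sequentially. \<bar>q (x n - z) y\<bar> <= sqrt (q (x n - z) (x n - z)) * sqrt (q y y)"
    using psd_Cauchy_Schwarz[OF V q d y]
    by (intro always_eventually allI) (simp add: real_sqrt_mult[symmetric] real_le_rsqrt)
  qed auto
  then have "(%n. q (x n - z) y + q z y) ----> 0 + q z y" by (intro tendsto_intros)
  then show ?thesis using x y by (simp add: symbil_diff[OF V s])
 qed
 then show "y \<in> V ==> (%n. q (x n) y) ----> q z y" .
 have "(%n. q (x n - z) (x n - z) + 2 * q (x n) z - q z z) ----> 0 + 2 * q z z - q z z"
  by (intro tendsto_intros lim 1 x)
 then show "(%n. q (x n) (x n)) ----> q z z"
  using x by (simp add: symbil_diff_sq[OF V s])
qed

definition form_Cauchy :: "('v::real_vector => 'v => real) => (nat => 'v) => bool" where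
 "form_Cauchy q x \<longleftrightarrow> (\<forall>e>0. \<exists>K. \<forall>i\<ge>K. \<forall>j\<ge>K. q (x i - x j) (x i - x j) < e)"

text \<open>\<open>S0\<close> is a part of the real line that the essential spectrum does not meet: everything for a bounded
 domain, the negative numbers for the exterior domain.\<close>

locale robin_form =
 fixes V :: "'v::real_vector set" and E B M :: "'v => 'v => real" and \<alpha> :: real and S0 :: "real set"
 assumes V: "subspace V" and E: "psd V E" and B: "psd V B" and M: "psd V M" and \<alpha>: "\<alpha> ~= 0"
  and complete: "!!x. (!!n::nat. x n \<in> V) ==> form_Cauchy (%y z. E y z + B y z + M y z) x ==>
   \<exists>z\<in>V. (%n. E (x n - z) (x n - z) + B (x n - z) (x n - z) + M (x n - z) (x n - z)) ----> 0"
  and trace: "\<exists>C. \<forall>x\<in>V. \<bar>\<alpha>\<bar> * B x x <= E x x / 2 + C * M x x"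
  and compact: "!!x C \<mu>. (!!n::nat. x n \<in> V) ==> (!!n. E (x n) (x n) + B (x n) (x n) + M (x n) (x n) <= C)
   ==> \<mu> \<in> S0 ==>
   \<exists>r. strict_mono (r :: nat => nat) \<and> form_Cauchy B (x \<circ> r) \<and> (\<mu> >= 0 --> form_Cauchy M (x \<circ> r))"
  and S0_down: "!!a b. b \<in> S0 ==> a <= b ==> a \<in> S0"
begin

section \<open>Rayleigh quotients, successive minimisation and the min-max principle\<close>

definition Q :: "'v => 'v => real" where "Q x y = E x y + \<alpha> * B x y"

text \<open>A trial space of dimension \<open>k\<close> whose Rayleigh quotients lie in
  \<open>S\<close>. Positivity of the mass for all nontrivial coefficients includes linear
  independence.\<close>

definition test :: "real set => nat => bool" where
 "test S k \<longleftrightarrow> (\<exists>x. (\<forall>i<k. x i \<in> V) \<and> (\<forall>c. (\<exists>i<k. c i ~= 0) -->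
   (let y = \<Sum>i<k. c i \<cdot> x i in M y y > 0 \<and> Q y y / M y y \<in> S)))"

definition eig :: "real => 'v => bool" where
 "eig \<mu> x \<longleftrightarrow> x \<in> V \<and> (\<forall>v\<in>V. Q x v = \<mu> * M x v)"

text \<open>The abstract counterpart of \<open>robin_count_ge\<close>: independence modulo null
  functions becomes the condition that only the trivial combination has mass zero.\<close>

definition count :: "real set => nat => bool" where
 "count S k \<longleftrightarrow> (\<exists>(\<mu> :: nat => real) x. (\<forall>i<k. \<mu> i \<in> S \<and> eig (\<mu> i) (x i)) \<and>
   (\<forall>c :: nat => real. M (\<Sum>i<k. c i \<cdot> x i) (\<Sum>i<k. c i \<cdot> x i) = 0 --> (\<forall>i<k. c i = 0)))"

text \<open>The outcome of \<open>k\<close> successive minimisations: \<open>l i\<close> is the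
  minimum of the Rayleigh quotient on the orthogonal complement of the earlier eigenvectors. All
  levels lie in \<open>S0\<close>, where compactness is available.\<close>

definition chain :: "nat => (nat => 'v) => (nat => real) => bool" where
 "chain k e l \<longleftrightarrow> (\<forall>i<k. eig (l i) (e i) \<and> M (e i) (e i) = 1 \<and> (\<forall>j<i. M (e i) (e j) = 0) \<and> l i \<in> S0 \<and>
   (\<forall>x\<in>V. (\<forall>j<i. M x (e j) = 0) --> l i * M x x <= Q x x))"

lemma symQ: "symbil V Q"
 using symbil_lincomb[OF psd_symbil[OF E] psd_symbil[OF B], of 1 \<alpha>] unfolding Q_def[abs_def] by simp

lemma symM: "symbil V M" by (rule psd_symbil[OF M])

text \<open>Garding's inequality: half of the energy absorbs a boundary term of either sign, so
  Rayleigh quotients are bounded below and an upper bound for \<open>Q\<close> bounds the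
  energy.\<close>

lemma lower_bound: "\<exists>C\<ge>0. \<forall>x\<in>V. E x x / 2 - C * M x x <= Q x x"
proof -
 obtain C where C: "!!x. x \<in> V ==> \<bar>\<alpha>\<bar> * B x x <= E x x / 2 + C * M x x" using trace by blast
 show ?thesis
 proof (intro exI[of _ "max C 0"] conjI ballI)
  fix x assume x: "x \<in> V"
  have "- \<alpha> * B x x <= \<bar>\<alpha>\<bar> * B x x" using psd_nonneg[OF B x] by (intro mult_right_mono) auto
  moreover have "C * M x x <= max C 0 * M x x" using psd_nonneg[OF M x] by (intro mult_right_mono) auto
  ultimately show "E x x / 2 - max C 0 * M x x <= Q x x"
   using C[OF x] unfolding Q_def by linarith
 qed simp
qed

lemma Q_nonneg_null: "x \<in> V ==> M x x = 0 ==> 0 <= Q x x"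
 using lower_bound psd_nonneg[OF E] by fastforce

text \<open>The direct method. With \<open>l\<close> the infimum, \<open>P = Q - l M\<close> is
  positive semidefinite on \<open>W\<close> and tends to zero along a minimising sequence, hence by
  the parallelogram bound also on differences of its members. Compactness of \<open>B\<close>, and
  of \<open>M\<close> if \<open>l\<close> is nonnegative, then makes a subsequence Cauchy in the
  full norm, and the limit is a minimiser.\<close>

lemma minimizer:
 assumes W: "W = {x\<in>V. \<forall>i<j. M x (e i) = 0}" and e: "!!i. i < j ==> e i \<in> V"
  and y: "y \<in> W" "M y y > 0" "Q y y / M y y \<in> S0"
 shows "\<exists>l z. l <= Q y y / M y y \<and> z \<in> W \<and> M z z = 1 \<and> Q z z = l \<and> (\<forall>x\<in>W. l * M x x <= Q x x)"
proof -
 have WV: "W \<subseteq> V" using W by auto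
 have sW: "subspace W"
  unfolding W subspace_def using V e
  by (auto simp: subspace_def symbil_add[OF symM] symbil_scale[OF symM] symbil_zero[OF V symM])
 define R where "R = {Q x x | x. x \<in> W \<and> M x x = 1}"
 obtain C where C: "C >= 0" "!!x. x \<in> V ==> E x x / 2 - C * M x x <= Q x x" using lower_bound by blast
 have bdd: "bdd_below R"
 proof (rule bdd_belowI[of _ "-C"])
  fix t assume "t \<in> R"
  then obtain x where "x \<in> W" "M x x = 1" "t = Q x x" by (auto simp: R_def)
  then show "-C <= t" using C(2)[of x] psd_nonneg[OF E, of x] WV by (auto simp: subset_eq)
 qed
 have norml: "Q x x / M x x \<in> R" if "x \<in> W" "M x x > 0" for x
 proof -
  let ?z = "(1 / sqrt (M x x)) \<cdot> x"
  have "?z \<in> W" using that sW by (simp add: subspace_scale)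
  moreover have "M ?z ?z = 1" "Q ?z ?z = Q x x / M x x" using that WV
   by (auto simp: symbil_scale_sq[OF V symM] symbil_scale_sq[OF V symQ] power_divide subset_eq)
  ultimately show ?thesis unfolding R_def by force
 qed
 define l where "l = Inf R"
 have lle: "l <= Q y y / M y y" unfolding l_def by (intro cInf_lower norml y bdd)
 \<comment> \<open>Here the trial vector \<open>y\<close> is used: it places the infimum in
   \<open>S0\<close>, so that the compactness assumption applies at the level
   \<open>l\<close>.\<close>
 have lS: "l \<in> S0" using S0_down[OF y(3) lle] .
 have low: "l * M x x <= Q x x" if "x \<in> W" for x
 proof (cases "M x x = 0")
  case True then show ?thesis using Q_nonneg_null that WV by auto
 next
  case False
  then have "M x x > 0" using psd_nonneg[OF M, of x] that WV by (auto simp: subset_eq less_le)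
  moreover have "l <= Q x x / M x x" unfolding l_def by (intro cInf_lower norml that \<open>M x x > 0\<close> bdd)
  ultimately show ?thesis by (simp add: field_simps)
 qed
 have "\<exists>x. x \<in> W \<and> M x x = 1 \<and> Q x x < l + 1 / real (Suc n)" for n
 proof -
  have "R ~= {}" using norml[OF y(1,2)] by auto
  moreover have "Inf R < l + 1 / real (Suc n)" by (simp add: l_def)
  ultimately obtain t where "t \<in> R" "t < l + 1 / real (Suc n)" using bdd by (meson cInf_lessD)
  then show ?thesis by (auto simp: R_def)
 qed
 then obtain x where x: "!!n. x n \<in> W" "!!n. M (x n) (x n) = 1"
  and Qx: "!!n. Q (x n) (x n) < l + 1 / real (Suc n)" by metis
 have xV: "x n \<in> V" for n using x WV by auto
 define P where "P y z = Q y z + (- l) * M y z" for y z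
 have symP: "symbil V P" using symbil_lincomb[OF symQ symM, of 1 "-l"] unfolding P_def[abs_def] by simp
 have psdP: "psd W P" unfolding psd_def using low symbil_subset[OF symP WV] by (auto simp: P_def)
 have Px: "P (x n) (x n) < 1 / real (Suc n)" for n using Qx[of n] x(2)[of n] by (simp add: P_def)
 obtain C1 where C1: "!!x. x \<in> V ==> \<bar>\<alpha>\<bar> * B x x <= E x x / 2 + C1 * M x x" using trace by blast
 have bE: "E (x n) (x n) <= 2 * (\<bar>l\<bar> + 1 + C)" for n
 proof -
  have n1: "1 / real (Suc n) <= 1" by (simp only: le_divide_eq_1 divide_le_eq_1) simp
  have c1: "E (x n) (x n) / 2 - C <= Q (x n) (x n)" using C(2)[OF xV, of n] x(2)[of n] by simp
  have "E (x n) (x n) / 2 < l + 1 + C" using Qx[of n] n1 c1 by linarith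
  moreover have "l <= \<bar>l\<bar>" by simp
  ultimately have "E (x n) (x n) / 2 <= \<bar>l\<bar> + 1 + C" by linarith
  then show ?thesis by simp
 qed
 have bB: "B (x n) (x n) <= (\<bar>l\<bar> + 1 + C + C1) / \<bar>\<alpha>\<bar>" for n
  using C1[OF xV, of n] bE[of n] x(2)[of n] \<alpha> by (simp add: field_simps)
 have bound: "E (x n) (x n) + B (x n) (x n) + M (x n) (x n) <=
   2 * (\<bar>l\<bar> + 1 + C) + (\<bar>l\<bar> + 1 + C + C1) / \<bar>\<alpha>\<bar> + 1" for n
  using bE[of n] bB[of n] x(2)[of n] by linarith
 from compact[of x, OF xV bound lS] obtain r where r: "strict_mono r" "form_Cauchy B (x \<circ> r)"
  "l >= 0 ==> form_Cauchy M (x \<circ> r)" by auto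
 define y' where "y' = x \<circ> r"
 have y'W: "y' n \<in> W" and y'V: "y' n \<in> V" for n using x(1) xV by (auto simp: y'_def)
 have dV: "y' i - y' j \<in> V" "y' i - y' j \<in> W" for i j
  using V sW y'V y'W by (auto intro: subspace_diff)
 have Psmall: "P (y' i - y' j) (y' i - y' j) <= 4 / real (Suc K)" if "i >= K" "j >= K" for i j K
 proof -
  have "P (y' i) (y' i) <= 1 / real (Suc K)" if "i >= K" for i
  proof -
   have "K <= r i" using seq_suble[OF r(1), of i] that by linarith
   then have "1 / real (Suc (r i)) <= 1 / real (Suc K)" by (simp add: frac_le)
   then show ?thesis using Px[of "r i"] by (simp add: y'_def)
  qed
  from this[OF that(1)] this[OF that(2)]
  have "2 * P (y' i) (y' i) + 2 * P (y' j) (y' j) <= 4 / real (Suc K)" by simp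
  with psd_diff_bound(1)[OF sW psdP y'W y'W, of i j] show ?thesis by linarith
 qed
 text \<open>For negative \<open>l\<close> the energy form plus a multiple of the mass is controlled by \<open>P\<close> and the
  boundary term; otherwise the mass is compact as well.\<close>
 define c where "c = (if l < 0 then max 1 (1 / \<bar>l\<bar>) else 1)"
 have cN: "E d d + B d d + M d d <= c * P d d + (c * \<bar>\<alpha>\<bar> + 1) * B d d + (if l < 0 then 0 else (c * l + 1) * M d d)"
  if "d \<in> V" for d
 proof -
  have nn: "0 <= E d d" "0 <= B d d" "0 <= M d d" using that psd_nonneg E B M by blast+
  have c1: "c >= 1" by (simp add: c_def)
  have 1: "E d d <= c * E d d" using nn c1 by (simp add: mult_le_cancel_right1)
  have 2: "c * P d d = c * E d d + c * \<alpha> * B d d - c * l * M d d" by (simp add: P_def Q_def algebra_simps)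
  have "- (c * \<alpha> * B d d) <= c * \<bar>\<alpha>\<bar> * B d d"
  proof -
   have "(c * B d d) * (- \<alpha>) <= (c * B d d) * \<bar>\<alpha>\<bar>" using nn c1 by (intro mult_left_mono) auto
   then show ?thesis by (simp add: algebra_simps)
  qed
  moreover have "M d d <= - (c * l) * M d d" if "l < 0"
  proof -
   have "1 <= c * \<bar>l\<bar>" using that by (auto simp: c_def max_def field_simps)
   then have "1 * M d d <= (c * \<bar>l\<bar>) * M d d" using nn by (intro mult_right_mono) auto
   then show ?thesis using that by simp
  qed
  ultimately show ?thesis using 1 2 by (auto simp: algebra_simps)
 qed
 have Cauchy: "form_Cauchy (%y z. E y z + B y z + M y z) y'"
  unfolding form_Cauchy_def
 proof (intro allI impI)
  fix \<epsilon> :: real assume \<epsilon>: "\<epsilon> > 0"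
  have c1: "c >= 1" by (simp add: c_def)
  define b where "b = c * \<bar>\<alpha>\<bar> + 1"
  have b: "b > 0" using c1 by (simp add: b_def add_nonneg_pos)
  obtain K1 where K1: "4 * c / real (Suc K1) < \<epsilon> / 3"
  proof -
   obtain n where "real n > 12 * c / \<epsilon>" using reals_Archimedean2 by blast
   then have "real (Suc n) * \<epsilon> > 12 * c" using \<epsilon> by (simp add: field_simps)
   then show ?thesis using that[of n] by (simp add: field_simps)
  qed
  obtain K2 where K2: "!!i j. i >= K2 ==> j >= K2 ==> B (y' i - y' j) (y' i - y' j) < \<epsilon> / (3 * b)"
   using r(2)[unfolded form_Cauchy_def, rule_format, of "\<epsilon> / (3 * b)"] \<epsilon> b unfolding y'_def by auto
  obtain K3 where K3: "!!i j. i >= K3 ==> j >= K3 ==>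
   (if l < 0 then 0 else (c * l + 1) * M (y' i - y' j) (y' i - y' j)) < \<epsilon> / 3"
  proof (cases "l < 0")
   case True then show ?thesis using that \<epsilon> by auto
  next
   case False
   then have p: "c * l + 1 > 0" using c1 by (simp add: add_nonneg_pos)
   obtain K where "!!i j. i >= K ==> j >= K ==> M (y' i - y' j) (y' i - y' j) < \<epsilon> / (3 * (c * l + 1))"
    using r(3)[unfolded form_Cauchy_def, rule_format, of "\<epsilon> / (3 * (c * l + 1))"] False \<epsilon> p
    unfolding y'_def by auto
   then show ?thesis using that[of K] False p by (simp add: field_simps)
  qed
  show "\<exists>K. \<forall>i\<ge>K. \<forall>j\<ge>K. E (y' i - y' j) (y' i - y' j) + B (y' i - y' j) (y' i - y' j)
    + M (y' i - y' j) (y' i - y' j) < \<epsilon>"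
  proof (intro exI[of _ "Max {K1, K2, K3}"] allI impI)
   fix i j assume ij: "Max {K1, K2, K3} <= i" "Max {K1, K2, K3} <= j"
   let ?d = "y' i - y' j"
   have "c * P ?d ?d <= c * (4 / real (Suc K1))"
    using Psmall[of K1 i j] ij c1 by (intro mult_left_mono) auto
   moreover have "c * (4 / real (Suc K1)) < \<epsilon> / 3" using K1 by (simp only: times_divide_eq_right mult.commute)
   ultimately have "c * P ?d ?d < \<epsilon> / 3" by linarith
   moreover have "b * B ?d ?d < \<epsilon> / 3" using K2[of i j] ij b by (simp add: field_simps)
   ultimately show "E ?d ?d + B ?d ?d + M ?d ?d < \<epsilon>"
    using cN[OF dV(1), of i j] K3[of i j] ij unfolding b_def by simp
  qed
 qed
 from complete[of y', OF y'V Cauchy] obtain z where z: "z \<in> V"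
  and lim: "(%n. E (y' n - z) (y' n - z) + B (y' n - z) (y' n - z) + M (y' n - z) (y' n - z)) ----> 0" by blast
 have dz: "y' n - z \<in> V" for n using V y'V z by (auto intro: subspace_diff)
 note nn = psd_nonneg[OF E dz] psd_nonneg[OF B dz] psd_nonneg[OF M dz]
 have limE: "(%n. E (y' n - z) (y' n - z)) ----> 0"
  by (rule tendsto_sandwich[OF _ _ tendsto_const lim]) (use nn in \<open>auto intro!: always_eventually simp: add_nonneg_nonneg\<close>)
 have limB: "(%n. B (y' n - z) (y' n - z)) ----> 0"
  by (rule tendsto_sandwich[OF _ _ tendsto_const lim]) (use nn in \<open>auto intro!: always_eventually simp: add_nonneg_nonneg\<close>)
 have limM: "(%n. M (y' n - z) (y' n - z)) ----> 0"
  by (rule tendsto_sandwich[OF _ _ tendsto_const lim]) (use nn in \<open>auto intro!: always_eventually simp: add_nonneg_nonneg\<close>)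
 note tE = psd_tendsto[where x = y', OF V E y'V z limE] and tB = psd_tendsto[where x = y', OF V B y'V z limB] and tM = psd_tendsto[where x = y', OF V M y'V z limM]
 have M1: "M (y' n) (y' n) = 1" for n using x(2) by (simp add: y'_def)
 have Mz: "M z z = 1" using tM(2) M1 by (simp add: LIMSEQ_const_iff)
 have zW: "z \<in> W"
 proof -
  have "M z (e i) = 0" if "i < j" for i
  proof -
   have "(%n. M (y' n) (e i)) ----> M z (e i)" by (rule tM(1)) (use e that in auto)
   moreover have "M (y' n) (e i) = 0" for n using y'W that W by auto
   ultimately show ?thesis by (simp add: LIMSEQ_const_iff)
  qed
  then show ?thesis using z W by auto
 qed
 have "Q z z <= l"
 proof -
  have tQ: "(%n. Q (y' n) (y' n)) ----> Q z z" unfolding Q_def by (intro tendsto_intros tE tB)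
  have "(%n. l + 1 / real (Suc (r n))) ----> l + 0"
   by (intro tendsto_intros LIMSEQ_subseq_LIMSEQ[OF LIMSEQ_inverse_real_of_nat r(1), unfolded o_def inverse_eq_divide])
  moreover have "Q (y' n) (y' n) <= l + 1 / real (Suc (r n))" for n
   using Qx[of "r n"] by (simp add: y'_def)
  ultimately show ?thesis using LIMSEQ_le[OF tQ] by auto
 qed
 then have "Q z z = l" using low[OF zW] Mz by simp
 then show ?thesis using lle zW Mz low by blast
qed

lemma eigV: "eig \<mu> x ==> x \<in> V" by (simp add: eig_def)

lemma chain_mono: assumes "chain k e l" "i <= j" "j < k" shows "l i <= l j"
proof -
 have j: "eig (l j) (e j)" "M (e j) (e j) = 1" "\<forall>a<j. M (e j) (e a) = 0" using assms by (auto simp: chain_def)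
 moreover have "\<forall>x\<in>V. (\<forall>j<i. M x (e j) = 0) --> l i * M x x <= Q x x" using assms by (auto simp: chain_def)
 ultimately have "l i * M (e j) (e j) <= Q (e j) (e j)" using assms(2) by (auto simp: eig_def)
 then show ?thesis using j by (simp add: eig_def)
qed

text \<open>A minimiser \<open>z\<close> on \<open>W\<close> satisfies \<open>P z z = 0\<close> for
  the semidefinite form \<open>P\<close>, so by Cauchy-Schwarz it is \<open>P\<close>-orthogonal to
  \<open>W\<close>. It is also \<open>P\<close>-orthogonal to the earlier eigenvectors, since it is
  \<open>M\<close>-orthogonal to them. Every \<open>v\<close> is the sum of its projection onto
  these and a vector of \<open>W\<close>, so \<open>z\<close> is an eigenvector on all of
  \<open>V\<close>.\<close>

lemma chain_extend:
 assumes ch: "chain j e l" and y: "y \<in> V" "!!i. i < j ==> M y (e i) = 0" "M y y > 0" "Q y y / M y y \<in> S0"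
 shows "\<exists>e l. chain (Suc j) e l"
proof -
 define W where "W = {x\<in>V. \<forall>i<j. M x (e i) = 0}"
 have eV: "e i \<in> V" if "i < j" for i using ch that by (auto simp: chain_def eig_def)
 have "y \<in> W" using y by (auto simp: W_def)
 from minimizer[OF W_def eV this y(3,4)] obtain \<mu> z where z: "z \<in> W" "M z z = 1" "Q z z = \<mu>"
  "!!x. x \<in> W ==> \<mu> * M x x <= Q x x" "\<mu> <= Q y y / M y y" by blast
 have \<mu>S: "\<mu> \<in> S0" using S0_down[OF y(4) z(5)] .
 have WV: "W \<subseteq> V" by (auto simp: W_def)
 have zV: "z \<in> V" using z(1) WV by auto
 have sW: "subspace W"
  unfolding W_def subspace_def using V eV
  by (auto simp: subspace_def symbil_add[OF symM] symbil_scale[OF symM] symbil_zero[OF V symM])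
 define P where "P y z = Q y z + (- \<mu>) * M y z" for y z
 have symP: "symbil V P" using symbil_lincomb[OF symQ symM, of 1 "-\<mu>"] unfolding P_def[abs_def] by simp
 have psdP: "psd W P" unfolding psd_def using z(4) symbil_subset[OF symP WV] by (auto simp: P_def)
 have ortho: "M (e a) (e b) = 0" if "a < j" "b < j" "a ~= b" for a b
  using ch that symbil_sym[OF symM eV eV, of a b] unfolding chain_def by (metis linorder_neqE_nat)
 have "P z v = 0" if v: "v \<in> V" for v
 proof -
  define w where "w = v - (\<Sum>i<j. M v (e i) \<cdot> e i)"
  have sV: "(\<Sum>i<j. M v (e i) \<cdot> e i) \<in> V" using V eV by (auto intro!: subspace_sum subspace_scale)
  have wW: "w \<in> W"
  proof -
   have "M w (e b) = 0" if b: "b < j" for b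
   proof -
    have "M w (e b) = M v (e b) - (\<Sum>i<j. M v (e i) * M (e i) (e b))"
     unfolding w_def using v sV eV b symbil_sum[OF V symM, of "{..<j}" e "e b" "%i. M v (e i)"]
     by (simp add: symbil_diff[OF V symM])
    also have "(\<Sum>i<j. M v (e i) * M (e i) (e b)) = (\<Sum>i<j. if i = b then M v (e b) else 0)"
     using ortho b ch by (intro sum.cong) (auto simp: chain_def)
    finally show ?thesis using b by simp
   qed
   then show ?thesis using V v sV unfolding W_def w_def by (auto intro: subspace_diff)
  qed
  have "(P z w)^2 <= 0"
   using psd_Cauchy_Schwarz[OF sW psdP z(1) wW] z(2,3) by (simp add: P_def)
  then have "P z w = 0" by simp
  moreover have "P z (e i) = 0" if i: "i < j" for i
  proof -
   have "Q (e i) z = l i * M (e i) z" using ch i zV by (auto simp: chain_def eig_def)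
   moreover have "M (e i) z = 0" using z(1) i symbil_sym[OF symM zV eV[OF i]] by (auto simp: W_def)
   ultimately show ?thesis using symbil_sym[OF symP zV eV[OF i]] by (simp add: P_def)
  qed
  then have "P z (\<Sum>i<j. M v (e i) \<cdot> e i) = 0"
   using symbil_sum2[OF V symP, of "{..<j}" e z "%i. M v (e i)"] eV zV by simp
  moreover have "v = w + (\<Sum>i<j. M v (e i) \<cdot> e i)" by (simp add: w_def)
  moreover have "w \<in> V" using wW WV by auto
  ultimately show ?thesis using symbil_add2[OF V symP, of w "\<Sum>i<j. M v (e i) \<cdot> e i" z] sV zV by simp
 qed
 then have eigz: "eig \<mu> z" using zV by (auto simp: eig_def P_def)
 have "chain (Suc j) (e(j := z)) (l(j := \<mu>))"
  using ch eigz z \<mu>S unfolding chain_def W_def by (auto simp: less_Suc_eq)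
 then show ?thesis by blast
qed

lemma lincomb_V: "(!!i. i < k ==> x i \<in> V) ==> (\<Sum>i<k. c i \<cdot> x i) \<in> V" for x :: "nat => 'v"
 using V by (auto intro!: subspace_sum subspace_scale)

text \<open>Dimension count: a \<open>k\<close>-dimensional trial space meets the orthogonal
  complement of fewer than \<open>k\<close> vectors.\<close>

lemma test_orthogonal:
 assumes t: "test S k" and e: "!!p. p < j ==> e p \<in> V" and "j < k"
 shows "\<exists>y. y \<in> V \<and> (\<forall>p<j. M y (e p) = 0) \<and> M y y > 0 \<and> Q y y / M y y \<in> S"
proof -
 from t obtain x where x: "!!i. i < k ==> x i \<in> V"
  "!!c y. (\<exists>i<k. c i ~= 0) ==> y = (\<Sum>i<k. c i \<cdot> x i) ==> M y y > 0 \<and> Q y y / M y y \<in> S"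
  unfolding test_def Let_def by blast
 obtain c where c: "\<exists>i\<in>{..<k}. c i ~= 0" "\<forall>p<j. (\<Sum>i<k. c i * M (x i) (e p)) = 0"
  using underdetermined_system[of "{..<k}" j "%p i. M (x i) (e p)"] \<open>j < k\<close> by auto
 define y where "y = (\<Sum>i<k. c i \<cdot> x i)"
 have "M y (e p) = 0" if "p < j" for p
  unfolding y_def using symbil_sum[OF V symM, of "{..<k}" x "e p" c] x(1) e that c(2) by auto
 moreover have "y \<in> V" unfolding y_def by (rule lincomb_V) (rule x(1))
 ultimately show ?thesis using x(2)[OF _ y_def] c(1) by auto
qed

lemma chain_exists: assumes "test S0 k" shows "\<exists>e l. chain k e l"
proof -
 have "j <= k ==> \<exists>e l. chain j e l" for j
 proof (induction j)
  case 0 show ?case by (auto simp: chain_def)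
 next
  case (Suc j)
  then obtain e l where ch: "chain j e l" by auto
  then have eV: "e p \<in> V" if "p < j" for p using that by (auto simp: chain_def eig_def)
  from test_orthogonal[OF assms eV] Suc.prems obtain y where "y \<in> V" "\<forall>p<j. M y (e p) = 0" "M y y > 0" "Q y y / M y y \<in> S0"
   by force
  then show ?case using chain_extend[OF ch, of y] by auto
 qed
 then show ?thesis by blast
qed

text \<open>The trial vector orthogonal to the first \<open>k - 1\<close> eigenvectors competes in
  the minimisation that defines \<open>l (k - 1)\<close>.\<close>

lemma test_chain:
 assumes t: "test S k" and down: "!!a b. b \<in> S ==> a <= b ==> a \<in> S" and ch: "chain k e l" and "k >= 1"
 shows "l (k - 1) \<in> S"
proof -
 have eV: "e p \<in> V" if "p < k - 1" for p using ch that by (auto simp: chain_def eig_def)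
 from test_orthogonal[OF t eV] \<open>k \<ge> 1\<close> obtain y where
  y: "y \<in> V" "\<forall>p<k-1. M y (e p) = 0" "M y y > 0" "Q y y / M y y \<in> S" by force
 have "l (k-1) * M y y <= Q y y" using ch y(1,2) \<open>k \<ge> 1\<close> unfolding chain_def
  by (meson diff_less less_one order_less_le_trans)
 then have "l (k-1) <= Q y y / M y y" using y(3) by (simp add: field_simps)
 then show ?thesis using down y(4) by blast
qed

text \<open>On the span of eigenvectors the Rayleigh quotient is at most the largest eigenvalue
  \<open>m\<close> involved. The eigenvectors need not be orthogonal within one eigenspace, so
  \<open>m * M y y - Q y y\<close> is not simply a sum of squares; it is recognised as the mass of
  another combination \<open>z\<close>.\<close>

lemma count_test:
 assumes c: "count S k" and down: "!!a b. b \<in> S ==> a <= b ==> a \<in> S"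
 shows "test S k"
proof -
 from c obtain \<mu> x where x: "!!i. i < k ==> \<mu> i \<in> S" "!!i. i < k ==> eig (\<mu> i) (x i)"
  and ind: "!!c. M (\<Sum>i<k. c i \<cdot> x i) (\<Sum>i<k. c i \<cdot> x i) = 0 ==> (\<forall>i<k. c i = 0)"
  unfolding count_def by blast
 have xV: "x i \<in> V" if "i < k" for i using x(2)[OF that] eigV by blast
 show ?thesis unfolding test_def Let_def
 proof (intro exI[of _ x] conjI allI impI)
  show "x i \<in> V" if "i < k" for i by (rule xV[OF that])
  fix c :: "nat => real" assume nz: "\<exists>i<k. c i ~= 0"
  define y where "y = (\<Sum>i<k. c i \<cdot> x i)"
  have yV: "y \<in> V" unfolding y_def by (rule lincomb_V) (rule xV)
  have "M y y ~= 0" using ind[of c] nz unfolding y_def by blast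
  then have My: "M y y > 0" using psd_nonneg[OF M yV] by linarith
  define m where "m = Max (\<mu> ` {..<k})"
  have ne: "\<mu> ` {..<k} ~= {}" using nz by auto
  have m: "\<mu> i <= m" if "i < k" for i unfolding m_def using that by (intro Max_ge) auto
  have mS: "m \<in> S" using Max_in[OF _ ne] x(1) unfolding m_def by auto
  have o: "M (x i) (x j) = 0" if "i < k" "j < k" "\<mu> i ~= \<mu> j" for i j
  proof -
   have "Q (x i) (x j) = \<mu> i * M (x i) (x j)" "Q (x j) (x i) = \<mu> j * M (x j) (x i)"
    using x(2) xV that by (auto simp: eig_def)
   then have "(\<mu> i - \<mu> j) * M (x i) (x j) = 0"
    using symbil_sym[OF symQ xV xV, of i j] symbil_sym[OF symM xV xV, of i j] that
    by (simp add: algebra_simps)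
   then show ?thesis using that by simp
  qed
  \<comment> \<open>The square roots distribute \<open>m - \<mu> i\<close> over both arguments of
    \<open>M\<close>. This is legitimate because \<open>M (x i) (x j)\<close> vanishes unless the
    two eigenvalues coincide.\<close>
  define z where "z = (\<Sum>i<k. (c i * sqrt (m - \<mu> i)) \<cdot> x i)"
  have zV: "z \<in> V" unfolding z_def by (rule lincomb_V) (rule xV)
  have "m * M y y - Q y y = (\<Sum>i<k. c i * ((m - \<mu> i) * M (x i) y))"
  proof -
   have "Q y y = (\<Sum>i<k. c i * Q (x i) y)" "M y y = (\<Sum>i<k. c i * M (x i) y)"
    using symbil_sum[OF V symQ, of "{..<k}" x y c] symbil_sum[OF V symM, of "{..<k}" x y c] xV yV
    by (auto simp: y_def[symmetric])
   moreover have "Q (x i) y = \<mu> i * M (x i) y" if "i < k" for i using x(2)[OF that] yV by (auto simp: eig_def)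
   ultimately show ?thesis by (simp add: sum_distrib_left sum_subtractf[symmetric] algebra_simps)
  qed
  also have "... = (\<Sum>i<k. \<Sum>j<k. c i * c j * ((m - \<mu> i) * M (x i) (x j)))"
  proof (rule sum.cong)
   fix i assume "i \<in> {..<k}"
   then have "M (x i) y = (\<Sum>j<k. c j * M (x i) (x j))"
    unfolding y_def using symbil_sum2[OF V symM, of "{..<k}" x "x i" c] xV by auto
   then show "c i * ((m - \<mu> i) * M (x i) y) = (\<Sum>j<k. c i * c j * ((m - \<mu> i) * M (x i) (x j)))"
    by (simp add: sum_distrib_left algebra_simps)
  qed simp
  also have "... = (\<Sum>i<k. \<Sum>j<k. (c i * sqrt (m - \<mu> i)) * ((c j * sqrt (m - \<mu> j)) * M (x i) (x j)))"
  proof (intro sum.cong refl)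
   fix i j assume ij: "i \<in> {..<k}" "j \<in> {..<k}"
   show "c i * c j * ((m - \<mu> i) * M (x i) (x j)) = (c i * sqrt (m - \<mu> i)) * ((c j * sqrt (m - \<mu> j)) * M (x i) (x j))"
   proof (cases "\<mu> i = \<mu> j")
    case True
    have "sqrt (m - \<mu> i) * sqrt (m - \<mu> j) = m - \<mu> i" using m[of i] ij True by simp
    then have "c i * c j * ((m - \<mu> i) * M (x i) (x j))
      = c i * c j * ((sqrt (m - \<mu> i) * sqrt (m - \<mu> j)) * M (x i) (x j))" by simp
    then show ?thesis by (simp only: mult_ac)
   qed (use o[of i j] ij in auto)
  qed
  also have "... = (\<Sum>i<k. (c i * sqrt (m - \<mu> i)) * M (x i) z)"
   unfolding z_def using symbil_sum2[OF V symM, of "{..<k}" x _ "%i. c i * sqrt (m - \<mu> i)"] xV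
   by (intro sum.cong) (auto simp: sum_distrib_left)
  also have "... = M z z"
   using symbil_sum[OF V symM, of "{..<k}" x z "%i. c i * sqrt (m - \<mu> i)"] xV zV by (auto simp: z_def[symmetric])
  finally have "Q y y <= m * M y y" using psd_nonneg[OF M zV] by linarith
  then have "Q y y / M y y <= m" using My by (simp add: field_simps)
  then show "0 < M (\<Sum>i<k. c i \<cdot> x i) (\<Sum>i<k. c i \<cdot> x i)"
   "Q (\<Sum>i<k. c i \<cdot> x i) (\<Sum>i<k. c i \<cdot> x i) / M (\<Sum>i<k. c i \<cdot> x i) (\<Sum>i<k. c i \<cdot> x i) \<in> S"
   using My down[OF mS] unfolding y_def by auto
 qed
qed

lemma chain_count:
 assumes ch: "chain k e l" and "l (k - 1) \<in> S" and down: "!!a b. b \<in> S ==> a <= b ==> a \<in> S"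
 shows "count S k"
 unfolding count_def
proof (intro exI[of _ l] exI[of _ e] conjI allI impI)
 fix i assume i: "i < k"
 show "l i \<in> S" using chain_mono[OF ch, of i "k - 1"] i down[OF assms(2)] by auto
 show "eig (l i) (e i)" using ch i by (auto simp: chain_def)
next
 fix c i assume 0: "M (\<Sum>i<k. c i \<cdot> e i) (\<Sum>i<k. c i \<cdot> e i) = 0" and i: "i < k"
 have eV: "e p \<in> V" if "p < k" for p using ch that by (auto simp: chain_def eig_def)
 define y where "y = (\<Sum>i<k. c i \<cdot> e i)"
 have yV: "y \<in> V" unfolding y_def by (rule lincomb_V) (rule eV)
 have ortho: "M (e a) (e b) = 0" if "a < k" "b < k" "a ~= b" for a b
  using ch that symbil_sym[OF symM eV eV, of a b] unfolding chain_def by (metis linorder_neqE_nat)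
 have "(M y (e i))^2 <= 0" using psd_Cauchy_Schwarz[OF V M yV eV[OF i]] 0 by (simp add: y_def)
 moreover have "M y (e i) = (\<Sum>p<k. c p * M (e p) (e i))"
  unfolding y_def using symbil_sum[OF V symM, of "{..<k}" e "e i" c] eV i by auto
 moreover have "... = (\<Sum>p<k. if p = i then c i else 0)"
  using ortho i ch by (intro sum.cong) (auto simp: chain_def)
 ultimately show "c i = 0" using i by simp
qed

text \<open>The min-max principle in the form used throughout: one number \<open>l\<close> decides,
  for each downward closed \<open>S\<close>, both the existence of \<open>k\<close> eigenvalues in
  \<open>S\<close> and that of a trial space. Closed half-lines give weak bounds and the least
  eigenvalue, open ones give strict bounds.\<close>

theorem eigenvalue_exists:
 assumes "test S0 k" "k >= 1"
 shows "\<exists>l\<in>S0. \<forall>S. (\<forall>a b. b \<in> S --> a <= b --> a \<in> S) --> (count S k \<longleftrightarrow> l \<in> S) \<and> (test S k \<longleftrightarrow> l \<in> S)"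
proof -
 from chain_exists[OF assms(1)] obtain e l where ch: "chain k e l" by blast
 have "l (k - 1) \<in> S0" using ch assms(2) by (auto simp: chain_def)
 moreover have "(count S k \<longleftrightarrow> l (k-1) \<in> S) \<and> (test S k \<longleftrightarrow> l (k-1) \<in> S)"
  if d: "\<forall>a b. b \<in> S --> a <= b --> a \<in> S" for S
  using chain_count[OF ch, of S] count_test[of S k] test_chain[of S k, OF _ _ ch assms(2)] d by blast
 ultimately show ?thesis by blast
qed

end

section \<open>Functions as vectors, so that the abstract theory applies to triples of
  functions\<close>

instantiation "fun" :: (type, real_vector) real_vector
begin
definition scaleR_fun :: "real => ('a => 'b) => 'a => 'b" where
 "scaleR_fun r f = (%x. r \<cdot> f x)"
instance
 by standard (auto simp: scaleR_fun_def fun_eq_iff algebra_simps)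
end

lemma scaleR_fun_apply [simp]: "(r \<cdot> f) x = r \<cdot> f x"
 by (simp add: scaleR_fun_def)

lemma minus_fun_apply [simp]: "(f - g) x = f x - g x" for f g :: "'a => 'b::ab_group_add"
 by (simp add: fun_diff_def)

lemma plus_fun_apply' [simp]: "(f + g) x = f x + g x" for f g :: "'a => 'b::monoid_add"
 by (simp add: plus_fun_def)

lemma zero_fun_apply' [simp]: "(0 :: 'a => 'b::monoid_add) x = 0"
 by (simp add: zero_fun_def)

lemma sum_fun_apply: "(\<Sum>i\<in>I. f i) x = (\<Sum>i\<in>I. f i x)" for f :: "'i => 'a => 'b::ab_group_add"
 by (induction I rule: infinite_finite_induct) auto

section \<open>Square integrable functions\<close>

text \<open>Genuine functions, not classes modulo null sets; this is one reason why the abstract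
  forms are only semidefinite.\<close>

definition L2 :: "'a measure => ('a => 'b::euclidean_space) set" where
 "L2 \<mu> = {f \<in> meas \<mu>. integrable \<mu> (%x. (norm (f x))^2)}"

lemma L2_measurable: "f \<in> L2 \<mu> ==> f \<in> meas \<mu>"
 and L2_integrable: "f \<in> L2 \<mu> ==> integrable \<mu> (%x. (norm (f x))^2)"
 by (auto simp: L2_def)

lemma L2_inner_integrable:
 assumes "f \<in> L2 \<mu>" "g \<in> L2 \<mu>" shows "integrable \<mu> (%x. f x \<bullet> g x)"
proof (rule Bochner_Integration.integrable_bound)
 show "integrable \<mu> (%x. (norm (f x))^2 + (norm (g x))^2)" using assms by (auto simp: L2_def)
 show "(%x. f x \<bullet> g x) \<in> meas \<mu>" using assms by (auto simp: L2_def)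
 show "AE x in \<mu>. norm (f x \<bullet> g x) <= norm ((norm (f x))^2 + (norm (g x))^2)"
 proof (rule AE_I2)
  fix x
  have "\<bar>f x \<bullet> g x\<bar> <= norm (f x) * norm (g x)" by (rule Cauchy_Schwarz_ineq2)
  also have "... <= (norm (f x))^2 + (norm (g x))^2"
   using sum_squares_bound[of "norm (f x)" "norm (g x)"] mult_nonneg_nonneg[OF norm_ge_zero norm_ge_zero, of "f x" "g x"]
   by linarith
  finally show "norm (f x \<bullet> g x) <= norm ((norm (f x))^2 + (norm (g x))^2)" by simp
 qed
qed

lemma L2_subspace: "subspace (L2 \<mu>)"
 unfolding subspace_def
proof (intro conjI ballI allI)
 show "0 \<in> L2 \<mu>" by (auto simp: L2_def zero_fun_def)
 fix f :: "'a => 'b" and c :: real assume f: "f \<in> L2 \<mu>"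
 then show "c \<cdot> f \<in> L2 \<mu>"
  by (auto simp: L2_def power_mult_distrib scaleR_fun_def)
next
 fix f g :: "'a => 'b" assume f: "f \<in> L2 \<mu>" "g \<in> L2 \<mu>"
 have "integrable \<mu> (%x. f x \<bullet> f x + 2 * (f x \<bullet> g x) + g x \<bullet> g x)"
  using f by (intro Bochner_Integration.integrable_add integrable_mult_right L2_inner_integrable)
 also have "(%x. f x \<bullet> f x + 2 * (f x \<bullet> g x) + g x \<bullet> g x) = (%x. (norm (f x + g x))^2)"
  by (auto simp: power2_norm_eq_inner algebra_simps inner_commute)
 finally show "f + g \<in> L2 \<mu>" using f by (auto simp: L2_def plus_fun_def)
qed

lemma L2_diff: "f \<in> L2 \<mu> ==> g \<in> L2 \<mu> ==> (%x. f x - g x) \<in> L2 \<mu>"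
 using subspace_diff[OF L2_subspace, of f \<mu> g] by (simp add: fun_diff_def)

lemma L2_nn: "f \<in> L2 \<mu> ==> (\<integral>\<^sup>+x. ennreal ((norm (f x))^2) \<partial>\<mu>) = ennreal (\<integral>x. (norm (f x))^2 \<partial>\<mu>)"
 by (rule nn_integral_eq_integral) (auto simp: L2_def)

lemma L2_nnI:
 assumes "f \<in> meas \<mu>" "(\<integral>\<^sup>+x. ennreal ((norm (f x))^2) \<partial>\<mu>) < \<infinity>"
 shows "f \<in> L2 \<mu>"
 using assms by (auto simp: L2_def intro!: integrableI_nonneg)

lemma summable_diffs_converge:
 fixes F :: "nat => 'b::banach"
 assumes "summable (%n. norm (F (Suc n) - F n))"
 shows "F ----> lim F"
proof -
 have "summable (%n. F (Suc n) - F n)" using assms by (rule summable_norm_cancel)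
 then have "convergent (%n. \<Sum>i<n. F (Suc i) - F i)" by (simp add: summable_iff_convergent)
 then have "convergent (%n. F n - F 0)" by (simp add: sum_lessThan_telescope)
 then obtain L where "(%n. F n - F 0) ----> L" by (auto simp: convergent_def)
 then have "(%n. (F n - F 0) + F 0) ----> L + F 0" by (intro tendsto_intros)
 then show ?thesis by (simp add: convergent_LIMSEQ_iff[symmetric] convergentI)
qed

text \<open>Riesz-Fischer: a rapidly convergent subsequence converges almost everywhere, and Fatou's
  lemma turns the Cauchy condition into convergence of the whole sequence to its pointwise
  limit.\<close>

lemma L2_complete:
 fixes f :: "nat => 'a => 'b::euclidean_space"
 assumes f: "!!n. f n \<in> L2 \<mu>"
  and Cauchy: "!!e. e > 0 ==> \<exists>K. \<forall>i\<ge>K. \<forall>j\<ge>K. (\<integral>x. (norm (f i x - f j x))^2 \<partial>\<mu>) < e"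
 shows "\<exists>g\<in>L2 \<mu>. (%n. \<integral>x. (norm (f n x - g x))^2 \<partial>\<mu>) ----> 0"
proof -
 have meas [measurable]: "f n \<in> meas \<mu>" for n using f by (rule L2_measurable)
 have "\<exists>K. \<forall>n. (\<forall>i\<ge>K n. \<forall>j\<ge>K n. (\<integral>x. (norm (f i x - f j x))^2 \<partial>\<mu>) < (1/4) ^ n)"
  by (intro choice allI Cauchy) simp
 then obtain K where K: "!!n i j. i >= K n ==> j >= K n ==> (\<integral>x. (norm (f i x - f j x))^2 \<partial>\<mu>) < (1/4) ^ n" by blast
 \<comment> \<open>The sum, in place of a maximum, makes \<open>r n\<close> dominate
   \<open>n\<close> and every \<open>K i\<close> with \<open>i <= n\<close>.\<close>
 define r where "r n = n + (\<Sum>i\<le>n. K i)" for n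
 have rK: "K n <= r n" "K n <= r (Suc n)" "n <= r n" for n
 proof -
  have "K n <= (\<Sum>i\<le>n. K i)" by (rule member_le_sum) auto
  then show "K n <= r n" "K n <= r (Suc n)" "n <= r n" by (auto simp: r_def)
 qed
 \<comment> \<open>The squared increments have integrals at most \<open>(1/4) ^ n\<close>, which
   leaves room for the factor \<open>2 ^ n\<close> below. Pointwise either
   \<open>d n x <= (1/2) ^ n\<close> or \<open>d n x <= 2 ^ n * (d n x)^2\<close>, so the increments
   are summable almost everywhere.\<close>
 define d where "d n x = norm (f (r (Suc n)) x - f (r n) x)" for n x
 have [measurable]: "d n \<in> meas \<mu>" for n unfolding d_def by measurable
 have dint: "(\<integral>\<^sup>+x. ennreal ((d n x)^2) \<partial>\<mu>) <= ennreal ((1/4) ^ n)" for n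
  using L2_nn[OF L2_diff[OF f f], of "r (Suc n)" "r n"] K[OF rK(2) rK(1), of n]
  by (auto simp: d_def intro!: ennreal_leI)
 have "(\<integral>\<^sup>+x. (\<Sum>n. ennreal (2 ^ n * (d n x)^2)) \<partial>\<mu>) = (\<Sum>n. \<integral>\<^sup>+x. ennreal (2 ^ n * (d n x)^2) \<partial>\<mu>)"
  by (rule nn_integral_suminf) measurable
 also have "... <= (\<Sum>n. ennreal ((1/2) ^ n))"
 proof (rule suminf_le)
  fix n
  have "(\<integral>\<^sup>+x. ennreal (2 ^ n * (d n x)^2) \<partial>\<mu>) = ennreal (2 ^ n) * (\<integral>\<^sup>+x. ennreal ((d n x)^2) \<partial>\<mu>)"
   by (simp add: ennreal_mult nn_integral_cmult)
  also have "... <= ennreal (2 ^ n) * ennreal ((1/4) ^ n)" by (intro mult_left_mono dint) auto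
  also have "... = ennreal ((1/2) ^ n)"
   by (simp only: ennreal_mult[symmetric] zero_le_power zero_le_divide_iff zero_le_one zero_le_numeral
     power_mult_distrib[symmetric] simp_thms) simp
  finally show "(\<integral>\<^sup>+x. ennreal (2 ^ n * (d n x)^2) \<partial>\<mu>) <= ennreal ((1/2) ^ n)" .
 qed auto
 also have "... < \<infinity>" using summable_geometric[of "1/2::real"]
  by (subst suminf_ennreal2) (auto simp: less_top[symmetric])
 finally have "AE x in \<mu>. (\<Sum>n. ennreal (2 ^ n * (d n x)^2)) ~= \<infinity>"
  by (intro nn_integral_noteq_infinite) auto
 then have conv: "AE x in \<mu>. (%n. f (r n) x) ----> lim (%n. f (r n) x)"
 proof eventually_elim
  case (elim x)
  have "summable (%n. 2 ^ n * (d n x)^2)" using elim by (intro summable_suminf_not_top) auto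
  then have "summable (%n. (1/2) ^ n + 2 ^ n * (d n x)^2)" by (intro summable_add summable_geometric) auto
  then have "summable (%n. d n x)"
  proof (rule summable_comparison_test_ev[rotated], intro always_eventually allI)
   fix n
   have dn: "d n x >= 0" by (simp add: d_def)
   have "d n x <= (1/2) ^ n + 2 ^ n * (d n x)^2"
   proof (cases "d n x <= (1/2) ^ n")
    case False
    then have "1 <= 2 ^ n * d n x" by (simp add: field_simps power_one_over)
    then have "1 * d n x <= 2 ^ n * d n x * d n x" using dn by (intro mult_right_mono) auto
    then show ?thesis by (simp add: power2_eq_square add_increasing)
   qed (use dn in \<open>simp add: add_increasing2\<close>)
   then show "norm (d n x) <= (1/2) ^ n + 2 ^ n * (d n x)^2" using dn by simp
  qed
  then show ?case unfolding d_def by (rule summable_diffs_converge)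
 qed
 define g where "g x = lim (%n. f (r n) x)" for x
 have gm [measurable]: "g \<in> meas \<mu>" unfolding g_def by (rule borel_measurable_lim_metric) simp
 \<comment> \<open>Used twice: with \<open>e = 1\<close> it shows that \<open>g\<close> is square
   integrable, with arbitrary \<open>e\<close> it gives the convergence.\<close>
 have Fatou: "(\<integral>\<^sup>+x. ennreal ((norm (f m x - g x))^2) \<partial>\<mu>) <= ennreal e"
  if e: "e > 0" and m: "!!i j. i >= N ==> j >= N ==> (\<integral>x. (norm (f i x - f j x))^2 \<partial>\<mu>) < e" and mN: "m >= N" for e m N
 proof -
  have "(\<integral>\<^sup>+x. ennreal ((norm (f m x - g x))^2) \<partial>\<mu>)
   = (\<integral>\<^sup>+x. liminf (%n. ennreal ((norm (f m x - f (r n) x))^2)) \<partial>\<mu>)"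
  proof (rule nn_integral_cong_AE, use conv in eventually_elim)
   case (elim x)
   have "(%n. ennreal ((norm (f m x - f (r n) x))^2)) ----> ennreal ((norm (f m x - g x))^2)"
    unfolding g_def by (intro tendsto_intros elim)
   then show ?case by (rule lim_imp_Liminf[OF trivial_limit_sequentially, symmetric])
  qed
  also have "... <= liminf (%n. \<integral>\<^sup>+x. ennreal ((norm (f m x - f (r n) x))^2) \<partial>\<mu>)"
   by (rule nn_integral_liminf) measurable
  also have "... <= ennreal e"
  proof (rule Liminf_le, simp, rule eventually_sequentiallyI[of N])
   fix n assume "N <= n"
   then have "N <= r n" using rK(3)[of n] by linarith
   then show "(\<integral>\<^sup>+x. ennreal ((norm (f m x - f (r n) x))^2) \<partial>\<mu>) <= ennreal e"
    using L2_nn[OF L2_diff[OF f f], of m "r n"] m[OF mN, of "r n"] by (auto intro!: ennreal_leI)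
  qed
  finally show ?thesis .
 qed
 obtain N1 where N1: "!!i j. i >= N1 ==> j >= N1 ==> (\<integral>x. (norm (f i x - f j x))^2 \<partial>\<mu>) < 1"
  using Cauchy[of 1] by auto
 have "(%x. f N1 x - g x) \<in> L2 \<mu>"
  using Fatou[of 1 N1 N1, OF _ N1] by (intro L2_nnI) (auto intro: le_less_trans)
 from L2_diff[OF f[of N1] this] have gL: "g \<in> L2 \<mu>" by simp
 moreover have "(%n. \<integral>x. (norm (f n x - g x))^2 \<partial>\<mu>) ----> 0"
 proof (rule LIMSEQ_I)
  fix e :: real assume "e > 0"
  then obtain N where N: "!!i j. i >= N ==> j >= N ==> (\<integral>x. (norm (f i x - f j x))^2 \<partial>\<mu>) < e/2"
   using Cauchy[of "e/2"] by auto
  show "\<exists>no. \<forall>n\<ge>no. norm ((\<integral>x. (norm (f n x - g x))^2 \<partial>\<mu>) - 0) < e"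
  proof (intro exI[of _ N] allI impI)
   fix n assume "N <= n"
   then have "ennreal (\<integral>x. (norm (f n x - g x))^2 \<partial>\<mu>) <= ennreal (e/2)"
    using Fatou[of "e/2" N n] N \<open>e > 0\<close> L2_nn[OF L2_diff[OF f gL], of n] by auto
   then have "(\<integral>x. (norm (f n x - g x))^2 \<partial>\<mu>) <= e/2" using \<open>e > 0\<close> by (simp add: ennreal_le_iff)
   then show "norm ((\<integral>x. (norm (f n x - g x))^2 \<partial>\<mu>) - 0) < e" using \<open>e > 0\<close> by (simp add: integral_nonneg_AE)
  qed
 qed
 ultimately show ?thesis by blast
qed

lemma L2_inner_psd: "psd (L2 \<mu>) (%f g. \<integral>x. f x \<bullet> g x \<partial>\<mu>)"
 unfolding psd_def symbil_def
 by (auto simp: inner_add_left inner_add_right L2_inner_integrable intro!: Bochner_Integration.integral_cong)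
   (simp_all add: inner_commute)

section \<open>The Sobolev space\<close>

text \<open>A function, its weak gradient and its trace on the unit circle.\<close>

type_synonym triple = "(real^2 => real) \<times> (real^2 => real^2) \<times> (real^2 => real)"

abbreviation leb :: "(real^2) set => (real^2) measure" where "leb U \<equiv> restrict_space lborel U"

definition circ_measure :: "(real^2) measure" where
 "circ_measure = distr (restrict_space lborel {0..<2*pi}) borel (cc 1)"

definition EE :: "(real^2) set => triple => triple => real" where
 "EE U x y = (\<integral>z. fst (snd x) z \<bullet> fst (snd y) z \<partial>leb U)"

definition MM :: "(real^2 => real) => (real^2) set => triple => triple => real" where
 "MM w U x y = (\<integral>z. w z * (fst x z * fst y z) \<partial>leb U)"

definition BB :: "triple => triple => real" where
 "BB x y = (\<integral>z. snd (snd x) z * snd (snd y) z \<partial>circ_measure)"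

definition T3 :: "(real^2) set => triple set" where
 "T3 U = L2 (leb U) \<times> L2 (leb U) \<times> L2 circ_measure"

text \<open>Smooth triples. The third component is the function on the whole plane, of which
  \<open>BB\<close> sees only the values on the unit circle.\<close>

definition SM :: "triple set" where
 "SM = {(\<phi>, D\<phi>, \<phi>) | \<phi> D\<phi>. C1c \<phi> D\<phi>}"

abbreviation one :: "real^2 => real" where "one \<equiv> %_. 1"

definition NN :: "(real^2) set => triple => triple => real" where
 "NN U x y = EE U x y + BB x y + MM one U x y"

text \<open>Closure of the smooth triples, with function, gradient and trace approximated by one and
  the same sequence. \<open>HH_iff_nn\<close> and \<open>H1_iff\<close> connect it with
  \<open>H1\<close>.\<close>

definition HH :: "(real^2) set => triple set" where
 "HH U = {x \<in> T3 U. \<forall>e>0. \<exists>s\<in>SM. NN U (x - s) (x - s) < e}"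

abbreviation "E2 U x \<equiv> EE U x x"
abbreviation "M2 w U x \<equiv> MM w U x x"
abbreviation "N2 U x \<equiv> NN U x x"
abbreviation "B2 x \<equiv> BB x x"

definition weight :: "(real^2 => real) => (real^2) set => bool" where
 "weight w U \<longleftrightarrow> w \<in> meas borel \<and> (\<exists>C. \<forall>z\<in>U. 0 <= w z \<and> w z <= C)"

lemma T3_subspace: "subspace (T3 U)"
 unfolding T3_def
 using L2_subspace[of "leb U", where 'b=real] L2_subspace[of "leb U", where 'b="real^2"] L2_subspace[of circ_measure, where 'b=real]
 by (auto simp: subspace_def zero_prod_def)

lemma EE_psd: "psd (T3 U) (EE U)"
 using L2_inner_psd[of "leb U", where 'b="real^2"] unfolding psd_def symbil_def T3_def EE_def by auto

lemma BB_psd: "psd (T3 U) BB"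
 using L2_inner_psd[of circ_measure, where 'b=real] unfolding psd_def symbil_def T3_def BB_def by auto

lemma weight_one [simp]: "weight one U" by (auto simp: weight_def intro: exI[of _ 1])

lemma MM_integrable:
 assumes "weight w U" "open U" "f \<in> L2 (leb U)" "g \<in> L2 (leb U)"
 shows "integrable (leb U) (%z. w z * (f z * g z :: real))"
proof -
 from assms obtain C where C: "!!z. z \<in> U ==> 0 <= w z \<and> w z <= C" by (auto simp: weight_def)
 have [measurable]: "w \<in> meas (leb U)" using assms(1)
  by (intro measurable_restrict_space1) (auto simp: weight_def)
 show ?thesis
 proof (rule Bochner_Integration.integrable_bound)
  show "integrable (leb U) (%z. C * (f z * g z))"
   using L2_inner_integrable[OF assms(3,4)] by auto
  show "(%z. w z * (f z * g z)) \<in> meas (leb U)"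
   using L2_measurable[OF assms(3)] L2_measurable[OF assms(4)] by auto
  show "AE z in leb U. norm (w z * (f z * g z)) <= norm (C * (f z * g z))"
  proof (rule AE_I2)
   fix z assume "z \<in> space (leb U)"
   then have "\<bar>w z\<bar> <= \<bar>C\<bar>" using C[of z] by (auto simp: space_restrict_space)
   then show "norm (w z * (f z * g z)) <= norm (C * (f z * g z))"
    by (simp add: abs_mult mult_right_mono)
  qed
 qed
qed

lemma MM_psd: assumes "weight w U" "open U" shows "psd (T3 U) (MM w U)"
proof -
 have sp: "space (leb U) = U" by (simp add: space_restrict_space)
 have nn: "0 <= MM w U x x" for x
  unfolding MM_def using assms(1) by (intro integral_nonneg_AE AE_I2) (auto simp: sp weight_def)
 have 1: "MM w U x y = MM w U y x" for x y by (simp add: MM_def mult_ac)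
 have 2: "MM w U (x + y) z = MM w U x z + MM w U y z" if "x \<in> T3 U" "y \<in> T3 U" "z \<in> T3 U" for x y z
  using that MM_integrable[OF assms]
  by (auto simp: MM_def T3_def algebra_simps simp flip: Bochner_Integration.integral_add)
 have "MM w U (c \<cdot> x) y = (\<integral>z. c * (w z * (fst x z * fst y z)) \<partial>leb U)" for c x y
  unfolding MM_def by (intro Bochner_Integration.integral_cong) auto
 then have 3: "MM w U (c \<cdot> x) y = c * MM w U x y" for c x y by (simp add: MM_def)
 show ?thesis unfolding psd_def symbil_def using nn 1 2 3 by blast
qed

lemma NN_psd: "open U ==> psd (T3 U) (NN U)"
 unfolding NN_def[abs_def] by (intro psd_sum EE_psd BB_psd MM_psd) auto

lemma MM_mono:
 assumes "weight w U" "weight w' U" "open U" "x \<in> T3 U" "!!z. z \<in> U ==> w z <= w' z"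
 shows "MM w U x x <= MM w' U x x"
 unfolding MM_def using assms
 by (intro integral_mono_AE AE_I2 MM_integrable mult_right_mono) (auto simp: T3_def space_restrict_space)

lemma MM_cmult: "MM (%z. c * w z) U x y = c * MM w U x y"
 by (simp add: MM_def mult.assoc)

lemma weight_cmult: "weight w U ==> c >= 0 ==> weight (%z. c * w z) U"
 unfolding weight_def
proof (elim conjE exE, intro conjI)
 fix C assume C: "c >= 0" "\<forall>z\<in>U. 0 <= w z \<and> w z <= C"
 then show "\<exists>C. \<forall>z\<in>U. 0 <= c * w z \<and> c * w z <= C"
  by (intro exI[of _ "c * C"]) (auto intro: mult_left_mono)
qed auto

section \<open>Smooth triples, their closure, and its completeness\<close>

lemma GDERIV_compact_support_zero:
 assumes "C1c \<phi> D\<phi>"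
 shows "\<exists>R>0. \<forall>x. norm x > R --> \<phi> x = 0 \<and> D\<phi> x = 0"
proof -
 from assms obtain R where R: "!!x. \<phi> x ~= 0 ==> norm x <= R" by (auto simp: C1_compact_support_def bounded_iff)
 show ?thesis
 proof (intro exI[of _ "max R 1"] conjI allI impI)
  fix x :: "real^2" assume x: "norm x > max R 1"
  then show "\<phi> x = 0" using R[of x] by force
  have "GDERIV \<phi> x :> D\<phi> x" using assms by (simp add: C1_compact_support_def)
  then have 1: "(\<phi> has_derivative (%h. h \<bullet> D\<phi> x)) (at x)" by (simp add: gderiv_def)
  have "((%_. 0) has_derivative (%h. h \<bullet> D\<phi> x)) (at x)"
  proof (rule has_derivative_transform_within_open[OF 1])
   show "open {y. norm y > max R 1}" by (intro open_Collect_less continuous_intros)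
   show "\<phi> y = 0" if "y \<in> {y. norm y > max R 1}" for y using that R[of y] by force
  qed (use x in auto)
  then have "(%h. h \<bullet> D\<phi> x) = (%h. 0)" by (rule has_derivative_unique) (rule has_derivative_const)
  then have "D\<phi> x \<bullet> D\<phi> x = 0" by meson
  then show "D\<phi> x = 0" by simp
 qed simp
qed

lemma C1_continuous: assumes "C1c \<phi> D\<phi>" shows "continuous_on A \<phi>" "continuous_on A D\<phi>"
proof -
 have "continuous_on UNIV \<phi>"
  using assms unfolding C1_compact_support_def gderiv_def
  by (intro continuous_at_imp_continuous_on ballI has_derivative_continuous) blast
 moreover have "continuous_on UNIV D\<phi>" using assms by (simp add: C1_compact_support_def)
 ultimately show "continuous_on A \<phi>" "continuous_on A D\<phi>" by (meson continuous_on_subset subset_UNIV)+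
qed

lemma continuous_compact_support_L2:
 fixes f :: "real^2 => 'b::euclidean_space"
 assumes "continuous_on UNIV f" "!!x. norm x > R ==> f x = 0" "open U"
 shows "f \<in> L2 (leb U)"
proof -
 have "integrable lborel (%x. indicator (cball 0 R) x \<cdot> (norm (f x))^2)"
  by (intro borel_integrable_compact) (auto intro!: continuous_intros continuous_on_subset[OF assms(1)])
 moreover have "(%x. indicator (cball 0 R) x \<cdot> (norm (f x))^2) = (%x. (norm (f x))^2)"
  using assms(2) by (auto simp: fun_eq_iff indicator_def not_le)
 ultimately have "integrable lborel (%x. (norm (f x))^2)" by simp
 then have "integrable (leb U) (%x. (norm (f x))^2)"
  using assms(3) integrable_mult_indicator[of U lborel "%x. (norm (f x))^2"]
  by (subst integrable_restrict_space) auto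
 moreover have "f \<in> meas (leb U)"
  using assms(1) by (intro measurable_restrict_space1) (simp add: borel_measurable_continuous_onI)
 ultimately show ?thesis by (simp add: L2_def)
qed

lemma circle_curve_nth [simp]: "cc r t $ 1 = r * cos t" "cc r t $ 2 = r * sin t"
 by (simp_all add: circle_curve_def)

lemma continuous_on_vec2:
 fixes f :: "'a::topological_space => real^2"
 assumes "continuous_on A (%x. f x $ 1)" "continuous_on A (%x. f x $ 2)"
 shows "continuous_on A f"
proof -
 have "continuous_on A (%x. f x $ i)" for i using assms exhaust_2[of i] by auto
 then have "continuous_on A (%x. \<chi> i. f x $ i)" by (rule continuous_on_vec_lambda)
 then show ?thesis by simp
qed

lemma continuous_on_circle_curve [continuous_intros]:
 fixes f g :: "'a::t2_space => real"
 assumes "continuous_on A f" "continuous_on A g"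
 shows "continuous_on A (%x. cc (f x) (g x))"
 by (rule continuous_on_vec2) (auto intro!: continuous_intros assms)

lemma circle_curve_measurable [measurable]: "cc r \<in> meas borel"
 by (intro borel_measurable_continuous_onI continuous_intros)

lemma norm_circle_curve [simp]: "norm (cc r t) = \<bar>r\<bar>"
proof -
 have "(r * cos t)^2 + (r * sin t)^2 = r^2 * ((sin t)^2 + (cos t)^2)"
  by (simp only: power_mult_distrib distrib_left add.commute)
 then have "(r * cos t)^2 + (r * sin t)^2 = r^2" by simp
 then show ?thesis by (simp add: norm_vec_def L2_set_def sum_2)
qed

lemma integral_circ: "f \<in> meas borel ==>
  (\<integral>z. f z \<partial>circ_measure) = (\<integral>t. f (cc 1 t) \<partial>restrict_space lborel {0..<2*pi})"
 for f :: "real^2 => real"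
 unfolding circ_measure_def by (rule integral_distr) (auto intro: measurable_restrict_space1)

lemma finite_measure_circ: "finite_measure circ_measure"
proof -
 have "finite_measure (restrict_space lborel {0..<2*pi})"
  by (intro finite_measureI) (simp add: emeasure_restrict_space space_restrict_space)
 then show ?thesis unfolding circ_measure_def
  by (rule finite_measure.finite_measure_distr) (auto intro: measurable_restrict_space1)
qed

lemma continuous_compact_support_L2_circ:
 fixes f :: "real^2 => real"
 assumes "continuous_on UNIV f"
 shows "f \<in> L2 circ_measure"
proof -
 have m: "f \<in> meas borel" using assms by (rule borel_measurable_continuous_onI)
 have "compact (f ` cball 0 1)" by (intro compact_continuous_image continuous_on_subset[OF assms]) auto
 then obtain C where C: "!!z. norm z <= 1 ==> norm (f z) <= C" by (force dest: compact_imp_bounded simp: bounded_iff)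
 have "AE z in circ_measure. norm ((norm (f z))^2) <= C^2"
  unfolding circ_measure_def
 proof (subst AE_distr_iff)
  show "AE t in restrict_space lborel {0..<2*pi}. norm ((norm (f (cc 1 t)))^2) <= C^2"
  proof (rule AE_I2)
   fix t :: real
   have "norm (cc 1 t) <= 1" by simp
   from power_mono[OF C[OF this], of 2] show "norm ((norm (f (cc 1 t)))^2) <= C^2" by simp
  qed
 qed (use m in \<open>auto intro: measurable_restrict_space1\<close>)
 moreover have "f \<in> meas circ_measure" using m by (simp add: circ_measure_def)
 ultimately show ?thesis unfolding L2_def
  by (auto intro!: finite_measure.integrable_const_bound[OF finite_measure_circ])
qed

lemma SM_T3: assumes "open U" shows "SM \<subseteq> T3 U"
proof
 fix s assume "s \<in> SM"
 then obtain \<phi> D\<phi> where s: "s = (\<phi>, D\<phi>, \<phi>)" and C: "C1c \<phi> D\<phi>" by (auto simp: SM_def)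
 from GDERIV_compact_support_zero[OF C] obtain R where R: "!!x. norm x > R ==> \<phi> x = 0" "!!x. norm x > R ==> D\<phi> x = 0" by blast
 show "s \<in> T3 U" unfolding T3_def s
  using continuous_compact_support_L2[OF C1_continuous(1)[OF C] R(1) assms]
   continuous_compact_support_L2[OF C1_continuous(2)[OF C] R(2) assms]
   continuous_compact_support_L2_circ[OF C1_continuous(1)[OF C]] by auto
qed

lemma SM_subspace: "subspace SM"
proof -
 have "C1c 0 0"
  by (auto simp: C1_compact_support_def gderiv_def zero_fun_def)
 moreover have "C1c (f + g) (Df + Dg)" if "C1c f Df" "C1c g Dg" for f g Df Dg
 proof -
  have "{x. f x + g x ~= 0} \<subseteq> {x. f x ~= 0} \<union> {x. g x ~= 0}" by auto
  then show ?thesis using that unfolding C1_compact_support_def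
   by (auto simp: plus_fun_def intro!: GDERIV_add continuous_intros elim: bounded_subset[rotated])
 qed
 moreover have "C1c (c \<cdot> f) (c \<cdot> Df)" if "C1c f Df" for f Df c
 proof -
  have "{x. c * f x ~= 0} \<subseteq> {x. f x ~= 0}" by auto
  moreover have "GDERIV (%x. c * f x) x :> c \<cdot> Df x" for x
   using that unfolding C1_compact_support_def gderiv_def
   by (auto intro!: derivative_eq_intros)
  ultimately show ?thesis using that unfolding C1_compact_support_def scaleR_fun_def
   by (auto intro!: continuous_intros elim: bounded_subset[rotated])
 qed
 ultimately show ?thesis
  unfolding subspace_def SM_def zero_prod_def
  by (intro conjI ballI allI; clarsimp; blast)
qed

lemma HH_T3: "HH U \<subseteq> T3 U" by (auto simp: HH_def)

lemma NN_parts: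
 assumes "open U" "x \<in> T3 U"
 shows "0 <= EE U x x" "0 <= B2 x" "0 <= MM one U x x" "EE U x x <= NN U x x" "B2 x <= NN U x x" "MM one U x x <= NN U x x"
proof -
 show 0: "0 <= EE U x x" "0 <= B2 x" "0 <= MM one U x x"
  using psd_nonneg[OF EE_psd assms(2)] psd_nonneg[OF BB_psd assms(2)] psd_nonneg[OF MM_psd assms(2)] assms(1) by auto
 then show "EE U x x <= NN U x x" "B2 x <= NN U x x" "MM one U x x <= NN U x x" by (auto simp: NN_def)
qed

lemma SM_HH: assumes "open U" shows "SM \<subseteq> HH U"
proof
 fix s assume s: "s \<in> SM"
 then have "N2 U (s - s) = 0" "s \<in> T3 U" using SM_T3[OF assms]
  by (auto simp: NN_def EE_def BB_def MM_def)
 then show "s \<in> HH U" using s unfolding HH_def by force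
qed

lemma HH_seq:
 assumes "open U" "x \<in> HH U"
 shows "\<exists>s. (\<forall>n. s n \<in> SM) \<and> (%n. N2 U (s n - x)) ----> 0"
proof -
 have xT: "x \<in> T3 U" using assms HH_T3[of U] by auto
 have sw: "N2 U (x - s) = N2 U (s - x)" if "s \<in> SM" for s
 proof -
  have "x - s \<in> T3 U" using that xT SM_T3[OF assms(1)] T3_subspace by (auto intro: subspace_diff)
  from symbil_scale_sq[OF T3_subspace psd_symbil[OF NN_psd[OF assms(1)]] this, of "-1"] show ?thesis by simp
 qed
 have "\<exists>s. \<forall>n. s n \<in> SM \<and> N2 U (x - s n) < 1 / real (Suc n)"
 proof (intro choice allI)
  fix n :: nat
  have "0 < 1 / real (Suc n)" by simp
  then show "\<exists>y. y \<in> SM \<and> N2 U (x - y) < 1 / real (Suc n)"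
   using assms(2) unfolding HH_def by blast
 qed
 then obtain s where s: "!!n. s n \<in> SM" "!!n. N2 U (x - s n) < 1 / real (Suc n)" by blast
 have "(%n. N2 U (s n - x)) ----> 0"
 proof (rule tendsto_sandwich[OF _ _ tendsto_const LIMSEQ_inverse_real_of_nat])
  have "s n - x \<in> T3 U" for n using s(1) xT SM_T3[OF assms(1)] T3_subspace by (auto intro: subspace_diff)
  then show "\<forall>\<^sub>F n in sequentially. 0 <= N2 U (s n - x)"
   using psd_nonneg[OF NN_psd[OF assms(1)]] by auto
  show "\<forall>\<^sub>F n in sequentially. N2 U (s n - x) <= inverse (real (Suc n))"
   using s sw by (auto simp: inverse_eq_divide less_imp_le intro!: always_eventually)
 qed
 with s(1) show ?thesis by blast
qed

lemma HH_seqI: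
 assumes "open U" "x \<in> T3 U" "!!n. s n \<in> HH U" "(%n. N2 U (s n - x)) ----> 0"
 shows "x \<in> HH U"
 unfolding HH_def
proof (intro CollectI conjI allI impI assms(2))
 fix e :: real assume "e > 0"
 then have "\<forall>\<^sub>F n in sequentially. N2 U (s n - x) < e/4"
  using order_tendstoD(2)[OF assms(4), of "e/4"] by simp
 then obtain n where n: "N2 U (s n - x) < e/4" by (auto simp: eventually_sequentially)
 have "e/4 > 0" using \<open>e > 0\<close> by simp
 then obtain t where t: "t \<in> SM" "N2 U (s n - t) < e/4" using assms(3)[of n] unfolding HH_def by blast
 have T: "s n \<in> T3 U" "t \<in> T3 U" using assms t SM_T3[OF assms(1)] HH_T3[of U] by auto
 have "N2 U ((s n - t) - (s n - x)) <= 2 * N2 U (s n - t) + 2 * N2 U (s n - x)"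
  using T assms(2) T3_subspace by (intro psd_diff_bound(1)[OF T3_subspace NN_psd[OF assms(1)]]) (auto intro: subspace_diff)
 then have "N2 U (x - t) < e" using n t by simp
 then show "\<exists>s\<in>SM. N2 U (x - s) < e" using t by blast
qed

lemma HH_subspace: assumes "open U" shows "subspace (HH U)"
proof -
 note sb = psd_symbil[OF NN_psd[OF assms]]
 have "0 \<in> HH U" using SM_HH[OF assms] subspace_0[OF SM_subspace] by auto
 moreover have "x + y \<in> HH U" if xy: "x \<in> HH U" "y \<in> HH U" for x y
 proof -
  obtain s where s: "!!n. s n \<in> SM" "(%n. N2 U (s n - x)) ----> 0"
   using HH_seq[OF assms xy(1)] by blast
  obtain t where t: "!!n. t n \<in> SM" "(%n. N2 U (t n - y)) ----> 0"
   using HH_seq[OF assms xy(2)] by blast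
  have T: "x \<in> T3 U" "y \<in> T3 U" "!!n. s n \<in> T3 U" "!!n. t n \<in> T3 U" using xy s t SM_T3[OF assms] HH_T3[of U] by auto
  show ?thesis
  proof (rule HH_seqI[OF assms, of _ "%n. s n + t n"])
   show "x + y \<in> T3 U" using T T3_subspace by (simp add: subspace_add)
   show "s n + t n \<in> HH U" for n using s t SM_HH[OF assms] subspace_add[OF SM_subspace] by blast
   have l: "(%n. 2 * N2 U (s n - x) + 2 * N2 U (t n - y)) ----> 0"
    using tendsto_add[OF tendsto_mult_left[OF s(2), of 2] tendsto_mult_left[OF t(2), of 2]] by simp
   have T': "s n - x \<in> T3 U" "t n - y \<in> T3 U" "(s n + t n) - (x + y) \<in> T3 U" for n
    using T T3_subspace by (auto intro!: subspace_diff subspace_add)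
   show "(%n. N2 U (s n + t n - (x + y))) ----> 0"
   proof (rule tendsto_sandwich[OF _ _ tendsto_const l])
    show "\<forall>\<^sub>F n in sequentially. 0 <= N2 U (s n + t n - (x + y))"
     using psd_nonneg[OF NN_psd[OF assms] T'(3)] by auto
    have "N2 U (s n + t n - (x + y)) <= 2 * N2 U (s n - x) + 2 * N2 U (t n - y)" for n
     using psd_diff_bound(2)[OF T3_subspace NN_psd[OF assms] T'(1,2), of n n] by (simp add: algebra_simps)
    then show "\<forall>\<^sub>F n in sequentially. N2 U (s n + t n - (x + y)) <= 2 * N2 U (s n - x) + 2 * N2 U (t n - y)"
     by auto
   qed
  qed
 qed
 moreover have "c \<cdot> x \<in> HH U" if xy: "x \<in> HH U" for c x
 proof -
  obtain s where s: "!!n. s n \<in> SM" "(%n. N2 U (s n - x)) ----> 0"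
   using HH_seq[OF assms xy] by blast
  have T: "x \<in> T3 U" "!!n. s n \<in> T3 U" using xy s SM_T3[OF assms] HH_T3[of U] by auto
  show ?thesis
  proof (rule HH_seqI[OF assms, of _ "%n. c \<cdot> s n"])
   show "c \<cdot> x \<in> T3 U" using T T3_subspace by (simp add: subspace_scale)
   show "c \<cdot> s n \<in> HH U" for n using s SM_HH[OF assms] subspace_scale[OF SM_subspace] by blast
   have "N2 U (c \<cdot> s n - c \<cdot> x) = c^2 * N2 U (s n - x)" for n
    using symbil_scale_sq[OF T3_subspace sb, of "s n - x" c] T T3_subspace
    by (simp add: scaleR_diff_right subspace_diff)
   then show "(%n. N2 U (c \<cdot> s n - c \<cdot> x)) ----> 0"
    using tendsto_mult_left[OF s(2), of "c^2"] by simp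
  qed
 qed
 ultimately show ?thesis by (auto simp: subspace_def)
qed

text \<open>The three components converge separately by completeness of \<open>L2\<close>, and a
  closure contains its limits.\<close>

lemma HH_complete:
 assumes "open U" "!!n. x n \<in> HH U" "form_Cauchy (NN U) x"
 shows "\<exists>z\<in>HH U. (%n. N2 U (x n - z)) ----> 0"
proof -
 have T1: "x n \<in> T3 U" for n using assms HH_T3[of U] by auto
 have T: "x n \<in> T3 U" "x i - x j \<in> T3 U" for n i j using T1 subspace_diff[OF T3_subspace T1 T1] by auto
 have c: "\<exists>K. \<forall>i\<ge>K. \<forall>j\<ge>K. E2 U (x i - x j) < e \<and> B2 (x i - x j) < e \<and> M2 one U (x i - x j) < e"
  if "e > 0" for e
  using assms(3)[unfolded form_Cauchy_def, rule_format, OF that] NN_parts[OF assms(1) T(2)]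
  by (meson le_less_trans)
 obtain u where u: "u \<in> L2 (leb U)" "(%n. \<integral>z. (norm (fst (x n) z - u z))^2 \<partial>leb U) ----> 0"
 proof -
  have "\<exists>g\<in>L2 (leb U). (%n. \<integral>z. (norm (fst (x n) z - g z))^2 \<partial>leb U) ----> 0"
  proof (rule L2_complete)
   show "fst (x n) \<in> L2 (leb U)" for n using T(1)[of n] by (auto simp: T3_def)
   show "\<exists>K. \<forall>i\<ge>K. \<forall>j\<ge>K. (\<integral>z. (norm (fst (x i) z - fst (x j) z))^2 \<partial>leb U) < e" if "e > 0" for e
    using c[OF that] by (auto simp: MM_def power2_eq_square)
  qed
  then show ?thesis using that by blast
 qed
 obtain D where D: "D \<in> L2 (leb U)" "(%n. \<integral>z. (norm (fst (snd (x n)) z - D z))^2 \<partial>leb U) ----> 0"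
 proof -
  have "\<exists>g\<in>L2 (leb U). (%n. \<integral>z. (norm (fst (snd (x n)) z - g z))^2 \<partial>leb U) ----> 0"
  proof (rule L2_complete)
   show "fst (snd (x n)) \<in> L2 (leb U)" for n using T(1)[of n] by (auto simp: T3_def)
   show "\<exists>K. \<forall>i\<ge>K. \<forall>j\<ge>K. (\<integral>z. (norm (fst (snd (x i)) z - fst (snd (x j)) z))^2 \<partial>leb U) < e" if "e > 0" for e
    using c[OF that] by (auto simp: EE_def power2_norm_eq_inner)
  qed
  then show ?thesis using that by blast
 qed
 obtain t where t: "t \<in> L2 circ_measure" "(%n. \<integral>z. (norm (snd (snd (x n)) z - t z))^2 \<partial>circ_measure) ----> 0"
 proof -
  have "\<exists>g\<in>L2 circ_measure. (%n. \<integral>z. (norm (snd (snd (x n)) z - g z))^2 \<partial>circ_measure) ----> 0"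
  proof (rule L2_complete)
   show "snd (snd (x n)) \<in> L2 circ_measure" for n using T(1)[of n] by (auto simp: T3_def)
   show "\<exists>K. \<forall>i\<ge>K. \<forall>j\<ge>K. (\<integral>z. (norm (snd (snd (x i)) z - snd (snd (x j)) z))^2 \<partial>circ_measure) < e" if "e > 0" for e
    using c[OF that] by (auto simp: BB_def power2_eq_square)
  qed
  then show ?thesis using that by blast
 qed
 define z where "z = (u, D, t)"
 have zT: "z \<in> T3 U" using u D t by (auto simp: z_def T3_def)
 have lim: "(%n. N2 U (x n - z)) ----> 0"
 proof -
  have "(%n. (\<integral>z. (norm (fst (snd (x n)) z - D z))^2 \<partial>leb U) + (\<integral>z. (norm (snd (snd (x n)) z - t z))^2 \<partial>circ_measure)
    + (\<integral>z. (norm (fst (x n) z - u z))^2 \<partial>leb U)) ----> 0 + 0 + 0"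
   by (intro tendsto_add u D t)
  then show ?thesis unfolding power2_norm_eq_inner
   by (simp add: NN_def EE_def BB_def MM_def z_def)
 qed
 have "z \<in> HH U" by (rule HH_seqI[OF assms(1) zT assms(2) lim])
 then show ?thesis using lim by blast
qed

lemma MM_le_NN:
 assumes "open U" "weight w U"
 shows "\<exists>C\<ge>0. \<forall>x\<in>T3 U. MM w U x x <= C * MM one U x x"
proof -
 from assms obtain C where C: "!!z. z \<in> U ==> 0 <= w z \<and> w z <= C" by (auto simp: weight_def)
 have "MM w U x x <= max C 0 * MM one U x x" if "x \<in> T3 U" for x
 proof -
  have "MM w U x x <= MM (%z. max C 0 * one z) U x x"
  proof (rule MM_mono[OF assms(2) _ assms(1) that])
   show "weight (%z. max C 0 * one z) U" by (rule weight_cmult) auto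
  qed (use C in force)
  then show ?thesis by (simp only: MM_cmult)
 qed
 then show ?thesis by (intro exI[of _ "max C 0"]) auto
qed

lemma NN_tendsto:
 assumes "open U" "!!n. s n \<in> T3 U" "x \<in> T3 U" "(%n. N2 U (s n - x)) ----> 0"
 shows "(%n. E2 U (s n)) ----> EE U x x" "(%n. B2 (s n)) ----> B2 x"
  "weight w U ==> (%n. M2 w U (s n)) ----> MM w U x x"
  "y \<in> T3 U ==> (%n. EE U (s n) y) ----> EE U x y" "y \<in> T3 U ==> (%n. BB (s n) y) ----> BB x y"
proof -
 have d: "s n - x \<in> T3 U" for n using assms T3_subspace by (auto intro: subspace_diff)
 note p = NN_parts[OF assms(1) d]
 have E0: "(%n. E2 U (s n - x)) ----> 0"
  by (rule tendsto_sandwich[OF _ _ tendsto_const assms(4)]) (use p in auto)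
 have B0: "(%n. B2 (s n - x)) ----> 0"
  by (rule tendsto_sandwich[OF _ _ tendsto_const assms(4)]) (use p in auto)
 have M0: "(%n. M2 one U (s n - x)) ----> 0"
  by (rule tendsto_sandwich[OF _ _ tendsto_const assms(4)]) (use p in auto)
 note tE = psd_tendsto[where x = s, OF T3_subspace EE_psd assms(2,3) E0]
 note tB = psd_tendsto[where x = s, OF T3_subspace BB_psd assms(2,3) B0]
 show "(%n. E2 U (s n)) ----> EE U x x" "(%n. B2 (s n)) ----> B2 x"
  "y \<in> T3 U ==> (%n. EE U (s n) y) ----> EE U x y" "y \<in> T3 U ==> (%n. BB (s n) y) ----> BB x y"
  using tE tB by auto
 assume w: "weight w U"
 obtain C where C: "!!x. x \<in> T3 U ==> MM w U x x <= C * MM one U x x" using MM_le_NN[OF assms(1) w] by blast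
 have "(%n. C * M2 one U (s n - x)) ----> 0" using tendsto_mult_left[OF M0, of C] by simp
 then have "(%n. M2 w U (s n - x)) ----> 0"
  by (rule tendsto_sandwich[OF _ _ tendsto_const, rotated -1])
    (use C d psd_nonneg[OF MM_psd[OF w assms(1)] d] in auto)
 from psd_tendsto(2)[where x = s, OF T3_subspace MM_psd[OF w assms(1)] assms(2,3) this]
 show "(%n. M2 w U (s n)) ----> MM w U x x" .
qed

section \<open>Polar coordinates\<close>

text \<open>Both sides are integrals of \<open>f\<close> against measures \<open>N1\<close> and
  \<open>N2\<close>, so it is enough that these agree. For bounded \<open>X\<close> the relevant
  part of the image has finite measure and \<open>has_measure_differentiable_image\<close> computes
  it; exhaustion by balls does the rest.\<close>

lemma nn_integral_change_of_variables:
 fixes g :: "real^2 => real^2" and f :: "real^2 => ennreal"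
 assumes S: "S \<in> sets borel" and der: "!!x. x \<in> S ==> (g has_derivative g' x) (at x within S)"
  and inj: "inj_on g S" and gm: "g \<in> meas borel" and gS: "g ` S \<in> sets borel"
  and Jm: "J \<in> meas borel" and J: "!!x. x \<in> S ==> J x = \<bar>det (matrix (g' x))\<bar>"
  and f: "f \<in> meas borel"
 shows "(\<integral>\<^sup>+z. f z * indicator (g ` S) z \<partial>lborel) = (\<integral>\<^sup>+z. f (g z) * (ennreal (J z) * indicator S z) \<partial>lborel)"
proof -
 note [measurable] = S gm gS Jm f
 define N1 where "N1 = density lborel (indicator (g ` S) :: real^2 => ennreal)"
 define N2 where "N2 = distr (density lborel (%z. ennreal (J z) * indicator S z)) borel g"
 have bounded_case: "emeasure N1 X = emeasure N2 X" if X [measurable]: "X \<in> sets borel" and "bounded X" for X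
 proof -
  have pre [simp]: "g -` X \<in> sets borel" using measurable_sets[OF gm X] by simp
  define S' where "S' = S \<inter> g -` X"
  have S'm [measurable]: "S' \<in> sets borel" unfolding S'_def using measurable_sets[OF gm X] S by auto
  have im: "g ` S' = g ` S \<inter> X" by (auto simp: S'_def)
  have lm: "g ` S' \<in> lmeasurable"
   unfolding im using that by (intro bounded_set_imp_lmeasurable) auto
  have "((%x. \<bar>det (matrix (g' x))\<bar>) has_integral measure lebesgue (g ` S')) S'"
  proof (subst has_measure_differentiable_image[symmetric, where f = g])
   show "(g has_derivative g' x) (at x within S')" if "x \<in> S'" for x
    using that der[of x] by (auto simp: S'_def intro: has_derivative_subset)
   show "inj_on g S'" using inj by (rule inj_on_subset) (auto simp: S'_def)
  qed (use lm in auto)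
  then have "(J has_integral measure lebesgue (g ` S')) S'"
   by (rule has_integral_eq[rotated]) (auto simp: J S'_def)
  then have "((%x. if x \<in> S' then J x else 0) has_integral measure lebesgue (g ` S')) UNIV"
   by (simp only: has_integral_restrict_UNIV)
  then have "(\<integral>\<^sup>+x. ennreal (if x \<in> S' then J x else 0) \<partial>lborel) = ennreal (measure lebesgue (g ` S'))"
   by (intro nn_integral_has_integral_lborel) (auto simp: J S'_def)
  moreover have "(\<integral>\<^sup>+x. ennreal (if x \<in> S' then J x else 0) \<partial>lborel) = emeasure N2 X"
   unfolding N2_def
   by (subst emeasure_distr, simp, simp, subst emeasure_density)
     (auto intro!: nn_integral_cong simp: S'_def indicator_def)
  moreover have "ennreal (measure lebesgue (g ` S')) = emeasure lebesgue (g ` S')"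
   by (rule emeasure_eq_measure2[OF lm, symmetric])
  moreover have "emeasure lebesgue (g ` S') = emeasure lborel (g ` S \<inter> X)"
   unfolding im by simp
  moreover have "emeasure N1 X = emeasure lborel (g ` S \<inter> X)"
   unfolding N1_def by (subst emeasure_density)
    (auto simp flip: indicator_inter_arith nn_integral_indicator)
  ultimately show ?thesis by simp
 qed
 have "N1 = N2"
 proof (rule measure_eqI)
  show "sets N1 = sets N2" by (simp add: N1_def N2_def)
  fix X assume "X \<in> sets N1"
  then have [measurable]: "X \<in> sets borel" by (simp add: N1_def)
  define Y where "Y n = X \<inter> ball 0 (real n)" for n
  have Y: "range Y \<subseteq> sets borel" "incseq Y" "(\<Union>n. Y n) = X"
   by (auto simp: Y_def incseq_def) (metis reals_Archimedean2)
  have "emeasure N1 X = (SUP n. emeasure N1 (Y n))"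
   using SUP_emeasure_incseq[of Y N1] Y by (simp add: N1_def)
  also have "... = (SUP n. emeasure N2 (Y n))"
  proof (rule SUP_cong)
   fix n show "emeasure N1 (Y n) = emeasure N2 (Y n)"
   proof (rule bounded_case)
    show "Y n \<in> sets borel" using Y by auto
    show "bounded (Y n)" unfolding Y_def by (rule bounded_subset[OF bounded_ball]) auto
   qed
  qed simp
  also have "... = emeasure N2 X"
   using SUP_emeasure_incseq[of Y N2] Y by (simp add: N2_def)
  finally show "emeasure N1 X = emeasure N2 X" .
 qed
 then have "(\<integral>\<^sup>+z. f z \<partial>N1) = (\<integral>\<^sup>+z. f z \<partial>N2)" by simp
 then show ?thesis
  unfolding N1_def N2_def by (simp add: nn_integral_density nn_integral_distr mult_ac)
qed

lemma has_derivative_vec2: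
 fixes f :: "'a::euclidean_space => real^2"
 assumes "((%x. f x $ 1) has_derivative (%h. f' h $ 1)) (at a within S)"
  and "((%x. f x $ 2) has_derivative (%h. f' h $ 2)) (at a within S)"
 shows "(f has_derivative f') (at a within S)"
 unfolding has_derivative_componentwise_within[of f]
proof
 fix i :: "real^2" assume "i \<in> Basis"
 then obtain j where "i = axis j 1" by (auto simp: Basis_vec_def)
 then show "((%x. f x \<bullet> i) has_derivative (%x. f' x \<bullet> i)) (at a within S)"
  using assms exhaust_2[of j] by (auto simp: inner_axis)
qed

lemma nth_has_derivative: "((%x::real^2. x $ i) has_derivative (%h. h $ i)) F"
 by (rule bounded_linear_imp_has_derivative[OF bounded_linear_vec_nth])

definition polar :: "real^2 => real^2" where "polar z = cc (z $ 1) (z $ 2)"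

definition dpolar :: "real^2 => real^2 => real^2" where
 "dpolar z h = vector [h $ 1 * cos (z $ 2) - z $ 1 * sin (z $ 2) * h $ 2, h $ 1 * sin (z $ 2) + z $ 1 * cos (z $ 2) * h $ 2]"

lemma polar_has_derivative: "(polar has_derivative dpolar z) (at z within S)"
 unfolding polar_def[abs_def]
 by (rule has_derivative_vec2) (auto simp: dpolar_def intro!: derivative_eq_intros nth_has_derivative)

lemma polar_measurable [measurable]: "polar \<in> meas borel"
 unfolding polar_def[abs_def] by (intro borel_measurable_continuous_onI continuous_intros)

lemma det_dpolar: "det (matrix (dpolar z)) = z $ 1"
proof -
 have "det (matrix (dpolar z)) = z $ 1 * (cos (z $ 2))^2 + z $ 1 * (sin (z $ 2))^2"
  by (simp add: det_2 matrix_def dpolar_def axis_def power2_eq_square)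
 also have "... = z $ 1 * ((sin (z $ 2))^2 + (cos (z $ 2))^2)" by (simp only: distrib_left add.commute)
 finally show ?thesis by simp
qed

text \<open>An open interval of angles makes the polar map injective, at the price of a closed
  half-axis, which is a null set.\<close>

lemma polar_image:
 "polar ` {z. 0 < z $ 1 \<and> 0 < z $ 2 \<and> z $ 2 < 2 * pi} = - {z. z $ 2 = 0 \<and> 0 <= z $ 1}" (is "_ ` ?S = - ?R")
proof (intro equalityI subsetI)
 fix y assume "y \<in> polar ` ?S"
 then obtain z where z: "0 < z $ 1" "0 < z $ 2" "z $ 2 < 2 * pi" "y = polar z" by auto
 show "y \<in> - ?R"
 proof
  assume "y \<in> ?R"
  then have "sin (z $ 2) = 0" "0 <= cos (z $ 2)" using z
   by (auto simp: polar_def zero_le_mult_iff)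
  moreover have "z $ 2 = pi" using \<open>sin (z $ 2) = 0\<close> z(2,3)
   by (metis sin_gt_zero sin_lt_zero linorder_neqE_linordered_idom less_irrefl)
  ultimately show False by simp
 qed
next
 fix y :: "real^2" assume y: "y \<in> - ?R"
 then have r: "norm y > 0" by auto
 have "(y $ 1)^2 + (y $ 2)^2 = (norm y)^2" by (simp add: norm_vec_def L2_set_def sum_2)
 then have "(y $ 1 / norm y)^2 + (y $ 2 / norm y)^2 = 1" using r by (simp add: power_divide flip: add_divide_distrib)
 then obtain t where t: "0 <= t" "t < 2 * pi" "y $ 1 / norm y = cos t" "y $ 2 / norm y = sin t"
  using sincos_total_2pi by metis
 have "t ~= 0" using y t r by (auto simp: field_simps)
 moreover have "y = polar (vector [norm y, t])"
 proof -
  have "y $ 1 = norm y * cos t" "y $ 2 = norm y * sin t" unfolding t(3,4)[symmetric] using r by simp_all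
  then show ?thesis by (simp add: vec_eq_iff forall_2 polar_def)
 qed
 ultimately show "y \<in> polar ` ?S" using t r by (intro image_eqI[where x = "vector [norm y, t]"]) auto
qed

lemma polar_inj: "inj_on polar {z. 0 < z $ 1 \<and> 0 < z $ 2 \<and> z $ 2 < 2 * pi}"
proof (rule inj_onI, clarsimp)
 fix x y :: "real^2"
 assume x: "0 < x $ 1" "0 < x $ 2" "x $ 2 < 2 * pi" and y: "0 < y $ 1" "0 < y $ 2" "y $ 2 < 2 * pi"
  and eq: "polar x = polar y"
 have 1: "x $ 1 = y $ 1" using arg_cong[OF eq, of norm] x y by (simp add: polar_def)
 have "cos (x $ 2) = cos (y $ 2)" "sin (x $ 2) = sin (y $ 2)"
  using arg_cong[OF eq, of "%z. z $ 1"] arg_cong[OF eq, of "%z. z $ 2"] x 1 by (auto simp: polar_def)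
 then obtain n :: int where n: "x $ 2 = y $ 2 + 2 * pi * n" using sin_cos_eq_iff by metis
 have "n = 0"
 proof -
  have "\<bar>2 * pi * n\<bar> < 2 * pi" using n x y by auto
  then have "\<bar>real_of_int n\<bar> < 1" by (simp add: abs_mult)
  then show ?thesis by linarith
 qed
 then show "x = y" using 1 n by (simp add: vec_eq_iff forall_2)
qed

lemma vec2_pair_measurable [measurable]: "(%p. vector [fst p, snd p] :: real^2) \<in> meas (lborel \<Otimes>\<^sub>M lborel)"
proof -
 have "continuous_on UNIV (%p. vector [fst p, snd p] :: real^2)"
  by (rule continuous_on_vec2) (auto intro!: continuous_intros)
 then show ?thesis by (simp add: lborel_prod borel_measurable_continuous_onI)
qed

text \<open>Links Lebesgue measure on \<open>real^2\<close>, where the change of variables takes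
  place, with the product measure to which Fubini's theorem applies.\<close>

lemma lborel_vec2: "lborel = distr (lborel \<Otimes>\<^sub>M lborel) borel (%p. vector [fst p, snd p] :: real^2)"
proof (rule lborel_eqI)
 fix l u :: "real^2" assume lu: "!!b. b \<in> Basis ==> l \<bullet> b <= u \<bullet> b"
 have le: "l $ i <= u $ i" for i using lu[of "axis i 1"] by (auto simp: inner_axis Basis_vec_def)
 have "(%p. vector [fst p, snd p] :: real^2) -` box l u \<inter> space (lborel \<Otimes>\<^sub>M lborel)
   = {l$1 <..< u$1} \<times> {l$2 <..< u$2}"
  by (auto simp: mem_box_cart forall_2 space_pair_measure)
 then have "emeasure (distr (lborel \<Otimes>\<^sub>M lborel) borel (%p. vector [fst p, snd p] :: real^2)) (box l u)
   = emeasure lborel {l$1 <..< u$1} * emeasure lborel {l$2 <..< u$2}"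
  by (subst emeasure_distr) (auto simp: lborel.emeasure_pair_measure_Times)
 also have "... = ennreal ((u$1 - l$1) * (u$2 - l$2))"
  using le by (simp add: ennreal_mult)
 also have "(u$1 - l$1) * (u$2 - l$2) = (\<Prod>b\<in>Basis. (u - l) \<bullet> b)"
  by (simp add: Basis_vec_def prod.UNION_disjoint UNIV_2 axis_eq_axis inner_axis)
 finally show "emeasure (distr (lborel \<Otimes>\<^sub>M lborel) borel (%p. vector [fst p, snd p] :: real^2)) (box l u)
   = ennreal (\<Prod>b\<in>Basis. (u - l) \<bullet> b)" by simp
qed simp

lemma nn_integral_polar:
 fixes f :: "real^2 => ennreal"
 assumes [measurable]: "f \<in> meas borel"
 shows "(\<integral>\<^sup>+z. f z \<partial>lborel) = (\<integral>\<^sup>+p. f (cc (fst p) (snd p)) *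
   (ennreal (fst p) * indicator ({0<..} \<times> {0<..<2*pi}) p) \<partial>(lborel \<Otimes>\<^sub>M lborel))"
proof -
 let ?S = "{z::real^2. 0 < z $ 1 \<and> 0 < z $ 2 \<and> z $ 2 < 2 * pi}"
 let ?R = "{z::real^2. z $ 2 = 0 \<and> 0 <= z $ 1}"
 have S: "?S \<in> sets borel"
  by (intro borel_open open_Collect_conj open_Collect_less continuous_intros)
 have "closed ?R" by (intro closed_Collect_conj closed_Collect_eq closed_Collect_le continuous_intros)
 then have R: "?R \<in> sets borel" by (rule borel_closed)
 have "?R \<in> null_sets lebesgue"
 proof -
  have "negligible {z::real^2. z $ 2 = 0}"
   using negligible_standard_hyperplane[of "axis 2 1 :: real^2" 0] by (auto simp: inner_axis Basis_vec_def)
  then have "negligible ?R" by (rule negligible_subset) auto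
  then show ?thesis by (simp add: negligible_iff_null_sets)
 qed
 then have "?R \<in> null_sets lborel" using R by (auto simp: null_sets_def)
 then have AE: "AE z in lborel. z \<notin> ?R" by (rule AE_not_in)
 have "(\<integral>\<^sup>+z. f z \<partial>lborel) = (\<integral>\<^sup>+z. f z * indicator (polar ` ?S) z \<partial>lborel)"
  unfolding polar_image by (rule nn_integral_cong_AE, use AE in eventually_elim) auto
 also have "... = (\<integral>\<^sup>+z. f (polar z) * (ennreal (z $ 1) * indicator ?S z) \<partial>lborel)"
  by (rule nn_integral_change_of_variables[where g' = dpolar])
    (auto simp: polar_has_derivative det_dpolar polar_inj S polar_image R)
 also have "... = (\<integral>\<^sup>+p. f (cc (fst p) (snd p)) *
   (ennreal (fst p) * indicator ({0<..} \<times> {0<..<2*pi}) p) \<partial>(lborel \<Otimes>\<^sub>M lborel))"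
 proof -
  have [measurable]: "(%z::real^2. z $ 1) \<in> meas borel"
   by (intro borel_measurable_continuous_onI continuous_intros)
  have "(%z. f (polar z) * (ennreal (z $ 1) * indicator ?S z)) \<in> meas borel"
   using S by measurable
  then show ?thesis
   by (subst lborel_vec2, subst nn_integral_distr) (auto simp: polar_def indicator_def intro!: nn_integral_cong)
 qed
 finally show ?thesis .
qed

abbreviation ang :: "real measure" where "ang \<equiv> restrict_space lborel {0..<2*pi}"

lemma circle_curve_measurable2 [measurable (raw)]:
 assumes [measurable]: "f \<in> meas M" "g \<in> meas M"
 shows "(%x. cc (f x) (g x)) \<in> meas M"
proof -
 have "continuous_on UNIV (%p::real\<times>real. cc (fst p) (snd p))" by (intro continuous_intros)
 then have "(%p::real\<times>real. cc (fst p) (snd p)) \<in> meas borel" by (rule borel_measurable_continuous_onI)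
 then have "(%p::real\<times>real. cc (fst p) (snd p)) \<in> meas (borel \<Otimes>\<^sub>M borel)" by (simp add: borel_prod)
 from measurable_compose[OF _ this, of "%x. (f x, g x)" M] show ?thesis by simp
qed

text \<open>The formula for nonnegative functions is restated as an identity of measures
  (\<open>lD\<close>), so that it applies to signed \<open>f\<close>; boundedness supplies the
  integrability for Fubini's theorem.\<close>

lemma integral_ball_polar:
 fixes f :: "real^2 => real"
 assumes fm [measurable]: "f \<in> meas borel" and bd: "!!z. norm z < 1 ==> \<bar>f z\<bar> <= C"
 shows "(\<integral>z. f z \<partial>leb (ball 0 1)) = (\<integral>t. (I01 (%r. r * f (cc r t))) \<partial>ang)"
  and "integrable ang (%t. \<integral>r. r * f (cc r t) * indicator {0..1} r \<partial>lborel)"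
proof -
 define D where "D = density (lborel \<Otimes>\<^sub>M lborel) (%p. ennreal (fst p) * indicator ({0<..} \<times> {0<..<2*pi}) p)"
 have [measurable]: "(%p::real\<times>real. ennreal (fst p) * indicator ({0<..} \<times> {0<..<2*pi}) p) \<in> meas (lborel \<Otimes>\<^sub>M lborel)"
  by measurable
 have lD: "lborel = distr D borel (%p. cc (fst p) (snd p))"
 proof (rule measure_eqI)
  fix X :: "(real^2) set" assume "X \<in> sets lborel"
  then have [measurable]: "X \<in> sets borel" by simp
  have "emeasure lborel X = (\<integral>\<^sup>+z. indicator X z \<partial>lborel)" by simp
  also have "... = (\<integral>\<^sup>+p. indicator X (cc (fst p) (snd p)) *
   (ennreal (fst p) * indicator ({0<..} \<times> {0<..<2*pi}) p) \<partial>(lborel \<Otimes>\<^sub>M lborel))"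
   by (rule nn_integral_polar) simp
  also have "... = emeasure (distr D borel (%p. cc (fst p) (snd p))) X"
   unfolding D_def by (simp add: nn_integral_indicator[symmetric] nn_integral_distr nn_integral_density mult_ac
    del: nn_integral_indicator)
  finally show "emeasure lborel X = emeasure (distr D borel (%p. cc (fst p) (snd p))) X" .
 qed simp
 let ?F = "%z. indicator (ball 0 1) z * f z"
 have [measurable]: "?F \<in> meas borel"
  by (intro borel_measurable_times borel_measurable_indicator fm) auto
 have int: "integrable lborel ?F"
 proof (rule integrableI_bounded_set[where A = "ball 0 1" and B = "\<bar>C\<bar>"])
  show "AE x in lborel. x \<in> ball 0 1 --> norm (indicat_real (ball 0 1) x * f x) <= \<bar>C\<bar>"
   using bd by (force simp: indicator_def)
  show "emeasure lborel (ball 0 (1::real) :: (real^2) set) < \<infinity>"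
   using emeasure_bounded_finite[OF bounded_ball] by simp
 qed (auto simp: indicator_def)
 let ?G = "%r t. r * indicator ({0<..} \<times> {0<..<2*pi}) (r, t) * (indicator (ball 0 1) (cc r t) * f (cc r t))"
 have e1: "(\<integral>z. f z \<partial>leb (ball 0 1)) = (\<integral>z. ?F z \<partial>lborel)"
  by (subst integral_restrict_space) auto
 have e2: "(\<integral>z. ?F z \<partial>lborel) = (\<integral>p. ?F (cc (fst p) (snd p)) \<partial>D)" 
  by (subst lD, rule integral_distr) (auto simp: D_def)
 have De: "D = density (lborel \<Otimes>\<^sub>M lborel) (%p. ennreal (fst p * indicator ({0<..} \<times> {0<..<2*pi}) p))"
  unfolding D_def by (intro density_cong) (auto simp: indicator_def)
 have iD: "integrable D (%p. ?F (cc (fst p) (snd p)))"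
  using int by (subst (asm) lD, subst (asm) integrable_distr_eq) (auto simp: D_def)
 have e3: "(\<integral>p. ?F (cc (fst p) (snd p)) \<partial>D) = (\<integral>p. case_prod ?G p \<partial>(lborel \<Otimes>\<^sub>M lborel))"
  unfolding De by (subst integral_real_density) (auto simp: indicator_def case_prod_beta intro!: Bochner_Integration.integral_cong)
 have i3: "integrable (lborel \<Otimes>\<^sub>M lborel) (case_prod ?G)"
 proof -
  have "integrable (lborel \<Otimes>\<^sub>M lborel)
    (%p. (fst p * indicator ({0<..} \<times> {0<..<2*pi}) p) * ?F (cc (fst p) (snd p)))"
   using iD unfolding De by (subst (asm) integrable_real_density) (auto simp: indicator_def)
  then show ?thesis by (simp add: case_prod_beta')
 qed
 have e4: "(\<integral>p. case_prod ?G p \<partial>(lborel \<Otimes>\<^sub>M lborel)) = (\<integral>t. (\<integral>r. ?G r t \<partial>lborel) \<partial>lborel)"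
  by (rule lborel_pair.integral_snd[OF i3, symmetric])
 \<comment> \<open>The exceptional values 0 and 1 account for the differences between open,
   half-open and closed intervals of angles and radii.\<close>
 have ae: "AE t in lborel. (\<integral>r. ?G r t \<partial>lborel) =
   indicator {0..<2*pi} t * (I01 (%r. r * f (cc r t)))"
   using AE_lborel_singleton[of 0]
  proof eventually_elim
   case (elim t)
   have "(\<integral>r. ?G r t \<partial>lborel) = (\<integral>r. indicator {0..<2*pi} t * (r * f (cc r t) * indicator {0..1} r) \<partial>lborel)"
   proof (rule integral_cong_AE)
    show "AE r in lborel. ?G r t = indicator {0..<2*pi} t * (r * f (cc r t) * indicator {0..1} r)"
     using AE_lborel_singleton[of 1] AE_lborel_singleton[of 0]
     by eventually_elim (use elim in \<open>auto simp: indicator_def\<close>)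
   qed measurable
   then show ?case by simp
  qed
 have e5: "(\<integral>t. (\<integral>r. ?G r t \<partial>lborel) \<partial>lborel) =
   (\<integral>t. indicator {0..<2*pi} t * (I01 (%r. r * f (cc r t))) \<partial>lborel)"
  by (rule integral_cong_AE[OF _ _ ae]) measurable
 show "(\<integral>z. f z \<partial>leb (ball 0 1)) = (\<integral>t. (I01 (%r. r * f (cc r t))) \<partial>ang)"
  unfolding e1 e2 e3 e4 e5 by (subst integral_restrict_space) auto
 have "integrable lborel (%t. \<integral>r. ?G r t \<partial>lborel)" by (rule lborel_pair.integrable_snd[OF i3])
 then have "integrable lborel (%t. indicator {0..<2*pi} t * (I01 (%r. r * f (cc r t))))"
  by (subst (asm) integrable_cong_AE[OF _ _ ae]) measurable
 then show "integrable ang (%t. \<integral>r. r * f (cc r t) * indicator {0..1} r \<partial>lborel)"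
  by (subst integrable_restrict_space) auto
qed

section \<open>The divergence theorem on the disk and its consequences\<close>

abbreviation disk :: "(real^2) set" where "disk \<equiv> ball 0 1"

abbreviation "ED x \<equiv> EE disk x x"
abbreviation "MD w x \<equiv> MM w disk x x"
abbreviation "ND x \<equiv> NN disk x x"

lemma disk_integrable:
 fixes f :: "real^2 => real"
 assumes "f \<in> meas borel" "!!z. norm z < 1 ==> \<bar>f z\<bar> <= C"
 shows "integrable (leb disk) f"
proof (rule integrableI_bounded_set[where A = disk and B = "\<bar>C\<bar>"])
 show "emeasure (leb disk) disk < \<infinity>"
  using emeasure_bounded_finite[OF bounded_ball, of "0::real^2" 1] by (simp add: emeasure_restrict_space)
 show "AE x in leb disk. x \<in> disk --> norm (f x) <= \<bar>C\<bar>"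
  using assms(2) by (intro AE_I2) (force simp: space_restrict_space)
qed (use assms(1) in \<open>auto simp: sets_restrict_space space_restrict_space intro: measurable_restrict_space1\<close>)

lemma disk_FTC:
 fixes f :: "real^2 => real"
 assumes f: "f \<in> meas borel" "!!z. norm z < 1 ==> \<bar>f z\<bar> <= C"
  and G: "!!r t. 0 <= r ==> r <= 1 ==> ((%r. G r t) has_real_derivative r * f (cc r t)) (at r)"
  and c: "!!r t. 0 <= r ==> r <= 1 ==> isCont (%r. r * f (cc r t)) r"
 shows "(\<integral>z. f z \<partial>leb disk) = (\<integral>t. G 1 t - G 0 t \<partial>ang)"
proof -
 have "(I01 (%r. r * f (cc r t))) = G 1 t - G 0 t" for t
  by (rule integral_FTC_Icc_real) (auto intro: G c)
 then show ?thesis using integral_ball_polar(1)[OF f] by simp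
qed

lemma C1_bounded:
 assumes "C1c \<phi> D\<phi>"
 obtains C where "!!z. \<bar>\<phi> z\<bar> <= C" "!!z. norm (D\<phi> z) <= C"
proof -
 from GDERIV_compact_support_zero[OF assms] obtain R where R: "!!x. norm x > R ==> \<phi> x = 0 \<and> D\<phi> x = 0" by blast
 have "compact (\<phi> ` cball 0 R)" "compact (D\<phi> ` cball 0 R)"
  by (intro compact_continuous_image C1_continuous[OF assms] compact_cball)+
 then obtain C1 C2 where "!!z. norm z <= R ==> norm (\<phi> z) <= C1" "!!z. norm z <= R ==> norm (D\<phi> z) <= C2"
  by (force dest!: compact_imp_bounded simp: bounded_iff)
 then have "\<bar>\<phi> z\<bar> <= max 0 (max C1 C2)" "norm (D\<phi> z) <= max 0 (max C1 C2)" for z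
  using R[of z] by (cases "norm z <= R"; force simp: max_def)+
 then show ?thesis using that by blast
qed

lemma C1_radial_derivative:
 assumes "C1c \<phi> D\<phi>"
 shows "((%r. \<phi> (cc r t)) has_real_derivative (cc 1 t \<bullet> D\<phi> (cc r t))) (at r)"
proof -
 have "((%r. cc r t) has_derivative (%h. h \<cdot> cc 1 t)) (at r)"
  by (rule has_derivative_vec2) (auto intro!: derivative_eq_intros)
 moreover have "(\<phi> has_derivative (%h. h \<bullet> D\<phi> (cc r t))) (at (cc r t))"
  using assms by (auto simp: C1_compact_support_def gderiv_def)
 ultimately have "((%r. \<phi> (cc r t)) has_derivative (%h. (h \<cdot> cc 1 t) \<bullet> D\<phi> (cc r t))) (at r)"
  by (rule has_derivative_compose)
 then show ?thesis by (simp add: has_field_derivative_def mult.commute[of _ "_ \<bullet> _"])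
qed

lemma C1_measurable:
 assumes "C1c \<phi> D\<phi>" shows "\<phi> \<in> meas borel" "D\<phi> \<in> meas borel"
 using C1_continuous[OF assms] by (auto intro: borel_measurable_continuous_onI)

text \<open>The divergence theorem for the field \<open>a(|z|^2) \<phi>^2 z\<close>:
  \<open>f\<close> is its divergence and the left-hand side its flux through the unit circle. Along
  each ray it is the fundamental theorem of calculus for \<open>G r t\<close>.\<close>

lemma disk_divergence:
 assumes C1: "C1c \<phi> D\<phi>"
  and a: "!!t. 0 <= t ==> t <= 1 ==> (a has_real_derivative a' t) (at t)" "!!t. 0 <= t ==> t <= 1 ==> isCont a' t"
  and [measurable]: "a \<in> meas borel" "a' \<in> meas borel"
 defines "f \<equiv> %z. (2 * a ((norm z)^2) + 2 * (norm z)^2 * a' ((norm z)^2)) * (\<phi> z)^2 + 2 * a ((norm z)^2) * \<phi> z * (z \<bullet> D\<phi> z)"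
 shows "integrable (leb disk) f" "a 1 * B2 (\<phi>, D\<phi>, \<phi>) = (\<integral>z. f z \<partial>leb disk)"
proof -
 note [measurable] = C1_measurable[OF C1]
 have fm: "f \<in> meas borel" unfolding f_def by measurable
 have ca: "isCont a t" if "0 <= t" "t <= 1" for t using a(1)[OF that] by (rule DERIV_isCont)
 have le1: "(norm z)^2 <= 1" if "norm z <= 1" for z :: "real^2"
  using that by (simp add: power_le_one)
 have sq: "continuous_on (cball 0 1) (%z::real^2. (norm z)^2)" by (intro continuous_intros)
 have sub: "(%z::real^2. (norm z)^2) ` cball 0 1 \<subseteq> {0..1}" using le1 by auto
 have ca1: "continuous_on {0..1} a" "continuous_on {0..1} a'" using ca a(2) by (auto intro: continuous_at_imp_continuous_on)
 note ca2 = continuous_on_compose2[OF ca1(1) sq sub] continuous_on_compose2[OF ca1(2) sq sub]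
 note C2 = C1_continuous[OF C1, of "cball 0 1"]
 have con: "continuous_on (cball 0 1) f"
  unfolding f_def
  by (rule continuous_on_add continuous_on_mult continuous_on_inner ca2 sq C2 continuous_on_const continuous_on_id continuous_on_power)+
 then have "compact (f ` cball 0 1)" by (intro compact_continuous_image) auto
 then obtain C where C: "!!z. norm z <= 1 ==> norm (f z) <= C" by (force dest: compact_imp_bounded simp: bounded_iff)
 then have bd: "\<bar>f z\<bar> <= C" if "norm z < 1" for z using that by force
 show "integrable (leb disk) f" by (rule disk_integrable[OF fm bd])
 define G where "G r t = r^2 * a (r^2) * (\<phi> (cc r t))^2" for r t
 have "(\<integral>z. f z \<partial>leb disk) = (\<integral>t. G 1 t - G 0 t \<partial>ang)"
 proof (rule disk_FTC[OF fm bd])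
  fix r t :: real assume r: "0 <= r" "r <= 1"
  have r2: "0 <= r^2" "r^2 <= 1" using r by (auto simp: power_le_one)
  have c: "cc r t = r \<cdot> cc 1 t" by (simp add: vec_eq_iff forall_2)
  have "((%r. a (r^2)) has_real_derivative a' (r^2) * (2 * r)) (at r)"
   by (rule DERIV_chain2[where f = a and g = "%r. r^2", OF a(1)[OF r2]]) (auto intro!: derivative_eq_intros)
  moreover have "((%r. r^2) has_real_derivative 2 * r) (at r)" by (auto intro!: derivative_eq_intros)
  ultimately have d: "((%r. r^2 * a (r^2) * (\<phi> (cc r t))^2) has_real_derivative
    (2 * r * a (r^2) + a' (r^2) * (2 * r) * r^2) * (\<phi> (cc r t))^2
    + of_nat 2 * (cc 1 t \<bullet> D\<phi> (cc r t) * \<phi> (cc r t) ^ (2 - Suc 0)) * (r^2 * a (r^2))) (at r)"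
   by (intro DERIV_mult DERIV_power C1_radial_derivative[OF C1])
  have "cc r t \<bullet> D\<phi> (cc r t) = r * (cc 1 t \<bullet> D\<phi> (cc r t))"
   by (subst (1) c) simp
  then have "r * f (cc r t) = (2 * r * a (r^2) + a' (r^2) * (2 * r) * r^2) * (\<phi> (cc r t))^2
    + of_nat 2 * (cc 1 t \<bullet> D\<phi> (cc r t) * \<phi> (cc r t) ^ (2 - Suc 0)) * (r^2 * a (r^2))"
   unfolding f_def by (simp add: power2_eq_square algebra_simps)
  with d show "((%r. G r t) has_real_derivative r * f (cc r t)) (at r)"
   unfolding G_def by simp
  have "isCont (%r. cc r t) r"
   using continuous_on_circle_curve[of UNIV "%r. r" "%_. t"] by (simp add: continuous_on_eq_continuous_at)
  moreover have "isCont \<phi> z" "isCont D\<phi> z" for z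
   using C1_continuous[OF C1, of UNIV] by (auto simp: continuous_on_eq_continuous_at)
  ultimately have "isCont (%r. \<phi> (cc r t)) r" "isCont (%r. D\<phi> (cc r t)) r" "isCont (%r. cc r t) r"
   by (auto intro: isCont_o2)
  moreover have "isCont (%r. a (r^2)) r" "isCont (%r. a' (r^2)) r"
   using r2 by (auto intro!: isCont_o2[where g = a] isCont_o2[where g = a'] ca a(2) continuous_intros)
  ultimately show "isCont (%r. r * f (cc r t)) r"
   unfolding f_def by simp
 qed
 also have "... = (\<integral>t. a 1 * (\<phi> (cc 1 t) * \<phi> (cc 1 t)) \<partial>ang)"
  by (simp add: G_def power2_eq_square)
 also have "... = a 1 * B2 (\<phi>, D\<phi>, \<phi>)"
  unfolding BB_def by (simp add: integral_circ)
 finally show "a 1 * B2 (\<phi>, D\<phi>, \<phi>) = (\<integral>z. f z \<partial>leb disk)" ..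
qed

lemma weight_zero [simp]: "weight (%_. 0) U" by (auto simp: weight_def intro: exI[of _ 0])

lemma weight_const: "c >= 0 ==> weight (%_. c) U" by (auto simp: weight_def)

lemma MM_zero [simp]: "MM (%_. 0) U x y = 0" by (simp add: MM_def)

lemma MM_const: "MM (%_. c) U x y = c * MM one U x y" by (simp add: MM_def)

lemma SM_integrable:
 assumes C1: "C1c \<phi> D\<phi>" and U: "open U"
 shows "integrable (leb U) (%z. (norm (D\<phi> z))^2)" "weight w U ==> integrable (leb U) (%z. w z * (\<phi> z)^2)"
proof -
 have "(\<phi>, D\<phi>, \<phi>) \<in> T3 U" using SM_T3[OF U] C1 by (auto simp: SM_def)
 then have "\<phi> \<in> L2 (leb U)" "D\<phi> \<in> L2 (leb U)" by (auto simp: T3_def)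
 then show "integrable (leb U) (%z. (norm (D\<phi> z))^2)" "weight w U ==> integrable (leb U) (%z. w z * (\<phi> z)^2)"
  using MM_integrable[of w U \<phi> \<phi>] U by (auto simp: L2_integrable power2_eq_square[of "\<phi> _"])
qed

text \<open>The density argument by which inequalities obtained from the divergence theorem for
  smooth triples reach all of \<open>HH U\<close>.\<close>

lemma HH_extend:
 assumes U: "open U" and w: "weight w1 U" "weight w2 U"
  and s: "!!\<phi> D\<phi> s. C1c \<phi> D\<phi> ==> s = (\<phi>, D\<phi>, \<phi>) ==>
   b1 * B2 s + MM w1 U s s <= b2 * B2 s + e * EE U s s + MM w2 U s s"
  and x: "x \<in> HH U"
 shows "b1 * B2 x + MM w1 U x x <= b2 * B2 x + e * EE U x x + MM w2 U x x"
proof -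
 obtain s where sn: "!!n. s n \<in> SM" "(%n. N2 U (s n - x)) ----> 0"
  using HH_seq[OF U x] by blast
 have T: "s n \<in> T3 U" "x \<in> T3 U" for n using sn(1) SM_T3[OF U] x HH_T3[of U] by auto
 note l = NN_tendsto[OF U T sn(2)]
 have "(%n. b1 * B2 (s n) + M2 w1 U (s n)) ----> b1 * B2 x + MM w1 U x x"
  by (intro tendsto_intros l w)
 moreover have "(%n. b2 * B2 (s n) + e * E2 U (s n) + M2 w2 U (s n)) ---->
   b2 * B2 x + e * EE U x x + MM w2 U x x"
  by (intro tendsto_intros l w)
 moreover have "b1 * B2 (s n) + M2 w1 U (s n) <= b2 * B2 (s n) + e * E2 U (s n) + M2 w2 U (s n)" for n
  using sn(1)[of n] s by (auto simp: SM_def)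
 ultimately show ?thesis by (meson LIMSEQ_le)
qed

text \<open>With \<open>p\<close> the product of \<open>z\<close> and the gradient, the mixed term
  of the divergence is split by Young's inequality \<open>2 a u p <= a^2 u^2 / h + h p^2\<close>;
  what multiplies \<open>u^2\<close> then has to be covered by the weight.\<close>

lemma trace_inequality:
 assumes a: "!!t. 0 <= t ==> t <= 1 ==> (a has_real_derivative a' t) (at t)" "!!t. 0 <= t ==> t <= 1 ==> isCont a' t"
  and am: "a \<in> meas borel" "a' \<in> meas borel"
  and w: "weight w disk" and h: "h > 0"
  and le: "!!z. norm z < 1 ==> 2 * a ((norm z)^2) + 2 * (norm z)^2 * a' ((norm z)^2) + (a ((norm z)^2))^2 / h <= w z"
  and x: "x \<in> HH disk"
 shows "a 1 * B2 x <= h * ED x + MD w x"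
proof -
 have "a 1 * B2 x + MD (%_. 0) x <= 0 * B2 x + h * ED x + MD w x"
 proof (rule HH_extend[OF _ _ w _ x])
  fix \<phi> D\<phi> s assume C1: "C1c \<phi> D\<phi>" and s: "s = (\<phi>, D\<phi>, \<phi>)"
  let ?f = "%z. (2 * a ((norm z)^2) + 2 * (norm z)^2 * a' ((norm z)^2)) * (\<phi> z)^2 + 2 * a ((norm z)^2) * \<phi> z * (z \<bullet> D\<phi> z)"
  note d = disk_divergence[OF C1 a am]
  have "a 1 * B2 s = (\<integral>z. ?f z \<partial>leb disk)" unfolding s by (rule d)
  also have "... <= (\<integral>z. h * (norm (D\<phi> z))^2 + w z * (\<phi> z)^2 \<partial>leb disk)"
  proof (rule integral_mono_AE[OF d(1)])
   show "integrable (leb disk) (%z. h * (norm (D\<phi> z))^2 + w z * (\<phi> z)^2)"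
    using SM_integrable[OF C1, of disk] w by auto
   show "AE z in leb disk. ?f z <= h * (norm (D\<phi> z))^2 + w z * (\<phi> z)^2"
   proof (rule AE_I2)
    fix z assume "z \<in> space (leb disk)"
    then have z: "norm z < 1" by (simp add: space_restrict_space)
    let ?a = "a ((norm z)^2)" and ?u = "\<phi> z" and ?p = "z \<bullet> D\<phi> z"
    have "?p^2 <= (norm (D\<phi> z))^2"
    proof -
     have "\<bar>?p\<bar> <= norm z * norm (D\<phi> z)" by (rule Cauchy_Schwarz_ineq2)
     also have "... <= 1 * norm (D\<phi> z)" using z by (intro mult_right_mono) auto
     finally show ?thesis by (simp add: abs_le_square_iff[symmetric])
    qed
    then have p: "h * ?p^2 <= h * (norm (D\<phi> z))^2" using h by simp
    have "0 <= (?a * ?u - h * ?p)^2 / h" using h by simp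
    then have "2 * ?a * ?u * ?p <= ?a^2 / h * ?u^2 + h * ?p^2"
     using h by (simp add: power2_eq_square field_simps)
    moreover have "(2 * ?a + 2 * (norm z)^2 * a' ((norm z)^2) + ?a^2 / h) * ?u^2 <= w z * ?u^2"
     by (intro mult_right_mono le z) simp
    ultimately show "?f z <= h * (norm (D\<phi> z))^2 + w z * (\<phi> z)^2"
     using p by (simp add: distrib_right)
   qed
  qed
  also have "... = h * ED s + MD w s"
   using SM_integrable[OF C1, of disk] w
   by (simp add: EE_def MM_def s power2_norm_eq_inner power2_eq_square[of "\<phi> _"])
  finally show "a 1 * B2 s + MD (%_. 0) s <= 0 * B2 s + h * ED s + MD w s" by simp
 qed auto
 then show ?thesis by simp
qed

text \<open>The divergence identity solved for the zero-order term, which is chosen to be the weight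
  itself. The constant \<kappa> bounds the mixed term, and its smallness is what later makes
  weighted masses small.\<close>

lemma mass_inequality:
 assumes a: "!!t. 0 <= t ==> t <= 1 ==> (a has_real_derivative a' t) (at t)" "!!t. 0 <= t ==> t <= 1 ==> isCont a' t"
  and am: "a \<in> meas borel" "a' \<in> meas borel"
  and w: "weight w disk"
  and eq: "!!z. norm z < 1 ==> 2 * a ((norm z)^2) + 2 * (norm z)^2 * a' ((norm z)^2) = w z"
  and le: "!!z::real^2. norm z < 1 ==> \<bar>a ((norm z)^2)\<bar> * norm z <= \<kappa>"
  and x: "x \<in> HH disk"
 shows "MD w x <= a 1 * B2 x + \<kappa> * (ED x + MD one x)"
proof -
 have \<kappa>: "\<kappa> >= 0" using le[of 0] by simp
 have "0 * B2 x + MD w x <= a 1 * B2 x + \<kappa> * ED x + MD (%_. \<kappa>) x"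
 proof (rule HH_extend[OF _ w _ _ x])
  show "weight (%_. \<kappa>) disk" using \<kappa> by (rule weight_const)
  fix \<phi> D\<phi> s assume C1: "C1c \<phi> D\<phi>" and s: "s = (\<phi>, D\<phi>, \<phi>)"
  let ?f = "%z. (2 * a ((norm z)^2) + 2 * (norm z)^2 * a' ((norm z)^2)) * (\<phi> z)^2 + 2 * a ((norm z)^2) * \<phi> z * (z \<bullet> D\<phi> z)"
  note d = disk_divergence[OF C1 a am]
  have "MD w s = (\<integral>z. w z * (\<phi> z)^2 \<partial>leb disk)" by (simp add: MM_def s power2_eq_square)
  also have "... <= (\<integral>z. ?f z + (\<kappa> * (norm (D\<phi> z))^2 + \<kappa> * (\<phi> z)^2) \<partial>leb disk)"
  proof (rule integral_mono_AE)
   show "integrable (leb disk) (%z. w z * (\<phi> z)^2)"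
    using SM_integrable[OF C1, of disk] w by auto
   show "integrable (leb disk) (%z. ?f z + (\<kappa> * (norm (D\<phi> z))^2 + \<kappa> * (\<phi> z)^2))"
    using SM_integrable(1)[OF C1, of disk] SM_integrable(2)[OF C1 _ weight_const[OF \<kappa>], of disk] d(1)
    by (intro Bochner_Integration.integrable_add[of _ ?f]) auto
   show "AE z in leb disk. w z * (\<phi> z)^2 <= ?f z + (\<kappa> * (norm (D\<phi> z))^2 + \<kappa> * (\<phi> z)^2)"
   proof (rule AE_I2)
    fix z assume "z \<in> space (leb disk)"
    then have z: "norm z < 1" by (simp add: space_restrict_space)
    let ?a = "a ((norm z)^2)" and ?u = "\<phi> z" and ?p = "z \<bullet> D\<phi> z" and ?d = "norm (D\<phi> z)"
    have "\<bar>?a * ?p\<bar> <= \<bar>?a\<bar> * (norm z * ?d)"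
     unfolding abs_mult by (intro mult_left_mono Cauchy_Schwarz_ineq2) auto
    also have "... = (\<bar>?a\<bar> * norm z) * ?d" by simp
    also have "... <= \<kappa> * ?d" using le z by (intro mult_right_mono) auto
    finally have ap: "\<bar>?a * ?p\<bar> <= \<kappa> * ?d" .
    have "\<bar>2 * ?a * ?u * ?p\<bar> = 2 * \<bar>?u\<bar> * \<bar>?a * ?p\<bar>" by (simp add: abs_mult)
    also have "... <= 2 * \<bar>?u\<bar> * (\<kappa> * ?d)" by (intro mult_left_mono ap) auto
    also have "... = \<kappa> * (2 * \<bar>?u\<bar> * ?d)" by simp
    also have "... <= \<kappa> * (\<bar>?u\<bar>^2 + ?d^2)" by (intro mult_left_mono sum_squares_bound \<kappa>)
    finally have "- (2 * ?a * ?u * ?p) <= \<kappa> * ?u^2 + \<kappa> * ?d^2" by (simp add: distrib_left)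
    then show "w z * (\<phi> z)^2 <= ?f z + (\<kappa> * (norm (D\<phi> z))^2 + \<kappa> * (\<phi> z)^2)"
     using eq z by simp
   qed
  qed
  also have "... = (\<integral>z. ?f z \<partial>leb disk) + (\<kappa> * ED s + MD (%_. \<kappa>) s)"
   using SM_integrable(1)[OF C1, of disk] SM_integrable(2)[OF C1 _ weight_const[OF \<kappa>], of disk] d(1)
   by (subst Bochner_Integration.integral_add)
     (auto simp: EE_def MM_def s power2_norm_eq_inner power2_eq_square[of "\<phi> _"])
  also have "(\<integral>z. ?f z \<partial>leb disk) = a 1 * B2 s" unfolding s by (rule d(2)[symmetric])
  finally show "0 * B2 s + MD w s <= a 1 * B2 s + \<kappa> * ED s + MD (%_. \<kappa>) s" by simp
 qed auto
 then show ?thesis unfolding MM_const[of \<kappa>] by (simp add: distrib_left)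
qed

text \<open>The constant multiplier \<open>1/2\<close> with \<open>h / 2\<close> in the place of
  \<open>h\<close>. The energy coefficient may be made as small as desired.\<close>

lemma trace_epsilon:
 assumes x: "x \<in> HH disk" and h: "h > 0"
 shows "B2 x <= h * ED x + (2 + 1/h) * MD one x"
proof -
 have "(1/2) * B2 x <= (h/2) * ED x + MD (%_. 1 + 1/(2*h)) x"
  by (rule trace_inequality[where a = "%_. 1/2" and a' = "%_. 0", OF _ _ _ _ _ _ _ x])
    (use h in \<open>auto simp: power2_eq_square field_simps intro!: weight_const\<close>)
 then show ?thesis using h unfolding MM_const[of "1 + 1/(2*h)"] by (simp add: field_simps)
qed

text \<open>With the constant multiplier \<open>1/2\<close> the zero-order coefficient is 1 and
  \<kappa> is \<open>1/2\<close>, so half of the mass can be absorbed on the left.\<close>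

lemma Friedrichs: assumes x: "x \<in> HH disk" shows "MD one x <= B2 x + ED x"
proof -
 have "MD one x <= (1/2) * B2 x + (1/2) * (ED x + MD one x)"
  by (rule mass_inequality[where a = "%_. 1/2" and a' = "%_. 0", OF _ _ _ _ _ _ _ x]) auto
 then show ?thesis by (simp add: add_divide_distrib)
qed

section \<open>Mass and trace estimates for the densities of the conformal family\<close>

definition ws :: "real => real^2 => real" where "ws s z = 1 / (1 + s * (norm z)^2)^2"

lemma ws_pos: assumes "s > -1" "norm z <= 1" shows "1 + s * (norm z)^2 > 0"
proof -
 have "(norm z)^2 <= 1" using assms by (simp add: power_le_one)
 show ?thesis
 proof (cases "s >= 0")
  case False
  then have "s * 1 <= s * (norm z)^2" using \<open>(norm z)\<^sup>2 \<le> 1\<close> by (intro mult_left_mono_neg) auto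
  then show ?thesis using assms by simp
 qed (simp add: add_pos_nonneg)
qed

lemma ws_lower: assumes "s > -1" "norm z <= 1" shows "min 1 (1 + s) <= 1 + s * (norm z)^2" "1 + s * (norm z)^2 <= max 1 (1 + s)"
proof -
 have n: "(norm z)^2 <= 1" "0 <= (norm z)^2" using assms by (auto simp: power_le_one)
 have "s >= 0 ==> 0 <= s * (norm z)^2 \<and> s * (norm z)^2 <= s * 1" using n by (auto intro!: mult_left_mono simp del: mult_1_right)
 moreover have "s < 0 ==> s * 1 <= s * (norm z)^2 \<and> s * (norm z)^2 <= 0" using n
  by (auto intro!: mult_left_mono_neg mult_nonpos_nonneg simp del: mult_1_right)
 ultimately show "min 1 (1 + s) <= 1 + s * (norm z)^2" "1 + s * (norm z)^2 <= max 1 (1 + s)" by linarith+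
qed

lemma ws_bounds:
 assumes "s > -1" "norm z <= 1"
 shows "1 / (max 1 (1 + s))^2 <= ws s z" "ws s z <= 1 / (min 1 (1 + s))^2" "ws s z > 0"
proof -
 note l = ws_lower[OF assms] ws_pos[OF assms]
 have m: "min 1 (1+s) > 0" using assms by simp
 show "1 / (max 1 (1 + s))^2 <= ws s z" unfolding ws_def using l by (intro divide_left_mono power_mono mult_pos_pos) auto
 show "ws s z <= 1 / (min 1 (1 + s))^2" unfolding ws_def using l m by (intro divide_left_mono power_mono mult_pos_pos) auto
 show "ws s z > 0" unfolding ws_def using l by simp
qed

lemma ws_measurable [measurable]: "ws s \<in> meas borel"
 unfolding ws_def[abs_def] by measurable

lemma weight_ws: "s > -1 ==> weight (ws s) disk"
 unfolding weight_def using ws_bounds(2,3)[of s]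
 by (intro conjI exI[of _ "1 / (min 1 (1 + s))^2"]) (auto intro: less_imp_le)

text \<open>The multiplier \<open>1 / (2 * (1 + s * t))\<close> solves
  \<open>2 a + 2 t a' = 1 / (1 + s t)^2\<close>, so the zero-order term in the divergence is exactly
  \<open>ws s\<close>.\<close>

lemma mass_ws:
 assumes x: "x \<in> HH disk" and s: "s > -1"
  and \<kappa>: "!!r. 0 <= r ==> r < 1 ==> r / (2 * (1 + s * r^2)) <= \<kappa>"
 shows "MD (ws s) x <= B2 x / (2 * (1 + s)) + \<kappa> * (ED x + MD one x)"
proof -
 have pos: "1 + s * t > 0" if "0 <= t" "t <= 1" for t
  using ws_pos[OF s, of "cc (sqrt t) 0"] that by (simp add: real_le_lsqrt)
 have "MD (ws s) x <= (1 / (2 * (1 + s * 1))) * B2 x + \<kappa> * (ED x + MD one x)"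
 proof (rule mass_inequality[where a = "%t. 1 / (2 * (1 + s * t))" and a' = "%t. - s / (2 * (1 + s * t)^2)", OF _ _ _ _ _ _ _ x])
  fix t :: real assume t: "0 <= t" "t <= 1"
  show "((%t. 1 / (2 * (1 + s * t))) has_real_derivative - s / (2 * (1 + s * t)^2)) (at t)"
  proof -
   have "((%t. 1 / (2 * (1 + s * t))) has_real_derivative - (2 * s) / (2 * (1 + s * t))^2) (at t)"
    using pos[OF t] by (auto intro!: derivative_eq_intros simp: power2_eq_square)
   moreover have "- (2 * s) / (2 * p)^2 = - s / (2 * p^2)" for p by (simp add: power_mult_distrib)
   ultimately show ?thesis by (simp only:)
  qed
  show "isCont (%t. - s / (2 * (1 + s * t)^2)) t" using pos[OF t] by (auto intro!: continuous_intros)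
 next
  fix z :: "real^2" assume z: "norm z < 1"
  define p where "p = 1 + s * (norm z)^2"
  have p: "p > 0" unfolding p_def using z ws_pos[OF s, of z] by simp
  have sn: "s * (norm z)^2 = p - 1" by (simp add: p_def)
  have "2 * (1 / (2 * p)) + 2 * (norm z)^2 * (- s / (2 * p^2)) = 1 / p - (s * (norm z)^2) / p^2"
   using p by (simp add: field_simps)
  also have "... = 1 / p^2" unfolding sn using p by (simp add: power2_eq_square field_simps)
  finally show "2 * (1 / (2 * (1 + s * (norm z)^2))) + 2 * (norm z)^2 * (- s / (2 * (1 + s * (norm z)^2)^2)) = ws s z"
   unfolding ws_def p_def .
  show "\<bar>1 / (2 * (1 + s * (norm z)^2))\<bar> * norm z <= \<kappa>"
   using \<kappa>[of "norm z"] z p by (simp add: p_def)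
 qed (use weight_ws[OF s] in auto)
 then show ?thesis by simp
qed

text \<open>Near the boundary \<open>ws s\<close> reaches the order \<open>1 / (1 + s)^2\<close>,
  but only in a thin layer: the mass is of order \<open>1 / (1 + s)\<close>. Hence
  \<open>(1 + s)^2\<close> times the mass tends to zero relative to the norm.\<close>

lemma mass_ws_minus1:
 assumes x: "x \<in> HH disk" and s: "-1 < s" "s <= 0"
 shows "(1 + s)^2 * MD (ws s) x <= (1 + s) * (B2 x + ED x)"
proof -
 have "MD (ws s) x <= B2 x / (2 * (1 + s)) + (1 / (2 * (1 + s))) * (ED x + MD one x)"
 proof (rule mass_ws[OF x s(1)])
  fix r :: real assume r: "0 <= r" "r < 1"
  have "s * 1 <= s * r^2" using s r by (intro mult_left_mono_neg) (auto simp: power_le_one)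
  then show "r / (2 * (1 + s * r^2)) <= 1 / (2 * (1 + s))" using r s by (intro frac_le) auto
 qed
 also have "... = (B2 x + ED x + MD one x) / (2 * (1 + s))" by (simp add: add_divide_distrib)
 also have "... <= (2 * (B2 x + ED x)) / (2 * (1 + s))"
  using Friedrichs[OF x] s by (intro divide_right_mono) auto
 also have "... = (B2 x + ED x) / (1 + s)" using s by (simp only: mult_divide_mult_cancel_left zero_neq_numeral if_False)
 finally have "(1 + s)^2 * MD (ws s) x <= (1 + s)^2 * ((B2 x + ED x) / (1 + s))"
  by (intro mult_left_mono) auto
 also have "... = (1 + s) * (B2 x + ED x)" using s by (simp add: power2_eq_square)
 finally show ?thesis .
qed

text \<open>The function \<open>r / (2 * (1 + s * r^2))\<close> is largest at
  \<open>r = 1 / sqrt s\<close>, with value \<open>1 / (4 * sqrt s)\<close>.\<close>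

lemma mass_ws_infinity:
 assumes x: "x \<in> HH disk" and s: "s >= 1"
 shows "MD (ws s) x <= (B2 x + ED x) / sqrt s"
proof -
 have sq: "sqrt s >= 1" "sqrt s * sqrt s = s" using s by auto
 have "MD (ws s) x <= B2 x / (2 * (1 + s)) + (1 / (4 * sqrt s)) * (ED x + MD one x)"
 proof (rule mass_ws[OF x])
  fix r :: real assume r: "0 <= r" "r < 1"
  have "2 * (sqrt s * r) * 1 <= (sqrt s * r)^2 + 1^2" by (rule sum_squares_bound)
  then have "2 * sqrt s * r <= 1 + s * r^2" using s by (simp add: power_mult_distrib)
  moreover have "1 + s * r^2 > 0" using s by (simp add: add_pos_nonneg)
  ultimately show "r / (2 * (1 + s * r^2)) <= 1 / (4 * sqrt s)" using sq by (simp add: field_simps)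
 qed (use s in auto)
 also have "B2 x / (2 * (1 + s)) <= B2 x / (2 * sqrt s)"
 proof (rule divide_left_mono)
  show "2 * sqrt s <= 2 * (1 + s)" using sq s mult_left_mono[of 1 "sqrt s" "sqrt s"] by simp
  show "0 <= B2 x" using psd_nonneg[OF BB_psd, of x disk] x HH_T3[of disk] by auto
 qed (use sq s in auto)
 also have "(1 / (4 * sqrt s)) * (ED x + MD one x) <= (1 / (4 * sqrt s)) * (B2 x + 2 * ED x)"
  using Friedrichs[OF x] s by (intro mult_left_mono) auto
 also have "B2 x / (2 * sqrt s) + (1 / (4 * sqrt s)) * (B2 x + 2 * ED x)
   = (3/4 * B2 x + 1/2 * ED x) / sqrt s"
  using sq by (simp add: field_simps)
 also have "... <= (B2 x + ED x) / sqrt s"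
  using psd_nonneg[OF BB_psd, of x disk] psd_nonneg[OF EE_psd, of x disk] x HH_T3[of disk] s
  by (intro divide_right_mono) auto
 finally show ?thesis by simp
qed

text \<open>As \<open>s\<close> tends to -1 the weight becomes so large at the boundary that it
  dominates the trace with a small constant. The multiplier \<open>t ^ (2 * q)\<close> lives where
  \<open>t\<close> is near 1, which is where the weight is large.\<close>

lemma trace_ws_minus1:
 assumes x: "x \<in> HH disk" and s: "-1 < s" "1 + s <= 1 / real q" and q: "q >= 1"
 shows "B2 x <= (28 / real q) * (ED x + MD (ws s) x)"
proof -
 \<comment> \<open>Split \<open>1 + s t = (1 - t) + (1 + s) t\<close>. The geometric sum gives
   \<open>(1 - t) * t ^ q <= 1 / q\<close>, and the hypothesis on \<open>s\<close> bounds the other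
   part by \<open>1 / q\<close>.\<close>
 have key: "(t ^ q * (1 + s * t)) <= 2 / real q" "0 <= t ^ q * (1 + s * t)" if t: "0 <= t" "t <= 1" for t
 proof -
  have "1 - t ^ q = (1 - t) * (\<Sum>i<q. t ^ i)" by (rule one_diff_power_eq)
  moreover have "(\<Sum>i<q. t ^ q) <= (\<Sum>i<q. t ^ i)" using t by (intro sum_mono power_decreasing) auto
  ultimately have "(1 - t) * (real q * t ^ q) <= 1 - t ^ q" using t by (simp add: mult_left_mono)
  moreover have "t ^ q >= 0" "t ^ q <= 1" using t by (auto simp: power_le_one)
  ultimately have 1: "(1 - t) * t ^ q <= 1 / real q" using q by (simp add: field_simps)
  have "(1 + s) * t * t ^ q <= (1 / real q) * 1 * 1"
   using s t \<open>t ^ q \<ge> 0\<close> \<open>t ^ q \<le> 1\<close> by (intro mult_mono) auto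
  then show "(t ^ q * (1 + s * t)) <= 2 / real q" using 1 by (simp add: algebra_simps)
  have "s * t >= - 1 * t" using s t by (intro mult_right_mono) auto
  then show "0 <= t ^ q * (1 + s * t)" using t \<open>t ^ q \<ge> 0\<close> by (intro mult_nonneg_nonneg) auto
 qed
 \<comment> \<open>The constant is \<open>28 = 7 * 2^2\<close>: the zero-order terms add up to at
   most \<open>7 q t ^ (2 q)\<close>, and \<open>key\<close> contributes the square of
   \<open>2 / q\<close>.\<close>
 define w where "w z = (28 / real q) * ws s z" for z
 have "(1::real) ^ (2 * q) * B2 x <= (1 / real q) * ED x + MD w x"
 proof (rule trace_inequality[where a = "%t. t ^ (2 * q)" and a' = "%t. real (2 * q) * t ^ (2 * q - 1)", OF _ _ _ _ _ _ _ x])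
  show "weight w disk" unfolding w_def by (intro weight_cmult weight_ws s) simp
  fix z :: "real^2" assume z: "norm z < 1"
  define t where "t = (norm z)^2"
  have t: "0 <= t" "t <= 1" using z by (auto simp: t_def power_le_one)
  have P: "1 + s * t > 0" unfolding t_def using ws_pos[OF s(1), of z] z by simp
  have T: "0 <= t ^ (2 * q)" "t ^ (2 * q) <= 1" using t by (auto simp: power_le_one)
  have tt: "t * t ^ (2 * q - 1) = t ^ (2 * q)" using q by (simp flip: power_Suc)
  have "2 * t ^ (2 * q) + 2 * t * (real (2 * q) * t ^ (2 * q - 1)) + (t ^ (2 * q))^2 / (1 / real q)
   = (2 + 4 * real q) * t ^ (2 * q) + real q * (t ^ (2 * q))^2"
   using tt by (simp add: algebra_simps)
  also have "... <= (2 + 4 * real q) * t ^ (2 * q) + real q * t ^ (2 * q)"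
   using T by (intro add_left_mono mult_left_mono) (auto simp: power2_eq_square mult_left_le)
  also have "... = (2 + 5 * real q) * t ^ (2 * q)" by (simp add: algebra_simps)
  also have "... <= (7 * real q) * t ^ (2 * q)" using q T by (intro mult_right_mono) auto
  also have "... <= (28 / real q) * (1 / (1 + s * t)^2)"
  proof -
   have "(t ^ q * (1 + s * t))^2 <= (2 / real q)^2" by (intro power_mono key t)
   then have "t ^ (2 * q) * (1 + s * t)^2 <= 4 / (real q)^2"
    by (simp add: power_mult_distrib power_divide power_mult[symmetric] mult.commute)
   then have "(t ^ (2 * q) * (1 + s * t)^2) * (7 * real q) <= 4 / (real q)^2 * (7 * real q)" by (intro mult_right_mono) auto
   also have "... = 28 / real q" using q by (simp add: power2_eq_square)
   finally have "7 * real q * t ^ (2 * q) * (1 + s * t)^2 <= 28 / real q" by (simp add: mult_ac)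
   then have "7 * real q * t ^ (2 * q) <= 28 / real q / (1 + s * t)^2" using P by (subst pos_le_divide_eq) auto
   then show ?thesis by simp
  qed
  finally show "2 * ((norm z)^2) ^ (2 * q) + 2 * (norm z)^2 * (real (2 * q) * ((norm z)^2) ^ (2 * q - 1))
    + (((norm z)^2) ^ (2 * q))^2 / (1 / real q) <= w z"
   unfolding w_def ws_def t_def by linarith
 next
  show "((%t. t ^ (2 * q)) has_real_derivative real (2 * q) * t ^ (2 * q - 1)) (at t)" for t :: real
   by (auto intro!: derivative_eq_intros)
 qed (use q in \<open>auto intro!: continuous_intros\<close>)
 also have "MD w x = (28 / real q) * MD (ws s) x" unfolding w_def by (rule MM_cmult)
 also have "(1 / real q) * ED x <= (28 / real q) * ED x"
  using psd_nonneg[OF EE_psd, of x disk] x HH_T3[of disk] q by (intro mult_right_mono divide_right_mono) auto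
 finally show ?thesis by (simp add: distrib_left)
qed

section \<open>Continuously differentiable cutoff functions\<close>

definition pos2 :: "real => real" where "pos2 u = (max 0 u)^2"

lemma pos2_DERIV: "(pos2 has_real_derivative 2 * max 0 u) (at u)"
proof -
 consider "u < 0" | "u > 0" | "u = 0" by linarith
 then show ?thesis
 proof cases
  case 1
  have "((%_. 0) has_real_derivative 0) (at u)" by simp
  then have "(pos2 has_real_derivative 0) (at u)"
   by (rule has_field_derivative_transform_within_open[where S = "{..<0}"]) (use 1 in \<open>auto simp: pos2_def\<close>)
  then show ?thesis using 1 by simp
 next
  case 2
  have "((%u. u^2) has_real_derivative 2 * u) (at u)" by (auto intro!: derivative_eq_intros)
  then have "(pos2 has_real_derivative 2 * u) (at u)"
   by (rule has_field_derivative_transform_within_open[where S = "{0<..}"]) (use 2 in \<open>auto simp: pos2_def\<close>)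
  then show ?thesis using 2 by simp
 next
  case 3
  have "((%h. max 0 h) \<longlongrightarrow> max 0 0) (at (0::real))" by (intro tendsto_intros)
  then have "((%h. (pos2 (0 + h) - pos2 0) / h) \<longlongrightarrow> 0) (at 0)"
   by (rule filterlim_cong[THEN iffD1, rotated -1])
     (auto simp: pos2_def eventually_at_filter max_def power2_eq_square)
  then show ?thesis using 3 by (simp add: DERIV_def)
 qed
qed

lemma pos2_nonneg [simp]: "0 <= pos2 u" by (simp add: pos2_def)
lemma pos2_zero [simp]: "u <= 0 ==> pos2 u = 0" by (simp add: pos2_def)
lemma pos2_pos: "u > 0 ==> pos2 u > 0" by (simp add: pos2_def)

text \<open>The usual quotient construction of a step from 1 on \<open>u <= 0\<close> to 0 on
  \<open>u >= 1\<close>. The squared positive part has one continuous derivative, as much as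
  \<open>C1_compact_support\<close> asks for.\<close>

definition step :: "real => real" where "step u = pos2 (1 - u) / (pos2 u + pos2 (1 - u))"
definition dstep :: "real => real" where
 "dstep u = (- 2 * max 0 (1 - u) * (pos2 u + pos2 (1 - u)) - pos2 (1 - u) * (2 * max 0 u - 2 * max 0 (1 - u)))
   / (pos2 u + pos2 (1 - u))^2"

lemma step_denominator: "pos2 u + pos2 (1 - u) > 0"
 using pos2_pos[of u] pos2_pos[of "1 - u"] pos2_nonneg[of u] pos2_nonneg[of "1 - u"]
 by (cases "u > 0") (auto intro: add_pos_nonneg add_nonneg_pos)

lemma step_DERIV: "(step has_real_derivative dstep u) (at u)"
proof -
 have "((%u. 1 - u) has_real_derivative -1) (at u)" by (auto intro!: derivative_eq_intros)
 from DERIV_chain2[OF pos2_DERIV this] have p: "((%u. pos2 (1 - u)) has_real_derivative 2 * max 0 (1 - u) * -1) (at u)" .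
 have "((%u. pos2 (1 - u) / (pos2 u + pos2 (1 - u))) has_real_derivative
   (2 * max 0 (1 - u) * -1 * (pos2 u + pos2 (1 - u)) - pos2 (1 - u) * (2 * max 0 u + 2 * max 0 (1 - u) * -1))
   / ((pos2 u + pos2 (1 - u)) * (pos2 u + pos2 (1 - u)))) (at u)"
  using step_denominator[of u] by (intro DERIV_divide DERIV_add p pos2_DERIV) auto
 then show ?thesis unfolding step_def[abs_def] dstep_def by (simp add: power2_eq_square)
qed

lemma continuous_on_pos2 [continuous_intros]: "continuous_on A f ==> continuous_on A (%x. pos2 (f x))"
 unfolding pos2_def by (intro continuous_intros)

lemma continuous_on_dstep: "continuous_on A dstep"
 unfolding dstep_def[abs_def] using step_denominator
 by (intro continuous_intros) (auto simp: less_imp_neq[THEN not_sym])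

lemma step_simps: "u <= 0 ==> step u = 1" "u >= 1 ==> step u = 0" "0 <= step u" "step u <= 1"
 "u <= 0 ==> dstep u = 0" "u >= 1 ==> dstep u = 0"
proof -
 show "u <= 0 ==> step u = 1" using step_denominator[of u] by (auto simp: step_def)
 show "u >= 1 ==> step u = 0" by (simp add: step_def)
 show "0 <= step u" "step u <= 1" using step_denominator[of u] by (auto simp: step_def)
 show "u <= 0 ==> dstep u = 0" using step_denominator[of u] by (simp add: dstep_def)
 show "u >= 1 ==> dstep u = 0" by (simp add: dstep_def)
qed

lemma dstep_bounded: "\<exists>K>0. \<forall>u. \<bar>dstep u\<bar> <= K"
proof -
 have "compact (dstep ` {0..1})" by (intro compact_continuous_image continuous_on_dstep) auto
 then obtain K where K: "!!u. u \<in> {0..1} ==> norm (dstep u) <= K" by (force dest: compact_imp_bounded simp: bounded_iff)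
 have "\<bar>dstep u\<bar> <= max K 1" for u
  using K[of u] step_simps(5,6)[of u] by (cases "0 <= u"; cases "u <= 1") auto
 then show ?thesis by (intro exI[of _ "max K 1"]) auto
qed

lemma GDERIV_norm_sq: "GDERIV (%x::real^2. (norm x)^2) x :> 2 \<cdot> x"
 unfolding gderiv_def power2_norm_eq_inner
 by (auto intro!: derivative_eq_intros simp: inner_commute)

lemma GDERIV_compose:
 assumes "GDERIV f x :> Df" "(g has_real_derivative g') (at (f x))"
 shows "GDERIV (%x. g (f x)) x :> g' \<cdot> Df"
proof -
 have "(g has_derivative (%h. h * g')) (at (f x))" using assms(2) by (simp add: has_field_derivative_def mult_commute_abs)
 from has_derivative_compose[OF assms(1)[unfolded gderiv_def] this] show ?thesis
  unfolding gderiv_def by (simp add: mult.commute)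
qed

text \<open>The argument of \<open>step\<close> runs from 0 at radius 1 to 1 at radius 2; the
  squared norm keeps the function differentiable at the origin.\<close>

definition cutoff :: "real^2 => real" where "cutoff x = step (((norm x)^2 - 1) / 3)"
definition dcutoff :: "real^2 => real^2" where "dcutoff x = dstep (((norm x)^2 - 1) / 3) \<cdot> (1/3) \<cdot> 2 \<cdot> x"

lemma cutoff_GDERIV: "GDERIV cutoff x :> dcutoff x"
proof -
 have "((%u. (u - 1) / 3) has_real_derivative 1/3) (at u)" for u :: real by (auto intro!: derivative_eq_intros)
 from GDERIV_compose[OF GDERIV_compose[OF GDERIV_norm_sq this] step_DERIV]
 show ?thesis unfolding cutoff_def[abs_def] dcutoff_def .
qed

lemma cutoff_C1: assumes "!!x. GDERIV f x :> Df x" "continuous_on UNIV Df"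
 shows "C1c (%x. cutoff x * f x) (%x. cutoff x \<cdot> Df x + f x \<cdot> dcutoff x)"
 unfolding C1_compact_support_def
proof (intro conjI allI)
 show "GDERIV (%x. cutoff x * f x) x :> cutoff x \<cdot> Df x + f x \<cdot> dcutoff x" for x
  by (rule GDERIV_mult[OF cutoff_GDERIV assms(1)])
 have cf: "continuous_on UNIV f" "continuous_on UNIV cutoff"
  using assms(1) cutoff_GDERIV unfolding gderiv_def
  by (intro continuous_at_imp_continuous_on ballI has_derivative_continuous; blast)+
 have "continuous_on UNIV dcutoff"
  unfolding dcutoff_def[abs_def]
  by (intro continuous_intros continuous_on_compose2[OF continuous_on_dstep[of UNIV]]) auto
 then show "continuous_on UNIV (%x. cutoff x \<cdot> Df x + f x \<cdot> dcutoff x)"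
  using cf assms(2) by (intro continuous_intros)
 have "cutoff x = 0" if "norm x > 2" for x :: "real^2"
 proof -
  have "2^2 <= (norm x)^2" using that by (intro power_mono) auto
  then show ?thesis by (simp add: cutoff_def step_simps)
 qed
 then have "{x. cutoff x * f x ~= 0} \<subseteq> cball 0 2" by (force simp: not_less)
 then show "bounded {x. cutoff x * f x ~= 0}" by (rule bounded_subset[OF bounded_cball])
qed

lemma cutoff_disk: "norm x <= 1 ==> cutoff x = 1" "norm x <= 1 ==> dcutoff x = 0"
 by (simp_all add: cutoff_def dcutoff_def step_simps power_le_one)

section \<open>Trigonometric functions and their harmonic extensions\<close>

text \<open>Index 0 is the constant, and the indices \<open>2n - 1\<close> and \<open>2n\<close> are
  the sine and the cosine of degree \<open>n\<close>. The first \<open>2m + 1\<close> indices are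
  exactly the degrees up to \<open>m\<close>, which is the origin of the numbers
  \<open>2m + 1\<close>, \<open>2m + 2\<close> and \<open>2m + 3\<close> in the theorem.\<close>

definition deg :: "nat => nat" where "deg i = (i + 1) div 2"
definition nrm :: "nat => real" where "nrm i = (if i = 0 then 1 / sqrt (2 * pi) else 1 / sqrt pi)"
definition trig :: "nat => real => real" where
 "trig i t = nrm i * (if even i then cos (real (deg i) * t) else sin (real (deg i) * t))"
definition dtrig :: "nat => real => real" where
 "dtrig i t = nrm i * real (deg i) * (if even i then - sin (real (deg i) * t) else cos (real (deg i) * t))"

lemma trig_DERIV: "(trig i has_real_derivative dtrig i t) (at t)"
 and dtrig_DERIV: "(dtrig i has_real_derivative - (real (deg i))\<^sup>2 * trig i t) (at t)"
 unfolding trig_def[abs_def] dtrig_def[abs_def]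
 by (cases "even i"; auto intro!: derivative_eq_intros simp: power2_eq_square)+

lemma trig_continuous: "continuous_on A (trig i)" "continuous_on A (dtrig i)"
 by (meson continuous_at_imp_continuous_on DERIV_isCont trig_DERIV dtrig_DERIV)+

lemma dtrig_period: "dtrig i (2 * pi) = dtrig i 0"
proof -
 have "sin (real n * (2 * pi)) = 0" "cos (real n * (2 * pi)) = 1" for n
  using sin_int_2pin[of "int n"] cos_int_2pin[of "int n"] by (auto simp: mult.commute mult.assoc)
 then show ?thesis by (simp add: dtrig_def)
qed

lemma circle_curve_2pi: "cc r (2 * pi) = cc r 0"
 by (simp add: vec_eq_iff forall_2)

lemma integral_ang_FTC:
 assumes "!!t. (F has_real_derivative f t) (at t)" "continuous_on UNIV f"
 shows "(\<integral>t. f t \<partial>ang) = F (2*pi) - F 0"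
proof -
 have "(\<integral>t. f t \<partial>ang) = (\<integral>t. indicator {0..<2*pi} t * f t \<partial>lborel)"
  by (subst integral_restrict_space) auto
 also have "... = (\<integral>t. f t * indicator {0..2*pi} t \<partial>lborel)"
 proof (rule integral_cong_AE)
  show "AE t in lborel. indicator {0..<2*pi} t * f t = f t * indicator {0..2*pi} t"
   using AE_lborel_singleton[of "2*pi"] by eventually_elim (auto simp: indicator_def)
 qed (use borel_measurable_continuous_onI[OF assms(2)] in \<open>auto intro!: borel_measurable_times\<close>)
 also have "... = F (2*pi) - F 0"
  using assms by (intro integral_FTC_Icc_real) (auto simp: continuous_on_eq_continuous_at)
 finally show ?thesis .
qed

lemma integral_cos_int: "(\<integral>t. cos (real_of_int j * t) \<partial>ang) = (if j = 0 then 2 * pi else 0)"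
 and integral_sin_int: "(\<integral>t. sin (real_of_int j * t) \<partial>ang) = 0"
proof -
 have p: "sin (real_of_int j * (2 * pi)) = 0" "cos (real_of_int j * (2 * pi)) = 1"
  using sin_int_2pin[of j] cos_int_2pin[of j] by (auto simp: mult.commute mult.assoc)
 show "(\<integral>t. cos (real_of_int j * t) \<partial>ang) = (if j = 0 then 2 * pi else 0)"
 proof (cases "j = 0")
  case True
  have "(\<integral>t. (1::real) \<partial>ang) = 2 * pi - 0"
   by (rule integral_ang_FTC[of "%t. t"]) (auto intro!: derivative_eq_intros)
  then show ?thesis using True by simp
 next
  case False
  have "(\<integral>t. cos (real_of_int j * t) \<partial>ang) = sin (real_of_int j * (2 * pi)) / j - sin (real_of_int j * 0) / j"
   by (rule integral_ang_FTC[of "%t. sin (real_of_int j * t) / j"])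
     (use False in \<open>auto intro!: derivative_eq_intros continuous_intros\<close>)
  then show ?thesis using False p by simp
 qed
 show "(\<integral>t. sin (real_of_int j * t) \<partial>ang) = 0"
 proof (cases "j = 0")
  case False
  have "(\<integral>t. sin (real_of_int j * t) \<partial>ang) = - cos (real_of_int j * (2 * pi)) / j - - cos (real_of_int j * 0) / j"
   by (rule integral_ang_FTC[of "%t. - cos (real_of_int j * t) / j"])
     (use False in \<open>auto intro!: derivative_eq_intros continuous_intros\<close>)
  then show ?thesis using p by simp
 qed simp
qed

lemma ang_integrable: assumes "continuous_on UNIV f" shows "integrable ang (f :: real => real)"
proof -
 have "integrable lborel (%t. indicator {0..2*pi} t \<cdot> f t)"
  using assms by (intro borel_integrable_compact) (auto intro: continuous_on_subset)
 from integrable_mult_indicator[OF _ this, of "{0..<2*pi}"]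
 have "integrable lborel (%t. indicator {0..<2*pi} t \<cdot> (indicator {0..2*pi} t \<cdot> f t))" by simp
 also have "(%t. indicator {0..<2*pi} t \<cdot> (indicator {0..2*pi} t \<cdot> f t)) = (%t. indicator {0..<2*pi} t \<cdot> f t)"
  by (auto simp: indicator_def)
 finally show ?thesis by (subst integrable_restrict_space) auto
qed

lemma trig_orthonormal: "(\<integral>t. trig i t * trig j t \<partial>ang) = (if i = j then 1 else 0)"
proof -
 let ?n = "int (deg i)" and ?m = "int (deg j)"
 have I: "integrable ang (%t. cos (real_of_int k * t))" "integrable ang (%t. sin (real_of_int k * t))" for k
  by (intro ang_integrable continuous_intros)+
 have cc: "(\<integral>t. cos (real (deg i) * t) * cos (real (deg j) * t) \<partial>ang)
   = ((if ?n - ?m = 0 then 2 * pi else 0) + (if ?n + ?m = 0 then 2 * pi else 0)) / 2"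
 proof -
  have "cos (real (deg i) * t) * cos (real (deg j) * t) = (cos (real_of_int (?n - ?m) * t) + cos (real_of_int (?n + ?m) * t)) / 2" for t
   by (simp only: cos_times_cos) (simp add: algebra_simps)
  then show ?thesis using I by (simp only: integral_cos_int Bochner_Integration.integral_add integral_divide_zero)
 qed
 have ss: "(\<integral>t. sin (real (deg i) * t) * sin (real (deg j) * t) \<partial>ang)
   = ((if ?n - ?m = 0 then 2 * pi else 0) - (if ?n + ?m = 0 then 2 * pi else 0)) / 2"
 proof -
  have "sin (real (deg i) * t) * sin (real (deg j) * t) = (cos (real_of_int (?n - ?m) * t) - cos (real_of_int (?n + ?m) * t)) / 2" for t
   by (simp only: sin_times_sin) (simp add: algebra_simps)
  then show ?thesis using I by (simp only: integral_cos_int Bochner_Integration.integral_diff integral_divide_zero)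
 qed
 have sc: "(\<integral>t. sin (real (deg i) * t) * cos (real (deg j) * t) \<partial>ang) = 0"
 proof -
  have "sin (real (deg i) * t) * cos (real (deg j) * t) = (sin (real_of_int (?n + ?m) * t) + sin (real_of_int (?n - ?m) * t)) / 2" for t
   by (simp only: sin_times_cos) (simp add: algebra_simps)
  then show ?thesis using I by (simp only: integral_sin_int Bochner_Integration.integral_add integral_divide_zero) simp
 qed
 have cs: "(\<integral>t. cos (real (deg i) * t) * sin (real (deg j) * t) \<partial>ang) = 0"
 proof -
  have "cos (real (deg i) * t) * sin (real (deg j) * t) = (sin (real_of_int (?n + ?m) * t) - sin (real_of_int (?n - ?m) * t)) / 2" for t
   by (simp only: cos_times_sin) (simp add: algebra_simps)
  then show ?thesis using I by (simp only: integral_sin_int Bochner_Integration.integral_diff integral_divide_zero) simp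
 qed
 have pull: "(\<integral>t. trig i t * trig j t \<partial>ang) = nrm i * nrm j *
   (\<integral>t. (if even i then cos (real (deg i) * t) else sin (real (deg i) * t)) * (if even j then cos (real (deg j) * t) else sin (real (deg j) * t)) \<partial>ang)"
  unfolding trig_def by (subst integral_mult_right_zero[symmetric]) (simp add: mult_ac)
 have d: "deg i = deg j ==> even i = even j ==> i = j" unfolding deg_def by presburger
 have d0: "deg i = 0 \<longleftrightarrow> i = 0" "deg j = 0 \<longleftrightarrow> j = 0" by (auto simp: deg_def)
 have o: "odd i ==> deg i ~= 0" unfolding deg_def by presburger
 show ?thesis
 proof (cases "i = j")
  case True
  then have ji: "j = i" by simp
  show ?thesis
  proof (cases "even i")
   case e: True
   have cci: "(\<integral>t. cos (real (deg i) * t) * cos (real (deg i) * t) \<partial>ang) = (2 * pi + (if i = 0 then 2 * pi else 0)) / 2"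
    using cc[unfolded ji] d0 by simp
   have "(\<integral>t. trig i t * trig j t \<partial>ang) = nrm i * nrm i * ((2 * pi + (if i = 0 then 2 * pi else 0)) / 2)"
    unfolding ji pull[unfolded ji] using e by (simp only: cci if_True)
   also have "... = 1" by (cases "i = 0") (auto simp: nrm_def)
   finally show ?thesis unfolding ji by simp
  next
   case e: False
   then have "i ~= 0" by (cases i) auto
   then have "nrm i * nrm i * pi = 1" by (simp add: nrm_def)
   then show ?thesis unfolding ji pull[unfolded ji] using e ss[unfolded ji] o[OF e] by simp
  qed
 next
  case ne: False
  consider "even i" "even j" | "even i" "odd j" | "odd i" "even j" | "odd i" "odd j" by blast
  then show ?thesis
  proof cases
   case 1
   then have "deg i ~= deg j" using d ne by blast
   then show ?thesis unfolding pull using 1 ne cc by (simp add: of_nat_diff)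
  next
   case 4
   then have "deg i ~= deg j" using d ne by blast
   then show ?thesis unfolding pull using 4 ne ss by simp
  qed (unfold pull, use ne sc cs in simp_all)
 qed
qed

section \<open>Harmonic extensions as real and imaginary parts of powers, and Green's
  formula\<close>

definition zc :: "real^2 => complex" where "zc x = Complex (x $ 1) (x $ 2)"

lemma zc_simps [simp]: "Re (zc x) = x $ 1" "Im (zc x) = x $ 2" by (simp_all add: zc_def)

lemma zc_bounded_linear: "bounded_linear zc"
proof -
 have "linear zc" by (rule linearI) (auto simp: zc_def complex_eq_iff)
 then show ?thesis by (rule linear_conv_bounded_linear[THEN iffD1])
qed

lemma zc_circle: "zc (cc r t) = rcis r t"
 by (simp add: zc_def complex_eq_iff)

definition hfun :: "nat => real^2 => real" where
 "hfun i x = nrm i * (if even i then Re (zc x ^ deg i) else Im (zc x ^ deg i))"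
text \<open>By the Cauchy-Riemann equations both gradients are read off from the complex derivative
  \<open>w\<close> of the power.\<close>

definition dhfun :: "nat => real^2 => real^2" where
 "dhfun i x = (let w = of_nat (deg i) * zc x ^ (deg i - 1) in
   nrm i \<cdot> (if even i then vector [Re w, - Im w] else vector [Im w, Re w]))"

lemma hfun_GDERIV: "GDERIV (hfun i) x :> dhfun i x"
proof -
 have "(zc has_derivative zc) (at x)" by (rule bounded_linear_imp_has_derivative[OF zc_bounded_linear])
 from has_derivative_power[OF this, of "deg i"]
 have d: "((%x. zc x ^ deg i) has_derivative (%h. of_nat (deg i) * zc h * zc x ^ (deg i - 1))) (at x)" .
 note r = bounded_linear.has_derivative[OF bounded_linear_Re d] bounded_linear.has_derivative[OF bounded_linear_Im d]
 define w where "w = of_nat (deg i) * zc x ^ (deg i - 1)"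
 have dh: "dhfun i x = nrm i \<cdot> (if even i then vector [Re w, - Im w] else vector [Im w, Re w])"
  by (simp add: dhfun_def w_def)
 have "of_nat (deg i) * zc h * zc x ^ (deg i - 1) = w * zc h" for h by (simp add: w_def)
 note r = r[unfolded this]
 show ?thesis
 proof (cases "even i")
  case True
  have "(%h. nrm i * Re (w * zc h)) = (%h. h \<bullet> dhfun i x)"
   using True by (auto simp: dh inner_vec_def sum_2 algebra_simps)
  with has_derivative_mult_right[OF r(1), of "nrm i"] show ?thesis
   unfolding gderiv_def hfun_def[abs_def] using True by simp
 next
  case False
  have "(%h. nrm i * Im (w * zc h)) = (%h. h \<bullet> dhfun i x)"
   using False by (auto simp: dh inner_vec_def sum_2 algebra_simps)
  with has_derivative_mult_right[OF r(2), of "nrm i"] show ?thesis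
   unfolding gderiv_def hfun_def[abs_def] using False by simp
 qed
qed

lemma dhfun_continuous: "continuous_on UNIV (dhfun i)"
proof -
 have z: "continuous_on UNIV zc" using zc_bounded_linear by (rule linear_continuous_on)
 show ?thesis
  by (rule continuous_on_vec2; cases "even i")
    (auto simp: dhfun_def Let_def intro!: continuous_intros z)
qed

lemma hfun_circle: "hfun i (cc r t) = r ^ deg i * trig i t"
 by (simp add: hfun_def trig_def zc_circle DeMoivre2)

text \<open>Decomposition of the gradient into its radial and tangential parts;
  \<open>cc 1 (t + pi/2)\<close> is the unit tangent vector.\<close>

lemma dhfun_circle:
 assumes "deg i >= 1"
 shows "dhfun i (cc r t) = r ^ (deg i - 1) \<cdot>
  ((real (deg i) * trig i t) \<cdot> cc 1 t + dtrig i t \<cdot> cc 1 (t + pi/2))"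
proof -
 define n where "n = deg i - 1"
 have n: "deg i = Suc n" using assms by (simp add: n_def)
 have w: "Re (zc (cc r t) ^ n) = r ^ n * cos (real n * t)" "Im (zc (cc r t) ^ n) = r ^ n * sin (real n * t)"
  by (auto simp: zc_circle DeMoivre2)
 have a: "cos (real n * t) = cos (real (Suc n) * t) * cos t + sin (real (Suc n) * t) * sin t"
  "sin (real n * t) = sin (real (Suc n) * t) * cos t - cos (real (Suc n) * t) * sin t"
  using cos_diff[of "real (Suc n) * t" t] sin_diff[of "real (Suc n) * t" t] by (simp_all add: algebra_simps)
 show ?thesis
  unfolding dhfun_def Let_def vec_eq_iff forall_2
  by (simp add: n w a trig_def dtrig_def cos_add sin_add del: of_nat_Suc) (simp add: algebra_simps del: of_nat_Suc)
qed

text \<open>The cutoff makes the support bounded. It equals 1 on the closed unit disk, where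
  \<open>hh i\<close> is therefore the harmonic polynomial itself.\<close>

definition hh :: "nat => triple" where
 "hh i = ((%x. cutoff x * hfun i x), (%x. cutoff x \<cdot> dhfun i x + hfun i x \<cdot> dcutoff x), (%x. cutoff x * hfun i x))"

lemma hh_C1: "C1c (%x. cutoff x * hfun i x) (%x. cutoff x \<cdot> dhfun i x + hfun i x \<cdot> dcutoff x)"
 by (rule cutoff_C1[OF hfun_GDERIV dhfun_continuous])

lemma hh_SM: "hh i \<in> SM" unfolding hh_def SM_def using hh_C1 by blast

lemma BB_hh: assumes "C1c \<phi> D\<phi>"
 shows "BB (\<phi>, D\<phi>, \<phi>) (hh i) = (\<integral>t. \<phi> (cc 1 t) * trig i t \<partial>ang)"
proof -
 have [measurable]: "\<phi> \<in> meas borel" "(%x. cutoff x * hfun i x) \<in> meas borel"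
  using C1_measurable[OF assms] C1_measurable[OF hh_C1] by auto
 have "BB (\<phi>, D\<phi>, \<phi>) (hh i) = (\<integral>z. \<phi> z * (cutoff z * hfun i z) \<partial>circ_measure)" by (simp add: BB_def hh_def)
 also have "... = (\<integral>t. \<phi> (cc 1 t) * (cutoff (cc 1 t) * hfun i (cc 1 t)) \<partial>ang)"
  by (rule integral_circ) measurable
 finally show ?thesis by (simp add: cutoff_disk hfun_circle)
qed

lemma BB_hh_hh: "BB (hh i) (hh j) = (if i = j then 1 else 0)"
proof -
 have "BB (hh i) (hh j) = (\<integral>t. cutoff (cc 1 t) * hfun i (cc 1 t) * trig j t \<partial>ang)"
  using BB_hh[OF hh_C1[of i], of j] by (simp add: hh_def[of i])
 then show ?thesis by (simp add: cutoff_disk hfun_circle trig_orthonormal)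
qed

lemma C1_angular_derivative:
 assumes "C1c \<phi> D\<phi>"
 shows "((%t. \<phi> (cc r t)) has_real_derivative r * (cc 1 (t + pi/2) \<bullet> D\<phi> (cc r t))) (at t)"
proof -
 have "((%t. cc r t) has_derivative (%h. h \<cdot> (r \<cdot> cc 1 (t + pi/2)))) (at t)"
  by (rule has_derivative_vec2) (auto intro!: derivative_eq_intros simp: cos_add sin_add)
 moreover have "(\<phi> has_derivative (%h. h \<bullet> D\<phi> (cc r t))) (at (cc r t))"
  using assms by (auto simp: C1_compact_support_def gderiv_def)
 ultimately have "((%t. \<phi> (cc r t)) has_derivative (%h. (h \<cdot> (r \<cdot> cc 1 (t + pi/2))) \<bullet> D\<phi> (cc r t))) (at t)"
  by (rule has_derivative_compose)
 then show ?thesis by (simp add: has_field_derivative_def mult_commute_abs mult.assoc mult.left_commute)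
qed

text \<open>The normal derivative of a homogeneous harmonic polynomial on the unit circle is its
  degree times its value; this makes the \<open>hh i\<close> Steklov eigenfunctions. In polar
  coordinates the integrand splits into an exact radial derivative, which yields the boundary term,
  and an exact angular derivative, which integrates to zero over each circle.\<close>

lemma Green:
 assumes C1: "C1c \<phi> D\<phi>"
 shows "EE disk (\<phi>, D\<phi>, \<phi>) (hh i) = real (deg i) * BB (\<phi>, D\<phi>, \<phi>) (hh i)"
proof (cases "deg i = 0")
 case True
 have "dhfun i z = 0" for z using True by (simp add: dhfun_def vec_eq_iff forall_2)
 then have "(\<integral>z. D\<phi> z \<bullet> (cutoff z \<cdot> dhfun i z + hfun i z \<cdot> dcutoff z) \<partial>leb disk) = (\<integral>z. 0 \<partial>leb disk)"
  by (intro Bochner_Integration.integral_cong) (auto simp: space_restrict_space cutoff_disk)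
 then show ?thesis using True by (simp add: EE_def hh_def)
next
 case False
 then have n1: "deg i >= 1" by simp
 define n where "n = deg i"
 note [measurable] = C1_measurable[OF C1] borel_measurable_continuous_onI[OF dhfun_continuous]
 have c\<phi>: "continuous_on UNIV \<phi>" "continuous_on UNIV D\<phi>" using C1_continuous[OF C1] by auto
 define f where "f z = D\<phi> z \<bullet> dhfun i z" for z
 have fm [measurable]: "f \<in> meas borel" unfolding f_def by measurable
 have "compact (f ` cball 0 1)" unfolding f_def
  by (intro compact_continuous_image continuous_on_inner C1_continuous[OF C1] continuous_on_subset[OF dhfun_continuous]) auto
 then obtain C where C: "!!z. norm z <= 1 ==> norm (f z) <= C" by (force dest: compact_imp_bounded simp: bounded_iff)
 \<comment> \<open>The terms with \<open>n^2 * \<phi>\<close> in \<open>A\<close> and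
   \<open>B\<close> cancel. They are inserted so that \<open>A\<close> is the
   \<open>r\<close>-derivative of \<open>n * trig i t * (r ^ n * \<phi>)\<close> and
   \<open>B\<close> the \<open>t\<close>-derivative of
   \<open>r ^ (n-1) * (\<phi> * dtrig i t)\<close>.\<close>
 define A where "A r t = n * trig i t * (n * r ^ (n-1) * \<phi> (cc r t) + r ^ n * (cc 1 t \<bullet> D\<phi> (cc r t)))" for r t :: real
 define B where "B r t = r ^ (n-1) * (r * (cc 1 (t + pi/2) \<bullet> D\<phi> (cc r t)) * dtrig i t
   + - (real n)\<^sup>2 * trig i t * \<phi> (cc r t))" for r t :: real
 have rn: "r * r ^ (n - 1) = r ^ n" for r :: real using n1 by (simp add: n_def flip: power_Suc)
 have rf: "r * f (cc r t) = A r t + B r t" for r t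
 proof -
  have "r * f (cc r t) = (r * r ^ (n - 1)) * (D\<phi> (cc r t) \<bullet>
    ((real n * trig i t) \<cdot> cc 1 t + dtrig i t \<cdot> cc 1 (t + pi/2)))"
   unfolding f_def dhfun_circle[OF n1] n_def[symmetric] by simp
  also have "... = r ^ n * (real n * trig i t * (cc 1 t \<bullet> D\<phi> (cc r t)))
    + r ^ n * (dtrig i t * (cc 1 (t + pi/2) \<bullet> D\<phi> (cc r t)))"
   unfolding rn by (simp add: inner_add_right inner_commute distrib_left)
  also have "... = A r t + B r t"
   unfolding A_def B_def by (simp add: rn[symmetric] algebra_simps power2_eq_square)
  finally show ?thesis .
 qed
 have cont: "continuous_on UNIV (%p. A (fst p) (snd p))" "continuous_on UNIV (%p. B (fst p) (snd p))"
  unfolding A_def B_def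
  by (intro continuous_intros continuous_on_compose2[OF c\<phi>(1)] continuous_on_compose2[OF c\<phi>(2)]
     continuous_on_compose2[OF trig_continuous(1)[of UNIV]] continuous_on_compose2[OF trig_continuous(2)[of UNIV]]; simp)+
 have contr: "continuous_on UNIV (%r. A r t)" "continuous_on UNIV (%r. B r t)" for t
 proof -
  have "continuous_on UNIV (%r::real. (r, t))" by (intro continuous_intros)
  from continuous_on_compose2[OF cont(1) this] continuous_on_compose2[OF cont(2) this]
  show "continuous_on UNIV (%r. A r t)" "continuous_on UNIV (%r. B r t)" by auto
 qed
 have contt: "continuous_on UNIV (%t. A r t)" "continuous_on UNIV (%t. B r t)" for r
 proof -
  have "continuous_on UNIV (%t::real. (r, t))" by (intro continuous_intros)
  from continuous_on_compose2[OF cont(1) this] continuous_on_compose2[OF cont(2) this]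
  show "continuous_on UNIV (%t. A r t)" "continuous_on UNIV (%t. B r t)" by auto
 qed
 have e1: "(\<integral>t. n * trig i t * \<phi> (cc 1 t) + (I01 (%r. B r t)) \<partial>ang)
   = n * (\<integral>t. \<phi> (cc 1 t) * trig i t \<partial>ang) + (\<integral>t. (I01 (%r. B r t)) \<partial>ang)"
  and e2: "(\<integral>t. (I01 (%r. B r t)) \<partial>ang) = 0"
 proof -
  have ib: "integrable lborel (%p. indicator ({0..1} \<times> {0..2*pi}) p \<cdot> B (fst p) (snd p))"
   by (intro borel_integrable_compact compact_Times continuous_on_subset[OF cont(2)]) auto
  then have "integrable (lborel \<Otimes>\<^sub>M lborel) (%p. indicator ({0..1} \<times> {0..<2*pi}) p \<cdot> (indicator ({0..1} \<times> {0..2*pi}) p \<cdot> B (fst p) (snd p)))"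
   unfolding lborel_prod by (intro integrable_mult_indicator[OF _ ib]) (auto simp: borel_prod[symmetric])
  also have "(%p. indicator ({0..1} \<times> {0..<2*pi}) p \<cdot> (indicator ({0..1} \<times> {0..2*pi}) p \<cdot> B (fst p) (snd p)))
    = (%(r, t). indicator {0..<2*pi} t * (B r t * indicator {0..1} r))"
   by (auto simp: indicator_def fun_eq_iff)
  finally have i2: "integrable (lborel \<Otimes>\<^sub>M lborel) (%(r, t). indicator {0..<2*pi} t * (B r t * indicator {0..1} r))" .
  have B0: "(\<integral>t. B r t \<partial>ang) = 0" for r
  proof -
   have "(\<integral>t. B r t \<partial>ang) = r ^ (n-1) * (\<phi> (cc r (2*pi)) * dtrig i (2*pi)) - r ^ (n-1) * (\<phi> (cc r 0) * dtrig i 0)"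
   proof (rule integral_ang_FTC[OF _ contt(2)])
    show "((%t. r ^ (n-1) * (\<phi> (cc r t) * dtrig i t)) has_real_derivative B r t) (at t)" for t
     unfolding B_def n_def
     by (rule DERIV_cong[OF DERIV_cmult[OF DERIV_mult[OF C1_angular_derivative[OF C1] dtrig_DERIV]]])
       (simp add: mult_ac)
   qed
   then show ?thesis by (simp add: circle_curve_2pi dtrig_period)
  qed
  have r1: "(\<integral>t. (I01 (%r. B r t)) \<partial>ang) = (\<integral>t. (\<integral>r. indicator {0..<2*pi} t * (B r t * indicator {0..1} r) \<partial>lborel) \<partial>lborel)"
   by (subst integral_restrict_space) auto
  also have "... = (\<integral>r. (\<integral>t. indicator {0..<2*pi} t * (B r t * indicator {0..1} r) \<partial>lborel) \<partial>lborel)"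
   by (rule lborel_pair.Fubini_integral[OF i2])
  also have "... = (\<integral>r. indicator {0..1} r * (\<integral>t. B r t \<partial>ang) \<partial>lborel)"
   by (intro Bochner_Integration.integral_cong refl) (subst integral_restrict_space, auto simp flip: integral_mult_right_zero simp: mult_ac)
  also have "... = 0" by (simp add: B0)
  finally show "(\<integral>t. (I01 (%r. B r t)) \<partial>ang) = 0" by simp
  have "integrable lborel (%t. (\<integral>r. indicator {0..<2*pi} t * (B r t * indicator {0..1} r) \<partial>lborel))"
   using lborel_pair.integrable_snd[OF i2] by simp
  then have "integrable ang (%t. (I01 (%r. B r t)))"
   by (subst integrable_restrict_space) auto
  moreover have "integrable ang (%t. n * trig i t * \<phi> (cc 1 t))"
   by (intro ang_integrable continuous_intros trig_continuous continuous_on_compose2[OF c\<phi>(1)]) auto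
  ultimately have "(\<integral>t. n * trig i t * \<phi> (cc 1 t) + (I01 (%r. B r t)) \<partial>ang)
   = (\<integral>t. n * trig i t * \<phi> (cc 1 t) \<partial>ang) + (\<integral>t. (I01 (%r. B r t)) \<partial>ang)"
   by (rule Bochner_Integration.integral_add[rotated])
  also have "(\<integral>t. n * trig i t * \<phi> (cc 1 t) \<partial>ang) = n * (\<integral>t. \<phi> (cc 1 t) * trig i t \<partial>ang)"
   by (subst integral_mult_right_zero[symmetric]) (simp add: mult_ac)
  finally show "(\<integral>t. n * trig i t * \<phi> (cc 1 t) + (I01 (%r. B r t)) \<partial>ang)
   = n * (\<integral>t. \<phi> (cc 1 t) * trig i t \<partial>ang) + (\<integral>t. (I01 (%r. B r t)) \<partial>ang)" .
 qed
 have "EE disk (\<phi>, D\<phi>, \<phi>) (hh i) = (\<integral>z. f z \<partial>leb disk)"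
  unfolding EE_def by (intro Bochner_Integration.integral_cong) (auto simp: hh_def space_restrict_space cutoff_disk f_def)
 also have "... = (\<integral>t. (I01 (%r. r * f (cc r t))) \<partial>ang)"
  by (rule integral_ball_polar(1)[OF fm]) (use C in force)
 also have "... = (\<integral>t. n * trig i t * \<phi> (cc 1 t) + (I01 (%r. B r t)) \<partial>ang)"
 proof (rule Bochner_Integration.integral_cong)
  fix t
  have "(I01 (%r. A r t)) = n * trig i t * (1 ^ n * \<phi> (cc 1 t)) - n * trig i t * (0 ^ n * \<phi> (cc 0 t))"
  proof (rule integral_FTC_Icc_real)
   fix r :: real
   show "((%r. n * trig i t * (r ^ n * \<phi> (cc r t))) has_real_derivative A r t) (at r)"
    unfolding A_def
    by (rule DERIV_cong[OF DERIV_cmult[OF DERIV_mult[OF DERIV_pow C1_radial_derivative[OF C1]]]])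
      (simp add: mult_ac)
   show "isCont (%r. A r t) r" using contr by (simp add: continuous_on_eq_continuous_at)
  qed simp
  moreover have "integrable lborel (%r. indicator {0..1} r \<cdot> A r t)" "integrable lborel (%r. indicator {0..1} r \<cdot> B r t)"
   by (intro borel_integrable_compact continuous_on_subset[OF contr(1)] continuous_on_subset[OF contr(2)]; simp)+
  ultimately show "(I01 (%r. r * f (cc r t))) =
    n * trig i t * \<phi> (cc 1 t) + (I01 (%r. B r t))"
   unfolding rf distrib_right using n1 by (simp add: mult.commute n_def)
 qed simp
 also have "... = n * (\<integral>t. \<phi> (cc 1 t) * trig i t \<partial>ang)" unfolding e1 e2 by simp
 finally show ?thesis by (simp add: BB_hh[OF C1] n_def)
qed


section \<open>Completeness of the trigonometric system and Steklov's inequality\<close>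

lemma span_sum_nat:
 assumes "p \<in> span (range (f :: nat => 'v::real_vector))"
 shows "\<exists>K a. p = (\<Sum>i<K. a i \<cdot> f i)"
 using assms
proof (induction rule: span_induct_alt)
 case base
 show ?case by (rule exI[of _ 0]) simp
next
 case (step c x y)
 then obtain K a j where y: "y = (\<Sum>i<K. a i \<cdot> f i)" and x: "x = f j" by auto
 define L where "L = max K (Suc j)"
 have "y = (\<Sum>i<L. (if i < K then a i else 0) \<cdot> f i)"
  unfolding y by (rule sum.mono_neutral_cong_left) (auto simp: L_def)
 moreover have "c \<cdot> x = (\<Sum>i<L. (if i = j then c else 0) \<cdot> f i)"
 proof -
  have "(\<Sum>i<L. (if i = j then c else 0) \<cdot> f i) = (\<Sum>i<L. if i = j then c \<cdot> f j else 0)"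
   by (rule sum.cong) auto
  moreover have "j < L" by (simp add: L_def)
  ultimately show ?thesis by (simp add: x)
 qed
 ultimately have "c \<cdot> x + y = (\<Sum>i<L. ((if i = j then c else 0) + (if i < K then a i else 0)) \<cdot> f i)"
  by (simp add: scaleR_add_left sum.distrib)
 then show ?case by (intro exI[of _ L] exI[of _ "%i. (if i = j then c else 0) + (if i < K then a i else 0)"])
qed

abbreviation trigs :: "(real => real) set" where "trigs \<equiv> span (range trig)"

lemma cos_sin_trigs: "(%t. cos (real n * t)) \<in> trigs" "(%t. sin (real n * t)) \<in> trigs"
proof -
 have nz: "nrm i ~= 0" for i by (simp add: nrm_def)
 have "(1 / nrm (2 * n)) \<cdot> trig (2 * n) \<in> trigs" by (intro span_scale span_base) auto
 also have "(1 / nrm (2 * n)) \<cdot> trig (2 * n) = (%t. cos (real n * t))"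
  using nz by (auto simp: fun_eq_iff trig_def deg_def)
 finally show "(%t. cos (real n * t)) \<in> trigs" .
 show "(%t. sin (real n * t)) \<in> trigs"
 proof (cases n)
  case 0
  then have "(%t. sin (real n * t)) = 0" by (auto simp: fun_eq_iff)
  then show ?thesis by (simp add: span_zero)
 next
  case (Suc k)
  have "(1 / nrm (2 * k + 1)) \<cdot> trig (2 * k + 1) \<in> trigs" by (intro span_scale span_base) auto
  also have "(1 / nrm (2 * k + 1)) \<cdot> trig (2 * k + 1) = (%t. sin (real n * t))"
   using nz by (auto simp: fun_eq_iff trig_def deg_def Suc)
  finally show ?thesis .
 qed
qed

lemma cos_sin_int_trigs: "(%t. cos (real_of_int j * t)) \<in> trigs" "(%t. sin (real_of_int j * t)) \<in> trigs"
proof -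
 consider n where "j = int n" | n where "j = - int n" by (metis int_cases2)
 then have "(%t. cos (real_of_int j * t)) \<in> trigs \<and> (%t. sin (real_of_int j * t)) \<in> trigs"
 proof cases
  case 1 then show ?thesis using cos_sin_trigs[of n] by simp
 next
  case 2
  have "(%t. sin (real_of_int j * t)) = - 1 \<cdot> (%t. sin (real n * t))" using 2 by (auto simp: fun_eq_iff)
  then have "(%t. sin (real_of_int j * t)) \<in> trigs" using cos_sin_trigs(2)[of n] by (simp only: span_scale)
  then show ?thesis using 2 cos_sin_trigs[of n] by simp
 qed
 then show "(%t. cos (real_of_int j * t)) \<in> trigs" "(%t. sin (real_of_int j * t)) \<in> trigs" by auto
qed

lemma trigs_linear: "f \<in> trigs ==> g \<in> trigs ==> (%t. a * f t + b * g t) \<in> trigs"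
proof -
 assume "f \<in> trigs" "g \<in> trigs"
 then have "a \<cdot> f + b \<cdot> g \<in> trigs" by (intro span_add span_scale)
 then show ?thesis by (simp add: plus_fun_def scaleR_fun_def)
qed

lemma trig_mult: "(%t. trig i t * trig j t) \<in> trigs"
proof -
 let ?n = "int (deg i)" and ?m = "int (deg j)"
 note c = cos_sin_int_trigs
 have 1: "(%t. cos (real (deg i) * t) * cos (real (deg j) * t)) = (%t. (1/2) * cos (real_of_int (?n - ?m) * t) + (1/2) * cos (real_of_int (?n + ?m) * t))"
  by (simp only: cos_times_cos) (simp add: algebra_simps add_divide_distrib)
 have 2: "(%t. sin (real (deg i) * t) * sin (real (deg j) * t)) = (%t. (1/2) * cos (real_of_int (?n - ?m) * t) + (-1/2) * cos (real_of_int (?n + ?m) * t))"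
  by (simp only: sin_times_sin) (simp add: algebra_simps diff_divide_distrib)
 have 3: "(%t. sin (real (deg i) * t) * cos (real (deg j) * t)) = (%t. (1/2) * sin (real_of_int (?n + ?m) * t) + (1/2) * sin (real_of_int (?n - ?m) * t))"
  by (simp only: sin_times_cos) (simp add: algebra_simps add_divide_distrib)
 have 4: "(%t. cos (real (deg i) * t) * sin (real (deg j) * t)) = (%t. (1/2) * sin (real_of_int (?n + ?m) * t) + (-1/2) * sin (real_of_int (?n - ?m) * t))"
  by (simp only: cos_times_sin) (simp add: algebra_simps diff_divide_distrib)
 have "(%t. (if even i then cos (real (deg i) * t) else sin (real (deg i) * t)) * (if even j then cos (real (deg j) * t) else sin (real (deg j) * t))) \<in> trigs"
  by (cases "even i"; cases "even j"; simp only: if_True if_False 1 2 3 4; intro trigs_linear c)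
 from span_scale[OF this, of "nrm i * nrm j"] show ?thesis
  by (simp add: trig_def scaleR_fun_def mult_ac)
qed

lemma trigs_mult: assumes "f \<in> trigs" "g \<in> trigs" shows "(%t. f t * g t) \<in> trigs"
proof -
 have 1: "(%t. trig i t * g t) \<in> trigs" for i
  using assms(2)
 proof (induction rule: span_induct_alt)
  case base then show ?case using span_zero[of "range trig"] by (simp add: zero_fun_def)
 next
  case (step c x y)
  then obtain j where x: "x = trig j" by auto
  show ?case using trigs_linear[OF trig_mult[of i j] step(2), of c 1] by (simp add: x algebra_simps)
 qed
 show ?thesis using assms(1)
 proof (induction rule: span_induct_alt)
  case base then show ?case using span_zero[of "range trig"] by (simp add: zero_fun_def)
 next
  case (step c x y)
  then obtain j where x: "x = trig j" by auto
  show ?case using trigs_linear[OF 1[of j] step(2), of c 1] by (simp add: x algebra_simps)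
 qed
qed

text \<open>Stone-Weierstrass on the unit circle, for the algebra of continuous functions that are
  trigonometric polynomials of the angle. It contains the two coordinates, which separate
  points.\<close>

lemma trig_approximation:
 assumes "continuous_on UNIV (f :: real^2 => real)" "e > 0"
 shows "\<exists>K a. \<forall>t. \<bar>f (cc 1 t) - (\<Sum>i<K. a i * trig i t)\<bar> < e"
proof -
 define R where "R = {g. continuous_on (sphere 0 1 :: (real^2) set) g \<and> (%t. g (cc 1 t)) \<in> trigs}"
 have coord: "(%z. z $ 1) \<in> R" "(%z. z $ 2) \<in> R"
  using cos_sin_trigs[of 1] by (auto simp: R_def intro!: continuous_intros)
 interpret function_ring_on R "sphere 0 1"
 proof
  fix f g assume f: "f \<in> R" and g: "g \<in> R"
  then show "(%x. f x + g x) \<in> R" "(%x. f x * g x) \<in> R"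
   using trigs_linear[of "%t. f (cc 1 t)" "%t. g (cc 1 t)" 1 1]
    trigs_mult[of "%t. f (cc 1 t)" "%t. g (cc 1 t)"]
   by (auto simp: R_def intro!: continuous_intros)
 next
  show "(%_. c) \<in> R" for c
   using trigs_linear[OF cos_sin_trigs(1)[of 0] cos_sin_trigs(1)[of 0], of c 0] by (simp add: R_def)
 next
  fix x y :: "real^2" assume "x ~= y"
  then have "x $ 1 ~= y $ 1 \<or> x $ 2 ~= y $ 2" by (auto simp: vec_eq_iff forall_2)
  then show "\<exists>f\<in>R. f x ~= f y"
  proof
   show "x $ 1 ~= y $ 1 ==> ?thesis" by (rule bexI[OF _ coord(1)])
   show "x $ 2 ~= y $ 2 ==> ?thesis" by (rule bexI[OF _ coord(2)])
  qed
 qed (auto simp: R_def)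
 obtain g where g: "g \<in> R" "!!x. x \<in> sphere 0 1 ==> \<bar>f x - g x\<bar> < e"
  using Stone_Weierstrass_basic[OF continuous_on_subset[OF assms(1)] assms(2)] by blast
 obtain K a where eq: "(%t. g (cc 1 t)) = (\<Sum>i<K. a i \<cdot> trig i)"
  using span_sum_nat[of "%t. g (cc 1 t)" trig] g(1) by (auto simp: R_def)
 have "g (cc 1 t) = (\<Sum>i<K. a i * trig i t)" for t
  using fun_cong[OF eq, of t] by (simp add: sum_fun_apply)
 then have "\<bar>f (cc 1 t) - (\<Sum>i<K. a i * trig i t)\<bar> < e" for t
  using g(2)[of "cc 1 t"] by simp
 then show ?thesis by blast
qed

lemma fst_sum: "fst (\<Sum>i\<in>I. f i) = (\<Sum>i\<in>I. fst (f i))" and snd_sum: "snd (\<Sum>i\<in>I. f i) = (\<Sum>i\<in>I. snd (f i))"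
 for f :: "'i => 'a::ab_group_add \<times> 'b::ab_group_add"
 by (induction I rule: infinite_finite_induct) auto

lemma hh_T3: "open U ==> hh i \<in> T3 U" using hh_SM SM_T3 by blast

lemma sum_hh_SM: "(\<Sum>i<K. a i \<cdot> hh i) \<in> SM"
 by (intro subspace_sum SM_subspace subspace_scale[OF SM_subspace] hh_SM)

text \<open>Completing the square: the last sum is the excess over the best approximation by
  combinations of the \<open>hh i\<close> in the boundary norm.\<close>

lemma BB_sum_hh: assumes "s \<in> T3 U" "open U"
 shows "B2 (s - (\<Sum>i<K. a i \<cdot> hh i)) = B2 s - (\<Sum>i<K. (BB s (hh i))^2) + (\<Sum>i<K. (a i - BB s (hh i))^2)"
proof -
 let ?h = "\<Sum>i<K. a i \<cdot> hh i"
 note sb = psd_symbil[OF BB_psd, of U]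
 have hT: "?h \<in> T3 U" using sum_hh_SM SM_T3[OF assms(2)] by auto
 have "BB s ?h = (\<Sum>i<K. a i * BB s (hh i))"
  by (rule symbil_sum2[OF T3_subspace sb hh_T3 assms(1)]) (rule assms)
 moreover have "B2 ?h = (\<Sum>i<K. (a i)^2)"
 proof -
  have "B2 ?h = (\<Sum>i<K. a i * BB (hh i) ?h)"
   by (rule symbil_sum[OF T3_subspace sb hh_T3 hT]) (rule assms)
  also have "... = (\<Sum>i<K. (a i)^2)"
  proof (rule sum.cong)
   fix i assume i: "i \<in> {..<K}"
   have "BB (hh i) ?h = (\<Sum>j<K. a j * BB (hh i) (hh j))"
    by (rule symbil_sum2[OF T3_subspace sb hh_T3 hh_T3]) (rule assms)+
   also have "... = (\<Sum>j<K. if j = i then a i else 0)" by (rule sum.cong) (auto simp: BB_hh_hh)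
   finally show "a i * BB (hh i) ?h = (a i)^2" using i by (simp add: power2_eq_square)
  qed simp
  finally show ?thesis .
 qed
 ultimately show ?thesis
  unfolding symbil_diff_sq[OF T3_subspace sb assms(1) hT]
  by (simp add: power2_diff sum.distrib sum_subtractf sum_distrib_left algebra_simps)
qed

text \<open>Among combinations of the first \<open>K\<close> functions the Fourier sum is the best
  in the boundary norm, so it does at least as well as a uniform approximation; a uniform error
  \<open>d\<close> costs at most \<open>2 * pi * d^2 = e\<close>.\<close>

lemma Parseval:
 assumes C1: "C1c \<phi> D\<phi>" and s: "s = (\<phi>, D\<phi>, \<phi>)" and e: "e > 0"
 shows "\<exists>K. B2 s - (\<Sum>i<K. (BB s (hh i))^2) <= e"
proof -
 have sT: "s \<in> T3 disk" using C1 s SM_T3[of disk] by (auto simp: SM_def)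
 define d where "d = sqrt (e / (2 * pi))"
 have d: "d > 0" "d^2 * (2 * pi) = e" using e by (auto simp: d_def)
 obtain K a where a: "!!t. \<bar>\<phi> (cc 1 t) - (\<Sum>i<K. a i * trig i t)\<bar> < d"
  using trig_approximation[OF C1_continuous(1)[OF C1] d(1)] by blast
 let ?x = "s - (\<Sum>i<K. a i \<cdot> hh i)"
 have "?x \<in> SM" using sum_hh_SM C1 s subspace_diff[OF SM_subspace] by (auto simp: SM_def)
 then obtain \<psi> D\<psi> where x: "?x = (\<psi>, D\<psi>, \<psi>)" "C1c \<psi> D\<psi>" by (auto simp: SM_def)
 note m [measurable] = C1_measurable(1)[OF x(2)]
 have \<psi>: "\<psi> (cc 1 t) = \<phi> (cc 1 t) - (\<Sum>i<K. a i * trig i t)" for t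
 proof -
  have "\<psi> z = fst ?x z" for z unfolding x by simp
  then show ?thesis by (simp add: s fst_sum sum_fun_apply hh_def cutoff_disk hfun_circle)
 qed
 have "B2 ?x = (\<integral>t. \<psi> (cc 1 t) * \<psi> (cc 1 t) \<partial>ang)"
  unfolding x BB_def by (simp add: integral_circ)
 also have "... <= (\<integral>t. d^2 \<partial>ang)"
 proof (rule integral_mono)
  show "integrable ang (%t. \<psi> (cc 1 t) * \<psi> (cc 1 t))" "integrable ang (%t. d^2)"
   by (intro ang_integrable continuous_intros continuous_on_compose2[OF C1_continuous(1)[OF x(2), of UNIV]]; simp)+
  fix t
  have "\<bar>\<psi> (cc 1 t)\<bar> <= \<bar>d\<bar>" using a[of t] \<psi>[of t] d by simp
  then show "\<psi> (cc 1 t) * \<psi> (cc 1 t) <= d^2"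
   by (simp add: abs_le_square_iff power2_eq_square)
 qed
 also have "... = e"
  using integral_cos_int[of 0] d(2) by (simp add: mult.commute)
 finally have "B2 ?x <= e" .
 moreover have "B2 ?x >= B2 s - (\<Sum>i<K. (BB s (hh i))^2)"
  unfolding BB_sum_hh[OF sT open_ball] by (simp add: sum_nonneg)
 ultimately show ?thesis by (intro exI[of _ K]) linarith
qed

text \<open>By Green's formula the \<open>hh i\<close> are orthogonal in energy, with squares
  \<open>deg i\<close>. The inequality says that the distance of \<open>s\<close> from its Fourier
  sum has nonnegative energy.\<close>

lemma Bessel_energy:
 assumes C1: "C1c \<phi> D\<phi>" and s: "s = (\<phi>, D\<phi>, \<phi>)"
 shows "(\<Sum>i<K. real (deg i) * (BB s (hh i))^2) <= ED s"
proof -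
 let ?h = "\<Sum>i<K. BB s (hh i) \<cdot> hh i"
 note sb = psd_symbil[OF EE_psd, of disk]
 have sT: "s \<in> T3 disk" using C1 s SM_T3[of disk] by (auto simp: SM_def)
 have hT: "?h \<in> T3 disk" "hh i \<in> T3 disk" for i using sum_hh_SM SM_T3[of disk] hh_T3 by auto
 have "EE disk s ?h = (\<Sum>i<K. BB s (hh i) * EE disk s (hh i))"
  by (rule symbil_sum2[OF T3_subspace sb hT(2) sT])
 then have 1: "EE disk s ?h = (\<Sum>i<K. real (deg i) * (BB s (hh i))^2)"
  using Green[OF C1] by (simp add: s[symmetric] power2_eq_square mult_ac)
 have gh: "EE disk (hh j) (hh i) = real (deg i) * BB (hh j) (hh i)" for i j
  using Green[OF hh_C1[of j], of i] by (simp add: hh_def[symmetric])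
 have "ED ?h = (\<Sum>i<K. BB s (hh i) * EE disk (hh i) ?h)"
  by (rule symbil_sum[OF T3_subspace sb hT(2) hT(1)])
 also have "... = (\<Sum>i<K. real (deg i) * (BB s (hh i))^2)"
 proof (rule sum.cong)
  fix i assume i: "i \<in> {..<K}"
  have "EE disk (hh i) ?h = (\<Sum>j<K. BB s (hh j) * EE disk (hh i) (hh j))"
   by (rule symbil_sum2[OF T3_subspace sb hT(2) hT(2)])
  also have "... = (\<Sum>j<K. if j = i then BB s (hh i) * real (deg i) else 0)"
   by (rule sum.cong) (auto simp: gh BB_hh_hh)
  finally show "BB s (hh i) * EE disk (hh i) ?h = real (deg i) * (BB s (hh i))^2"
   using i by (simp add: power2_eq_square)
 qed simp
 finally have 2: "ED ?h = (\<Sum>i<K. real (deg i) * (BB s (hh i))^2)" .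
 have "0 <= ED (s - ?h)" by (intro psd_nonneg[OF EE_psd] subspace_diff[OF T3_subspace] sT hT)
 then show ?thesis unfolding symbil_diff_sq[OF T3_subspace sb sT hT(1)] 1 2 by simp
qed

text \<open>Every index from \<open>2m + 1\<close> on has degree at least \<open>m + 1\<close>, so
  these Fourier coefficients are paid for by the energy divided by \<open>m + 1\<close>; Parseval's
  equation shows that nothing else contributes to the trace.\<close>

theorem Steklov:
 assumes "x \<in> HH disk"
 shows "B2 x <= (\<Sum>i<2*m+1. (BB x (hh i))^2) + ED x / real (m + 1)"
proof -
 have smooth: "B2 s <= (\<Sum>i<2*m+1. (BB s (hh i))^2) + ED s / real (m + 1)"
  if C1: "C1c \<phi> D\<phi>" and s: "s = (\<phi>, D\<phi>, \<phi>)" for s \<phi> D\<phi>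
 proof (rule field_le_epsilon)
  fix e :: real assume "e > 0"
  then obtain K where K: "B2 s - (\<Sum>i<K. (BB s (hh i))^2) <= e" using Parseval[OF C1 s] by blast
  let ?c = "%i. (BB s (hh i))^2"
  define L where "L = max K (2*m+1)"
  have "(\<Sum>i<K. ?c i) <= (\<Sum>i<L. ?c i)" by (rule sum_mono2) (auto simp: L_def)
  also have "(\<Sum>i<L. ?c i) <= (\<Sum>i<2*m+1. ?c i) + (\<Sum>i<L. real (deg i) * ?c i) / real (m + 1)"
  proof -
   have "?c i <= (if i < 2*m+1 then ?c i else 0) + real (deg i) * ?c i / real (m + 1)" for i
   proof (cases "i < 2*m+1")
    case False
    then have "m + 1 <= deg i" unfolding deg_def by linarith
    then have "real (m + 1) * ?c i <= real (deg i) * ?c i" by (intro mult_right_mono) (auto simp del: of_nat_add)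
    then show ?thesis using False by (simp add: field_simps)
   qed simp
   then have "(\<Sum>i<L. ?c i) <= (\<Sum>i<L. (if i < 2*m+1 then ?c i else 0) + real (deg i) * ?c i / real (m + 1))"
    by (intro sum_mono)
   also have "... = (\<Sum>i<L. (if i < 2*m+1 then ?c i else 0)) + (\<Sum>i<L. real (deg i) * ?c i) / real (m + 1)"
    by (simp add: sum.distrib sum_divide_distrib)
   also have "(\<Sum>i<L. (if i < 2*m+1 then ?c i else 0)) = (\<Sum>i<2*m+1. ?c i)"
    by (rule sum.mono_neutral_cong_right) (auto simp: L_def)
   finally show ?thesis .
  qed
  also have "(\<Sum>i<L. real (deg i) * ?c i) / real (m + 1) <= ED s / real (m + 1)"
   by (intro divide_right_mono Bessel_energy[OF C1 s]) simp
  finally show "B2 s <= (\<Sum>i<2*m+1. ?c i) + ED s / real (m + 1) + e" using K by linarith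
 qed
 obtain s where sn: "!!n. s n \<in> SM" "(%n. ND (s n - x)) ----> 0"
  using HH_seq[OF open_ball assms] by blast
 have T: "s n \<in> T3 disk" "x \<in> T3 disk" for n using sn(1) SM_T3[of disk] assms HH_T3[of disk] by auto
 note l = NN_tendsto[OF open_ball T sn(2)]
 have "(%n. B2 (s n)) ----> B2 x" by (rule l)
 moreover have "(%n. (\<Sum>i<2*m+1. (BB (s n) (hh i))^2) + ED (s n) / real (m + 1)) ---->
   (\<Sum>i<2*m+1. (BB x (hh i))^2) + ED x / real (m + 1)"
  by (intro tendsto_intros l hh_T3 open_ball) simp
 moreover have "B2 (s n) <= (\<Sum>i<2*m+1. (BB (s n) (hh i))^2) + ED (s n) / real (m + 1)" for n
  using sn(1)[of n] smooth by (auto simp: SM_def)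
 ultimately show ?thesis by (meson LIMSEQ_le)
qed

lemma form_hh:
 "EE disk (hh i) (hh j) = (if i = j then real (deg i) else 0)"
 using Green[OF hh_C1[of i], of j] by (simp add: hh_def[symmetric] BB_hh_hh)

section \<open>Compactness\<close>

text \<open>The diagonal argument in topological form: a countable product of compact intervals is
  sequentially compact.\<close>

lemma pointwise_subsequence:
 fixes y :: "nat => 'i::countable => real"
 assumes "!!i n. \<bar>y n i\<bar> <= C i"
 shows "\<exists>r l. strict_mono (r :: nat => nat) \<and> (\<forall>i. (%n. y (r n) i) ----> l i)"
proof -
 define S where "S = PiE UNIV (%i. {- C i .. C i})"
 have "compactin (product_topology (%i::'i. euclidean :: real topology) UNIV) S"
  unfolding S_def by (subst compactin_PiE) auto
 then have "compact S" by (simp add: euclidean_product_topology)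
 then have "seq_compact S" by (rule compact_imp_seq_compact)
 moreover have "\<forall>n. y n \<in> S" using assms by (auto simp: S_def abs_le_iff) (smt (verit))
 ultimately obtain l r where r: "strict_mono (r :: nat => nat)" "(y \<circ> r) ----> l"
  unfolding seq_compact_def by blast
 have "(%n. y (r n) i) ----> l i" for i
 proof -
  have "isCont (%x. x i) l"
   by (metis UNIV_I continuous_on_eq_continuous_at continuous_on_product_coordinates open_UNIV)
  from isCont_tendsto_compose[OF this r(2)] show ?thesis by (simp add: o_def)
 qed
 then show ?thesis using r by blast
qed

text \<open>A compactness criterion. If, up to an arbitrarily small multiple of the norm, a form is
  controlled by finitely many of countably many functionals, then a subsequence along which all
  functionals converge is Cauchy for the form.\<close>

lemma form_Cauchy_from_functionals:
 fixes l :: "'i::countable => 'v::real_vector => real"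
 assumes V: "subspace V" and N: "psd V N" and x: "!!n. x n \<in> V" "!!n. N (x n) (x n) <= C"
  and lin: "!!i a b. a \<in> V ==> b \<in> V ==> l i (a - b) = l i a - l i b"
  and bd: "!!i n. \<bar>l i (x n)\<bar> <= D i"
  and K: "!!\<epsilon>. \<epsilon> > 0 ==> \<exists>I. finite I \<and> (\<forall>v\<in>V. K v v <= (\<Sum>i\<in>I. (l i v)^2) + \<epsilon> * N v v)"
 shows "\<exists>r. strict_mono (r :: nat => nat) \<and> form_Cauchy K (x \<circ> r)"
proof -
 obtain r L where r: "strict_mono (r :: nat => nat)" "!!i. (%n. l i (x (r n))) ----> L i"
  using pointwise_subsequence[of "%n i. l i (x n)" D] bd by blast
 have "form_Cauchy K (x \<circ> r)"
  unfolding form_Cauchy_def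
 proof (intro allI impI)
  fix e :: real assume e: "e > 0"
  \<comment> \<open>\<open>C'\<close> bounds the norm of the difference of two members of the
    sequence, the summand 1 keeping it positive. Functionals and norm each receive half of
    \<open>e\<close>.\<close>
  define C' where "C' = 4 * \<bar>C\<bar> + 1"
  have C': "C' > 0" by (simp add: C'_def)
  obtain I where I: "finite I" "!!v. v \<in> V ==> K v v <= (\<Sum>i\<in>I. (l i v)^2) + (e / (2 * C')) * N v v"
   using K[of "e / (2 * C')"] e C' by auto
  define d where "d = sqrt (e / (2 * (real (card I) + 1)))"
  have d: "d > 0" using e by (simp add: d_def)
  have "\<exists>k. \<forall>i\<in>I. \<forall>m\<ge>k. \<forall>n\<ge>k. \<bar>l i (x (r m)) - l i (x (r n))\<bar> < d"
  proof -
   have "\<forall>i. \<exists>k. \<forall>m\<ge>k. \<forall>n\<ge>k. norm (l i (x (r m)) - l i (x (r n))) < d"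
    using LIMSEQ_imp_Cauchy[OF r(2)] d by (auto simp: Cauchy_iff)
   then obtain k where k: "!!i m n. m >= k i ==> n >= k i ==> norm (l i (x (r m)) - l i (x (r n))) < d" by metis
   have "k i <= Max (insert 0 (k ` I))" if "i \<in> I" for i using that I by (intro Max_ge) auto
   then show ?thesis using k by (intro exI[of _ "Max (insert 0 (k ` I))"]) (force intro: order_trans)
  qed
  then obtain k where k: "!!i m n. i \<in> I ==> m >= k ==> n >= k ==> \<bar>l i (x (r m)) - l i (x (r n))\<bar> < d" by blast
  show "\<exists>K'. \<forall>i\<ge>K'. \<forall>j\<ge>K'. K ((x \<circ> r) i - (x \<circ> r) j) ((x \<circ> r) i - (x \<circ> r) j) < e"
  proof (intro exI[of _ k] allI impI)
   fix m n assume mn: "k <= m" "k <= n"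
   let ?v = "x (r m) - x (r n)"
   have vV: "?v \<in> V" using x V by (auto intro: subspace_diff)
   have "N ?v ?v <= 2 * N (x (r m)) (x (r m)) + 2 * N (x (r n)) (x (r n))"
    by (rule psd_diff_bound[OF V N x(1) x(1)])
   also have "... <= C'" using x(2)[of "r m"] x(2)[of "r n"] unfolding C'_def by linarith
   finally have "(e / (2 * C')) * N ?v ?v <= (e / (2 * C')) * C'" using e C' by (intro mult_left_mono) auto
   then have 1: "(e / (2 * C')) * N ?v ?v <= e / 2" using C' by simp
   have "(\<Sum>i\<in>I. (l i ?v)^2) <= (\<Sum>i\<in>I. d^2)"
   proof (rule sum_mono)
    fix i assume "i \<in> I"
    from k[OF this mn] have "\<bar>l i ?v\<bar> <= \<bar>d\<bar>" using d by (simp add: lin x)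
    then show "(l i ?v)^2 <= d^2" by (simp only: abs_le_square_iff)
   qed
   also have "... = real (card I) * (e / (2 * (real (card I) + 1)))" using e by (simp add: d_def)
   also have "... < e / 2" using e by (simp add: field_simps)
   finally show "K ((x \<circ> r) m - (x \<circ> r) n) ((x \<circ> r) m - (x \<circ> r) n) < e"
    using I(2)[OF vV] 1 unfolding o_apply by linarith
  qed
 qed
 then show ?thesis using r by blast
qed

lemma form_Cauchy_subseq:
 assumes "form_Cauchy q x" "strict_mono r" shows "form_Cauchy q (x \<circ> r)"
 unfolding form_Cauchy_def
proof (intro allI impI)
 fix e :: real assume "e > 0"
 then obtain K where "\<forall>i\<ge>K. \<forall>j\<ge>K. q (x i - x j) (x i - x j) < e" using assms(1) by (auto simp: form_Cauchy_def)
 then show "\<exists>K. \<forall>i\<ge>K. \<forall>j\<ge>K. q ((x \<circ> r) i - (x \<circ> r) j) ((x \<circ> r) i - (x \<circ> r) j) < e"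
  using seq_suble[OF assms(2)] by (intro exI[of _ K]) (auto intro: order_trans)
qed

lemma HH_psd:
 assumes "open U"
 shows "psd (HH U) (EE U)" "psd (HH U) BB" "psd (HH U) (NN U)" "weight w U ==> psd (HH U) (MM w U)"
 using EE_psd[of U] BB_psd[of U] NN_psd[OF assms] MM_psd[of w U] assms HH_T3[of U] symbil_subset[OF _ HH_T3]
 unfolding psd_def by blast+

text \<open>Steklov's inequality is precisely the hypothesis of the criterion: the functionals are
  the Fourier coefficients of the trace, and the remainder has the factor
  \<open>1 / (m + 1)\<close>.\<close>

lemma BB_compact_disk:
 assumes x: "!!n. x n \<in> HH disk" "!!n. ND (x n) <= C"
 shows "\<exists>r. strict_mono (r :: nat => nat) \<and> form_Cauchy BB (x \<circ> r)"
proof (rule form_Cauchy_from_functionals[where l = "%i v. BB v (hh i)" and D = "%i. sqrt \<bar>C\<bar>" and N = "NN disk" and C = C])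
 show "subspace (HH disk)" by (rule HH_subspace) simp
 show "psd (HH disk) (NN disk)" by (rule HH_psd) simp
 show "x n \<in> HH disk" "ND (x n) <= C" for n by (rule x)+
 have hH: "hh i \<in> HH disk" for i using hh_SM SM_HH[of disk] by auto
 note pB = HH_psd(2)[OF open_ball, of 0 1] and sV = HH_subspace[OF open_ball, of 0 1]
 show "BB (a - b) (hh i) = BB a (hh i) - BB b (hh i)" if "a \<in> HH disk" "b \<in> HH disk" for i a b
  using that by (intro symbil_diff[OF sV psd_symbil[OF pB]] hH)
 show "\<bar>BB (x n) (hh i)\<bar> <= sqrt \<bar>C\<bar>" for i n
 proof -
  have "(BB (x n) (hh i))^2 <= B2 (x n) * B2 (hh i)" by (rule psd_Cauchy_Schwarz[OF sV pB x(1) hH])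
  also have "... <= ND (x n)" using NN_parts(5)[OF open_ball, of "x n"] x(1) HH_T3[of disk] by (auto simp: BB_hh_hh)
  also have "... <= \<bar>C\<bar>" using x(2)[of n] by linarith
  finally show ?thesis by (rule real_le_rsqrt[of "\<bar>_\<bar>", unfolded power2_abs])
 qed
 fix \<epsilon> :: real assume e: "\<epsilon> > 0"
 obtain m where m: "1 / real (Suc m) < \<epsilon>" using nat_approx_posE[OF e] by auto
 have "B2 v <= (\<Sum>i<2*m+1. (BB v (hh i))^2) + \<epsilon> * ND v" if v: "v \<in> HH disk" for v
 proof -
  have vT: "v \<in> T3 disk" using v HH_T3[of disk] by auto
  have "ED v / real (m + 1) <= \<epsilon> * ND v"
  proof -
   have "ED v / real (m + 1) = (1 / real (Suc m)) * ED v" by simp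
   also have "... <= \<epsilon> * ND v"
    using m e NN_parts(1,4)[OF open_ball vT] by (intro mult_mono) auto
   finally show ?thesis .
  qed
  then show ?thesis using Steklov[OF v, of m] by linarith
 qed
 then show "\<exists>I. finite I \<and> (\<forall>v\<in>HH disk. B2 v <= (\<Sum>i\<in>I. (BB v (hh i))^2) + \<epsilon> * ND v)"
  by (intro exI[of _ "{..<2*m+1}"]) auto
qed

section \<open>Rellich compactness by restriction to concentric circles\<close>

lemma antiderivative_real:
 assumes "continuous_on UNIV (f :: real => real)"
 shows "\<exists>F. \<forall>x. (F has_real_derivative f x) (at x)"
proof -
 have "\<exists>F. \<forall>x. - \<infinity> < ereal x --> ereal x < \<infinity> --> (F has_vector_derivative f x) (at x)"
  using assms by (intro einterval_antiderivative) (auto simp: continuous_on_eq_continuous_at)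
 then show ?thesis by (auto simp: has_real_derivative_iff_has_vector_derivative)
qed

text \<open>Comparison with the values at the points of a grid, by means of the sawtooth function that equals
 \<open>r\<^sup>2 - (i/n)\<^sup>2\<close> between the grid points \<open>i/n\<close> and \<open>(i+1)/n\<close>.\<close>

lemma sawtooth:
 fixes u u' e :: "real => real"
 assumes u: "!!r. (u has_real_derivative u' r) (at r)" and cont: "continuous_on UNIV u'" "continuous_on UNIV e"
  and e: "!!r. (u' r)^2 <= e r" and n: "n >= 1"
 shows "(I01 (%r. r * (u r)^2)) <=
   (\<Sum>i<n. (u (real (Suc i) / real n))^2) / 2 + (I01 (%r. r * ((u r)^2 + e r))) / real n"
proof -
 have cu: "continuous_on UNIV u" using u by (meson DERIV_isCont continuous_at_imp_continuous_on)
 obtain A where A: "!!r. (A has_real_derivative r * (u r)^2) (at r)"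
 proof -
  have "continuous_on UNIV (%r. r * (u r)^2)" by (intro continuous_intros cu)
  from antiderivative_real[OF this] show ?thesis using that by blast
 qed
 obtain P where P: "!!r. (P has_real_derivative r * ((u r)^2 + e r)) (at r)"
 proof -
  have "continuous_on UNIV (%r. r * ((u r)^2 + e r))" by (intro continuous_intros cu cont)
  from antiderivative_real[OF this] show ?thesis using that by blast
 qed
 have iA: "(I01 (%r. r * (u r)^2)) = A 1 - A 0"
  by (rule integral_FTC_Icc_real) (use A cu in \<open>auto simp: continuous_on_eq_continuous_at intro!: continuous_intros\<close>)
 have iP: "(I01 (%r. r * ((u r)^2 + e r))) = P 1 - P 0"
  by (rule integral_FTC_Icc_real) (use P cu cont in \<open>auto simp: continuous_on_eq_continuous_at intro!: continuous_intros\<close>)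
 have step: "A (real (Suc i) / real n) - A (real i / real n) <=
   (u (real (Suc i) / real n))^2 / 2 + (P (real (Suc i) / real n) - P (real i / real n)) / real n" if i: "i < n" for i
 proof -
  define a b where "a = real i / real n" and "b = real (Suc i) / real n"
  have ab: "0 <= a" "a <= b" "b <= 1" "b - a = 1 / real n" using i n by (auto simp: a_def b_def field_simps)
  \<comment> \<open>That \<open>D\<close> decreases on a cell is the desired inequality in
    integrated form: the sawtooth vanishes at \<open>a\<close>, is at most \<open>2 * r / n\<close>
    inside and at most 1 at \<open>b\<close>.\<close>
  define D where "D r = A r - P r / real n - (r^2 - a^2) * (u r)^2 / 2" for r
  have "D b <= D a"
  proof (rule DERIV_nonpos_imp_nonincreasing[OF ab(2)])
   fix r assume r: "a <= r" "r <= b"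
   have "(D has_real_derivative r * (u r)^2 - r * ((u r)^2 + e r) / real n - (2 * r * (u r)^2 + 2 * u r * u' r * (r^2 - a^2)) / 2) (at r)"
    using n unfolding D_def by (auto intro!: derivative_eq_intros A P u)
   moreover have "r * (u r)^2 - r * ((u r)^2 + e r) / real n - (2 * r * (u r)^2 + 2 * u r * u' r * (r^2 - a^2)) / 2 <= 0"
   proof -
    have ra: "0 <= r^2 - a^2" "r^2 - a^2 <= 2 * r / real n"
    proof -
     have "r^2 - a^2 = (r - a) * (r + a)" by (simp add: power2_eq_square algebra_simps)
     moreover have "(r - a) * (r + a) <= (1 / real n) * (2 * r)" using r ab by (intro mult_mono) auto
     ultimately show "0 <= r^2 - a^2" "r^2 - a^2 <= 2 * r / real n" using r ab by (auto simp: mult_ac)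
    qed
    have "- (u r * u' r) * (r^2 - a^2) <= (((u r)^2 + e r) / 2) * (r^2 - a^2)"
    proof (rule mult_right_mono[OF _ ra(1)])
     have "0 <= (u r + u' r)^2" by simp
     then show "- (u r * u' r) <= ((u r)^2 + e r) / 2" using e[of r] by (simp add: power2_sum)
    qed
    also have "... <= (((u r)^2 + e r) / 2) * (2 * r / real n)"
     using e[of r] order_trans[OF zero_le_power2 e[of r]] by (intro mult_left_mono ra) auto
    also have "... = r * ((u r)^2 + e r) / real n" by simp
    finally have "- (u r * u' r * (r^2 - a^2)) <= r * ((u r)^2 + e r) / real n" by simp
    moreover have "(2 * r * (u r)^2 + 2 * u r * u' r * (r^2 - a^2)) / 2 = r * (u r)^2 + u r * u' r * (r^2 - a^2)"
     by (simp add: add_divide_distrib mult.assoc)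
    ultimately show ?thesis by linarith
   qed
   ultimately show "\<exists>y. (D has_real_derivative y) (at r) \<and> y <= 0" by blast
  qed
  moreover have "(b^2 - a^2) * (u b)^2 <= 1 * (u b)^2"
  proof (rule mult_right_mono)
   have "b^2 <= 1" using ab by (simp add: power_le_one)
   then show "b^2 - a^2 <= 1" using zero_le_power2[of a] by linarith
  qed simp
  ultimately show ?thesis unfolding D_def a_def[symmetric] b_def[symmetric] by (simp add: diff_divide_distrib)
 qed
 have "A 1 - A 0 = (\<Sum>i<n. A (real (Suc i) / real n) - A (real i / real n))"
  using n by (subst sum_lessThan_telescope[of "%i. A (real i / real n)"]) simp
 also have "... <= (\<Sum>i<n. (u (real (Suc i) / real n))^2 / 2 + (P (real (Suc i) / real n) - P (real i / real n)) / real n)"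
  by (intro sum_mono step) auto
 also have "... = (\<Sum>i<n. (u (real (Suc i) / real n))^2) / 2 + (\<Sum>i<n. P (real (Suc i) / real n) - P (real i / real n)) / real n"
  by (simp add: sum.distrib sum_divide_distrib)
 also have "(\<Sum>i<n. P (real (Suc i) / real n) - P (real i / real n)) = P 1 - P 0"
  using n by (subst sum_lessThan_telescope[of "%i. P (real i / real n)"]) simp
 finally show ?thesis unfolding iA iP .
qed

text \<open>Turns restriction to the circle of radius \<open>\<rho>\<close> into the trace of a
  dilated function, to which Steklov's inequality applies.\<close>

definition scl :: "real => triple => triple" where
 "scl \<rho> x = ((%z. fst x (\<rho> \<cdot> z)), (%z. \<rho> \<cdot> fst (snd x) (\<rho> \<cdot> z)), (%z. fst x (\<rho> \<cdot> z)))"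

lemma scl_C1:
 assumes "C1c \<phi> D\<phi>" "\<rho> > 0"
 shows "C1c (%z. \<phi> (\<rho> \<cdot> z)) (%z. \<rho> \<cdot> D\<phi> (\<rho> \<cdot> z))"
 unfolding C1_compact_support_def
proof (intro conjI allI)
 fix z :: "real^2"
 have "((%z. \<rho> \<cdot> z) has_derivative (%h. \<rho> \<cdot> h)) (at z)" by (auto intro!: derivative_eq_intros)
 moreover have "(\<phi> has_derivative (%h. h \<bullet> D\<phi> (\<rho> \<cdot> z))) (at (\<rho> \<cdot> z))"
  using assms(1) by (simp add: C1_compact_support_def gderiv_def)
 ultimately have "((%z. \<phi> (\<rho> \<cdot> z)) has_derivative (%h. (\<rho> \<cdot> h) \<bullet> D\<phi> (\<rho> \<cdot> z))) (at z)"
  by (rule has_derivative_compose)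
 then show "GDERIV (%z. \<phi> (\<rho> \<cdot> z)) z :> \<rho> \<cdot> D\<phi> (\<rho> \<cdot> z)" by (simp add: gderiv_def)
next
 show "continuous_on UNIV (%z. \<rho> \<cdot> D\<phi> (\<rho> \<cdot> z))"
  by (intro continuous_intros continuous_on_compose2[OF C1_continuous(2)[OF assms(1), of UNIV]]) auto
 obtain R where R: "!!x. norm x > R ==> \<phi> x = 0" using GDERIV_compact_support_zero[OF assms(1)] by blast
 have "norm x <= R / \<rho>" if "\<phi> (\<rho> \<cdot> x) ~= 0" for x
  using R[of "\<rho> \<cdot> x"] that assms(2) by (force simp: field_simps not_less)
 then show "bounded {z. \<phi> (\<rho> \<cdot> z) ~= 0}" unfolding bounded_iff by blast
qed

lemma nn_integral_scale:
 fixes f :: "real^2 => ennreal"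
 assumes [measurable]: "f \<in> meas borel" and "\<rho> > 0"
 shows "(\<integral>\<^sup>+z. f z \<partial>lborel) = ennreal (\<rho>^2) * (\<integral>\<^sup>+z. f (\<rho> \<cdot> z) \<partial>lborel)"
proof -
 have "\<rho> ~= 0" using assms by simp
 from lborel_affine[OF this, of "0::real^2"]
 have "(lborel :: (real^2) measure) = density (distr lborel borel (%x. \<rho> \<cdot> x)) (%_. ennreal (\<rho>^2))"
  using assms(2) by simp
 then have "(\<integral>\<^sup>+z. f z \<partial>lborel) = (\<integral>\<^sup>+z. f z \<partial>density (distr lborel borel (%x. \<rho> \<cdot> x)) (%_. ennreal (\<rho>^2)))" by simp
 also have "... = ennreal (\<rho>^2) * (\<integral>\<^sup>+z. f (\<rho> \<cdot> z) \<partial>lborel)"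
  by (simp add: nn_integral_density nn_integral_distr nn_integral_cmult)
 finally show ?thesis .
qed

lemma integral_scale_le:
 fixes f :: "real^2 => real"
 assumes [measurable]: "f \<in> meas borel" and f: "!!z. 0 <= f z" "integrable (leb disk) f" and \<rho>: "0 < \<rho>" "\<rho> <= 1"
 shows "\<rho>^2 * (\<integral>z. f (\<rho> \<cdot> z) \<partial>leb disk) <= (\<integral>z. f z \<partial>leb disk)"
proof -
 have [measurable]: "disk \<in> sets borel" by simp
 have m: "f \<in> meas (leb disk)" "(%z. f (\<rho> \<cdot> z)) \<in> meas (leb disk)"
  by (auto intro!: measurable_restrict_space1)
 have fin: "(\<integral>\<^sup>+z. f z \<partial>leb disk) = ennreal (\<integral>z. f z \<partial>leb disk)" using f by (intro nn_integral_eq_integral) auto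
 have "ennreal (\<rho>^2) * (\<integral>\<^sup>+z. f (\<rho> \<cdot> z) \<partial>leb disk) = ennreal (\<rho>^2) * (\<integral>\<^sup>+z. f (\<rho> \<cdot> z) * indicator disk z \<partial>lborel)"
  by (subst nn_integral_restrict_space) (auto intro!: arg_cong2[where f = times] nn_integral_cong simp: indicator_def)
 also have "... = ennreal (\<rho>^2) * (\<integral>\<^sup>+z. f (\<rho> \<cdot> z) * indicator disk ((1/\<rho>) \<cdot> (\<rho> \<cdot> z)) \<partial>lborel)"
  using \<rho> by simp
 also have "... = (\<integral>\<^sup>+z. f z * indicator disk ((1/\<rho>) \<cdot> z) \<partial>lborel)"
  by (rule nn_integral_scale[symmetric, of "%z. f z * indicator disk ((1/\<rho>) \<cdot> z)"]) (use \<rho> in \<open>measurable\<close>)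
 also have "... <= (\<integral>\<^sup>+z. f z * indicator disk z \<partial>lborel)"
 proof (rule nn_integral_mono)
  fix z :: "real^2"
  have "norm z / \<rho> < 1 ==> norm z < 1" using \<rho> by (simp add: field_simps)
  then show "ennreal (f z * indicator disk ((1/\<rho>) \<cdot> z)) <= ennreal (f z * indicator disk z)"
   using \<rho> by (auto simp: indicator_def)
 qed
 also have "... = (\<integral>\<^sup>+z. f z \<partial>leb disk)"
  by (subst nn_integral_restrict_space) (auto intro!: nn_integral_cong simp: indicator_def)
 finally have le: "ennreal (\<rho>^2) * (\<integral>\<^sup>+z. f (\<rho> \<cdot> z) \<partial>leb disk) <= ennreal (\<integral>z. f z \<partial>leb disk)" unfolding fin .
 have "(\<integral>\<^sup>+z. f (\<rho> \<cdot> z) \<partial>leb disk) < \<infinity>"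
 proof (rule ccontr)
  assume "\<not> ?thesis"
  then have "(\<integral>\<^sup>+z. f (\<rho> \<cdot> z) \<partial>leb disk) = \<infinity>" by (metis infinity_ennreal_def not_top_less less_top)
  then show False using le \<rho> by (simp add: ennreal_mult_top top_unique)
 qed
 then have "integrable (leb disk) (%z. f (\<rho> \<cdot> z))" using m f by (intro integrableI_nonneg) auto
 then have "(\<integral>\<^sup>+z. f (\<rho> \<cdot> z) \<partial>leb disk) = ennreal (\<integral>z. f (\<rho> \<cdot> z) \<partial>leb disk)"
  using f by (intro nn_integral_eq_integral) auto
 with le have "ennreal (\<rho>^2 * (\<integral>z. f (\<rho> \<cdot> z) \<partial>leb disk)) <= ennreal (\<integral>z. f z \<partial>leb disk)"
  by (simp add: ennreal_mult')
 then show ?thesis using f by (simp add: ennreal_le_iff integral_nonneg_AE)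
qed

text \<open>The Dirichlet integral is scale invariant in dimension two, so the dilated function has
  the energy of \<open>s\<close> on a smaller disk; the mass acquires the factor
  \<open>1 / \<rho>^2\<close>.\<close>

lemma scl_bounds:
 assumes s: "s \<in> SM" and \<rho>: "0 < \<rho>" "\<rho> <= 1"
 shows "scl \<rho> s \<in> SM" "ED (scl \<rho> s) <= ED s" "\<rho>^2 * MD one (scl \<rho> s) <= MD one s"
proof -
 obtain \<phi> D\<phi> where C1: "C1c \<phi> D\<phi>" and s: "s = (\<phi>, D\<phi>, \<phi>)" using s by (auto simp: SM_def)
 show "scl \<rho> s \<in> SM" unfolding SM_def scl_def s using scl_C1[OF C1 \<rho>(1)] by auto
 note [measurable] = C1_measurable[OF C1]
 have w: "integrable (leb disk) (%z. 1 * (\<phi> z)^2)" using SM_integrable(2)[OF C1 open_ball weight_one] by simp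
 have "ED (scl \<rho> s) = \<rho>^2 * (\<integral>z. (norm (D\<phi> (\<rho> \<cdot> z)))^2 \<partial>leb disk)"
  unfolding power2_norm_eq_inner by (simp add: EE_def scl_def s power2_eq_square mult.assoc)
 also have "... <= (\<integral>z. (norm (D\<phi> z))^2 \<partial>leb disk)"
  by (rule integral_scale_le[OF _ _ SM_integrable(1)[OF C1 open_ball] \<rho>]) auto
 finally show "ED (scl \<rho> s) <= ED s" by (simp add: EE_def s power2_norm_eq_inner)
 have "\<rho>^2 * MD one (scl \<rho> s) = \<rho>^2 * (\<integral>z. (\<phi> (\<rho> \<cdot> z))^2 \<partial>leb disk)"
  by (simp add: MM_def scl_def s power2_eq_square)
 also have "... <= (\<integral>z. (\<phi> z)^2 \<partial>leb disk)"
  by (rule integral_scale_le[OF _ _ _ \<rho>]) (use w in auto)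
 finally show "\<rho>^2 * MD one (scl \<rho> s) <= MD one s" by (simp add: MM_def s power2_eq_square)
qed

text \<open>The sawtooth estimate integrated over the angle: the mass is controlled by the traces on
  \<open>n\<close> concentric circles up to an error of relative size \<open>1 / n\<close>.\<close>

lemma mass_grid:
 assumes s: "s \<in> SM" and n: "n >= 1"
 shows "MD one s <= (\<Sum>i<n. B2 (scl (real (Suc i) / real n) s)) / 2
   + (MD one s + ED s) / real n"
proof -
 obtain \<phi> D\<phi> where C1: "C1c \<phi> D\<phi>" and s: "s = (\<phi>, D\<phi>, \<phi>)" using s by (auto simp: SM_def)
 obtain C where C: "!!z. \<bar>\<phi> z\<bar> <= C" "!!z. norm (D\<phi> z) <= C" using C1_bounded[OF C1] by blast
 note [measurable] = C1_measurable[OF C1]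
 note cp = C1_continuous[OF C1, of UNIV]
 have C2: "(\<phi> z)^2 <= C^2" "(norm (D\<phi> z))^2 <= C^2" for z
  using power_mono[OF C(1)[of z] abs_ge_zero, of 2] power_mono[OF C(2)[of z] norm_ge_zero, of 2] by simp_all
 define f where "f z = (\<phi> z)^2 + (norm (D\<phi> z))^2" for z
 have fm [measurable]: "f \<in> meas borel" unfolding f_def by measurable
 note p1 = integral_ball_polar[of "%z. (\<phi> z)^2" "C^2"] and p2 = integral_ball_polar[of f "2 * C^2"]
 have b1: "\<bar>(\<phi> z)^2\<bar> <= C^2" "\<bar>f z\<bar> <= 2 * C^2" for z using C2[of z] by (auto simp: f_def)
 let ?r = "%i. real (Suc i) / real n"
 have iB: "integrable ang (%t. (\<phi> (cc (?r i) t))^2)" for i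
  by (intro ang_integrable continuous_intros continuous_on_compose2[OF cp(1)]) auto
 have "MD one s = (\<integral>z. (\<phi> z)^2 \<partial>leb disk)" by (simp add: MM_def s power2_eq_square)
 also have "... = (\<integral>t. (I01 (%r. r * (\<phi> (cc r t))^2)) \<partial>ang)"
  by (rule p1) (use b1 in auto)
 also have "... <= (\<integral>t. (\<Sum>i<n. (\<phi> (cc (?r i) t))^2) / 2 + (I01 (%r. r * f (cc r t))) / real n \<partial>ang)"
 proof (rule integral_mono)
  show "integrable ang (%t. \<integral>r. r * (\<phi> (cc r t))^2 * indicator {0..1} r \<partial>lborel)"
   by (rule p1) (use b1 in auto)
  show "integrable ang (%t. (\<Sum>i<n. (\<phi> (cc (?r i) t))^2) / 2 + (I01 (%r. r * f (cc r t))) / real n)"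
   using p2(2) b1 iB by (intro Bochner_Integration.integrable_add integrable_divide Bochner_Integration.integrable_sum) auto
  fix t
  show "(I01 (%r. r * (\<phi> (cc r t))^2)) <=
    (\<Sum>i<n. (\<phi> (cc (?r i) t))^2) / 2 + (I01 (%r. r * f (cc r t))) / real n"
   unfolding f_def
  proof (rule sawtooth[OF C1_radial_derivative[OF C1] _ _ _ n])
   show "continuous_on UNIV (%r. cc 1 t \<bullet> D\<phi> (cc r t))" "continuous_on UNIV (%r. (norm (D\<phi> (cc r t)))^2)"
    by (intro continuous_intros continuous_on_compose2[OF cp(2)]; simp)+
   fix r
   have "\<bar>cc 1 t \<bullet> D\<phi> (cc r t)\<bar> <= norm (cc 1 t) * norm (D\<phi> (cc r t))" by (rule Cauchy_Schwarz_ineq2)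
   then show "(cc 1 t \<bullet> D\<phi> (cc r t))^2 <= (norm (D\<phi> (cc r t)))^2"
    by (simp add: abs_le_square_iff[symmetric])
  qed
 qed
 also have "... = (\<Sum>i<n. \<integral>t. (\<phi> (cc (?r i) t))^2 \<partial>ang) / 2 + (\<integral>t. (I01 (%r. r * f (cc r t))) \<partial>ang) / real n"
  using p2(2) b1 iB by (subst Bochner_Integration.integral_add) (auto intro!: Bochner_Integration.integrable_sum)
 also have "(\<integral>t. (I01 (%r. r * f (cc r t))) \<partial>ang) = (\<integral>z. f z \<partial>leb disk)"
  by (rule p2(1)[symmetric]) (use b1 in auto)
 also have "... = MD one s + ED s"
  unfolding f_def using SM_integrable(1)[OF C1 open_ball] SM_integrable(2)[OF C1 open_ball weight_one]
  by (subst Bochner_Integration.integral_add) (auto simp: MM_def EE_def s power2_norm_eq_inner power2_eq_square[of "\<phi> _"])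
 finally have le: "MD one s <= (\<Sum>i<n. \<integral>t. (\<phi> (cc (?r i) t))^2 \<partial>ang) / 2
   + (MD one s + ED s) / real n" .
 have Bi: "(\<integral>t. (\<phi> (cc (?r i) t))^2 \<partial>ang) = B2 (scl (?r i) s)" for i
 proof -
  have c: "cc (?r i) t = ?r i \<cdot> cc 1 t" for t by (simp add: vec_eq_iff forall_2)
  have "B2 (scl (?r i) s) = (\<integral>z. \<phi> (?r i \<cdot> z) * \<phi> (?r i \<cdot> z) \<partial>circ_measure)"
   by (simp add: BB_def scl_def s)
  also have "... = (\<integral>t. (\<phi> (cc (?r i) t))^2 \<partial>ang)"
   unfolding c by (subst integral_circ) (measurable, simp add: power2_eq_square)
  finally show ?thesis ..
 qed
 show ?thesis using le unfolding Bi .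
qed

text \<open>Rellich's theorem for smooth triples: \<open>mass_grid\<close> reduces the mass to
  finitely many circles, and Steklov's inequality reduces each circle to finitely many Fourier
  coefficients. These coefficients, for all rational radii, are the functionals of the
  criterion.\<close>

lemma MM_compact_smooth:
 assumes x: "!!n. x n \<in> SM" "!!n. ND (x n) <= C"
 shows "\<exists>r. strict_mono (r :: nat => nat) \<and> form_Cauchy (MM one disk) (x \<circ> r)"
proof -
 \<comment> \<open>Encoding of the functionals by triples of naturals: the first two entries give a
   rational radius in the interval from 0 to 1, the third the Fourier index. The triple
   \<open>(n - i, i, j)\<close> has radius \<open>(i + 1) / (n + 1)\<close>.\<close>
 define rho :: "nat \<times> nat \<times> nat => real" where "rho p = real (Suc (fst (snd p))) / real (Suc (fst p + fst (snd p)))" for p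
 let ?l = "%p v. BB (scl (rho p) v) (hh (snd (snd p)))"
 have \<rho>: "0 < rho p" "rho p <= 1" for p by (auto simp: rho_def)
 have SMd: "SM \<subseteq> T3 disk" by (rule SM_T3) simp
 show ?thesis
 proof (rule form_Cauchy_from_functionals[where l = ?l and D = "%p. sqrt ((1 + 3 / (rho p)^2) * \<bar>C\<bar>)" and N = "NN disk" and C = C and V = SM])
  show "subspace SM" by (rule SM_subspace)
  show "psd SM (NN disk)" using NN_psd[of disk] symbil_subset[OF _ SMd] SMd unfolding psd_def by auto
  show "x n \<in> SM" "ND (x n) <= C" for n by (rule x)+
  show "?l p (a - b) = ?l p a - ?l p b" if "a \<in> SM" "b \<in> SM" for p a b
  proof -
   have "scl (rho p) (a - b) = scl (rho p) a - scl (rho p) b" by (simp add: scl_def fun_eq_iff scaleR_diff_right)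
   moreover have "scl (rho p) a \<in> T3 disk" "scl (rho p) b \<in> T3 disk" "hh (snd (snd p)) \<in> T3 disk"
    using scl_bounds(1)[OF that(1) \<rho>] scl_bounds(1)[OF that(2) \<rho>] SMd hh_SM by blast+
   ultimately show ?thesis
    using symbil_diff[OF T3_subspace psd_symbil[OF BB_psd], of "scl (rho p) a" disk "scl (rho p) b" "hh (snd (snd p))"] by simp
  qed
  show "\<bar>?l p (x n)\<bar> <= sqrt ((1 + 3 / (rho p)^2) * \<bar>C\<bar>)" for p n
  proof -
   let ?y = "scl (rho p) (x n)"
   note sb = scl_bounds[OF x(1)[of n] \<rho>[of p]]
   have yT: "?y \<in> T3 disk" "x n \<in> T3 disk" using sb(1) x(1) SMd by auto
   note pn = NN_parts[OF open_ball yT(2)]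
   have "(?l p (x n))^2 <= B2 ?y * B2 (hh (snd (snd p)))"
    using yT hh_SM SMd by (intro psd_Cauchy_Schwarz[OF T3_subspace BB_psd]) auto
   also have "... = B2 ?y" by (simp add: BB_hh_hh)
   also have "... <= 1 * ED ?y + (2 + 1/1) * MD one ?y"
    using sb(1) SM_HH[of disk] by (intro trace_epsilon) auto
   also have "MD one ?y <= MD one (x n) / (rho p)^2"
    using sb(3) \<rho>(1)[of p] by (simp add: pos_le_divide_eq mult.commute del: of_nat_Suc)
   also have "1 * ED ?y + (2 + 1/1) * (MD one (x n) / (rho p)^2) <= \<bar>C\<bar> + (3 / (rho p)^2) * \<bar>C\<bar>"
   proof -
    have a: "ED ?y <= \<bar>C\<bar>" "MD one (x n) <= \<bar>C\<bar>" using sb(2) pn x(2)[of n] by linarith+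
    have "(3 / (rho p)^2) * MD one (x n) <= (3 / (rho p)^2) * \<bar>C\<bar>" by (intro mult_left_mono a) simp
    then show ?thesis using a by (simp del: of_nat_Suc)
   qed
   finally have "\<bar>?l p (x n)\<bar>^2 <= (1 + 3 / (rho p)^2) * \<bar>C\<bar>" by (simp add: algebra_simps del: of_nat_Suc)
   then show ?thesis by (rule real_le_rsqrt)
  qed
  fix \<epsilon> :: real assume e: "\<epsilon> > 0"
  obtain n where n: "1 / real (Suc n) < \<epsilon> / 2" using nat_approx_posE[of "\<epsilon> / 2"] e by auto
  define N where "N = Suc n"
  obtain m where m: "1 / real (Suc m) < \<epsilon> / real N" using nat_approx_posE[of "\<epsilon> / real N"] e by (auto simp: N_def)
  define I where "I = (%(i, j). (n - i, i, j)) ` ({..<N} \<times> {..<2*m+1})"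
  have "MD one v <= (\<Sum>p\<in>I. (?l p v)^2) + \<epsilon> * ND v" if v: "v \<in> SM" for v
  proof -
   have vT: "v \<in> T3 disk" using v SMd by auto
   note pn = NN_parts[OF open_ball vT]
   have r1: "0 < real (Suc i) / real N" "real (Suc i) / real N <= 1" if "i < N" for i using that by (auto simp: N_def)
   let ?s = "%i. scl (real (Suc i) / real N) v"
   have Bi: "B2 (?s i) <= (\<Sum>j<2*m+1. (BB (?s i) (hh j))^2) + (\<epsilon> / real N) * ED v" if "i < N" for i
   proof -
    note sb = scl_bounds[OF v r1[OF that]]
    have "B2 (?s i) <= (\<Sum>j<2*m+1. (BB (?s i) (hh j))^2) + ED (?s i) / real (m + 1)"
     using sb(1) SM_HH[of disk] by (intro Steklov) auto
    also have "ED (?s i) / real (m + 1) <= ED v / real (m + 1)" using sb(2) by (intro divide_right_mono) auto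
    also have "... = (1 / real (Suc m)) * ED v" by simp
    also have "... <= (\<epsilon> / real N) * ED v" using m pn by (intro mult_right_mono) auto
    finally show ?thesis by simp
   qed
   have "(\<Sum>i<N. B2 (?s i)) <= (\<Sum>i<N. (\<Sum>j<2*m+1. (BB (?s i) (hh j))^2) + (\<epsilon> / real N) * ED v)"
    by (intro sum_mono Bi) auto
   also have "... = (\<Sum>i<N. \<Sum>j<2*m+1. (BB (?s i) (hh j))^2) + \<epsilon> * ED v"
    by (simp add: sum.distrib N_def del: of_nat_Suc)
   also have "(\<Sum>i<N. \<Sum>j<2*m+1. (BB (?s i) (hh j))^2) = (\<Sum>p\<in>I. (?l p v)^2)"
   proof -
    have inj: "inj_on (%(i, j). (n - i, i, j)) ({..<N} \<times> {..<2*m+1})" by (auto simp: inj_on_def)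
    have "(\<Sum>p\<in>I. (?l p v)^2) = (\<Sum>(i,j)\<in>{..<N} \<times> {..<2*m+1}. (BB (?s i) (hh j))^2)"
     unfolding I_def sum.reindex[OF inj] by (rule sum.cong) (auto simp: N_def rho_def)
    then show ?thesis by (simp only: sum.cartesian_product)
   qed
   finally have S: "(\<Sum>i<N. B2 (?s i)) <= (\<Sum>p\<in>I. (?l p v)^2) + \<epsilon> * ED v" .
   have S0: "0 <= (\<Sum>p\<in>I. (?l p v)^2)" by (intro sum_nonneg) simp
   have "MD one v <= (\<Sum>i<N. B2 (?s i)) / 2 + (MD one v + ED v) / real N"
    by (rule mass_grid[OF v]) (simp add: N_def)
   also have "(MD one v + ED v) / real N = (1 / real N) * (MD one v + ED v)" by simp
   also have "... <= (\<epsilon> / 2) * (MD one v + ED v)"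
    using n pn by (intro mult_right_mono) (auto simp: N_def)
   finally have "MD one v <= (\<Sum>p\<in>I. (?l p v)^2) + \<epsilon> * ED v / 2 + \<epsilon> / 2 * (MD one v + ED v)"
    using S S0 by linarith
   also have "... <= (\<Sum>p\<in>I. (?l p v)^2) + \<epsilon> * ND v"
   proof -
    have "0 <= \<epsilon> * B2 v" "0 <= \<epsilon> * MD one v" using e pn by auto
    then show ?thesis by (simp add: NN_def algebra_simps)
   qed
   finally show ?thesis .
  qed
  then show "\<exists>I. finite I \<and> (\<forall>v\<in>SM. MD one v <= (\<Sum>p\<in>I. (?l p v)^2) + \<epsilon> * ND v)"
   by (intro exI[of _ I]) (auto simp: I_def)
 qed
qed

text \<open>Values on inner circles are available for smooth triples only, so the sequence is
  replaced by a smooth one whose distance from it tends to zero.\<close>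

lemma MM_compact_disk:
 assumes x: "!!n. x n \<in> HH disk" "!!n. ND (x n) <= C"
 shows "\<exists>r. strict_mono (r :: nat => nat) \<and> form_Cauchy (MM one disk) (x \<circ> r)"
proof -
 have "\<exists>s. \<forall>n. s n \<in> SM \<and> ND (x n - s n) < 1 / real (Suc n)"
 proof (intro choice allI)
  fix n
  have "(0::real) < 1 / real (Suc n)" by simp
  then show "\<exists>y. y \<in> SM \<and> ND (x n - y) < 1 / real (Suc n)"
   using x(1)[of n] unfolding HH_def by blast
 qed
 then obtain s where s: "!!n. s n \<in> SM" "!!n. ND (x n - s n) < 1 / real (Suc n)" by blast
 have T: "x n \<in> T3 disk" "s n \<in> T3 disk" "x n - s n \<in> T3 disk" for n
  using x(1)[of n] HH_T3[of disk] s(1)[of n] SM_T3[of disk] T3_subspace[of disk] by (auto intro: subspace_diff)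
 note pN = NN_psd[OF open_ball, of 0 1] and pM = MM_psd[OF weight_one open_ball, of 0 1]
 have "ND (s n) <= 2 * \<bar>C\<bar> + 2" for n
 proof -
  have "ND (x n - (x n - s n)) <= 2 * ND (x n) + 2 * ND (x n - s n)"
   by (rule psd_diff_bound[OF T3_subspace pN T(1) T(3)])
  moreover have "1 / real (Suc n) <= 1" by (simp only: divide_le_eq_1) simp
  ultimately have "ND (x n - (x n - s n)) <= 2 * \<bar>C\<bar> + 2"
   using x(2)[of n] s(2)[of n] by linarith
  then show ?thesis by simp
 qed
 from MM_compact_smooth[of s, OF s(1) this] obtain r where r: "strict_mono (r :: nat => nat)" "form_Cauchy (MM one disk) (s \<circ> r)" by blast
 have "form_Cauchy (MM one disk) (x \<circ> r)"
  unfolding form_Cauchy_def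
 proof (intro allI impI)
  fix e :: real assume e: "e > 0"
  obtain K1 where K1: "!!i j. i >= K1 ==> j >= K1 ==> MD one (s (r i) - s (r j)) < e / 4"
   using r(2)[unfolded form_Cauchy_def, rule_format, of "e / 4"] e by auto
  obtain K2 where K2: "1 / real (Suc K2) < e / 16" using nat_approx_posE[of "e / 16"] e by auto
  have small: "MD one (x (r i) - s (r i)) < e / 16" if "i >= K2" for i
  proof -
   have "K2 <= r i" using seq_suble[OF r(1), of i] that by linarith
   then have "1 / real (Suc (r i)) <= 1 / real (Suc K2)" by (simp add: frac_le)
   then show ?thesis using s(2)[of "r i"] K2 NN_parts(6)[OF open_ball T(3), of "r i"] by linarith
  qed
  show "\<exists>K. \<forall>i\<ge>K. \<forall>j\<ge>K. MD one ((x \<circ> r) i - (x \<circ> r) j) < e"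
  proof (intro exI[of _ "max K1 K2"] allI impI)
   fix i j assume ij: "max K1 K2 <= i" "max K1 K2 <= j"
   let ?a = "x (r i) - s (r i)" and ?b = "x (r j) - s (r j)" and ?c = "s (r i) - s (r j)"
   have TT: "?a \<in> T3 disk" "?b \<in> T3 disk" "?c \<in> T3 disk" "?a - ?b \<in> T3 disk" using T T3_subspace[of disk] by (auto intro!: subspace_diff)
   have "MD one (?c + (?a - ?b)) <= 2 * MD one ?c + 2 * MD one (?a - ?b)"
    by (rule psd_diff_bound[OF T3_subspace pM TT(3) TT(4)])
   also have "MD one (?a - ?b) <= 2 * MD one ?a + 2 * MD one ?b"
    by (rule psd_diff_bound[OF T3_subspace pM TT(1) TT(2)])
   finally have "MD one (?c + (?a - ?b)) < e"
    using K1[of i j] small[of i] small[of j] ij by simp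
   moreover have "?c + (?a - ?b) = x (r i) - x (r j)" by simp
   ultimately show "MD one ((x \<circ> r) i - (x \<circ> r) j) < e" by simp
  qed
 qed
 then show ?thesis using r by blast
qed

lemma form_Cauchy_mono:
 assumes "form_Cauchy q x" "!!i j. p (x i - x j) (x i - x j) <= c * q (x i - x j) (x i - x j)" "c > 0"
 shows "form_Cauchy p x"
 unfolding form_Cauchy_def
proof (intro allI impI)
 fix e :: real assume "e > 0"
 then have "e / c > 0" using assms(3) by simp
 then obtain K where K: "!!i j. i >= K ==> j >= K ==> q (x i - x j) (x i - x j) < e / c"
  using assms(1) unfolding form_Cauchy_def by blast
 have "p (x i - x j) (x i - x j) < e" if "i >= K" "j >= K" for i j
 proof -
  have "c * q (x i - x j) (x i - x j) < e" using K[OF that] assms(3) by (simp add: field_simps)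
  then show ?thesis using assms(2)[of i j] by linarith
 qed
 then show "\<exists>K. \<forall>i\<ge>K. \<forall>j\<ge>K. p (x i - x j) (x i - x j) < e" by blast
qed

text \<open>A weight between positive bounds gives an equivalent norm, so everything transfers from
  weight 1. On the disk the mass is compact as well, hence \<open>S0\<close> is the whole
  line.\<close>

lemma robin_form_disk:
 assumes w: "weight w disk" and c: "c > 0" "!!z. norm z < 1 ==> c <= w z" and \<alpha>: "\<alpha> ~= 0"
 shows "robin_form (HH disk) (EE disk) BB (MM w disk) \<alpha> UNIV"
proof
 have o: "open disk" by simp
 note HV = HH_subspace[OF o]
 obtain C where C: "C >= 0" "!!x. x \<in> T3 disk ==> MD w x <= C * MD one x" using MM_le_NN[OF o w] by blast
 have cM: "MD one x <= (1 / c) * MD w x" if x: "x \<in> T3 disk" for x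
 proof -
  have "MD (%z. c * one z) x <= MD w x"
   by (rule MM_mono[OF weight_cmult[OF weight_one] w o x]) (use c in auto)
  then have "c * MD one x <= MD w x" by (simp only: MM_cmult)
  then show ?thesis using c by (simp add: field_simps)
 qed
 show "subspace (HH disk)" "psd (HH disk) (EE disk)" "psd (HH disk) BB" "psd (HH disk) (MM w disk)" "\<alpha> ~= 0"
  using HV HH_psd[OF o] w \<alpha> by auto
 define m where "m = max 1 (1 / c)"
 have m: "m >= 1" "m >= 1 / c" by (auto simp: m_def)
 have Nm: "ND x <= m * (ED x + B2 x + MD w x)" if x: "x \<in> T3 disk" for x
 proof -
  note pn = NN_parts[OF o x]
  have w0: "0 <= MD w x" using psd_nonneg[OF MM_psd[OF w o] x] .
  have "1 * ED x <= m * ED x" "1 * B2 x <= m * B2 x" "(1 / c) * MD w x <= m * MD w x"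
   using m pn w0 by (intro mult_right_mono; simp)+
  then show ?thesis using cM[OF x] unfolding NN_def by (simp add: distrib_left)
 qed
 show "\<exists>z\<in>HH disk. (%n. ED (x n - z) + B2 (x n - z) + MD w (x n - z)) ----> 0"
  if x: "!!n. x n \<in> HH disk" and Ca: "form_Cauchy (%y z. EE disk y z + BB y z + MM w disk y z) x" for x
 proof -
  have T: "x i - x j \<in> T3 disk" for i j using subspace_diff[OF HV x x] HH_T3[of disk] by auto
  have "form_Cauchy (NN disk) x" by (rule form_Cauchy_mono[where c = m, OF Ca]) (use m Nm[OF T] in simp_all)
  from HH_complete[of _ x, OF o x this] obtain z where z: "z \<in> HH disk" and lim: "(%n. ND (x n - z)) ----> 0" by blast
  have T: "x n - z \<in> T3 disk" for n using subspace_diff[OF HV x z] HH_T3[of disk] by auto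
  have l: "(%n. (1 + C) * ND (x n - z)) ----> 0" using tendsto_mult_left[OF lim, of "1 + C"] by simp
  have "(%n. ED (x n - z) + B2 (x n - z) + MD w (x n - z)) ----> 0"
  proof (rule tendsto_sandwich[OF _ _ tendsto_const l]; intro always_eventually allI)
   fix n
   let ?d = "x n - z"
   note pn = NN_parts[OF o T, of n]
   have w0: "0 <= MD w ?d" using psd_nonneg[OF MM_psd[OF w o] T] .
   show "0 <= ED ?d + B2 ?d + MD w ?d" using pn w0 by simp
   have "0 <= C * ED ?d" "0 <= C * B2 ?d" using C pn by auto
   then show "ED ?d + B2 ?d + MD w ?d <= (1 + C) * ND ?d"
    using C(2)[OF T, of n] pn unfolding NN_def by (simp add: algebra_simps)
  qed
  then show ?thesis using z by blast
 qed
 show "\<exists>C. \<forall>x\<in>HH disk. \<bar>\<alpha>\<bar> * B2 x <= ED x / 2 + C * MD w x"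
 proof (intro exI ballI)
  fix x assume x: "x \<in> HH disk"
  have "B2 x <= (1 / (2 * \<bar>\<alpha>\<bar>)) * ED x + (2 + 1 / (1 / (2 * \<bar>\<alpha>\<bar>))) * MD one x"
   using \<alpha> by (intro trace_epsilon x) simp
  also have "... <= (1 / (2 * \<bar>\<alpha>\<bar>)) * ED x + (2 + 2 * \<bar>\<alpha>\<bar>) * ((1 / c) * MD w x)"
   using cM[of x] x HH_T3[of disk] by (intro add_mono mult_mono) (auto simp: NN_parts)
  finally have "\<bar>\<alpha>\<bar> * B2 x <= \<bar>\<alpha>\<bar> * ((1 / (2 * \<bar>\<alpha>\<bar>)) * ED x + (2 + 2 * \<bar>\<alpha>\<bar>) * ((1 / c) * MD w x))"
   by (intro mult_left_mono) auto
  also have "... = ED x / 2 + (\<bar>\<alpha>\<bar> * (2 + 2 * \<bar>\<alpha>\<bar>) / c) * MD w x"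
   using \<alpha> by (simp add: distrib_left)
  finally show "\<bar>\<alpha>\<bar> * B2 x <= ED x / 2 + (\<bar>\<alpha>\<bar> * (2 + 2 * \<bar>\<alpha>\<bar>) / c) * MD w x" .
 qed
 show "\<exists>r. strict_mono (r :: nat => nat) \<and> form_Cauchy BB (x \<circ> r) \<and> (\<mu> >= 0 --> form_Cauchy (MM w disk) (x \<circ> r))"
  if x: "!!n. x n \<in> HH disk" and bd: "!!n. ED (x n) + B2 (x n) + MD w (x n) <= D" for x D and \<mu> :: real
 proof -
  have T: "x n \<in> T3 disk" for n using x HH_T3[of disk] by auto
  have N: "ND (x n) <= m * D" for n
   using order_trans[OF Nm[OF T] mult_left_mono[OF bd]] m by simp
  obtain r where r: "strict_mono (r :: nat => nat)" "form_Cauchy BB (x \<circ> r)" using BB_compact_disk[of x, OF x N] by blast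
  obtain r' where r': "strict_mono (r' :: nat => nat)" "form_Cauchy (MM one disk) ((x \<circ> r) \<circ> r')"
   using MM_compact_disk[of "x \<circ> r" "m * D"] x N by auto
  have T2: "((x \<circ> r) \<circ> r') i - ((x \<circ> r) \<circ> r') j \<in> T3 disk" for i j using subspace_diff[OF T3_subspace T T] by simp
  have "form_Cauchy (MM w disk) ((x \<circ> r) \<circ> r')"
  proof (rule form_Cauchy_mono[OF r'(2), where c = "C + 1"])
   fix i j
   let ?d = "((x \<circ> r) \<circ> r') i - ((x \<circ> r) \<circ> r') j"
   show "MD w ?d <= (C + 1) * MD one ?d"
    using C(2)[OF T2, of i j] NN_parts(3)[OF o T2, of i j] by (simp add: distrib_right)
  qed (use C in simp)
  then show ?thesis using r r' form_Cauchy_subseq[OF r(2) r'(1)] strict_mono_o[OF r(1) r'(1)]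
   by (intro exI[of _ "r \<circ> r'"]) (auto simp: comp_assoc)
 qed
qed simp_all

section \<open>Passage to the unit disk\<close>

text \<open>The description of \<open>HH\<close> in the terms of the definition of
  \<open>H1\<close>, with nonnegative integrals. Square integrability of the limit is not
  presupposed there; it follows from that of the approximants.\<close>

lemma HH_iff_nn:
 assumes U: "open U"
 shows "(u, D, T) \<in> HH U \<longleftrightarrow> u \<in> meas (leb U) \<and> D \<in> meas (leb U) \<and> T \<in> meas circ_measure \<and>
  (\<exists>\<phi> D\<phi>. (\<forall>n::nat. C1c (\<phi> n) (D\<phi> n)) \<and>
   (%n. \<integral>\<^sup>+z. ennreal ((\<phi> n z - u z)^2) \<partial>leb U) ----> 0 \<and>
   (%n. \<integral>\<^sup>+z. ennreal ((norm (D\<phi> n z - D z))^2) \<partial>leb U) ----> 0 \<and>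
   (%n. \<integral>\<^sup>+z. ennreal ((\<phi> n z - T z)^2) \<partial>circ_measure) ----> 0)" (is "?l \<longleftrightarrow> ?m \<and> ?m2 \<and> ?m3 \<and> (\<exists>\<phi> D\<phi>. ?r \<phi> D\<phi>)")
proof
 assume l: ?l
 then have xT: "(u, D, T) \<in> T3 U" using HH_T3 by auto
 obtain s where s: "!!n. s n \<in> SM" "(%n. N2 U (s n - (u, D, T))) ----> 0"
  using HH_seq[OF U l] by blast
 have sT: "s n - (u, D, T) \<in> T3 U" for n using s(1) SM_T3[OF U] xT T3_subspace[of U] by (auto intro: subspace_diff)
 obtain \<phi> D\<phi> where \<phi>: "!!n. C1c (\<phi> n) (D\<phi> n)" "!!n. s n = (\<phi> n, D\<phi> n, \<phi> n)"
 proof -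
  have "\<forall>n. \<exists>p. C1c (fst p) (snd p) \<and> s n = (fst p, snd p, fst p)" using s(1) by (fastforce simp: SM_def)
  then obtain p where "!!n. C1c (fst (p n)) (snd (p n)) \<and> s n = (fst (p n), snd (p n), fst (p n))" by metis
  then show ?thesis using that[of "%n. fst (p n)" "%n. snd (p n)"] by blast
 qed
 have lim0: "(%n. ennreal (N2 U (s n - (u, D, T)))) ----> 0"
  using tendsto_ennrealI[OF s(2)] by simp
 note pn = NN_parts[OF U sT]
 have L: "(%z. \<phi> n z - u z) \<in> L2 (leb U)" "(%z. D\<phi> n z - D z) \<in> L2 (leb U)" "(%z. \<phi> n z - T z) \<in> L2 circ_measure" for n
  using sT[of n] \<phi>(2)[of n] by (auto simp: T3_def fun_diff_def)
 have e: "(\<integral>\<^sup>+z. ennreal ((\<phi> n z - u z)^2) \<partial>leb U) = ennreal (M2 one U (s n - (u, D, T)))"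
  "(\<integral>\<^sup>+z. ennreal ((norm (D\<phi> n z - D z))^2) \<partial>leb U) = ennreal (E2 U (s n - (u, D, T)))"
  "(\<integral>\<^sup>+z. ennreal ((\<phi> n z - T z)^2) \<partial>circ_measure) = ennreal (B2 (s n - (u, D, T)))" for n
  using L2_nn[OF L(1)[of n]] L2_nn[OF L(2)[of n]] L2_nn[OF L(3)[of n]]
  by (simp_all add: MM_def EE_def BB_def \<phi>(2) power2_eq_square[of "_ :: real"] dot_square_norm)
 have "?r \<phi> D\<phi>"
  unfolding e using \<phi>(1) pn
  by (intro conjI allI tendsto_sandwich[OF _ _ tendsto_const lim0]) (auto intro!: always_eventually ennreal_leI)
 moreover have "?m \<and> ?m2 \<and> ?m3" using xT by (auto simp: T3_def L2_def)
 ultimately show "?m \<and> ?m2 \<and> ?m3 \<and> (\<exists>\<phi> D\<phi>. ?r \<phi> D\<phi>)" by blast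
next
 assume r: "?m \<and> ?m2 \<and> ?m3 \<and> (\<exists>\<phi> D\<phi>. ?r \<phi> D\<phi>)"
 then obtain \<phi> D\<phi> where \<phi>: "!!n::nat. C1c (\<phi> n) (D\<phi> n)"
  and l: "(%n. \<integral>\<^sup>+z. ennreal ((\<phi> n z - u z)^2) \<partial>leb U) ----> 0"
   "(%n. \<integral>\<^sup>+z. ennreal ((norm (D\<phi> n z - D z))^2) \<partial>leb U) ----> 0"
   "(%n. \<integral>\<^sup>+z. ennreal ((\<phi> n z - T z)^2) \<partial>circ_measure) ----> 0" by blast
 define s where "s n = (\<phi> n, D\<phi> n, \<phi> n)" for n
 have sSM: "s n \<in> SM" for n using \<phi> by (auto simp: s_def SM_def)
 have sT: "s n \<in> T3 U" for n using sSM SM_T3[OF U] by blast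
 have \<phi>L: "\<phi> n \<in> L2 (leb U)" "D\<phi> n \<in> L2 (leb U)" "\<phi> n \<in> L2 circ_measure" for n using sT[of n] by (auto simp: s_def T3_def)
 have close: "\<exists>n. (u, D, T) \<in> T3 U \<and> N2 U ((u, D, T) - s n) < e" if e: "e > 0" for e
 proof -
  have e3: "0 < ennreal (e / 4)" using e by simp
  have "\<forall>\<^sub>F n in sequentially. (\<integral>\<^sup>+z. ennreal ((\<phi> n z - u z)^2) \<partial>leb U) < ennreal (e/4) \<and>
    (\<integral>\<^sup>+z. ennreal ((norm (D\<phi> n z - D z))^2) \<partial>leb U) < ennreal (e/4) \<and> (\<integral>\<^sup>+z. ennreal ((\<phi> n z - T z)^2) \<partial>circ_measure) < ennreal (e/4)"
   by (intro eventually_conj order_tendstoD(2)[OF l(1) e3] order_tendstoD(2)[OF l(2) e3] order_tendstoD(2)[OF l(3) e3])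
  then obtain n where n: "(\<integral>\<^sup>+z. ennreal ((\<phi> n z - u z)^2) \<partial>leb U) < ennreal (e/4)"
    "(\<integral>\<^sup>+z. ennreal ((norm (D\<phi> n z - D z))^2) \<partial>leb U) < ennreal (e/4)"
    "(\<integral>\<^sup>+z. ennreal ((\<phi> n z - T z)^2) \<partial>circ_measure) < ennreal (e/4)" by (auto simp: eventually_sequentially)
  have m: "(%z. \<phi> n z - u z) \<in> meas (leb U)" "(%z. D\<phi> n z - D z) \<in> meas (leb U)"
   "(%z. \<phi> n z - T z) \<in> meas circ_measure"
   using r \<phi>L[of n] by (auto simp: L2_def)
  have dL: "(%z. \<phi> n z - u z) \<in> L2 (leb U)" "(%z. D\<phi> n z - D z) \<in> L2 (leb U)" "(%z. \<phi> n z - T z) \<in> L2 circ_measure"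
   using n by (auto intro!: L2_nnI m) (auto intro: less_trans simp: less_top[symmetric])
  from L2_diff[OF \<phi>L(1)[of n] dL(1)] L2_diff[OF \<phi>L(2)[of n] dL(2)] L2_diff[OF \<phi>L(3)[of n] dL(3)]
  have xT: "(u, D, T) \<in> T3 U" by (simp add: T3_def)
  have "(\<integral>z. (\<phi> n z - u z)^2 \<partial>leb U) < e/4" "(\<integral>z. (norm (D\<phi> n z - D z))^2 \<partial>leb U) < e/4" "(\<integral>z. (\<phi> n z - T z)^2 \<partial>circ_measure) < e/4"
   using n e L2_nn[OF dL(1)] L2_nn[OF dL(2)] L2_nn[OF dL(3)] by (simp_all add: ennreal_less_iff)
  then have "N2 U (s n - (u, D, T)) < e"
   using e by (simp add: NN_def MM_def EE_def BB_def s_def power2_eq_square[of "_ :: real"] dot_square_norm)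
  moreover have "N2 U ((u, D, T) - s n) = N2 U (s n - (u, D, T))"
   using symbil_scale_sq[OF T3_subspace psd_symbil[OF NN_psd[OF U]], of "s n - (u, D, T)" "-1"] xT sT T3_subspace[of U]
   by (simp add: subspace_diff)
  ultimately show ?thesis using xT by (intro exI[of _ n]) simp
 qed
 show ?l unfolding HH_def using close[of 1] close sSM by force
qed

lemma det_mat_2: "det (mat c :: real^2^2) = c^2"
 by (simp add: det_2 mat_def power2_eq_square)

lemma matrix_inv_mat: assumes "c ~= 0" shows "matrix_inv (mat c :: real^2^2) = mat (1/c)"
proof -
 let ?A = "mat c :: real^2^2" and ?B = "mat (1/c) :: real^2^2"
 have 1: "?A ** ?B = mat 1" "?B ** ?A = mat 1"
  using assms by (auto simp: matrix_matrix_mult_def mat_def vec_eq_iff sum_2 forall_2)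
 have uniq: "X = ?B" if "?A ** X = mat 1" for X
 proof -
  have "X = (?B ** ?A) ** X" unfolding 1 by simp
  also have "... = ?B" unfolding matrix_mul_assoc[symmetric] that by simp
  finally show ?thesis .
 qed
 show ?thesis unfolding matrix_inv_def
 proof (rule some_equality)
  show "?A ** ?B = mat 1 \<and> ?B ** ?A = mat 1" using 1 ..
  show "X = ?B" if "?A ** X = mat 1 \<and> X ** ?A = mat 1" for X using uniq[OF that[THEN conjunct1]] .
 qed
qed

lemma mat_mult_vec: "(mat c :: real^2^2) *v x = c \<cdot> x"
 by (simp add: matrix_vector_mult_def mat_def vec_eq_iff sum_2 forall_2)

text \<open>A metric that is \<open>c\<close> times the Euclidean one, in a chart where the boundary
  is the circle of radius \<open>R\<close>; \<open>cR\<close> is the factor on that circle. The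
  reference domain \<open>U0\<close> is left open, so that the unit disk and its exterior are both
  covered, and the metric is prescribed only where it matters.\<close>

locale conformal_disk =
 fixes g :: "real^2 => real^2^2" and c :: "real^2 => real" and R :: real and U0 :: "(real^2) set" and cR c1 c2 :: real
 assumes g: "!!x. (1/R) \<cdot> x \<in> U0 ==> g x = mat (c x)" "!!t. g (cc R t) = mat cR"
  and cm [measurable]: "c \<in> meas borel" and cb: "!!x. (1/R) \<cdot> x \<in> U0 ==> c1 <= c x \<and> c x <= c2"
  and c1: "c1 > 0" and cR: "cR > 0" and R: "R > 0" and U0: "open U0"
begin

definition U where "U = {x. (1/R) \<cdot> x \<in> U0}"
abbreviation "area \<equiv> area_measure g U"
abbreviation "len \<equiv> length_measure g R"
definition w where "w z = R^2 * c (R \<cdot> z)"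
definition tr :: "(real^2 => real) => (real^2 => real^2) => (real^2 => real) => triple" where
 "tr u D T = ((%z. u (R \<cdot> z)), (%z. R \<cdot> D (R \<cdot> z)), (%z. T (R \<cdot> z)))"

lemma scale_measurable [measurable]: "(%z::real^2. r \<cdot> z) \<in> meas borel"
 by measurable

lemma U0_borel [measurable]: "U0 \<in> sets borel" using U0 by (rule borel_open)

lemma U_borel [measurable]: "U \<in> sets borel"
proof -
 have "U = (%x. (1/R) \<cdot> x) -` U0 \<inter> space borel" by (auto simp: U_def)
 also have "... \<in> sets borel" by (rule measurable_sets[OF scale_measurable U0_borel])
 finally show ?thesis .
qed

lemma scale_U: "R \<cdot> z \<in> U \<longleftrightarrow> z \<in> U0" using R by (simp add: U_def)

lemma w_measurable [measurable]: "w \<in> meas borel" unfolding w_def[abs_def] by measurable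

lemma w_bounds: assumes "z \<in> U0" shows "R^2 * c1 <= w z" "w z <= R^2 * c2"
 using cb[of "R \<cdot> z"] assms R by (auto simp: w_def)

lemma weight_w: "weight w U0"
proof -
 have "0 <= w z" if "z \<in> U0" for z using w_bounds[OF that] R c1 by (meson less_imp_le mult_pos_pos order_trans zero_less_power)
 then show ?thesis using w_bounds unfolding weight_def by auto
qed

lemma scale_measurable_U: "(%z. R \<cdot> z) \<in> measurable (leb U0) (restrict_space borel U)"
 using scale_U by (intro measurable_restrict_space2) (auto simp: space_restrict_space intro: measurable_restrict_space1)

lemma area_eq: "area = distr (density (leb U0) (%z. ennreal (w z))) (restrict_space borel U) (%z. R \<cdot> z)"
proof (rule measure_eqI)
 show "sets (area) = sets (distr (density (leb U0) (%z. ennreal (w z))) (restrict_space borel U) (%z. R \<cdot> z))"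
  by (simp add: area_measure_def sets_restrict_space)
 fix X assume "X \<in> sets (area)"
 then have X': "X \<in> sets (restrict_space borel U)" by (simp add: area_measure_def sets_restrict_space)
 then have X [measurable]: "X \<in> sets borel" and XU: "X \<subseteq> U" by (auto simp: sets_restrict_space)
 have "area = density (leb U) (%x. ennreal (c x))"
  unfolding area_measure_def
 proof (rule density_cong)
  have sq: "sqrt (det (g x)) = c x" if "x \<in> U" for x
   using that cb[of x] c1 unfolding g(1)[OF that[unfolded U_def, simplified]] det_mat_2 by (auto simp: U_def)
  have "(%x. ennreal (c x)) \<in> meas (leb U)" by (auto intro: measurable_restrict_space1)
  then show "(%x. ennreal (sqrt (det (g x)))) \<in> meas (leb U)"
   by (subst measurable_cong[where g = "%x. ennreal (c x)"]) (auto simp: space_restrict_space sq)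
  show "AE x in leb U. ennreal (sqrt (det (g x))) = ennreal (c x)" by (rule AE_I2) (simp add: space_restrict_space sq)
 qed (auto intro: measurable_restrict_space1)
 then have "emeasure (area) X = (\<integral>\<^sup>+x\<in>X. ennreal (c x) \<partial>leb U)"
  using X' by (simp, subst emeasure_density) (auto simp: sets_restrict_space intro: measurable_restrict_space1)
 also have "... = (\<integral>\<^sup>+x. ennreal (c x) * indicator X x \<partial>lborel)"
  using XU by (subst nn_integral_restrict_space) (auto intro!: nn_integral_cong simp: indicator_def)
 also have "... = ennreal (R^2) * (\<integral>\<^sup>+z. ennreal (c (R \<cdot> z)) * indicator X (R \<cdot> z) \<partial>lborel)"
  by (rule nn_integral_scale[OF _ R]) measurable
 also have "... = (\<integral>\<^sup>+z. ennreal (w z) * indicator X (R \<cdot> z) \<partial>lborel)"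
  by (subst nn_integral_cmult[symmetric]) (auto simp: w_def ennreal_mult' mult.assoc)
 also have "... = (\<integral>\<^sup>+z\<in>(%z. R \<cdot> z) -` X \<inter> U0. ennreal (w z) \<partial>leb U0)"
  using XU scale_U by (subst nn_integral_restrict_space) (auto intro!: nn_integral_cong simp: indicator_def)
 also have "... = emeasure (distr (density (leb U0) (%z. ennreal (w z))) (restrict_space borel U) (%z. R \<cdot> z)) X"
 proof -
  have S: "(%z. R \<cdot> z) -` X \<inter> U0 \<in> sets (leb U0)"
   using measurable_sets[OF scale_measurable_U X'] by (simp add: space_restrict_space)
  have "emeasure (density (leb U0) (%z. ennreal (w z))) ((%z. R \<cdot> z) -` X \<inter> U0) = (\<integral>\<^sup>+z\<in>(%z. R \<cdot> z) -` X \<inter> U0. ennreal (w z) \<partial>leb U0)"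
   by (rule emeasure_density[OF _ S]) (auto intro: measurable_restrict_space1)
  then show ?thesis using X' S scale_measurable_U
   by (subst emeasure_distr) (auto simp: space_restrict_space)
 qed
 finally show "emeasure (area) X = emeasure (distr (density (leb U0) (%z. ennreal (w z))) (restrict_space borel U) (%z. R \<cdot> z)) X" .
qed

lemma length_eq: "len = distr (density circ_measure (%_. ennreal (R * sqrt cR))) borel (%z. R \<cdot> z)"
proof -
 have v: "vector_derivative (cc R) (at t) = cc R (t + pi/2)" for t
 proof (rule vector_derivative_at)
  show "(cc R has_vector_derivative cc R (t + pi/2)) (at t)"
   unfolding has_vector_derivative_def
   by (rule has_derivative_vec2) (auto intro!: derivative_eq_intros simp: cos_add sin_add)
 qed
 have "len = distr (density ang (%t. ennreal (R * sqrt cR))) borel (cc R)"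
  unfolding length_measure_def Let_def v g(2) mat_mult_vec
  using R cR by (simp add: dot_square_norm real_sqrt_mult mult.commute)
 also have "... = distr (distr (density ang (%t. ennreal (R * sqrt cR))) borel (cc 1)) borel (%z. R \<cdot> z)"
 proof -
  have "cc R = (%z. R \<cdot> z) \<circ> cc 1" by (auto simp: fun_eq_iff vec_eq_iff forall_2)
  then show ?thesis by (subst distr_distr) (auto intro: measurable_restrict_space1)
 qed
 also have "distr (density ang (%t. ennreal (R * sqrt cR))) borel (cc 1) = density circ_measure (%_. ennreal (R * sqrt cR))"
  unfolding circ_measure_def by (rule density_distr[symmetric]) (auto intro: measurable_restrict_space1)
 finally show ?thesis .
qed

lemma comp_measurable_U:
 fixes f :: "real^2 => 'b::euclidean_space"
 shows "f \<in> meas (area) \<longleftrightarrow> (%z. f (R \<cdot> z)) \<in> meas (leb U0)"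
proof
 assume "f \<in> meas (area)"
 then have "f \<in> meas (restrict_space borel U)" by (simp add: area_eq)
 from measurable_compose[OF scale_measurable_U this] show "(%z. f (R \<cdot> z)) \<in> meas (leb U0)" .
next
 assume f: "(%z. f (R \<cdot> z)) \<in> meas (leb U0)"
 have "(%x. (1/R) \<cdot> x) \<in> measurable (restrict_space borel U) (leb U0)"
  by (intro measurable_restrict_space2) (auto simp: space_restrict_space U_def intro: measurable_restrict_space1)
 from measurable_compose[OF this f] show "f \<in> meas (area)"
  using R by (simp add: area_eq)
qed

lemma comp_measurable_circ:
 fixes f :: "real^2 => real"
 shows "f \<in> meas (len) \<longleftrightarrow> (%z. f (R \<cdot> z)) \<in> meas circ_measure"
proof -
 have "f \<in> meas borel \<longleftrightarrow> (%z. f (R \<cdot> z)) \<in> meas borel"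
 proof
  assume "(%z. f (R \<cdot> z)) \<in> meas borel"
  from measurable_compose[OF scale_measurable[of "1/R"] this] show "f \<in> meas borel" using R by simp
 qed (rule measurable_compose[OF scale_measurable])
 then show ?thesis by (simp add: length_eq circ_measure_def)
qed

lemma nn_area:
 assumes "f \<in> meas (area)"
 shows "(\<integral>\<^sup>+x. ennreal (f x) \<partial>area) = (\<integral>\<^sup>+z. ennreal (w z) * ennreal (f (R \<cdot> z)) \<partial>leb U0)"
proof -
 have f: "f \<in> meas (restrict_space borel U)" using assms by (simp add: area_eq)
 have f': "(%z. f (R \<cdot> z)) \<in> meas (leb U0)" using assms by (simp add: comp_measurable_U)
 have "w \<in> meas (leb U0)" by (auto intro: measurable_restrict_space1)
 then show ?thesis unfolding area_eq
  using f f' scale_measurable_U by (simp add: nn_integral_distr nn_integral_density)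
qed

lemma nn_circ:
 assumes "f \<in> meas (len)"
 shows "(\<integral>\<^sup>+x. ennreal (f x) \<partial>len) = ennreal (R * sqrt cR) * (\<integral>\<^sup>+z. ennreal (f (R \<cdot> z)) \<partial>circ_measure)"
proof -
 have f': "(%z. f (R \<cdot> z)) \<in> meas circ_measure" using assms by (simp add: comp_measurable_circ)
 have [measurable]: "f \<in> meas borel" using assms by (simp add: length_eq)
 show ?thesis unfolding length_eq
  using f' by (simp add: nn_integral_distr nn_integral_density nn_integral_cmult circ_measure_def)
qed

lemma integral_area:
 fixes f :: "real^2 => real"
 assumes "f \<in> meas (area)"
 shows "(\<integral>x. f x \<partial>area) = (\<integral>z. w z * f (R \<cdot> z) \<partial>leb U0)"
proof -
 have f: "f \<in> meas (restrict_space borel U)" using assms by (simp add: area_eq)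
 have f': "(%z. f (R \<cdot> z)) \<in> meas (leb U0)" using assms by (simp add: comp_measurable_U)
 have wm: "w \<in> meas (leb U0)" by (auto intro: measurable_restrict_space1)
 have w0: "AE z in leb U0. 0 <= w z" using weight_w by (intro AE_I2) (auto simp: space_restrict_space weight_def)
 have "(\<integral>x. f x \<partial>area) = (\<integral>z. f (R \<cdot> z) \<partial>density (leb U0) (%z. ennreal (w z)))"
  unfolding area_eq by (rule integral_distr) (use scale_measurable_U f in auto)
 also have "... = (\<integral>z. w z * f (R \<cdot> z) \<partial>leb U0)" by (rule integral_real_density[OF wm w0 f'])
 finally show ?thesis .
qed

lemma integral_length:
 fixes f :: "real^2 => real"
 assumes "f \<in> meas (len)"
 shows "(\<integral>x. f x \<partial>len) = R * sqrt cR * (\<integral>z. f (R \<cdot> z) \<partial>circ_measure)"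
proof -
 have [measurable]: "f \<in> meas borel" using assms by (simp add: length_eq)
 have f': "(%z. f (R \<cdot> z)) \<in> meas circ_measure" using assms by (simp add: comp_measurable_circ)
 have "(\<integral>x. f x \<partial>len) = (\<integral>z. f (R \<cdot> z) \<partial>density circ_measure (%_. ennreal (R * sqrt cR)))"
  unfolding length_eq by (rule integral_distr) (auto simp: circ_measure_def)
 also have "... = (\<integral>z. (R * sqrt cR) * f (R \<cdot> z) \<partial>circ_measure)"
  using f' R cR by (subst integral_density) auto
 finally show ?thesis by simp
qed

lemma cometric_eq: assumes "x \<in> U" shows "cometric g x D E = (D \<bullet> E) / c x"
proof -
 have "c x > 0" using cb[of x] c1 assms by (auto simp: U_def)
 then show ?thesis unfolding cometric_def using g(1)[of x] assms by (simp add: U_def matrix_inv_mat mat_mult_vec)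
qed

lemma cometric_measurable:
 assumes "D \<in> meas (area)" "E \<in> meas (area)"
 shows "(%x. cometric g x (D x) (E x)) \<in> meas (area)"
proof -
 have "(%x. (D x \<bullet> E x) / c x) \<in> meas (area)"
 proof (intro borel_measurable_divide borel_measurable_inner assms)
  show "c \<in> meas (area)" by (auto simp: area_eq intro: measurable_restrict_space1)
 qed
 then show ?thesis
  by (subst measurable_cong[where g = "%x. (D x \<bullet> E x) / c x"]) (auto simp: cometric_eq area_eq space_restrict_space)
qed

text \<open>Conformal invariance of the Dirichlet integral in dimension two: the factor
  \<open>c\<close> of the area cancels that of the inverse metric.\<close>

lemma w_cometric: assumes "z \<in> U0"
 shows "w z * cometric g (R \<cdot> z) D E = (R \<cdot> D) \<bullet> (R \<cdot> E)"
proof -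
 have "c (R \<cdot> z) > 0" using cb[of "R \<cdot> z"] c1 assms R by auto
 then show ?thesis using assms by (simp add: cometric_eq scale_U w_def power2_eq_square)
qed

text \<open>Dilation is a bijection of the test functions. It preserves the energy, multiplies the
  boundary integral by a constant, and changes the mass by a factor between positive bounds, so
  convergence to zero means the same on both sides.\<close>

lemma H1_iff: "H1 g U R u D T \<longleftrightarrow> tr u D T \<in> HH U0"
proof -
 have C1: "C1c \<phi> D\<phi> \<longleftrightarrow> C1c (%z. \<phi> (R \<cdot> z)) (%z. R \<cdot> D\<phi> (R \<cdot> z))" for \<phi> D\<phi>
 proof
  assume "C1c (%z. \<phi> (R \<cdot> z)) (%z. R \<cdot> D\<phi> (R \<cdot> z))"
  from scl_C1[OF this, of "1/R"] show "C1c \<phi> D\<phi>" using R by simp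
 qed (rule scl_C1[OF _ R])
 let ?A = "%f. \<integral>\<^sup>+x. ennreal (f x) \<partial>area" and ?L = "%f. \<integral>\<^sup>+x. ennreal (f x) \<partial>len"
 have mD: "(%z. R \<cdot> D (R \<cdot> z)) \<in> meas (leb U0) \<longleftrightarrow> (%z. D (R \<cdot> z)) \<in> meas (leb U0)"
 proof
  assume "(%z. R \<cdot> D (R \<cdot> z)) \<in> meas (leb U0)"
  then have "(%z. (1/R) \<cdot> R \<cdot> D (R \<cdot> z)) \<in> meas (leb U0)" by (rule borel_measurable_scaleR[OF borel_measurable_const])
  then show "(%z. D (R \<cdot> z)) \<in> meas (leb U0)" using R by simp
 qed auto
 have sand: "f ----> 0 \<longleftrightarrow> h ----> 0"
  if "!!n. ennreal a * h n <= f n" "!!n. f n <= ennreal b * h n" "a > 0" "b > 0" for f h :: "nat => ennreal" and a b :: real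
 proof
  assume "f ----> 0"
  then have l: "(%n. ennreal (1/a) * f n) ----> ennreal (1/a) * 0" by (intro ennreal_tendsto_cmult) auto
  have "h n <= ennreal (1/a) * f n" for n
  proof -
   have "h n = ennreal (1/a) * (ennreal a * h n)" using that(3) by (simp add: mult.assoc[symmetric] ennreal_mult''[symmetric])
   also have "... <= ennreal (1/a) * f n" by (intro mult_left_mono that) simp
   finally show ?thesis .
  qed
  with l show "h ----> 0" by (intro tendsto_sandwich[OF _ _ tendsto_const, of _ h]) auto
 next
  assume "h ----> 0"
  then have l: "(%n. ennreal b * h n) ----> ennreal b * 0" by (intro ennreal_tendsto_cmult) auto
  with that(2) show "f ----> 0" by (intro tendsto_sandwich[OF _ _ tendsto_const, of _ f]) auto
 qed
 let ?P = "%(\<phi> :: nat => _) D\<phi>. (%n. ?A (%x. (\<phi> n x - u x)^2)) ----> 0 \<and>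
   (%n. ?A (%x. cometric g x (D\<phi> n x - D x) (D\<phi> n x - D x))) ----> 0 \<and> (%n. ?L (%x. (\<phi> n x - T x)^2)) ----> 0"
  and ?P' = "%(\<phi> :: nat => _) D\<phi>. (%n. \<integral>\<^sup>+z. ennreal ((\<phi> n z - u (R \<cdot> z))^2) \<partial>leb U0) ----> 0 \<and>
   (%n. \<integral>\<^sup>+z. ennreal ((norm (D\<phi> n z - R \<cdot> D (R \<cdot> z)))^2) \<partial>leb U0) ----> 0 \<and>
   (%n. \<integral>\<^sup>+z. ennreal ((\<phi> n z - T (R \<cdot> z))^2) \<partial>circ_measure) ----> 0"
 have key: "?P \<phi> D\<phi> \<longleftrightarrow> ?P' (%n z. \<phi> n (R \<cdot> z)) (%n z. R \<cdot> D\<phi> n (R \<cdot> z))"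
  if m: "u \<in> meas (area)" "D \<in> meas (area)" "T \<in> meas (len)"
   and \<phi>: "!!n::nat. C1c (\<phi> n) (D\<phi> n)" for \<phi> D\<phi>
 proof (intro conj_cong)
  have \<phi>m: "\<phi> n \<in> meas (area)" "D\<phi> n \<in> meas (area)" "\<phi> n \<in> meas (len)" for n
   using C1_measurable[OF \<phi>] by (auto simp: area_eq length_eq intro: measurable_restrict_space1)
  let ?k = "%n z. ennreal ((\<phi> n (R \<cdot> z) - u (R \<cdot> z))^2)"
  have hm: "?k n \<in> meas (leb U0)" for n
   using m(1) \<phi>m(1)[of n] by (auto simp: comp_measurable_U)
  have e1: "?A (%x. (\<phi> n x - u x)^2) = (\<integral>\<^sup>+z. ennreal (w z) * ?k n z \<partial>leb U0)" for n
   by (rule nn_area) (use m \<phi>m in auto)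
  have wb: "w z <= R^2 * max c2 1" if "z \<in> U0" for z
   using order_trans[OF w_bounds(2)[OF that] mult_left_mono[of c2 "max c2 1" "R^2"]] by simp
  show "(%n. ?A (%x. (\<phi> n x - u x)^2)) ----> 0 \<longleftrightarrow> (%n. \<integral>\<^sup>+z. ?k n z \<partial>leb U0) ----> 0"
   by (rule sand[where a = "R^2 * c1" and b = "R^2 * max c2 1"], unfold e1 nn_integral_cmult[OF hm, symmetric])
     (use wb w_bounds R c1 in \<open>auto intro!: nn_integral_mono mult_right_mono ennreal_leI simp: space_restrict_space\<close>)
  have "?A (%x. cometric g x (D\<phi> n x - D x) (D\<phi> n x - D x)) = (\<integral>\<^sup>+z. ennreal ((norm (R \<cdot> D\<phi> n (R \<cdot> z) - R \<cdot> D (R \<cdot> z)))^2) \<partial>leb U0)" for n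
   using weight_w m \<phi>m by (subst nn_area, intro cometric_measurable, auto intro!: nn_integral_cong
    simp: space_restrict_space weight_def ennreal_mult'[symmetric] w_cometric dot_square_norm scaleR_diff_right[symmetric] simp del: inner_scaleR_left inner_scaleR_right)
  then show "(%n. ?A (%x. cometric g x (D\<phi> n x - D x) (D\<phi> n x - D x))) ----> 0 \<longleftrightarrow>
    (%n. \<integral>\<^sup>+z. ennreal ((norm (R \<cdot> D\<phi> n (R \<cdot> z) - R \<cdot> D (R \<cdot> z)))^2) \<partial>leb U0) ----> 0"
   by (simp only:)
  have "?L (%x. (\<phi> n x - T x)^2) = ennreal (R * sqrt cR) * (\<integral>\<^sup>+z. ennreal ((\<phi> n (R \<cdot> z) - T (R \<cdot> z))^2) \<partial>circ_measure)" for n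
   by (rule nn_circ) (use m \<phi>m in auto)
  then show "(%n. ?L (%x. (\<phi> n x - T x)^2)) ----> 0 \<longleftrightarrow> (%n. \<integral>\<^sup>+z. ennreal ((\<phi> n (R \<cdot> z) - T (R \<cdot> z))^2) \<partial>circ_measure) ----> 0"
   by (intro sand[where a = "R * sqrt cR" and b = "R * sqrt cR"]) (use R cR in auto)
 qed
 have ex: "(\<exists>\<phi> D\<phi>. (\<forall>n. C1c (\<phi> n) (D\<phi> n)) \<and> ?P \<phi> D\<phi>) \<longleftrightarrow> (\<exists>\<phi> D\<phi>. (\<forall>n. C1c (\<phi> n) (D\<phi> n)) \<and> ?P' \<phi> D\<phi>)"
  (is "?l \<longleftrightarrow> ?r") if m: "u \<in> meas (area)" "D \<in> meas (area)" "T \<in> meas (len)"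
 proof
  assume ?l
  then obtain \<phi> D\<phi> where \<phi>: "!!n. C1c (\<phi> n) (D\<phi> n)" "?P \<phi> D\<phi>" by blast
  then show ?r using key[where \<phi>=\<phi> and D\<phi>=D\<phi>, OF m \<phi>(1)] C1
   by (intro exI[of _ "%n z. \<phi> n (R \<cdot> z)"] exI[of _ "%n z. R \<cdot> D\<phi> n (R \<cdot> z)"]) blast
 next
  assume ?r
  then obtain \<phi> D\<phi> where \<phi>: "!!n. C1c (\<phi> n) (D\<phi> n)" "?P' \<phi> D\<phi>" by blast
  define \<psi> D\<psi> where "\<psi> n x = \<phi> n ((1/R) \<cdot> x)" and "D\<psi> n x = (1/R) \<cdot> D\<phi> n ((1/R) \<cdot> x)" for n x
  have bck: "\<psi> n (R \<cdot> z) = \<phi> n z" "R \<cdot> D\<psi> n (R \<cdot> z) = D\<phi> n z" for n z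
   using R by (auto simp: \<psi>_def D\<psi>_def)
  have \<psi>: "C1c (\<psi> n) (D\<psi> n)" for n unfolding C1[of "\<psi> n"] bck by (rule \<phi>(1))
  show ?l using key[where \<phi>=\<psi> and D\<phi>=D\<psi>, OF m \<psi>, unfolded bck] \<phi>(2) \<psi> by blast
 qed
 have ms: "u \<in> meas (area) \<longleftrightarrow> (%z. u (R \<cdot> z)) \<in> meas (leb U0)"
  "D \<in> meas (area) \<longleftrightarrow> (%z. R \<cdot> D (R \<cdot> z)) \<in> meas (leb U0)"
  "T \<in> meas (len) \<longleftrightarrow> (%z. T (R \<cdot> z)) \<in> meas circ_measure"
  unfolding mD by (rule comp_measurable_U comp_measurable_circ)+
 show ?thesis
  unfolding H1_def tr_def HH_iff_nn[OF U0] ms[symmetric] by (intro conj_cong refl ex)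
qed

lemma forms_eq:
 assumes "H1 g U R u D T" "H1 g U R v Dv Tv"
 shows "(\<integral>x. cometric g x (D x) (Dv x) \<partial>area) = EE U0 (tr u D T) (tr v Dv Tv)"
  and "(\<integral>x. T x * Tv x \<partial>len) = R * sqrt cR * BB (tr u D T) (tr v Dv Tv)"
  and "(\<integral>x. u x * v x \<partial>area) = MM w U0 (tr u D T) (tr v Dv Tv)"
proof -
 have m: "D \<in> meas (area)" "Dv \<in> meas (area)" "u \<in> meas (area)"
  "v \<in> meas (area)" "T \<in> meas (len)" "Tv \<in> meas (len)"
  using assms by (auto simp: H1_def)
 have "(\<integral>x. cometric g x (D x) (Dv x) \<partial>area) = (\<integral>z. w z * cometric g (R \<cdot> z) (D (R \<cdot> z)) (Dv (R \<cdot> z)) \<partial>leb U0)"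
  by (rule integral_area) (intro cometric_measurable m)
 also have "... = EE U0 (tr u D T) (tr v Dv Tv)"
  unfolding EE_def tr_def by (intro Bochner_Integration.integral_cong) (auto simp: w_cometric space_restrict_space simp del: inner_scaleR_left inner_scaleR_right)
 finally show "(\<integral>x. cometric g x (D x) (Dv x) \<partial>area) = EE U0 (tr u D T) (tr v Dv Tv)" .
 show "(\<integral>x. T x * Tv x \<partial>len) = R * sqrt cR * BB (tr u D T) (tr v Dv Tv)"
  unfolding BB_def tr_def snd_conv by (rule integral_length) (use m in auto)
 show "(\<integral>x. u x * v x \<partial>area) = MM w U0 (tr u D T) (tr v Dv Tv)"
  unfolding MM_def tr_def fst_conv by (rule integral_area) (use m in auto)
qed

lemma tr_surj: "\<exists>u D T. x = tr u D T"
 by (rule exI[of _ "%z. fst x ((1/R) \<cdot> z)"], rule exI[of _ "%z. (1/R) \<cdot> fst (snd x) ((1/R) \<cdot> z)"],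
   rule exI[of _ "%z. snd (snd x) ((1/R) \<cdot> z)"])
   (use R in \<open>simp add: tr_def\<close>)

abbreviation eigd where "eigd \<alpha> \<equiv> robin_form.eig (HH U0) (EE U0) BB (MM w U0) \<alpha>"

text \<open>The boundary length contributes \<open>R * sqrt cR\<close>, which multiplies the Robin
  parameter. For the parameters in the theorem the product is \<alpha>, whatever the
  aperture.\<close>

lemma eigenfunction_iff:
 assumes rf: "robin_form (HH U0) (EE U0) BB (MM w U0) (\<beta> * (R * sqrt cR)) S0"
 shows "robin_eigenfunction g U R \<beta> \<mu> u \<longleftrightarrow> \<not> (AE x in area. u x = 0) \<and> (\<exists>D T. eigd (\<beta> * (R * sqrt cR)) \<mu> (tr u D T))"
proof -
 let ?F = "%D T. H1 g U R u D T \<and> (\<forall>v Dv Tv. H1 g U R v Dv Tv -->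
      (\<integral>x. cometric g x (D x) (Dv x) \<partial>area) + \<beta> * (\<integral>x. T x * Tv x \<partial>len)
      = \<mu> * (\<integral>x. u x * v x \<partial>area))"
 have "?F D T \<longleftrightarrow> eigd (\<beta> * (R * sqrt cR)) \<mu> (tr u D T)" for D T
 proof
  assume l: "?F D T"
  show "eigd (\<beta> * (R * sqrt cR)) \<mu> (tr u D T)"
   unfolding robin_form.eig_def[OF rf] robin_form.Q_def[OF rf]
  proof (intro conjI ballI)
   show "tr u D T \<in> HH U0" using l H1_iff by blast
   fix y assume y: "y \<in> HH U0"
   obtain v Dv Tv where yt: "y = tr v Dv Tv" using tr_surj by blast
   then have H: "H1 g U R v Dv Tv" using y H1_iff by blast
   then show "EE U0 (tr u D T) y + \<beta> * (R * sqrt cR) * BB (tr u D T) y = \<mu> * MM w U0 (tr u D T) y"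
    using l[THEN conjunct2, rule_format, OF H] forms_eq[OF l[THEN conjunct1] H] unfolding yt by (simp add: mult.assoc)
  qed
 next
  assume r: "eigd (\<beta> * (R * sqrt cR)) \<mu> (tr u D T)"
  then have H: "H1 g U R u D T" using H1_iff by (simp add: robin_form.eig_def[OF rf])
  have "(\<integral>x. cometric g x (D x) (Dv x) \<partial>area) + \<beta> * (\<integral>x. T x * Tv x \<partial>len)
      = \<mu> * (\<integral>x. u x * v x \<partial>area)" if Hv: "H1 g U R v Dv Tv" for v Dv Tv
   using r H1_iff[of v Dv Tv] Hv forms_eq[OF H Hv]
   by (auto simp: robin_form.eig_def[OF rf] robin_form.Q_def[OF rf] mult.assoc)
  then show "?F D T" using H by blast
 qed
 then show ?thesis unfolding robin_eigenfunction_def by blast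
qed

lemma AE_zero_iff:
 assumes "tr u D T \<in> T3 U0"
 shows "(AE x in area. u x = 0) \<longleftrightarrow> M2 w U0 (tr u D T) = 0"
proof -
 have uL: "(%z. u (R \<cdot> z)) \<in> L2 (leb U0)" using assms by (simp add: T3_def tr_def)
 have um: "u \<in> meas (area)" using L2_measurable[OF uL] by (simp add: comp_measurable_U)
 have um': "u \<in> meas (restrict_space borel U)" using um by (simp add: area_eq)
 have wm: "w \<in> meas (leb U0)" by (auto intro: measurable_restrict_space1)
 have wp: "w z > 0" if "z \<in> U0" for z using w_bounds(1)[OF that] R c1 by (meson less_le_trans mult_pos_pos zero_less_power)
 have S: "{x \<in> space (restrict_space borel U). u x = 0} \<in> sets (restrict_space borel U)" using um' by measurable
 have "(AE x in area. u x = 0) \<longleftrightarrow> (AE z in density (leb U0) (%z. ennreal (w z)). u (R \<cdot> z) = 0)"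
  unfolding area_eq using scale_measurable_U by (subst AE_distr_iff) (use S in auto)
 also have "... \<longleftrightarrow> (AE z in leb U0. 0 < ennreal (w z) --> u (R \<cdot> z) = 0)" using wm by (subst AE_density) auto
 also have "... \<longleftrightarrow> (AE z in leb U0. w z * (u (R \<cdot> z) * u (R \<cdot> z)) = 0)"
  by (rule AE_cong) (use wp in \<open>force simp: space_restrict_space\<close>)
 also have "... \<longleftrightarrow> M2 w U0 (tr u D T) = 0"
  unfolding MM_def tr_def fst_conv
  by (rule integral_nonneg_eq_0_iff_AE[symmetric, OF MM_integrable[OF weight_w U0 uL uL]])
    (rule AE_I2, rule mult_nonneg_nonneg[OF less_imp_le[OF wp] zero_le_square], simp add: space_restrict_space)
 finally show ?thesis .
qed

lemma tr_sum: "(\<Sum>i<k. a i \<cdot> tr (u i) (D i) (T i)) = tr (%x. \<Sum>i<k. a i * u i x) (%x. \<Sum>i<k. a i \<cdot> D i x) (%x. \<Sum>i<k. a i * T i x)" for k :: nat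
 by (induction k) (auto simp: tr_def zero_prod_def fun_eq_iff scaleR_add_right)

theorem count_iff:
 assumes rf: "robin_form (HH U0) (EE U0) BB (MM w U0) (\<beta> * (R * sqrt cR)) S0"
 shows "robin_count_ge g U R \<beta> S k \<longleftrightarrow> robin_form.count (HH U0) (EE U0) BB (MM w U0) (\<beta> * (R * sqrt cR)) S k"
proof
 assume "robin_count_ge g U R \<beta> S k"
 then obtain \<mu> u where mu: "!!i. i < k ==> \<mu> i \<in> S" "!!i. i < k ==> robin_eigenfunction g U R \<beta> (\<mu> i) (u i)"
  and ind: "!!c. (AE x in area. (\<Sum>i<k. c i * u i x) = 0) ==> (\<forall>i<k. c i = 0)"
  unfolding robin_count_ge_def by blast
 have "\<forall>i. \<exists>p. i < k --> eigd (\<beta> * (R * sqrt cR)) (\<mu> i) (tr (u i) (fst p) (snd p))"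
  using mu(2) eigenfunction_iff[OF rf] by fastforce
 then obtain p where p: "!!i. i < k ==> eigd (\<beta> * (R * sqrt cR)) (\<mu> i) (tr (u i) (fst (p i)) (snd (p i)))" by metis
 let ?x = "%i. tr (u i) (fst (p i)) (snd (p i))"
 show "robin_form.count (HH U0) (EE U0) BB (MM w U0) (\<beta> * (R * sqrt cR)) S k"
  unfolding robin_form.count_def[OF rf]
 proof (intro exI[of _ \<mu>] exI[of _ ?x] conjI allI impI)
  fix a :: "nat => real" and i assume 0: "M2 w U0 (\<Sum>i<k. a i \<cdot> ?x i) = 0" and i: "i < k"
  have "(\<Sum>i<k. a i \<cdot> ?x i) \<in> T3 U0"
   by (intro subspace_sum T3_subspace subspace_scale[OF T3_subspace]) (use p HH_T3[of U0] in \<open>auto simp: robin_form.eig_def[OF rf]\<close>)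
  then have "AE x in area. (\<Sum>i<k. a i * u i x) = 0" using 0 unfolding tr_sum by (subst AE_zero_iff)
  then show "a i = 0" using ind i by blast
 qed (use mu p in auto)
next
 assume "robin_form.count (HH U0) (EE U0) BB (MM w U0) (\<beta> * (R * sqrt cR)) S k"
 then obtain \<mu> x where mu: "!!i. i < k ==> \<mu> i \<in> S" "!!i. i < k ==> eigd (\<beta> * (R * sqrt cR)) (\<mu> i) (x i)"
  and ind: "!!c. M2 w U0 (\<Sum>i<k. c i \<cdot> x i) = 0 ==> (\<forall>i<k. c i = 0)"
  unfolding robin_form.count_def[OF rf] by blast
 have "\<forall>i. \<exists>p. x i = tr (fst p) (fst (snd p)) (snd (snd p))" using tr_surj by fastforce
 then obtain p where p: "!!i. x i = tr (fst (p i)) (fst (snd (p i))) (snd (snd (p i)))" by metis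
 let ?u = "%i. fst (p i)"
 have ind2: "\<forall>i<k. a i = 0" if "AE x in area. (\<Sum>i<k. a i * ?u i x) = 0" for a
 proof -
  have "(\<Sum>i<k. a i \<cdot> x i) \<in> T3 U0"
   by (intro subspace_sum T3_subspace subspace_scale[OF T3_subspace]) (use mu HH_T3[of U0] in \<open>auto simp: robin_form.eig_def[OF rf]\<close>)
  then have "M2 w U0 (\<Sum>i<k. a i \<cdot> x i) = 0" using that unfolding p tr_sum by (subst AE_zero_iff[symmetric])
  then show ?thesis using ind by blast
 qed
 show "robin_count_ge g U R \<beta> S k"
  unfolding robin_count_ge_def
 proof (intro exI[of _ \<mu>] exI[of _ ?u] conjI allI impI)
  fix i assume i: "i < k"
  show "\<mu> i \<in> S" using mu i by blast
  \<comment> \<open>An eigenfunction must not vanish almost everywhere; this is independence applied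
    to the \<open>i\<close>-th unit coefficient vector.\<close>
  have "\<not> (AE x in area. ?u i x = 0)"
  proof
   assume "AE x in area. ?u i x = 0"
   moreover have "(\<Sum>j<k. (if j = i then 1 else 0) * ?u j x) = ?u i x" for x
   proof -
    have "(\<Sum>j<k. (if j = i then 1 else 0) * ?u j x) = (\<Sum>j<k. if j = i then ?u i x else 0)" by (rule sum.cong) auto
    then show ?thesis using i by simp
   qed
   ultimately have "AE x in area. (\<Sum>j<k. (if j = i then 1 else 0) * ?u j x) = 0" by simp
   from ind2[OF this] i show False by auto
  qed
  then show "robin_eigenfunction g U R \<beta> (\<mu> i) (?u i)"
   unfolding eigenfunction_iff[OF rf] using mu(2)[OF i] p by metis
 next
  fix a i assume "AE x in area. (\<Sum>i<k. a i * ?u i x) = 0" "i < k"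
  then show "a i = 0" using ind2 by blast
 qed
qed

end

section \<open>The eigenvalues on the unit disk\<close>

definition good_weight :: "(real^2 => real) => bool" where
 "good_weight w \<longleftrightarrow> weight w disk \<and> (\<exists>c>0. \<forall>z. norm z < 1 --> c <= w z)"

abbreviation "cnt w \<alpha> S k \<equiv> robin_form.count (HH disk) (EE disk) BB (MM w disk) \<alpha> S k"
abbreviation "tst w \<alpha> S k \<equiv> robin_form.test (HH disk) (EE disk) BB (MM w disk) \<alpha> S k"

definition QQ :: "real => triple => real" where "QQ \<alpha> y = ED y + \<alpha> * B2 y"

definition lam :: "(real^2 => real) => real => nat => real" where
 "lam w \<alpha> k = (LEAST \<mu>. cnt w \<alpha> {..\<mu>} k)"

abbreviation lcomb :: "nat => (nat => real) => (nat => triple) => triple" where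
 "lcomb k c x \<equiv> \<Sum>i<k. c i \<cdot> x i"

lemma good_weight_form: "good_weight w ==> \<alpha> ~= 0 ==> robin_form (HH disk) (EE disk) BB (MM w disk) \<alpha> UNIV"
 unfolding good_weight_def using robin_form_disk by blast

lemma lcomb_HH: "(!!i. i < k ==> x i \<in> HH disk) ==> lcomb k c x \<in> HH disk"
 using HH_subspace[of disk] by (auto intro!: subspace_sum subspace_scale)

lemma tst_iff:
 assumes "good_weight w" "\<alpha> ~= 0"
 shows "tst w \<alpha> S k \<longleftrightarrow> (\<exists>x. (\<forall>i<k. x i \<in> HH disk) \<and> (\<forall>c. (\<exists>i<k. c i ~= 0) -->
   0 < MD w (lcomb k c x) \<and> QQ \<alpha> (lcomb k c x) / MD w (lcomb k c x) \<in> S))"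
 unfolding robin_form.test_def[OF good_weight_form[OF assms]] robin_form.Q_def[OF good_weight_form[OF assms]] QQ_def Let_def
 by (rule refl)

lemma BB_lcomb_hh: "B2 (lcomb k c hh) = (\<Sum>i<k. (c i)^2)"
proof -
 note sb = psd_symbil[OF BB_psd, of disk]
 have T: "hh i \<in> T3 disk" "lcomb k c hh \<in> T3 disk" for i using hh_T3[of disk] sum_hh_SM SM_T3[of disk] by auto
 have "B2 (lcomb k c hh) = (\<Sum>i<k. c i * BB (hh i) (lcomb k c hh))"
  by (rule symbil_sum[OF T3_subspace sb T(1) T(2)])
 also have "... = (\<Sum>i<k. (c i)^2)"
 proof (rule sum.cong)
  fix i assume i: "i \<in> {..<k}"
  have "BB (hh i) (lcomb k c hh) = (\<Sum>j<k. c j * BB (hh i) (hh j))"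
   by (rule symbil_sum2[OF T3_subspace sb T(1) T(1)])
  also have "... = (\<Sum>j<k. if j = i then c i else 0)" by (rule sum.cong) (auto simp: BB_hh_hh)
  finally show "c i * BB (hh i) (lcomb k c hh) = (c i)^2" using i by (simp add: power2_eq_square)
 qed simp
 finally show ?thesis .
qed

lemma EE_lcomb_hh: "ED (lcomb k c hh) = (\<Sum>i<k. real (deg i) * (c i)^2)"
proof -
 note sb = psd_symbil[OF EE_psd, of disk]
 have T: "hh i \<in> T3 disk" "lcomb k c hh \<in> T3 disk" for i using hh_T3[of disk] sum_hh_SM SM_T3[of disk] by auto
 have "ED (lcomb k c hh) = (\<Sum>i<k. c i * EE disk (hh i) (lcomb k c hh))"
  by (rule symbil_sum[OF T3_subspace sb T(1) T(2)])
 also have "... = (\<Sum>i<k. real (deg i) * (c i)^2)"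
 proof (rule sum.cong)
  fix i assume i: "i \<in> {..<k}"
  have "EE disk (hh i) (lcomb k c hh) = (\<Sum>j<k. c j * EE disk (hh i) (hh j))"
   by (rule symbil_sum2[OF T3_subspace sb T(1) T(1)])
  also have "... = (\<Sum>j<k. if j = i then c i * real (deg i) else 0)" by (rule sum.cong) (auto simp: form_hh)
  finally show "c i * EE disk (hh i) (lcomb k c hh) = real (deg i) * (c i)^2" using i by (simp add: power2_eq_square)
 qed simp
 finally show ?thesis .
qed

lemma sum_sq_pos: "(\<exists>i<k. c i ~= 0) ==> 0 < (\<Sum>i<k. (c i)^2)" for c :: "nat => real"
 by (auto intro!: sum_pos2)

lemma good_weight_MM:
 assumes "good_weight w" "x \<in> HH disk"
 shows "0 <= MD w x" "MD w x = 0 ==> MD one x = 0"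
proof -
 have o: "open disk" by simp
 from assms obtain c where w: "weight w disk" and c: "c > 0" "!!z. norm z < 1 ==> c <= w z" by (auto simp: good_weight_def)
 have xT: "x \<in> T3 disk" using assms HH_T3[of disk] by auto
 show "0 <= MD w x" using psd_nonneg[OF MM_psd[OF w o] xT] .
 have "MD (%z. c * one z) x <= MD w x"
  by (rule MM_mono[OF weight_cmult[OF weight_one] w o xT]) (use c in auto)
 then have "c * MD one x <= MD w x" by (simp only: MM_cmult)
 then show "MD w x = 0 ==> MD one x = 0"
  using NN_parts(3)[OF o xT] c by (simp add: mult_le_0_iff)
qed

text \<open>With zero mass, \<open>trace_epsilon\<close> bounds the trace by \<open>h\<close> times
  the energy for every positive \<open>h\<close>; the chosen \<open>h\<close> makes this at most
  half of the trace.\<close>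

lemma MM_zero_BB_zero:
 assumes "x \<in> HH disk" "MD one x = 0" shows "B2 x = 0"
proof -
 have xT: "x \<in> T3 disk" using assms HH_T3[of disk] by auto
 note pn = NN_parts[OF open_ball xT]
 show ?thesis
 proof (rule ccontr)
  assume "B2 x ~= 0"
  then have B: "B2 x > 0" using pn by simp
  define h where "h = B2 x / (2 * (ED x + 1))"
  have h: "h > 0" using B pn by (simp add: h_def)
  have "h * ED x < B2 x"
  proof -
   have "h * ED x <= h * (ED x + 1)" using h by simp
   also have "... = B2 x / 2" using pn by (simp add: h_def field_simps)
   finally show ?thesis using B by simp
  qed
  then show False using trace_epsilon[OF assms(1) h] assms(2) by simp
 qed
qed

text \<open>Trial functions must have positive mass. In the applications this follows from a nonzero
  trace or from a negative quadratic form.\<close>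

lemma MM_pos:
 assumes "good_weight w" "x \<in> HH disk" "B2 x > 0 \<or> MD one x > 0 \<or> QQ \<alpha> x < 0"
 shows "MD w x > 0"
proof (rule ccontr)
 assume "\<not> ?thesis"
 then have "MD w x = 0" using good_weight_MM(1)[OF assms(1,2)] by simp
 then have 0: "MD one x = 0" by (rule good_weight_MM(2)[OF assms(1,2)])
 have "ED x >= 0" using NN_parts(1)[OF open_ball, of x] assms(2) HH_T3[of disk] by auto
 then show False using assms(3) 0 MM_zero_BB_zero[OF assms(2) 0] by (auto simp: QQ_def)
qed

text \<open>The harmonic functions \<open>hh\<close> are orthonormal on the boundary, so their
  combinations have nonzero trace and positive mass. They provide trial spaces of every dimension,
  which is what \<open>eigenvalue_exists\<close> asks for.\<close>

lemma lam_spec: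
 assumes w: "good_weight w" and \<alpha>: "\<alpha> ~= 0" and k: "k >= 1" and S: "!!a b. b \<in> S ==> a <= b ==> a \<in> S"
 shows "cnt w \<alpha> S k \<longleftrightarrow> lam w \<alpha> k \<in> S" "tst w \<alpha> S k \<longleftrightarrow> lam w \<alpha> k \<in> S"
proof -
 note rf = good_weight_form[OF w \<alpha>]
 have H: "hh i \<in> HH disk" for i using hh_SM SM_HH[of disk] by auto
 have "tst w \<alpha> UNIV k"
  unfolding tst_iff[OF w \<alpha>]
 proof (rule exI[of _ hh], intro conjI allI impI)
  show "0 < MD w (lcomb k c hh)" if "\<exists>i<k. c i ~= 0" for c
   using MM_pos[OF w lcomb_HH[OF H], where \<alpha>=\<alpha>] BB_lcomb_hh[of c k] sum_sq_pos[OF that] by simp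
 qed (auto intro: H)
 from robin_form.eigenvalue_exists[OF rf this k] obtain l where
  l: "!!S. (\<forall>a b. b \<in> S --> a <= b --> a \<in> S) ==> (cnt w \<alpha> S k \<longleftrightarrow> l \<in> S) \<and> (tst w \<alpha> S k \<longleftrightarrow> l \<in> S)" by blast
 have "cnt w \<alpha> {..\<mu>} k \<longleftrightarrow> l <= \<mu>" for \<mu> using l[of "{..\<mu>}"] by auto
 then have "lam w \<alpha> k = l" unfolding lam_def by (simp add: Least_equality)
 then show "cnt w \<alpha> S k \<longleftrightarrow> lam w \<alpha> k \<in> S" "tst w \<alpha> S k \<longleftrightarrow> lam w \<alpha> k \<in> S" using l[of S] S by blast+
qed

lemma lam_le:
 assumes w: "good_weight w" and \<alpha>: "\<alpha> ~= 0" and k: "k >= 1" and x: "!!i. i < k ==> x i \<in> HH disk"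
  and le: "!!c y. (\<exists>i<k. c i ~= 0) ==> y = lcomb k c x ==> y \<in> HH disk ==> 0 < MD w y \<and> QQ \<alpha> y <= \<mu> * MD w y"
 shows "lam w \<alpha> k <= \<mu>"
proof -
 have "tst w \<alpha> {..\<mu>} k"
  unfolding tst_iff[OF w \<alpha>]
  using le[OF _ refl lcomb_HH[OF x]] x by (intro exI[of _ x]) (simp add: divide_le_eq)
 then show ?thesis using lam_spec(2)[OF w \<alpha> k, of "{..\<mu>}"] by auto
qed

lemma lam_less:
 assumes w: "good_weight w" and \<alpha>: "\<alpha> ~= 0" and k: "k >= 1" and x: "!!i. i < k ==> x i \<in> HH disk"
  and le: "!!c y. (\<exists>i<k. c i ~= 0) ==> y = lcomb k c x ==> y \<in> HH disk ==> 0 < MD w y \<and> QQ \<alpha> y < \<mu> * MD w y"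
 shows "lam w \<alpha> k < \<mu>"
proof -
 have "tst w \<alpha> {..<\<mu>} k"
  unfolding tst_iff[OF w \<alpha>]
  using le[OF _ refl lcomb_HH[OF x]] x by (intro exI[of _ x]) (simp add: divide_less_eq)
 then show ?thesis using lam_spec(2)[OF w \<alpha> k, of "{..<\<mu>}"] by auto
qed

text \<open>An optimal trial space, to be transplanted to another weight or to another
  domain.\<close>

lemma lam_family:
 assumes w: "good_weight w" and \<alpha>: "\<alpha> ~= 0" and k: "k >= 1"
 shows "\<exists>x. (\<forall>i<k. x i \<in> HH disk) \<and> (\<forall>c y. (\<exists>i<k. c i ~= 0) --> y = lcomb k c x -->
  y \<in> HH disk \<and> 0 < MD w y \<and> QQ \<alpha> y <= lam w \<alpha> k * MD w y)"
proof -
 have "tst w \<alpha> {..lam w \<alpha> k} k" using lam_spec(2)[OF w \<alpha> k, of "{..lam w \<alpha> k}"] by auto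
 then obtain x where x: "!!i. i < k ==> x i \<in> HH disk" "!!c. (\<exists>i<k. c i ~= 0) ==>
   0 < MD w (lcomb k c x) \<and> QQ \<alpha> (lcomb k c x) / MD w (lcomb k c x) \<in> {..lam w \<alpha> k}"
  unfolding tst_iff[OF w \<alpha>] by blast
 show ?thesis
 proof (intro exI[of _ x] conjI allI impI)
  fix c y assume c: "\<exists>i<k. c i ~= 0" and y: "y = lcomb k c x"
  show "y \<in> HH disk" unfolding y by (rule lcomb_HH[OF x(1)])
  show "0 < MD w y" "QQ \<alpha> y <= lam w \<alpha> k * MD w y" using x(2)[OF c] unfolding y by (auto simp: divide_le_eq)
 qed (use x in auto)
qed

text \<open>The source of lower bounds. Orthogonality is imposed on the traces, not on the
  functions, since this is what Steklov's inequality exploits; it does not depend on the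
  weight.\<close>

lemma lam_orthogonal:
 assumes w: "good_weight w" and \<alpha>: "\<alpha> ~= 0" and j: "j < k"
 shows "\<exists>y\<in>HH disk. (\<forall>p<j. BB y (hh p) = 0) \<and> 0 < MD w y \<and> QQ \<alpha> y <= lam w \<alpha> k * MD w y"
proof -
 have k: "k >= 1" using j by simp
 from lam_family[OF w \<alpha> k] obtain x where x: "!!i. i < k ==> x i \<in> HH disk"
  "!!c y. (\<exists>i<k. c i ~= 0) ==> y = lcomb k c x ==> y \<in> HH disk \<and> 0 < MD w y \<and> QQ \<alpha> y <= lam w \<alpha> k * MD w y" by blast
 obtain c where c: "\<exists>i\<in>{..<k}. c i ~= 0" "\<forall>p<j. (\<Sum>i<k. c i * BB (x i) (hh p)) = 0"
  using underdetermined_system[of "{..<k}" j "%p i. BB (x i) (hh p)"] j by auto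
 have T: "x i \<in> T3 disk" if "i < k" for i using x(1)[OF that] HH_T3[of disk] by auto
 have "BB (lcomb k c x) (hh p) = 0" if "p < j" for p
  using symbil_sum[OF T3_subspace psd_symbil[OF BB_psd], of "{..<k}" x disk "hh p" c] T hh_T3[of disk p] c(2) that by auto
 then show ?thesis using x(2)[OF _ refl, of c] c(1) by auto
qed

lemma lam_scale:
 assumes w: "good_weight w" and c: "c > 0" and \<alpha>: "\<alpha> ~= 0" and k: "k >= 1"
 shows "good_weight (%z. c * w z)" "lam (%z. c * w z) \<alpha> k = lam w \<alpha> k / c"
proof -
 show cw: "good_weight (%z. c * w z)"
  using w c weight_cmult[of w disk c] unfolding good_weight_def
  by (metis less_imp_le mult_le_cancel_left_pos mult_pos_pos)
 have "lam (%z. c * w z) \<alpha> k <= lam w \<alpha> k / c"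
 proof -
  from lam_family[OF w \<alpha> k] obtain x where x: "!!i. i < k ==> x i \<in> HH disk"
   "!!c y. (\<exists>i<k. c i ~= 0) ==> y = lcomb k c x ==> y \<in> HH disk \<and> 0 < MD w y \<and> QQ \<alpha> y <= lam w \<alpha> k * MD w y" by blast
  show ?thesis
  proof (rule lam_le[OF cw \<alpha> k x(1)])
   fix a y assume "\<exists>i<k. a i ~= 0" "y = lcomb k a x"
   from x(2)[OF this] c show "0 < MD (%z. c * w z) y \<and> QQ \<alpha> y <= lam w \<alpha> k / c * MD (%z. c * w z) y"
    by (simp add: MM_cmult)
  qed
 qed
 moreover have "lam w \<alpha> k <= c * lam (%z. c * w z) \<alpha> k"
 proof -
  from lam_family[OF cw \<alpha> k] obtain x where x: "!!i. i < k ==> x i \<in> HH disk"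
   "!!a y. (\<exists>i<k. a i ~= 0) ==> y = lcomb k a x ==> y \<in> HH disk \<and> 0 < MD (%z. c * w z) y \<and> QQ \<alpha> y <= lam (%z. c * w z) \<alpha> k * MD (%z. c * w z) y" by blast
  show ?thesis
  proof (rule lam_le[OF w \<alpha> k x(1)])
   fix a y assume "\<exists>i<k. a i ~= 0" "y = lcomb k a x"
   from x(2)[OF this] c show "0 < MD w y \<and> QQ \<alpha> y <= c * lam (%z. c * w z) \<alpha> k * MD w y"
    by (simp add: MM_cmult zero_less_mult_iff mult_ac)
  qed
 qed
 ultimately show "lam (%z. c * w z) \<alpha> k = lam w \<alpha> k / c" using c by (simp add: field_simps)
qed

lemma good_weight_ws: assumes "s > -1" shows "good_weight (ws s)"
 unfolding good_weight_def
proof (intro conjI weight_ws assms exI[of _ "1 / (max 1 (1 + s))^2"] allI impI)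
 show "1 / (max 1 (1 + s))^2 <= ws s z" if "norm z < 1" for z using ws_bounds(1)[OF assms, of z] that by simp
qed (use assms in auto)

section \<open>Spherical caps, hyperbolic disks and the Euclidean disk\<close>

text \<open>The transported density is \<open>a\<close> times a normalised weight, and a constant
  factor in the mass divides the eigenvalue.\<close>

lemma conformal_eigenvalue:
 assumes cd: "conformal_disk g c R disk cR c1 c2" and \<alpha>: "\<alpha> ~= 0" and k: "k >= 1"
  and w: "good_weight w" and cw: "!!z. norm z < 1 ==> R^2 * c (R \<cdot> z) = a * w z" and a: "a > 0"
  and U: "U = {x. norm x < R}"
 shows "robin_eigenvalue g U R k (\<alpha> / (R * sqrt cR)) = lam w \<alpha> k / a"
proof -
 interpret cd: conformal_disk g c R disk cR c1 c2 by (rule cd)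
 have pos: "R * sqrt cR > 0" using cd.R cd.cR by simp
 have UU: "U = cd.U" using cd.R by (auto simp: U cd.U_def field_simps)
 note aw = lam_scale[OF w a \<alpha> k]
 have MMeq: "MM cd.w disk = MM (%z. a * w z) disk"
  unfolding MM_def fun_eq_iff
  by (intro allI Bochner_Integration.integral_cong) (auto simp: space_restrict_space cd.w_def cw)
 have be: "\<alpha> / (R * sqrt cR) * (R * sqrt cR) = \<alpha>"
  by (simp only: times_divide_eq_left nonzero_mult_div_cancel_right[OF less_imp_neq[OF pos, THEN not_sym]])
 have rf: "robin_form (HH disk) (EE disk) BB (MM cd.w disk) (\<alpha> / (R * sqrt cR) * (R * sqrt cR)) UNIV"
  unfolding MMeq be by (rule good_weight_form[OF aw(1) \<alpha>])
 have "robin_count_ge g U R (\<alpha> / (R * sqrt cR)) S k \<longleftrightarrow> cnt (%z. a * w z) \<alpha> S k" for S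
  using cd.count_iff[OF rf] unfolding MMeq be UU .
 then have "robin_eigenvalue g U R k (\<alpha> / (R * sqrt cR)) = lam (%z. a * w z) \<alpha> k"
  unfolding robin_eigenvalue_def lam_def by simp
 then show ?thesis unfolding aw(2) .
qed

text \<open>Stereographic projection is conformal. The map is written as the quotient of
  \<open>v\<close> by \<open>q\<close>, and the Gram matrix of its differential is computed from the
  inner products of \<open>v\<close> and its derivative \<open>v'\<close>.\<close>

lemma sphere_metric_eq: "sphere_metric x = mat (4 / (1 + (norm x)^2)^2)"
proof -
 define q where "q = 1 + (norm x)^2"
 have q: "q > 0" by (simp add: q_def add_pos_nonneg)
 define v where "v y = (vector [2 * y$1, 2 * y$2, 1 - (norm y)^2] :: real^3)" for y :: "real^2"
 define v' where "v' h = (vector [2 * h$1, 2 * h$2, - (2 * (x \<bullet> h))] :: real^3)" for h :: "real^2"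
 define D where "D h = (1 / q) \<cdot> v' h + (- (2 * (x \<bullet> h)) / q^2) \<cdot> v x" for h
 have nd: "((%y::real^2. (norm y)^2) has_derivative (%h. 2 * (x \<bullet> h))) (at x)"
  using GDERIV_norm_sq[of x] by (simp add: gderiv_def inner_commute)
 have vd: "(v has_derivative v') (at x)"
  unfolding has_derivative_componentwise_within[of v]
 proof
  fix i :: "real^3" assume "i \<in> Basis"
  then obtain j where i: "i = axis j 1" by (auto simp: Basis_vec_def)
  have "((%y. v y $ j) has_derivative (%h. v' h $ j)) (at x)"
   using exhaust_3[of j] nd by (auto simp: v_def v'_def intro!: derivative_eq_intros nth_has_derivative)
  then show "((%y. v y \<bullet> i) has_derivative (%h. v' h \<bullet> i)) (at x)" by (simp add: i inner_axis)
 qed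
 have rd: "((%y::real^2. 1 / (1 + (norm y)^2)) has_derivative (%h. - (2 * (x \<bullet> h)) / q^2)) (at x)"
 proof -
  have "((%u. 1 / (1 + u)) has_real_derivative - 1 / q^2) (at ((norm x)^2))"
   using q unfolding q_def by (auto intro!: derivative_eq_intros simp: power2_eq_square)
  from has_derivative_compose[OF nd this[unfolded has_field_derivative_def]] show ?thesis by simp
 qed
 have "(stereo has_derivative D) (at x)"
  using has_derivative_scaleR[OF rd vd] unfolding stereo_def[abs_def] v_def[symmetric] D_def[abs_def] q_def .
 then have fd: "frechet_derivative stereo (at x) = D" by (rule frechet_derivative_at[symmetric])
 have nx: "(norm x)^2 = x$1 * x$1 + x$2 * x$2" by (simp add: power2_norm_eq_inner inner_vec_def sum_2)
 have xa: "x \<bullet> axis i 1 = x $ i" for i by (simp add: inner_axis)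
 have D3: "D h \<bullet> D k = (4 * (h \<bullet> k)) / q^2" for h k
 proof -
  define a b where "a = x \<bullet> h" and "b = x \<bullet> k"
  have v3: "v y $ 1 = 2 * y$1" "v y $ 2 = 2 * y$2" "v y $ 3 = 1 - (norm y)^2"
   "v' y $ 1 = 2 * y$1" "v' y $ 2 = 2 * y$2" "v' y $ 3 = - (2 * (x \<bullet> y))" for y by (simp_all add: v_def v'_def)
  \<comment> \<open>The last identity says that \<open>stereo x\<close> is a unit vector. Together
    the four make all terms except \<open>4 * (h \<bullet> k) / q^2\<close> cancel.\<close>
  have vv: "v' h \<bullet> v' k = 4 * (h \<bullet> k) + 4 * a * b" "v' h \<bullet> v x = 2 * a * q" "v x \<bullet> v' k = 2 * b * q" "v x \<bullet> v x = q^2"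
   unfolding a_def b_def q_def inner_vec_def sum_3 sum_2 v3 nx[unfolded inner_vec_def sum_2]
   by (simp_all add: algebra_simps power2_eq_square)
  define p r t where "p = 1 / q" and "r = - (2 * a) / q^2" and "t = - (2 * b) / q^2"
  have Dh: "D h = p \<cdot> v' h + r \<cdot> v x" "D k = p \<cdot> v' k + t \<cdot> v x"
   by (simp_all add: D_def a_def b_def p_def r_def t_def)
  have "D h \<bullet> D k = p * p * (v' h \<bullet> v' k) + p * t * (v' h \<bullet> v x) + r * p * (v x \<bullet> v' k) + r * t * (v x \<bullet> v x)"
   unfolding Dh by (simp add: inner_add_left inner_add_right distrib_left)
  also have "... = (4 * (h \<bullet> k)) / q^2"
   unfolding vv p_def r_def t_def using q by (simp add: power2_eq_square divide_simps)
  finally show ?thesis .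
 qed
 show ?thesis
  unfolding sphere_metric_def fd D3 q_def[symmetric]
  by (simp add: mat_def vec_eq_iff forall_2 inner_axis_axis)
qed

lemma cos_tan_half': assumes "0 < \<Theta>" "\<Theta> < pi"
 shows "tan (\<Theta>/2) > 0" "cos \<Theta> = (1 - (tan (\<Theta>/2))^2) / (1 + (tan (\<Theta>/2))^2)" "sin \<Theta> = 2 * tan (\<Theta>/2) / (1 + (tan (\<Theta>/2))^2)"
proof -
 have "cos (\<Theta>/2) > 0" using assms by (intro cos_gt_zero) auto
 then show "cos \<Theta> = (1 - (tan (\<Theta>/2))^2) / (1 + (tan (\<Theta>/2))^2)" using cos_tan_half[of "\<Theta>/2"] by simp
 show "sin \<Theta> = 2 * tan (\<Theta>/2) / (1 + (tan (\<Theta>/2))^2)" using sin_tan_half[of "\<Theta>/2"] by simp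
 show "tan (\<Theta>/2) > 0" using assms by (intro tan_gt_zero) auto
qed

text \<open>In the chart the cap is the disk of radius \<open>R = tan (\<Theta>/2)\<close>. Its
  boundary has length \<open>2 pi R sqrt cR\<close> with \<open>R * sqrt cR = sin \<Theta>\<close>,
  so the Robin parameter becomes \<alpha> on the unit circle; the density is \<open>4 * R^2\<close>
  times \<open>ws (R^2)\<close>, and this factor reappears in \<open>F_fun\<close>.\<close>

lemma lambda_cap_sphere:
 assumes \<Theta>: "0 < \<Theta>" "\<Theta> < pi" and \<alpha>: "\<alpha> ~= 0" and k: "k >= 1"
 shows "lambda_cap k \<Theta> (\<alpha> / sin \<Theta>) = lam (ws ((tan (\<Theta>/2))^2)) \<alpha> k / (4 * (tan (\<Theta>/2))^2)"
proof -
 define R where "R = tan (\<Theta>/2)"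
 note t = cos_tan_half'[OF \<Theta>, folded R_def]
 have cap: "spherical_cap \<Theta> = {x. norm x < R}"
 proof -
  have "arccos (stereo x \<bullet> axis 3 1) < \<Theta> \<longleftrightarrow> norm x < R" for x
  proof -
   define a where "a = (norm x)^2"
   have a: "a >= 0" by (simp add: a_def)
   have st: "stereo x \<bullet> axis 3 1 = (1 - a) / (1 + a)" by (simp add: stereo_def inner_axis a_def)
   have b: "\<bar>(1 - a) / (1 + a)\<bar> <= 1" using a by (simp add: abs_le_iff field_simps)
   have "arccos ((1 - a) / (1 + a)) < arccos (cos \<Theta>) \<longleftrightarrow> cos \<Theta> < (1 - a) / (1 + a)"
    by (rule arccos_less_mono[OF b]) simp
   also have "arccos (cos \<Theta>) = \<Theta>" using \<Theta> by (simp add: arccos_cos)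
   also have "cos \<Theta> < (1 - a) / (1 + a) \<longleftrightarrow> a < R^2"
   proof -
    have p: "1 + R^2 > 0" "1 + a > 0" using a by (auto simp: add_pos_nonneg)
    show ?thesis unfolding t(2) using p by (simp add: divide_less_eq less_divide_eq) (simp add: field_simps)
   qed
   also have "... \<longleftrightarrow> norm x < R" unfolding a_def using t(1) by (metis norm_ge_zero power2_less_imp_less power_strict_mono less_imp_le zero_less_numeral)
   finally show ?thesis unfolding st .
  qed
  then show ?thesis by (auto simp: spherical_cap_def)
 qed
 define c where "c x = 4 / (1 + (norm x)^2)^2" for x :: "real^2"
 have pos: "1 + (norm x)^2 > 0" for x :: "real^2" by (simp add: add_pos_nonneg)
 have cd: "conformal_disk sphere_metric c R disk (4 / (1 + R^2)^2) (4 / (1 + R^2)^2) 4"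
 proof
  fix x :: "real^2" assume "(1/R) \<cdot> x \<in> disk"
  then have "norm x < R" using t(1) by (simp add: field_simps)
  then have "(norm x)^2 <= R^2" by (intro power_mono) auto
  then have "(1 + (norm x)^2)^2 <= (1 + R^2)^2" by (intro power_mono) auto
  then have "4 / (1 + R^2)^2 <= c x" unfolding c_def using pos[of x] by (intro divide_left_mono mult_pos_pos) auto
  moreover have "c x <= 4" unfolding c_def using pos[of x] power_mono[of 1 "1 + (norm x)^2" 2] by (simp add: divide_le_eq)
  ultimately show "4 / (1 + R^2)^2 <= c x \<and> c x <= 4" ..
 next
  have "1 + R^2 > 0" by (simp add: add_pos_nonneg)
  then have "0 < (1 + R^2)^2" by (rule zero_less_power)
  then show "0 < 4 / (1 + R^2)^2" by simp
  show "c \<in> meas borel" unfolding c_def[abs_def] by measurable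
 qed (use t(1) in \<open>auto simp: sphere_metric_eq c_def\<close>)
 have "1 + R^2 > 0" by (simp add: add_pos_nonneg)
 then have sq: "R * sqrt (4 / (1 + R^2)^2) = sin \<Theta>"
  unfolding t(3) using t(1) by (simp add: real_sqrt_divide real_sqrt_abs add_pos_nonneg)
 have "robin_eigenvalue sphere_metric {x. norm x < R} R k (\<alpha> / (R * sqrt (4 / (1 + R^2)^2))) = lam (ws (R^2)) \<alpha> k / (4 * R^2)"
 proof (rule conformal_eigenvalue[OF cd \<alpha> k])
  show "good_weight (ws (R^2))" by (rule good_weight_ws) (use zero_le_power2[of R] in linarith)
 qed (use t(1) in \<open>auto simp: c_def ws_def power_mult_distrib\<close>)
 then show ?thesis unfolding lambda_cap_def using \<Theta> unfolding sq cap R_def[symmetric] by simp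
qed

lemma tanh_half: assumes "r > 0"
 shows "0 < tanh (r/2)" "tanh (r/2) < (1::real)" "sinh r = 2 * tanh (r/2) / (1 - (tanh (r/2))^2)"
proof -
 show "0 < tanh (r/2)" "tanh (r/2) < 1" using assms by (auto simp: tanh_real_lt_1)
 have c: "cosh (r/2) ~= 0" using cosh_real_pos[of "r/2"] by linarith
 have "1 - (tanh (r/2))^2 = ((cosh (r/2))^2 - (sinh (r/2))^2) / (cosh (r/2))^2"
  using c by (simp add: tanh_def power_divide diff_divide_distrib)
 also have "... = 1 / (cosh (r/2))^2" using cosh_square_eq[of "r/2"] by simp
 finally have 1: "1 - (tanh (r/2))^2 = 1 / (cosh (r/2))^2" .
 have "sinh r = 2 * sinh (r/2) * cosh (r/2)" using sinh_double[of "r/2"] by simp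
 then show "sinh r = 2 * tanh (r/2) / (1 - (tanh (r/2))^2)"
  unfolding 1 using c by (simp add: tanh_def power2_eq_square)
qed

lemma lambda_cap_hyperbolic:
 assumes \<Theta>: "\<Theta> < 0" and \<alpha>: "\<alpha> ~= 0" and k: "k >= 1"
 shows "lambda_cap k \<Theta> (\<alpha> / sinh \<bar>\<Theta>\<bar>) = lam (ws (- (tanh (\<Theta>/2))\<^sup>2)) \<alpha> k / (4 * (tanh (\<Theta>/2))^2)"
proof -
 define R where "R = tanh (\<bar>\<Theta>\<bar>/2)"
 have "\<bar>\<Theta>\<bar> > 0" using \<Theta> by simp
 note t = tanh_half[OF this, folded R_def]
 have R2: "(tanh (\<Theta>/2))^2 = R^2" using \<Theta> by (simp add: R_def)
 have R1: "R^2 < 1" using power_strict_mono[OF t(2), of 2] t(1) by simp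
 have disk: "hyperbolic_disk \<bar>\<Theta>\<bar> = {x. norm x < R}"
 proof -
  have "norm x < 1 \<and> 2 * artanh (norm x) < \<bar>\<Theta>\<bar> \<longleftrightarrow> norm x < R" for x :: "real^2"
  proof -
   have aR: "artanh R = \<bar>\<Theta>\<bar> / 2" by (simp add: R_def artanh_tanh_real)
   have "2 * artanh y < \<bar>\<Theta>\<bar> \<longleftrightarrow> y < R" if y: "0 <= y" "y < 1" for y :: real
   proof -
    have "2 * artanh y < \<bar>\<Theta>\<bar> \<longleftrightarrow> artanh y < artanh R" unfolding aR by auto
    also have "... \<longleftrightarrow> (1 + y) / (1 - y) < (1 + R) / (1 - R)"
     using y t(1,2) by (simp add: artanh_def)
    also have "... \<longleftrightarrow> y < R" using y t(1,2) by (simp add: divide_less_eq less_divide_eq algebra_simps)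
    finally show ?thesis .
   qed
   from this[of "norm x"] have "norm x < 1 ==> 2 * artanh (norm x) < \<bar>\<Theta>\<bar> \<longleftrightarrow> norm x < R" by simp
   then show ?thesis using t(2) by auto
  qed
  then show ?thesis by (auto simp: hyperbolic_disk_def)
 qed
 define c where "c x = (2 / (1 - (norm x)^2))^2" for x :: "real^2"
 have cd: "conformal_disk hyperbolic_metric c R disk ((2 / (1 - R^2))^2) 4 ((2 / (1 - R^2))^2)"
 proof
  fix x :: "real^2" assume "(1/R) \<cdot> x \<in> disk"
  then have "norm x < R" using t(1) by (simp add: field_simps)
  then have n: "(norm x)^2 <= R^2" by (intro power_mono) auto
  have "2 / 1 <= 2 / (1 - (norm x)^2)" using n R1 by (intro divide_left_mono) auto
  from power_mono[OF this, of 2] have "4 <= c x" by (simp add: c_def)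
  moreover have "c x <= (2 / (1 - R^2))^2"
   unfolding c_def using n R1 by (intro power_mono divide_left_mono mult_pos_pos) auto
  ultimately show "4 <= c x \<and> c x <= (2 / (1 - R^2))^2" ..
 next
  show "c \<in> meas borel" unfolding c_def[abs_def] by measurable
 qed (use t(1) R1 in \<open>auto simp: hyperbolic_metric_def c_def\<close>)
 have sq: "R * sqrt ((2 / (1 - R^2))^2) = sinh \<bar>\<Theta>\<bar>"
  unfolding t(3) using R1 by (simp add: mult.commute)
 have "robin_eigenvalue hyperbolic_metric {x. norm x < R} R k (\<alpha> / (R * sqrt ((2 / (1 - R^2))^2))) = lam (ws (- R\<^sup>2)) \<alpha> k / (4 * R^2)"
 proof (rule conformal_eigenvalue[OF cd \<alpha> k])
  show "good_weight (ws (- R\<^sup>2))" by (rule good_weight_ws) (use R1 in simp)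
 qed (use t(1) in \<open>auto simp: c_def ws_def power_mult_distrib power_divide\<close>)
 then show ?thesis unfolding lambda_cap_def R2 using \<Theta> unfolding sq disk R_def[symmetric] by simp
qed

lemma lambda_disk_eq:
 assumes \<alpha>: "\<alpha> ~= 0" and k: "k >= 1"
 shows "lambda_disk k \<alpha> = lam (ws 0) \<alpha> k"
proof -
 have cd: "conformal_disk flat_metric (%_. 1) 1 disk 1 1 1"
  by unfold_locales (auto simp: flat_metric_def)
 have "robin_eigenvalue flat_metric disk 1 k (\<alpha> / (1 * sqrt 1)) = lam (ws 0) \<alpha> k / 1"
  by (rule conformal_eigenvalue[OF cd \<alpha> k]) (auto simp: ws_def good_weight_ws)
 then show ?thesis by (simp add: lambda_disk_def)
qed

text \<open>The parameter in which the three geometries form one family: 0 is the flat disk, 1 the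
  hemisphere, and the ends -1 and infinity correspond to apertures tending to minus infinity and to
  \<open>pi\<close>.\<close>

definition sT :: "real => real" where
 "sT \<Theta> = (if \<Theta> < 0 then - (tanh (\<Theta>/2))\<^sup>2 else (tan (\<Theta>/2))^2)"

lemma sT_gt: "sT \<Theta> > -1"
proof (cases "\<Theta> < 0")
 case True
 have "(tanh (\<Theta>/2))^2 < 1" using tanh_half[of "\<bar>\<Theta>\<bar>"] True power_strict_mono[of "\<bar>tanh (\<Theta>/2)\<bar>" 1 2] by simp
 then show ?thesis using True by (simp add: sT_def)
next
 case False
 then have "sT \<Theta> = (tan (\<Theta>/2))^2" by (simp add: sT_def)
 then show ?thesis using zero_le_power2[of "tan (\<Theta>/2)"] by linarith
qed

text \<open>The factor in \<open>G_fun\<close> is that in \<open>F_fun\<close> divided by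
  \<open>(1 + s)^2\<close>, because \<open>sin \<Theta> = 2 R / (1 + R^2)\<close> with
  \<open>R = tan (\<Theta>/2)\<close>, and likewise for \<open>sinh\<close> and \<open>tanh\<close>
  with a minus sign. Only positive factors are involved, so signs agree.\<close>

lemma F_G_lam:
 assumes \<alpha>: "\<alpha> ~= 0" and k: "k >= 1" and \<Theta>: "\<Theta> < pi"
 shows "F_fun k \<alpha> \<Theta> = lam (ws (sT \<Theta>)) \<alpha> k" "G_fun k \<alpha> \<Theta> = lam (ws (sT \<Theta>)) \<alpha> k / (1 + sT \<Theta>)^2"
  "sgn (scaled_lambda k \<alpha> \<Theta>) = sgn (lam (ws (sT \<Theta>)) \<alpha> k)"
proof -
 consider "\<Theta> < 0" | "\<Theta> = 0" | "\<Theta> > 0" by linarith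
 then have "F_fun k \<alpha> \<Theta> = lam (ws (sT \<Theta>)) \<alpha> k \<and> G_fun k \<alpha> \<Theta> = lam (ws (sT \<Theta>)) \<alpha> k / (1 + sT \<Theta>)^2 \<and>
  sgn (scaled_lambda k \<alpha> \<Theta>) = sgn (lam (ws (sT \<Theta>)) \<alpha> k)"
 proof cases
  case 1
  define R where "R = tanh (\<Theta>/2)"
  have R0: "R ~= 0" using 1 by (simp add: R_def)
  have "\<bar>\<Theta>\<bar> > 0" using 1 by simp
  note t = tanh_half(3)[OF this]
  have "R^2 < 1" using sT_gt[of \<Theta>] 1 by (simp add: sT_def R_def)
  moreover have "(sinh \<Theta>)^2 = (2 * R / (1 - R^2))^2"
   using t 1 by (simp add: R_def power2_eq_square)
  moreover note l = lambda_cap_hyperbolic[OF 1 \<alpha> k, folded R_def]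
  ultimately show ?thesis using 1 R0
   by (simp add: F_fun_def G_fun_def scaled_lambda_def sT_def R_def[symmetric] power_divide power_mult_distrib sgn_divide)
 next
  case 2
  then show ?thesis using lambda_disk_eq[OF \<alpha> k] by (simp add: F_fun_def G_fun_def scaled_lambda_def sT_def)
 next
  case 3
  define R where "R = tan (\<Theta>/2)"
  note t = cos_tan_half'[OF 3 \<Theta>, folded R_def]
  note l = lambda_cap_sphere[OF 3 \<Theta> \<alpha> k, folded R_def]
  show ?thesis using 3 t(1,3) l
   by (simp add: F_fun_def G_fun_def scaled_lambda_def sT_def R_def[symmetric] power_divide power_mult_distrib sgn_divide)
 qed
 then show "F_fun k \<alpha> \<Theta> = lam (ws (sT \<Theta>)) \<alpha> k" "G_fun k \<alpha> \<Theta> = lam (ws (sT \<Theta>)) \<alpha> k / (1 + sT \<Theta>)^2"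
  "sgn (scaled_lambda k \<alpha> \<Theta>) = sgn (lam (ws (sT \<Theta>)) \<alpha> k)" by auto
qed

section \<open>Inversion in the unit circle\<close>

text \<open>At the origin the division yields 0, so \<open>inv2\<close> is an involution of the
  whole plane.\<close>

definition inv2 :: "real^2 => real^2" where "inv2 x = (1 / (norm x)^2) \<cdot> x"
definition dinv :: "real^2 => real^2 => real^2" where
 "dinv x v = (1 / (norm x)^2) \<cdot> v + (- (2 * (x \<bullet> v)) / (norm x) ^ 4) \<cdot> x"

lemma norm_inv2: "norm (inv2 x) = 1 / norm x"
 by (cases "x = 0") (auto simp: inv2_def power2_eq_square)

lemma inv2_inv2 [simp]: "inv2 (inv2 x) = x"
proof (cases "x = 0")
 case False
 then show ?thesis unfolding inv2_def[of "inv2 x"] norm_inv2 by (simp add: inv2_def power_divide)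
qed (simp add: inv2_def)

lemma inv2_zero [simp]: "inv2 0 = 0" "inv2 x = 0 \<longleftrightarrow> x = 0" by (auto simp: inv2_def)

lemma inv2_measurable [measurable]: "inv2 \<in> meas borel"
 unfolding inv2_def[abs_def] by measurable

lemma dinv_linear: "dinv x (a + b) = dinv x a + dinv x b" "dinv x (c \<cdot> a) = c \<cdot> dinv x a" "dinv x 0 = 0"
 unfolding dinv_def by (simp_all add: inner_add_right scaleR_add_right scaleR_add_left[symmetric] add_divide_distrib[symmetric] algebra_simps)

text \<open>\<open>dinv x\<close> is \<open>1 / |x|^2\<close> times the reflection in the line
  orthogonal to \<open>x\<close>. Hence it is conformal and symmetric, with determinant
  \<open>- 1 / |x|^4\<close>.\<close>

lemma norm_dinv: "(norm (dinv x v))^2 = (norm v)^2 / (norm x) ^ 4"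
proof (cases "x = 0")
 case False
 define n where "n = (norm x)^2"
 have n: "n > 0" "x \<bullet> x = n" "(norm x) ^ 4 = n^2" using False by (auto simp: n_def power2_norm_eq_inner[symmetric] power_mult[symmetric])
 have d: "dinv x v = (1 / n) \<cdot> v + (- (2 * (x \<bullet> v)) / n^2) \<cdot> x" unfolding dinv_def n(3) n_def[symmetric] ..
 define p q where "p = 1 / n" and "q = - (2 * (x \<bullet> v)) / n^2"
 have "(norm (dinv x v))^2 = p * p * (v \<bullet> v) + 2 * (p * q * (x \<bullet> v)) + q * q * n"
  unfolding d p_def[symmetric] q_def[symmetric] power2_norm_eq_inner
  by (simp add: inner_add_left inner_add_right n(2) inner_commute[of v x]) (simp add: algebra_simps)
 also have "... = (v \<bullet> v) / n^2"
  unfolding p_def q_def using n(1) by (simp add: power2_eq_square divide_simps)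
 finally show ?thesis unfolding n(3) power2_norm_eq_inner .
qed (simp add: dinv_def)

lemma inv2_has_derivative: assumes "x ~= 0" shows "(inv2 has_derivative dinv x) (at x)"
proof -
 have nd: "((%y::real^2. (norm y)^2) has_derivative (%h. 2 * (x \<bullet> h))) (at x)"
  using GDERIV_norm_sq[of x] by (simp add: gderiv_def inner_commute)
 have "((%u. 1 / u) has_real_derivative - 1 / (norm x) ^ 4) (at ((norm x)^2))"
  using assms by (auto intro!: derivative_eq_intros simp: power2_eq_square power4_eq_xxxx)
 from has_derivative_compose[OF nd this[unfolded has_field_derivative_def]]
 have "((%y::real^2. 1 / (norm y)^2) has_derivative (%h. - (2 * (x \<bullet> h)) / (norm x) ^ 4)) (at x)" by simp
 from has_derivative_scaleR[OF this has_derivative_ident] show ?thesis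
  unfolding inv2_def[abs_def] dinv_def[abs_def] .
qed

lemma dinv_symmetric: "dinv x u \<bullet> v = u \<bullet> dinv x v"
 unfolding dinv_def inner_add_left inner_add_right by (simp add: inner_commute[of v x] inner_commute[of u x] mult_ac)

lemma GDERIV_inv2:
 assumes "x ~= 0" "GDERIV f (inv2 x) :> D" shows "GDERIV (%x. f (inv2 x)) x :> dinv x D"
 using has_derivative_compose[OF inv2_has_derivative[OF assms(1)] assms(2)[unfolded gderiv_def]]
 unfolding gderiv_def dinv_symmetric .

lemma det_dinv: assumes "x ~= 0" shows "\<bar>det (matrix (dinv x))\<bar> = 1 / (norm x) ^ 4"
proof -
 define n where "n = (norm x)^2"
 define p r a b where "p = 1 / n" and "r = - 2 / n^2" and "a = x $ 1" and "b = x $ 2"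
 have n: "n > 0" "a * a + b * b = n" "(norm x) ^ 4 = n^2"
  using assms by (auto simp: n_def a_def b_def power_mult[symmetric]) (simp add: power2_norm_eq_inner inner_vec_def sum_2)
 have d: "dinv x v = p \<cdot> v + (r * (x \<bullet> v)) \<cdot> x" for v
  unfolding dinv_def n(3) n_def[symmetric] p_def r_def by simp
 have m: "matrix (dinv x) $ i $ j = p * (axis j 1 $ i) + r * x $ j * x $ i" for i j
  by (simp add: matrix_def d inner_axis)
 have "det (matrix (dinv x)) = p * p + p * r * (a * a + b * b)"
  unfolding det_2 m by (simp add: axis_def a_def b_def algebra_simps)
 also have "... = - (1 / n^2)" unfolding n(2) p_def r_def using n(1) by (simp add: power2_eq_square)
 finally show ?thesis unfolding n(3) by simp
qed

text \<open>Two domains exchanged by the inversion up to the origin. Functions are carried from the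
  exterior to the disk and also back, so both orders occur.\<close>

definition inverse_domains :: "(real^2) set => (real^2) set => bool" where
 "inverse_domains U U' \<longleftrightarrow> open U \<and> open U' \<and> (\<forall>z. z ~= 0 --> (inv2 z \<in> U' \<longleftrightarrow> z \<in> U))"

abbreviation ext :: "(real^2) set" where "ext \<equiv> - cball 0 1"

lemma inverse_domains_disk_ext: "inverse_domains disk ext" "inverse_domains ext disk"
 by (auto simp: inverse_domains_def norm_inv2 field_simps)

lemma nn_integral_inv2:
 assumes U: "inverse_domains U U'" and f: "f \<in> meas (leb U')"
 shows "(\<integral>\<^sup>+z. f z \<partial>leb U') = (\<integral>\<^sup>+z. f (inv2 z) * ennreal (1 / (norm z) ^ 4) \<partial>leb U)"
proof -
 have [measurable]: "U \<in> sets borel" "U' \<in> sets borel" using U by (auto simp: inverse_domains_def borel_open)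
 define g where "g z = f z * indicator U' z" for z
 have g [measurable]: "g \<in> meas borel"
  using f unfolding g_def[abs_def] by (subst (asm) borel_measurable_restrict_space_iff_ennreal) auto
 have im: "inv2 ` (U - {0}) = U' - {0}"
 proof (intro equalityI subsetI)
  fix y assume "y \<in> U' - {0}"
  then have "inv2 y \<in> U - {0}" using U unfolding inverse_domains_def by (metis inv2_inv2 inv2_zero(2) DiffE DiffI singletonD singletonI)
  then show "y \<in> inv2 ` (U - {0})" by (metis imageI inv2_inv2)
 qed (use U in \<open>auto simp: inverse_domains_def\<close>)
 have "(\<integral>\<^sup>+z. f z \<partial>leb U') = (\<integral>\<^sup>+z. g z \<partial>lborel)"
  by (subst nn_integral_restrict_space) (auto simp: g_def intro!: nn_integral_cong)
 also have "... = (\<integral>\<^sup>+z. g z * indicator (inv2 ` (U - {0})) z \<partial>lborel)"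
  unfolding im using AE_lborel_singleton[of "0::real^2"]
  by (intro nn_integral_cong_AE) (auto simp: g_def elim!: eventually_mono split: split_indicator)
 also have "... = (\<integral>\<^sup>+z. g (inv2 z) * (ennreal (1 / (norm z) ^ 4) * indicator (U - {0}) z) \<partial>lborel)"
 proof (rule nn_integral_change_of_variables[where g' = dinv])
  show "inj_on inv2 (U - {0})" by (metis inj_onI inv2_inv2)
  show "inv2 ` (U - {0}) \<in> sets borel" unfolding im by measurable
  show "(inv2 has_derivative dinv x) (at x within U - {0})" if "x \<in> U - {0}" for x
   using inv2_has_derivative[of x] that by (auto intro: has_derivative_at_withinI)
 qed (auto simp: det_dinv)
 also have "... = (\<integral>\<^sup>+z. f (inv2 z) * ennreal (1 / (norm z) ^ 4) * indicator U z \<partial>lborel)"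
 proof (rule nn_integral_cong)
  fix z
  show "g (inv2 z) * (ennreal (1 / (norm z) ^ 4) * indicator (U - {0}) z) = f (inv2 z) * ennreal (1 / (norm z) ^ 4) * indicator U z"
   using U by (cases "z = 0") (auto simp: g_def inverse_domains_def split: split_indicator)
 qed
 also have "... = (\<integral>\<^sup>+z. f (inv2 z) * ennreal (1 / (norm z) ^ 4) \<partial>leb U)"
  by (subst nn_integral_restrict_space) auto
 finally show ?thesis .
qed

lemma inv2_measurable_leb:
 fixes f :: "real^2 => 'b::euclidean_space"
 assumes U: "inverse_domains U U'" and f: "f \<in> meas (leb U)" and f0: "f 0 = 0"
 shows "(%z. f (inv2 z)) \<in> meas (leb U')"
proof -
 have [measurable]: "U \<in> sets borel" using U by (auto simp: inverse_domains_def borel_open)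
 have g [measurable]: "(%z. indicator U z \<cdot> f z) \<in> meas borel"
  using f by (subst (asm) borel_measurable_restrict_space_iff) auto
 have "(%z. indicator U (inv2 z) \<cdot> f (inv2 z)) \<in> meas borel" by measurable
 then have "(%z. indicator U (inv2 z) \<cdot> f (inv2 z)) \<in> meas (leb U')" by (intro measurable_restrict_space1) auto
 moreover have "indicator U (inv2 z) \<cdot> f (inv2 z) = f (inv2 z)" if "z \<in> U'" for z
  using U that f0 by (cases "z = 0") (auto simp: inverse_domains_def indicator_def, metis inv2_inv2 inv2_zero(2))
 ultimately show ?thesis by (subst measurable_cong[where g = "%z. indicator U (inv2 z) \<cdot> f (inv2 z)"]) (auto simp: space_restrict_space)
qed

section \<open>Multiplication by a cutoff function and the Kelvin transform\<close>

text \<open>The trace is left alone, since a \<open>multiplier\<close> equals 1 on the unit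
  circle.\<close>

definition mul :: "(real^2 => real) => (real^2 => real^2) => triple => triple" where
 "mul \<eta> D\<eta> x = ((%z. \<eta> z * fst x z), (%z. \<eta> z \<cdot> fst (snd x) z + fst x z \<cdot> D\<eta> z), snd (snd x))"

text \<open>In dimension two the Kelvin transform is plain composition with the inversion. The trace
  is unchanged because the unit circle is fixed pointwise.\<close>

definition kel :: "triple => triple" where
 "kel x = ((%z. fst x (inv2 z)), (%z. dinv z (fst (snd x) (inv2 z))), snd (snd x))"

lemma linear_mul: "linear (mul \<eta> D\<eta>)"
 by (rule linearI) (auto simp: mul_def fun_eq_iff algebra_simps)

lemma linear_kel: "linear kel"
 by (rule linearI) (auto simp: kel_def fun_eq_iff dinv_linear)

definition multiplier :: "(real^2 => real) => (real^2 => real^2) => bool" where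
 "multiplier \<eta> D\<eta> \<longleftrightarrow> (\<forall>z. GDERIV \<eta> z :> D\<eta> z) \<and> continuous_on UNIV D\<eta> \<and>
   (\<forall>z. norm z = 1 --> \<eta> z = 1)"

lemma multiplierD:
 assumes "multiplier \<eta> D\<eta>"
 shows "continuous_on A \<eta>" "continuous_on A D\<eta>" "\<eta> \<in> meas borel" "D\<eta> \<in> meas borel"
proof -
 have c: "continuous_on UNIV \<eta>" "continuous_on UNIV D\<eta>"
  using assms unfolding multiplier_def gderiv_def by (auto intro!: has_derivative_continuous continuous_at_imp_continuous_on)
 then show "continuous_on A \<eta>" "continuous_on A D\<eta>" "\<eta> \<in> meas borel" "D\<eta> \<in> meas borel"
  by (auto intro: continuous_on_subset borel_measurable_continuous_onI)
qed

text \<open>Only the values on the unit circle count in the third component. The maps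
  \<open>mul\<close> and \<open>kel\<close> keep the old trace function, which agrees with the new
  function on the circle but not elsewhere.\<close>

lemma HH_change_trace:
 assumes C1: "C1c \<psi> D\<psi>" and T: "continuous_on UNIV T" and eq: "!!z. norm z = 1 ==> \<psi> z = T z" and U: "open U"
 shows "(\<psi>, D\<psi>, T) \<in> HH U"
proof -
 have s: "(\<psi>, D\<psi>, \<psi>) \<in> SM" using C1 by (auto simp: SM_def)
 have TT: "(\<psi>, D\<psi>, T) \<in> T3 U"
  using SM_T3[OF U] s continuous_compact_support_L2_circ[OF T] by (auto simp: T3_def)
 have [measurable]: "\<psi> \<in> meas borel" "T \<in> meas borel"
  using T C1_continuous(1)[OF C1] by (auto intro: borel_measurable_continuous_onI)
 have "N2 U ((\<psi>, D\<psi>, \<psi>) - (\<psi>, D\<psi>, T)) = 0"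
  unfolding NN_def EE_def BB_def MM_def by (simp add: integral_circ eq)
 then have "(%n::nat. N2 U ((\<psi>, D\<psi>, \<psi>) - (\<psi>, D\<psi>, T))) ----> 0" by simp
 then show ?thesis using SM_HH[OF U] s by (intro HH_seqI[OF U TT, of "%_. (\<psi>, D\<psi>, \<psi>)"]) auto
qed

lemma C1_mul:
 assumes "multiplier \<eta> D\<eta>" "C1c \<phi> D\<phi>"
 shows "C1c (%z. \<eta> z * \<phi> z) (%z. \<eta> z \<cdot> D\<phi> z + \<phi> z \<cdot> D\<eta> z)"
 unfolding C1_compact_support_def
proof (intro conjI allI)
 show "GDERIV (%z. \<eta> z * \<phi> z) x :> \<eta> x \<cdot> D\<phi> x + \<phi> x \<cdot> D\<eta> x" for x
  using assms by (intro GDERIV_mult) (auto simp: multiplier_def C1_compact_support_def)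
 show "continuous_on UNIV (%z. \<eta> z \<cdot> D\<phi> z + \<phi> z \<cdot> D\<eta> z)"
  using multiplierD(1,2)[OF assms(1)] C1_continuous[OF assms(2)] by (intro continuous_intros)
 have "{z. \<eta> z * \<phi> z ~= 0} \<subseteq> {z. \<phi> z ~= 0}" by auto
 then show "bounded {z. \<eta> z * \<phi> z ~= 0}" using assms(2) by (auto simp: C1_compact_support_def elim: bounded_subset[rotated])
qed

lemma mul_HH_smooth:
 assumes m: "multiplier \<eta> D\<eta>" and s: "s \<in> SM" and U: "open U"
 shows "mul \<eta> D\<eta> s \<in> HH U"
proof -
 obtain \<phi> D\<phi> where C1: "C1c \<phi> D\<phi>" and s: "s = (\<phi>, D\<phi>, \<phi>)" using s by (auto simp: SM_def)
 show ?thesis unfolding s mul_def fst_conv snd_conv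
  by (rule HH_change_trace[OF C1_mul[OF m C1] C1_continuous(1)[OF C1] _ U]) (use m in \<open>auto simp: multiplier_def\<close>)
qed

text \<open>Inversion exchanges vanishing near the origin with boundedness of the support: the
  former makes the support of the transform bounded, the latter makes the transform vanish near the
  origin and so be smooth there.\<close>

lemma C1_kelvin:
 assumes C1: "C1c \<psi> D\<psi>" and \<delta>: "\<delta> > 0" "!!z. norm z < \<delta> ==> \<psi> z = 0" "!!z. norm z < \<delta> ==> D\<psi> z = 0"
 shows "C1c (%z. \<psi> (inv2 z)) (%z. dinv z (D\<psi> (inv2 z)))"
proof -
 obtain R where R: "!!z. norm z > R ==> \<psi> z = 0" "!!z. norm z > R ==> D\<psi> z = 0"
  using GDERIV_compact_support_zero[OF C1] by blast
 define r where "r = 1 / (max R 1 + 1)"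
 have r: "r > 0" by (simp add: r_def)
 have far: "norm (inv2 z) > R" if "z ~= 0" "norm z < r" for z
 proof -
  have "max R 1 + 1 < 1 / norm z" using that unfolding r_def by (simp add: field_simps)
  then show ?thesis by (simp add: norm_inv2)
 qed
 have z0: "\<psi> (inv2 z) = 0" "D\<psi> (inv2 z) = 0" if "norm z < r" for z
  using far[of z] R \<delta> that by (cases "z = 0"; force)+
 have G: "GDERIV (%z. \<psi> (inv2 z)) z :> dinv z (D\<psi> (inv2 z))" for z
 proof (cases "z = 0")
  case False
  then show ?thesis using C1 by (intro GDERIV_inv2) (auto simp: C1_compact_support_def)
 next
  case True
  have "((%_. 0) has_derivative (%h. h \<bullet> dinv z (D\<psi> (inv2 z)))) (at z)" using True \<delta> by (simp add: dinv_linear)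
  then show ?thesis unfolding gderiv_def
   by (rule has_derivative_transform_within_open[of _ _ z UNIV "ball 0 r"]) (use True r z0 in auto)
 qed
 have "isCont (%z. dinv z (D\<psi> (inv2 z))) z" for z
 proof (cases "z = 0")
  case False
  have "continuous_on UNIV D\<psi>" using C1 by (simp add: C1_compact_support_def)
  then have c: "isCont D\<psi> (inv2 z)" by (simp add: continuous_on_eq_continuous_at)
  have i: "isCont inv2 z" using inv2_has_derivative[OF False] by (rule has_derivative_continuous)
  show ?thesis unfolding dinv_def using False by (intro continuous_intros isCont_o2[OF i c]) auto
 next
  case True
  have "\<forall>\<^sub>F y in nhds z. dinv y (D\<psi> (inv2 y)) = 0"
   using eventually_nhds_in_open[of "ball 0 r" z] True r by (auto simp: z0 dinv_linear elim!: eventually_mono)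
  then show ?thesis by (subst isCont_cong[where g = "%_. 0"]) auto
 qed
 then have "continuous_on UNIV (%z. dinv z (D\<psi> (inv2 z)))" by (simp add: continuous_at_imp_continuous_on)
 moreover have "{z. \<psi> (inv2 z) ~= 0} \<subseteq> cball 0 (1 / \<delta>)"
 proof
  fix z assume "z \<in> {z. \<psi> (inv2 z) ~= 0}"
  then have "\<not> norm (inv2 z) < \<delta>" using \<delta> by auto
  then show "z \<in> cball 0 (1 / \<delta>)" using \<delta>(1) by (cases "z = 0") (auto simp: norm_inv2 field_simps)
 qed
 then have "bounded {z. \<psi> (inv2 z) ~= 0}" by (rule bounded_subset[OF bounded_cball])
 ultimately show ?thesis using G unfolding C1_compact_support_def by blast
qed

lemma kel_mul_HH_smooth:
 assumes m: "multiplier \<eta> D\<eta>" and \<delta>: "\<delta> > 0" "!!z. norm z < \<delta> ==> \<eta> z = 0" "!!z. norm z < \<delta> ==> D\<eta> z = 0"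
  and s: "s \<in> SM" and U: "open U"
 shows "kel (mul \<eta> D\<eta> s) \<in> HH U"
proof -
 obtain \<phi> D\<phi> where C1: "C1c \<phi> D\<phi>" and s: "s = (\<phi>, D\<phi>, \<phi>)" using s by (auto simp: SM_def)
 have "C1c (%z. \<eta> (inv2 z) * \<phi> (inv2 z)) (%z. dinv z (\<eta> (inv2 z) \<cdot> D\<phi> (inv2 z) + \<phi> (inv2 z) \<cdot> D\<eta> (inv2 z)))"
  by (rule C1_kelvin[OF C1_mul[OF m C1] \<delta>(1)]) (use \<delta> in auto)
 moreover have "inv2 z = z" if "norm z = 1" for z using that by (simp add: inv2_def)
 ultimately show ?thesis unfolding s mul_def kel_def fst_conv snd_conv
  by (intro HH_change_trace C1_continuous(1)[OF C1] U) (use m in \<open>auto simp: multiplier_def\<close>)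
qed

text \<open>A bounded linear map needs to be checked on smooth triples only.\<close>

lemma HH_map:
 assumes U: "open U" "open U'" and P: "linear P" and T: "!!x. x \<in> T3 U ==> P x \<in> T3 U'"
  and le: "!!x. x \<in> T3 U ==> N2 U' (P x) <= C * NN U x x"
  and SM: "!!s. s \<in> SM ==> P s \<in> HH U'" and x: "x \<in> HH U"
 shows "P x \<in> HH U'"
proof -
 obtain s where s: "!!n. s n \<in> SM" "(%n. N2 U (s n - x)) ----> 0" using HH_seq[OF U(1) x] by blast
 have xT: "x \<in> T3 U" using x HH_T3[of U] by auto
 have d: "s n - x \<in> T3 U" for n using s(1) SM_T3[OF U(1)] xT T3_subspace[of U] by (auto intro: subspace_diff)
 show ?thesis
 proof (rule HH_seqI[OF U(2) T[OF xT], of "%n. P (s n)"])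
  have l: "(%n. C * N2 U (s n - x)) ----> 0" using tendsto_mult_left[OF s(2), of C] by simp
  show "(%n. N2 U' (P (s n) - P x)) ----> 0"
   unfolding linear_diff[OF P, symmetric]
   by (rule tendsto_sandwich[OF _ _ tendsto_const l]; intro always_eventually allI le d psd_nonneg[OF NN_psd[OF U(2)] T])
 qed (use SM s in auto)
qed

text \<open>Product rule and Young's inequality: the factor \<open>1 + \<tau>\<close> falls on the
  energy, and the gradient of the multiplier enters as a mass with weight \<open>w\<close>. This
  weight is left free, so that it can be a multiple of the mass of the eigenvalue problem or an
  integrable density.\<close>

lemma mul_T3:
 assumes U: "open U" and m: "multiplier \<eta> D\<eta>" and b: "\<forall>z\<in>U. \<bar>\<eta> z\<bar> <= 1" and w: "weight w U" "\<forall>z\<in>U. (norm (D\<eta> z))^2 <= w z"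
  and x: "x \<in> T3 U"
 shows "mul \<eta> D\<eta> x \<in> T3 U" "\<tau> > 0 ==> E2 U (mul \<eta> D\<eta> x) <= (1 + \<tau>) * EE U x x + (1 + 1 / \<tau>) * MM w U x x"
  "B2 (mul \<eta> D\<eta> x) = B2 x" "weight v U ==> M2 v U (mul \<eta> D\<eta> x) <= MM v U x x"
proof -
 obtain u D T where xe: "x = (u, D, T)" by (cases x)
 have L: "u \<in> L2 (leb U)" "D \<in> L2 (leb U)" "T \<in> L2 circ_measure" using x by (auto simp: xe T3_def)
 note [measurable] = L2_measurable[OF L(1)] L2_measurable[OF L(2)]
 have [measurable]: "\<eta> \<in> meas (leb U)" "D\<eta> \<in> meas (leb U)"
  using multiplierD[OF m] by (auto intro: measurable_restrict_space1)
 have sp: "space (leb U) = U" by (simp add: space_restrict_space)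
 have eta: "(\<eta> z * r)^2 <= r^2" "(\<eta> z)^2 * r^2 <= r^2" if "z \<in> U" for z r
  using b[rule_format, OF that] mult_right_mono[of "(\<eta> z)^2" 1 "r^2"] by (auto simp: power_mult_distrib abs_square_le_1)
 have iu: "integrable (leb U) (%z. (u z)^2)" using L2_integrable[OF L(1)] by simp
 have iD: "integrable (leb U) (%z. (norm (D z))^2)" by (rule L2_integrable[OF L(2)])
 have iw: "integrable (leb U) (%z. w z * (u z)^2)"
  using MM_integrable[OF w(1) U L(1) L(1)] by (simp add: power2_eq_square)
 have pw: "(norm (\<eta> z \<cdot> D z + u z \<cdot> D\<eta> z))^2 <= (1 + \<tau>) * (norm (D z))^2 + (1 + 1 / \<tau>) * (w z * (u z)^2)"
  if z: "z \<in> U" and t: "\<tau> > 0" for z \<tau>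
 proof -
  define a c where "a = \<eta> z \<cdot> D z" and "c = u z \<cdot> D\<eta> z"
  have "0 <= (norm (\<tau> \<cdot> a - c))^2 / \<tau>" using t by simp
  also have "... = \<tau> * (norm a)^2 - 2 * (a \<bullet> c) + (norm c)^2 / \<tau>"
   unfolding power2_norm_eq_inner using t
   by (simp add: inner_diff_left inner_diff_right inner_commute[of c a] power2_eq_square field_simps)
  finally have "(norm (a + c))^2 <= (1 + \<tau>) * (norm a)^2 + (1 + 1 / \<tau>) * (norm c)^2"
   unfolding power2_norm_eq_inner by (simp add: inner_add_left inner_add_right inner_commute[of c a] algebra_simps)
  also have "... <= (1 + \<tau>) * (norm (D z))^2 + (1 + 1 / \<tau>) * (w z * (u z)^2)"
  proof (intro add_mono mult_left_mono)
   show "(norm a)^2 <= (norm (D z))^2" using eta(2)[OF z, of "norm (D z)"] by (simp add: a_def power_mult_distrib)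
   show "(norm c)^2 <= w z * (u z)^2" using mult_right_mono[OF w(2)[rule_format, OF z], of "(u z)^2"] by (simp add: c_def power_mult_distrib mult.commute)
  qed (use t in auto)
  finally show ?thesis unfolding a_def c_def .
 qed
 have iE: "integrable (leb U) (%z. (norm (\<eta> z \<cdot> D z + u z \<cdot> D\<eta> z))^2)"
 proof (rule Bochner_Integration.integrable_bound)
  show "integrable (leb U) (%z. (1 + 1) * (norm (D z))^2 + (1 + 1 / 1) * (w z * (u z)^2))" using iD iw by auto
  show "AE z in leb U. norm ((norm (\<eta> z \<cdot> D z + u z \<cdot> D\<eta> z))^2) <= norm ((1 + 1) * (norm (D z))^2 + (1 + 1 / 1) * (w z * (u z)^2))"
   using pw[of _ 1] by (intro AE_I2) (force simp: sp)
 qed measurable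
 have iu': "integrable (leb U) (%z. (\<eta> z * u z)^2)"
  by (rule Bochner_Integration.integrable_bound[OF iu]) (auto intro!: AE_I2 simp: sp eta)
 show T: "mul \<eta> D\<eta> x \<in> T3 U"
  unfolding T3_def mul_def xe using iE iu' L(3) by (auto simp: L2_def)
 show "B2 (mul \<eta> D\<eta> x) = B2 x" by (simp add: BB_def mul_def)
 show "E2 U (mul \<eta> D\<eta> x) <= (1 + \<tau>) * EE U x x + (1 + 1 / \<tau>) * MM w U x x" if t: "\<tau> > 0"
 proof -
  have "E2 U (mul \<eta> D\<eta> x) <= (\<integral>z. (1 + \<tau>) * (norm (D z))^2 + (1 + 1 / \<tau>) * (w z * (u z)^2) \<partial>leb U)"
   unfolding EE_def mul_def xe fst_conv snd_conv power2_norm_eq_inner[symmetric]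
   by (rule integral_mono_AE[OF iE]) (use iD iw pw[OF _ t] in \<open>auto intro!: AE_I2 simp: sp\<close>)
  also have "... = (1 + \<tau>) * EE U x x + (1 + 1 / \<tau>) * MM w U x x"
   using iD iw by (simp add: EE_def MM_def xe power2_norm_eq_inner[symmetric] power2_eq_square[of "u _"])
  finally show ?thesis .
 qed
 show "M2 v U (mul \<eta> D\<eta> x) <= MM v U x x" if v: "weight v U"
  unfolding MM_def
 proof (rule integral_mono_AE)
  have "fst (mul \<eta> D\<eta> x) \<in> L2 (leb U)" using iu' by (simp add: L2_def mul_def xe)
  then show "integrable (leb U) (%z. v z * (fst (mul \<eta> D\<eta> x) z * fst (mul \<eta> D\<eta> x) z))" by (intro MM_integrable[OF v U])
  show "integrable (leb U) (%z. v z * (fst x z * fst x z))" using MM_integrable[OF v U] L(1) by (simp add: xe)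
  show "AE z in leb U. v z * (fst (mul \<eta> D\<eta> x) z * fst (mul \<eta> D\<eta> x) z) <= v z * (fst x z * fst x z)"
   using v eta(1) by (intro AE_I2 mult_left_mono) (auto simp: sp weight_def mul_def xe power2_eq_square)
 qed
qed

text \<open>Conformal invariance keeps the energy, while the mass acquires the Jacobian
  \<open>1 / |z|^4\<close>. Vanishing for \<open>|z| < \<delta>\<close> bounds this Jacobian where
  it matters.\<close>

lemma kel_T3:
 assumes U: "inverse_domains U U'" and y: "y \<in> T3 U" and \<delta>: "\<delta> > 0" "\<forall>z. norm z < \<delta> --> fst y z = 0 \<and> fst (snd y) z = 0"
 shows "kel y \<in> T3 U'" "E2 U' (kel y) = EE U y y" "B2 (kel y) = B2 y"
  "w \<in> meas borel ==> (!!z. 0 <= w z) ==> M2 w U' (kel y) = MM (%z. w (inv2 z) / (norm z) ^ 4) U y y"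
  "M2 one U' (kel y) <= (1 / \<delta> ^ 4) * MM one U y y"
proof -
 obtain u D T where ye: "y = (u, D, T)" by (cases y)
 have L: "u \<in> L2 (leb U)" "D \<in> L2 (leb U)" "T \<in> L2 circ_measure" using y by (auto simp: ye T3_def)
 have z0: "u z = 0" "D z = 0" if "norm z < \<delta>" for z using \<delta>(2) that by (auto simp: ye)
 note [measurable] = L2_measurable[OF L(1)] L2_measurable[OF L(2)]
 have um [measurable]: "(%z. u (inv2 z)) \<in> meas (leb U')" using z0 \<delta>(1) by (intro inv2_measurable_leb[OF U]) auto
 have Dm: "(%z. D (inv2 z)) \<in> meas (leb U')" using z0 \<delta>(1) by (intro inv2_measurable_leb[OF U]) auto
 note [measurable] = Dm
 have idm [measurable]: "(%z. z) \<in> meas (leb A)" for A :: "(real^2) set" by (intro measurable_restrict_space1) simp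
 have dm [measurable]: "(%z. dinv z (D (inv2 z))) \<in> meas (leb U')"
  unfolding dinv_def by measurable
 have ns: "(norm (inv2 z)) ^ 4 = 1 / (norm z) ^ 4" for z by (simp add: norm_inv2 power_divide)
 have nnD: "(\<integral>\<^sup>+z. ennreal ((norm (dinv z (D (inv2 z))))^2) \<partial>leb U') = (\<integral>\<^sup>+z. ennreal ((norm (D z))^2) \<partial>leb U)"
 proof (subst nn_integral_inv2[OF U], measurable, rule nn_integral_cong)
  fix z :: "real^2"
  show "ennreal ((norm (dinv (inv2 z) (D (inv2 (inv2 z)))))^2) * ennreal (1 / norm z ^ 4) = ennreal ((norm (D z))^2)"
   using z0(2)[of 0] \<delta>(1) unfolding norm_dinv ns
   by (cases "z = 0") (auto simp: ennreal_mult[symmetric])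
 qed
 have nnw: "(\<integral>\<^sup>+z. ennreal (w z * (u (inv2 z))^2) \<partial>leb U') = (\<integral>\<^sup>+z. ennreal (w (inv2 z) / (norm z) ^ 4 * (u z)^2) \<partial>leb U)"
  if [measurable]: "w \<in> meas borel" and w0: "!!z. 0 <= w z" for w
 proof -
  have [measurable]: "w \<in> meas (leb U')" by (intro measurable_restrict_space1) simp
  show ?thesis
  proof (subst nn_integral_inv2[OF U], measurable, rule nn_integral_cong)
   fix z :: "real^2"
   show "ennreal (w (inv2 z) * (u (inv2 (inv2 z)))^2) * ennreal (1 / norm z ^ 4) = ennreal (w (inv2 z) / norm z ^ 4 * (u z)^2)"
    using w0 by (simp add: ennreal_mult[symmetric])
  qed
 qed
 have nnu: "(\<integral>\<^sup>+z. ennreal ((u (inv2 z))^2) \<partial>leb U') <= ennreal ((1 / \<delta> ^ 4) * (\<integral>z. (u z)^2 \<partial>leb U))"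
 proof -
  have "(\<integral>\<^sup>+z. ennreal ((u (inv2 z))^2) \<partial>leb U') = (\<integral>\<^sup>+z. ennreal (1 / (norm z) ^ 4 * (u z)^2) \<partial>leb U)"
   using nnw[of one] by simp
  also have "... <= (\<integral>\<^sup>+z. ennreal (1 / \<delta> ^ 4) * ennreal ((norm (u z))^2) \<partial>leb U)"
  proof (rule nn_integral_mono)
   fix z :: "real^2"
   have "1 / (norm z) ^ 4 * (u z)^2 <= 1 / \<delta> ^ 4 * (u z)^2"
   proof (cases "norm z < \<delta>")
    case False
    then have "\<delta> ^ 4 <= norm z ^ 4" using \<delta>(1) by (intro power_mono) auto
    moreover have "0 < \<delta> ^ 4" using \<delta>(1) by simp
    ultimately show ?thesis by (intro mult_right_mono divide_left_mono mult_pos_pos) auto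
   qed (simp add: z0)
   then show "ennreal (1 / (norm z) ^ 4 * (u z)^2) <= ennreal (1 / \<delta> ^ 4) * ennreal ((norm (u z))^2)"
    using \<delta>(1) by (simp add: ennreal_mult[symmetric] ennreal_leI)
  qed
  also have "... = ennreal (1 / \<delta> ^ 4) * ennreal (\<integral>z. (u z)^2 \<partial>leb U)"
   using L2_nn[OF L(1)] by (subst nn_integral_cmult) auto
  finally show ?thesis using \<delta>(1) by (simp add: ennreal_mult[symmetric])
 qed
 have uL: "(%z. u (inv2 z)) \<in> L2 (leb U')" using nnu by (intro L2_nnI) (auto intro: le_less_trans)
 have DL: "(%z. dinv z (D (inv2 z))) \<in> L2 (leb U')" using nnD L2_nn[OF L(2)] by (intro L2_nnI) auto
 show kT: "kel y \<in> T3 U'" using uL DL L(3) by (simp add: kel_def ye T3_def)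
 show "B2 (kel y) = B2 y" by (simp add: BB_def kel_def)
 show "E2 U' (kel y) = EE U y y"
  using nnD unfolding EE_def kel_def ye fst_conv snd_conv power2_norm_eq_inner[symmetric]
  by (subst (1 2) integral_eq_nn_integral) auto
 show "M2 w U' (kel y) = MM (%z. w (inv2 z) / (norm z) ^ 4) U y y"
  if [measurable]: "w \<in> meas borel" and w0: "!!z. 0 <= w z"
 proof -
  have [measurable]: "w \<in> meas (leb U')" by (intro measurable_restrict_space1) simp
  have [measurable]: "(%z. w (inv2 z) / (norm z) ^ 4) \<in> meas (leb U)" by (intro measurable_restrict_space1) simp
  have [measurable]: "(%z. w (inv2 z)) \<in> meas (leb U)" by (intro measurable_restrict_space1) simp
  show ?thesis
   using nnw[OF that] unfolding MM_def kel_def ye fst_conv snd_conv power2_eq_square[symmetric]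
   using w0 by (subst (1 2) integral_eq_nn_integral) auto
 qed
 have "ennreal (\<integral>z. (u (inv2 z))^2 \<partial>leb U') <= ennreal ((1 / \<delta> ^ 4) * (\<integral>z. (u z)^2 \<partial>leb U))"
  using nnu L2_nn[OF uL] by simp
 moreover have "0 <= (1 / \<delta> ^ 4) * (\<integral>z. (u z)^2 \<partial>leb U)" using \<delta>(1) by (intro mult_nonneg_nonneg integral_nonneg_AE) auto
 ultimately show "M2 one U' (kel y) <= (1 / \<delta> ^ 4) * MM one U y y"
  by (simp add: ennreal_le_iff MM_def kel_def ye power2_eq_square)
qed

lemma kel_mul_HH:
 assumes U: "inverse_domains U U'" and m: "multiplier \<eta> D\<eta>" and \<delta>: "\<delta> > 0" "!!z. norm z < \<delta> ==> \<eta> z = 0" "!!z. norm z < \<delta> ==> D\<eta> z = 0"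
  and b: "\<forall>z\<in>U. \<bar>\<eta> z\<bar> <= 1" and C: "\<forall>z\<in>U. norm (D\<eta> z) <= C" and x: "x \<in> HH U"
 shows "kel (mul \<eta> D\<eta> x) \<in> HH U'"
proof (rule HH_map[of U U' "%x. kel (mul \<eta> D\<eta> x)", OF _ _ _ _ _ kel_mul_HH_smooth[OF m \<delta>] x])
 show o: "open U" "open U'" using U by (auto simp: inverse_domains_def)
 show "linear (%x. kel (mul \<eta> D\<eta> x))" using linear_compose[OF linear_mul linear_kel] by (simp add: o_def)
 have w: "weight (%_. C^2) U" by (simp add: weight_const)
 have w2: "\<forall>z\<in>U. (norm (D\<eta> z))^2 <= C^2" using C by (auto intro: power_mono)
 fix y assume y: "y \<in> T3 U"
 note mt = mul_T3[OF o(1) m b w w2 y]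
 have z0: "\<forall>z. norm z < \<delta> --> fst (mul \<eta> D\<eta> y) z = 0 \<and> fst (snd (mul \<eta> D\<eta> y)) z = 0" using \<delta>(2,3) by (auto simp: mul_def)
 note kt = kel_T3[OF U mt(1) \<delta>(1) z0]
 show "kel (mul \<eta> D\<eta> y) \<in> T3 U'" by (rule kt)
 note pn = NN_parts[OF o(1) y]
 define K where "K = 3 + 2 * C^2 + 1 / \<delta> ^ 4"
 define d c where "d = 1 / \<delta> ^ 4" and "c = C^2"
 have d4: "0 <= d" "0 <= c" using \<delta>(1) by (auto simp: d_def c_def)
 have "E2 U (mul \<eta> D\<eta> y) <= 2 * EE U y y + 2 * (c * MM one U y y)"
  using mt(2)[of 1] unfolding MM_const[of "C^2"] c_def by simp
 moreover have "M2 one U' (kel (mul \<eta> D\<eta> y)) <= d * MM one U y y"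
  using kt(5) mult_left_mono[OF mt(4)[OF weight_one] d4(1)] unfolding d_def by linarith
 moreover have "0 <= d * EE U y y" "0 <= d * B2 y" "0 <= c * EE U y y" "0 <= c * B2 y"
  using pn d4 by (auto intro!: mult_nonneg_nonneg)
 moreover have "(3 + 2 * c + d) * NN U y y = 3 * EE U y y + 3 * B2 y + 3 * MM one U y y + 2 * (c * EE U y y) + 2 * (c * B2 y)
   + 2 * (c * MM one U y y) + d * EE U y y + d * B2 y + d * MM one U y y" unfolding NN_def by (simp add: algebra_simps)
 ultimately show "N2 U' (kel (mul \<eta> D\<eta> y)) <= K * NN U y y"
  using pn(1-3) unfolding NN_def[of U'] kt(2,3) mt(3) K_def c_def[symmetric] d_def[symmetric] by linarith
qed (use U in \<open>auto simp: inverse_domains_def\<close>)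

section \<open>Cutoff at the origin\<close>

definition hole :: "real => real^2 => real" where "hole \<delta> z = 1 - cutoff ((1 / \<delta>) \<cdot> z)"
definition dhole :: "real => real^2 => real^2" where "dhole \<delta> z = - ((1 / \<delta>) \<cdot> dcutoff ((1 / \<delta>) \<cdot> z))"

lemma cutoff_far: assumes "norm x >= 2" shows "cutoff x = 0" "dcutoff x = 0"
proof -
 have "2^2 <= (norm x)^2" using assms by (intro power_mono) auto
 then show "cutoff x = 0" "dcutoff x = 0" by (simp_all add: cutoff_def dcutoff_def step_simps)
qed

lemma dcutoff_bounded: "\<exists>K>0. \<forall>x. norm (dcutoff x) <= K"
proof -
 obtain K where K: "K > 0" "!!u. \<bar>dstep u\<bar> <= K" using dstep_bounded by blast
 have "norm (dcutoff x) <= K * 2" for x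
 proof (cases "norm x >= 2")
  case False
  have "norm (dcutoff x) = \<bar>dstep (((norm x)^2 - 1) / 3)\<bar> * (2 / 3 * norm x)" by (simp add: dcutoff_def abs_mult)
  also have "... <= K * 2" using K False by (intro mult_mono) auto
  finally show ?thesis .
 qed (use K in \<open>simp add: cutoff_far\<close>)
 then show ?thesis using K(1) by (intro exI[of _ "K * 2"]) auto
qed

lemma hole:
 assumes \<delta>: "0 < \<delta>"
 shows "\<delta> <= 1/2 ==> multiplier (hole \<delta>) (dhole \<delta>)" "norm z < \<delta> ==> hole \<delta> z = 0" "norm z < \<delta> ==> dhole \<delta> z = 0" "\<bar>hole \<delta> z\<bar> <= 1"
  "norm z >= 2 * \<delta> ==> hole \<delta> z = 1" "norm z >= 2 * \<delta> ==> dhole \<delta> z = 0" "0 <= hole \<delta> z"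
proof -
 have n: "norm ((1 / \<delta>) \<cdot> z) = norm z / \<delta>" for z :: "real^2" using \<delta> by simp
 show "norm z < \<delta> ==> hole \<delta> z = 0" "norm z < \<delta> ==> dhole \<delta> z = 0"
  using \<delta> cutoff_disk[of "(1 / \<delta>) \<cdot> z"] by (auto simp: hole_def dhole_def n)
 show one: "norm z >= 2 * \<delta> ==> hole \<delta> z = 1" "norm z >= 2 * \<delta> ==> dhole \<delta> z = 0" for z
  using \<delta> cutoff_far[of "(1 / \<delta>) \<cdot> z"] by (auto simp: hole_def dhole_def n field_simps)
 show "0 <= hole \<delta> z" "\<bar>hole \<delta> z\<bar> <= 1"
  using step_simps(3,4)[of "((norm ((1 / \<delta>) \<cdot> z))^2 - 1) / 3"] by (auto simp: hole_def cutoff_def)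
 assume d2: "\<delta> <= 1/2"
 show "multiplier (hole \<delta>) (dhole \<delta>)"
  unfolding multiplier_def
 proof (intro conjI allI impI)
  fix z :: "real^2"
  have "((%y. (1 / \<delta>) \<cdot> y) has_derivative (%h. (1 / \<delta>) \<cdot> h)) (at z)" by (auto intro!: derivative_eq_intros)
  from has_derivative_compose[OF this cutoff_GDERIV[unfolded gderiv_def]]
  have "((%y. cutoff ((1 / \<delta>) \<cdot> y)) has_derivative (%h. (1 / \<delta>) \<cdot> h \<bullet> dcutoff ((1 / \<delta>) \<cdot> z))) (at z)" .
  from has_derivative_diff[OF has_derivative_const[of 1] this]
  show "GDERIV (hole \<delta>) z :> dhole \<delta> z"
   unfolding gderiv_def hole_def[abs_def] dhole_def by (simp add: inner_minus_right)
  show "norm z = 1 ==> hole \<delta> z = 1" using d2 by (intro one) auto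
 next
  have "continuous_on UNIV dcutoff"
   unfolding dcutoff_def[abs_def]
   by (intro continuous_intros continuous_on_compose2[OF continuous_on_dstep[of UNIV]]) auto
  then have "continuous_on UNIV (%z. dcutoff ((1 / \<delta>) \<cdot> z))"
   by (rule continuous_on_compose2) (auto intro!: continuous_intros)
  then show "continuous_on UNIV (dhole \<delta>)" unfolding dhole_def[abs_def]
   by (intro continuous_on_minus continuous_on_scaleR continuous_on_const)
 qed
qed

lemma dhole_bounded: "\<exists>K>0. \<forall>\<delta>>0. \<forall>z. norm (dhole \<delta> z) <= K / \<delta>"
proof -
 obtain K where K: "K > 0" "!!x. norm (dcutoff x) <= K" using dcutoff_bounded by blast
 show ?thesis
 proof (intro exI[of _ K] conjI allI impI K(1))
  fix \<delta> :: real and z :: "real^2" assume "\<delta> > 0"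
  then show "norm (dhole \<delta> z) <= K / \<delta>" using K(2)[of "(1 / \<delta>) \<cdot> z"] by (simp add: dhole_def divide_right_mono)
 qed
qed

section \<open>The exterior problem\<close>

text \<open>On the exterior domain the multiplier is identically 1. It only replaces the values near
  the origin, which carry no meaning for the exterior domain, by 0, as \<open>kel_T3\<close>
  requires.\<close>

definition invert :: "triple => triple" where "invert x = kel (mul (hole (1/2)) (dhole (1/2)) x)"

lemma linear_invert: "linear invert"
 using linear_compose[OF linear_mul linear_kel] by (simp add: invert_def[abs_def] o_def)

lemma BB_kel_mul [simp]: "BB (kel (mul \<eta> D\<eta> x)) (kel (mul \<eta> D\<eta> y)) = BB x y"
 by (simp add: BB_def kel_def mul_def)

lemma invert:
 assumes x: "x \<in> HH ext"
 shows "invert x \<in> HH disk" "ED (invert x) = EE ext x x" "B2 (invert x) = B2 x"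
  "w \<in> meas borel ==> (!!z. 0 <= w z) ==>
   MD w (invert x) = MM (%z. w (inv2 z) / (norm z) ^ 4) ext x x"
proof -
 define \<eta> D\<eta> where "\<eta> = hole (1/2)" and "D\<eta> = dhole (1/2)"
 note id = inverse_domains_disk_ext(2)
 have m: "multiplier \<eta> D\<eta>" unfolding \<eta>_def D\<eta>_def by (rule hole) auto
 have d: "(0::real) < 1/2" by simp
 have z: "norm z < 1/2 ==> \<eta> z = 0" "norm z < 1/2 ==> D\<eta> z = 0" for z unfolding \<eta>_def D\<eta>_def by (rule hole; simp)+
 have far: "\<eta> z = 1" "D\<eta> z = 0" if "z \<in> ext" for z using that unfolding \<eta>_def D\<eta>_def by (auto intro: hole)
 have b: "\<forall>z\<in>ext. \<bar>\<eta> z\<bar> <= 1" "\<forall>z\<in>ext. norm (D\<eta> z) <= 0" "\<forall>z\<in>ext. (norm (D\<eta> z))^2 <= 0" by (auto simp: far)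
 have xT: "x \<in> T3 ext" using x HH_T3[of ext] by auto
 have sp: "space (leb ext) = ext" by (simp add: space_restrict_space)
 have o: "open ext" by auto
 have mT: "mul \<eta> D\<eta> x \<in> T3 ext" using mul_T3(1)[OF o m b(1) weight_zero b(3) xT] .
 have v0: "\<forall>z. norm z < 1/2 --> fst (mul \<eta> D\<eta> x) z = 0 \<and> fst (snd (mul \<eta> D\<eta> x)) z = 0" using z by (simp add: mul_def)
 note kt = kel_T3[OF id mT d v0]
 show "invert x \<in> HH disk" unfolding invert_def \<eta>_def[symmetric] D\<eta>_def[symmetric]
  by (rule kel_mul_HH[OF id m d z b(1,2) x])
 have "E2 ext (mul \<eta> D\<eta> x) = EE ext x x"
  unfolding EE_def by (intro Bochner_Integration.integral_cong) (auto simp: sp mul_def far simp del: Compl_iff)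
 then show "ED (invert x) = EE ext x x" using kt(2) unfolding invert_def \<eta>_def D\<eta>_def by simp
 show "B2 (invert x) = B2 x" by (simp add: invert_def)
 show "MD w (invert x) = MM (%z. w (inv2 z) / (norm z) ^ 4) ext x x" if w: "w \<in> meas borel" "!!z. 0 <= w z"
 proof -
  have "M2 v ext (mul \<eta> D\<eta> x) = MM v ext x x" for v
   unfolding MM_def by (intro Bochner_Integration.integral_cong) (auto simp: sp mul_def far simp del: Compl_iff)
  then show ?thesis using kt(4)[OF w] unfolding invert_def \<eta>_def D\<eta>_def by simp
 qed
qed

lemma weight_ext: "weight (%z. 1 / (norm z) ^ 4) ext"
 unfolding weight_def by (intro conjI exI[of _ 1]) (auto simp: divide_le_eq intro!: one_le_power less_imp_le)

lemma MM_invert_le: assumes "x \<in> HH ext" shows "MD one (invert x) <= MM one ext x x"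
proof -
 have "x \<in> T3 ext" using assms HH_T3[of ext] by auto
 then have "MM (%z. 1 / (norm z) ^ 4) ext x x <= MM one ext x x"
  by (intro MM_mono[OF weight_ext weight_one]) (auto simp: divide_le_eq intro!: one_le_power less_imp_le)
 then show ?thesis using invert(4)[OF assms, of one] by simp
qed

lemma trace_ext:
 assumes x: "x \<in> HH ext" and h: "h > 0"
 shows "B2 x <= h * EE ext x x + (2 + 1/h) * MM one ext x x"
proof -
 have "B2 x <= h * EE ext x x + (2 + 1/h) * MD one (invert x)"
  using trace_epsilon[OF invert(1)[OF x] h] by (simp add: invert[OF x])
 also have "... <= h * EE ext x x + (2 + 1/h) * MM one ext x x"
  using MM_invert_le[OF x] h by (intro add_left_mono mult_left_mono) auto
 finally show ?thesis .
qed

text \<open>Inversion preserves energy and trace and does not increase the mass, so compactness of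
  the boundary form is inherited from the disk. The mass is not compact on an unbounded domain;
  therefore \<open>S0\<close> consists of the negative numbers.\<close>

lemma robin_form_ext:
 assumes \<alpha>: "\<alpha> ~= 0" shows "robin_form (HH ext) (EE ext) BB (MM one ext) \<alpha> {..<0}"
proof
 have o: "open ext" by auto
 show "subspace (HH ext)" "psd (HH ext) (EE ext)" "psd (HH ext) BB" "psd (HH ext) (MM one ext)" "\<alpha> ~= 0"
  using HH_subspace[OF o] HH_psd[OF o] \<alpha> by auto
 show "\<exists>z\<in>HH ext. (%n. E2 ext (x n - z) + B2 (x n - z) + M2 one ext (x n - z)) ----> 0"
  if x: "!!n. x n \<in> HH ext" and Ca: "form_Cauchy (%y z. EE ext y z + BB y z + MM one ext y z) x" for x
  using HH_complete[of _ x, OF o x] Ca unfolding NN_def[abs_def] by blast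
 show "\<exists>C. \<forall>x\<in>HH ext. \<bar>\<alpha>\<bar> * B2 x <= EE ext x x / 2 + C * MM one ext x x"
 proof (intro exI ballI)
  fix x assume x: "x \<in> HH ext"
  have "B2 x <= (1 / (2 * \<bar>\<alpha>\<bar>)) * EE ext x x + (2 + 1 / (1 / (2 * \<bar>\<alpha>\<bar>))) * MM one ext x x"
   using \<alpha> by (intro trace_ext x) simp
  then have "\<bar>\<alpha>\<bar> * B2 x <= \<bar>\<alpha>\<bar> * ((1 / (2 * \<bar>\<alpha>\<bar>)) * EE ext x x + (2 + 1 / (1 / (2 * \<bar>\<alpha>\<bar>))) * MM one ext x x)"
   by (intro mult_left_mono) auto
  also have "... = EE ext x x / 2 + (\<bar>\<alpha>\<bar> * (2 + 2 * \<bar>\<alpha>\<bar>)) * MM one ext x x" using \<alpha> by (simp add: field_simps)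
  finally show "\<bar>\<alpha>\<bar> * B2 x <= EE ext x x / 2 + (\<bar>\<alpha>\<bar> * (2 + 2 * \<bar>\<alpha>\<bar>)) * MM one ext x x" .
 qed
 show "\<exists>r. strict_mono (r :: nat => nat) \<and> form_Cauchy BB (x \<circ> r) \<and> (\<mu> >= 0 --> form_Cauchy (MM one ext) (x \<circ> r))"
  if x: "!!n. x n \<in> HH ext" and C: "!!n. E2 ext (x n) + B2 (x n) + M2 one ext (x n) <= C" and \<mu>: "\<mu> \<in> {..<0}" for x C and \<mu> :: real
 proof -
  have "ND (invert (x n)) <= C" for n
   using C[of n] MM_invert_le[OF x, of n] by (simp add: NN_def invert[OF x])
  from BB_compact_disk[of "%n. invert (x n)", OF invert(1)[OF x] this]
  obtain r where r: "strict_mono (r :: nat => nat)" "form_Cauchy BB ((%n. invert (x n)) \<circ> r)" by blast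
  then have "form_Cauchy BB (x \<circ> r)"
   by (simp add: form_Cauchy_def linear_diff[OF linear_invert, symmetric]) (simp add: invert_def)
  then show ?thesis using r(1) \<mu> by (intro exI[of _ r]) auto
 qed
qed auto

section \<open>Comparison of the disk with the exterior domain\<close>

abbreviation "tstX \<alpha> S k \<equiv> robin_form.test (HH ext) (EE ext) BB (MM one ext) \<alpha> S k"
definition QX :: "real => triple => real" where "QX \<alpha> y = EE ext y y + \<alpha> * B2 y"

lemma tstX_iff:
 assumes "\<alpha> ~= 0"
 shows "tstX \<alpha> S k \<longleftrightarrow> (\<exists>x. (\<forall>i<k. x i \<in> HH ext) \<and> (\<forall>c. (\<exists>i<k. c i ~= 0) -->
   0 < M2 one ext (lcomb k c x) \<and> QX \<alpha> (lcomb k c x) / M2 one ext (lcomb k c x) \<in> S))"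
 unfolding robin_form.test_def[OF robin_form_ext[OF assms]] robin_form.Q_def[OF robin_form_ext[OF assms]] QX_def Let_def
 by (rule refl)

lemma lambda_ext_spec:
 assumes \<alpha>: "\<alpha> ~= 0" and k: "k >= 1" and t: "tstX \<alpha> {..<0} k"
 shows "robin_count_ge flat_metric ext 1 \<alpha> {..<0} k" "lambda_ext k \<alpha> < 0" "tstX \<alpha> {..\<mu>} k \<longleftrightarrow> lambda_ext k \<alpha> <= \<mu>"
proof -
 note rf = robin_form_ext[OF \<alpha>]
 interpret cd: conformal_disk flat_metric "%_. 1" 1 ext 1 1 1
  by unfold_locales (auto simp: flat_metric_def)
 have "MM cd.w ext = MM one ext" by (simp add: cd.w_def MM_def fun_eq_iff)
 moreover have "cd.U = ext" by (auto simp: cd.U_def)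
 ultimately have cnt: "robin_count_ge flat_metric ext 1 \<alpha> S k \<longleftrightarrow> robin_form.count (HH ext) (EE ext) BB (MM one ext) \<alpha> S k" for S
  using cd.count_iff[of \<alpha> "{..<0}" S k] rf by simp
 from robin_form.eigenvalue_exists[OF rf t k] obtain l where l0: "l < 0"
  and l: "!!S. (\<forall>a b. b \<in> S --> a <= b --> a \<in> S) ==>
   (robin_form.count (HH ext) (EE ext) BB (MM one ext) \<alpha> S k \<longleftrightarrow> l \<in> S) \<and> (tstX \<alpha> S k \<longleftrightarrow> l \<in> S)" by auto
 have "robin_count_ge flat_metric ext 1 \<alpha> ({..\<mu>} \<inter> {..<0}) k \<longleftrightarrow> l <= \<mu>" for \<mu> using l[of "{..\<mu>} \<inter> {..<0}"] l0 unfolding cnt by auto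
 then have le: "lambda_ext k \<alpha> = l"
  unfolding lambda_ext_def robin_negative_eigenvalue_def by (simp add: Least_equality)
 show "robin_count_ge flat_metric ext 1 \<alpha> {..<0} k" using l[of "{..<0}"] l0 unfolding cnt by auto
 show "lambda_ext k \<alpha> < 0" "tstX \<alpha> {..\<mu>} k \<longleftrightarrow> lambda_ext k \<alpha> <= \<mu>" using l0 l[of "{..\<mu>}"] le by auto
qed

text \<open>Trial functions of the exterior problem are inverted into the disk. Carried to the
  exterior, \<open>(1 + s)^2\<close> times the density \<open>ws s\<close> is
  \<open>((1 + s) / (|v|^2 + s))^2\<close>, which is at most 1 there; a smaller mass makes a
  negative quotient still lower.\<close>

lemma lam_le_ext:
 assumes \<alpha>: "\<alpha> ~= 0" and k: "k >= 1" and t: "tstX \<alpha> {..<0} k" and s: "s > -1"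
 shows "lam (ws s) \<alpha> k <= lambda_ext k \<alpha> * (1 + s)^2"
proof -
 define l where "l = lambda_ext k \<alpha>"
 note ls = lambda_ext_spec[OF \<alpha> k t, folded l_def]
 have "tstX \<alpha> {..l} k" using ls(3) by simp
 then obtain x where x: "!!i. i < k ==> x i \<in> HH ext" and t': "!!c. (\<exists>i<k. c i ~= 0) ==>
   0 < M2 one ext (lcomb k c x) \<and> QX \<alpha> (lcomb k c x) / M2 one ext (lcomb k c x) \<in> {..l}"
  unfolding tstX_iff[OF \<alpha>] by blast
 have t: "0 < M2 one ext (lcomb k c x) \<and> QX \<alpha> (lcomb k c x) <= l * M2 one ext (lcomb k c x)"
  if "\<exists>i<k. c i ~= 0" for c using t'[OF that] by (auto simp: divide_le_eq)
 show ?thesis unfolding l_def[symmetric]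
 proof (rule lam_le[OF good_weight_ws[OF s] \<alpha> k, of "%i. invert (x i)"])
  fix c y assume c: "\<exists>i<k. c i ~= 0" and y: "y = (\<Sum>i<k. c i \<cdot> invert (x i))" and yH: "y \<in> HH disk"
  define z where "z = lcomb k c x"
  have z: "z \<in> HH ext" unfolding z_def using x HH_subspace[of ext] by (intro subspace_sum subspace_scale) auto
  have zT: "z \<in> T3 ext" using z HH_T3[of ext] by auto
  have yz: "y = invert z" by (simp add: y z_def linear_sum[OF linear_invert] linear_scale[OF linear_invert])
  have q: "QQ \<alpha> y <= l * MM one ext z z" "MM one ext z z > 0"
   using t[OF c] unfolding z_def[symmetric] yz QQ_def QX_def by (auto simp: invert[OF z])
  have "MM (%v. ws s (inv2 v) / (norm v) ^ 4) ext z z <= MM (%v. 1 / (1 + s)^2 * one v) ext z z"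
  proof (rule MM_mono)
   have le: "ws s (inv2 v) / (norm v) ^ 4 <= 1 / (1 + s)^2" "0 <= ws s (inv2 v) / (norm v) ^ 4" if "v \<in> ext" for v
   proof -
    have n: "norm v > 1" using that by simp
    then have n2: "(norm v)^2 >= 1" by simp
    have "ws s (inv2 v) / (norm v) ^ 4 = 1 / ((1 + s / (norm v)^2) * (norm v)^2)^2"
     by (simp add: ws_def norm_inv2 power_divide power_mult_distrib power_mult[symmetric])
    also have "(1 + s / (norm v)^2) * (norm v)^2 = (norm v)^2 + s"
    proof -
     have "(norm v)^2 ~= 0" using n2 by linarith
     then show ?thesis by (simp add: distrib_right)
    qed
    also have "1 / ((norm v)^2 + s)^2 <= 1 / (1 + s)^2" using n2 s by (intro divide_left_mono power_mono mult_pos_pos zero_less_power) auto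
    finally show "ws s (inv2 v) / (norm v) ^ 4 <= 1 / (1 + s)^2" .
    show "0 <= ws s (inv2 v) / (norm v) ^ 4" by (simp add: ws_def)
   qed
   then show "ws s (inv2 v) / (norm v) ^ 4 <= 1 / (1 + s)^2 * one v" if "v \<in> ext" for v using that by simp
   have "(%v. ws s (inv2 v) / (norm v) ^ 4) \<in> meas borel" by measurable
   then show "weight (%v. ws s (inv2 v) / (norm v) ^ 4) ext" using le unfolding weight_def by blast
  qed (use zT in \<open>auto intro: weight_cmult weight_const\<close>)
  also have "MM (%v. ws s (inv2 v) / (norm v) ^ 4) ext z z = MD (ws s) y"
   unfolding yz by (rule invert(4)[OF z, symmetric]) (auto simp: ws_def)
  finally have M: "(1 + s)^2 * MD (ws s) y <= MM one ext z z" unfolding MM_cmult using s by (simp add: field_simps)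
  have "l * MM one ext z z < 0" using q(2) ls(2) by (simp add: mult_neg_pos)
  then have "0 < MD (ws s) y" using q(1) by (intro MM_pos[OF good_weight_ws[OF s] yH, where \<alpha> = \<alpha>]) auto
  moreover have "l * MM one ext z z <= l * ((1 + s)^2 * MD (ws s) y)" using M ls(2) by (intro mult_left_mono_neg) auto
  ultimately show "0 < MD (ws s) y \<and> QQ \<alpha> y <= l * (1 + s)^2 * MD (ws s) y" using q(1) by (simp add: mult.assoc)
 qed (use invert(1)[OF x] in auto)
qed

text \<open>The transplantation from the disk to the exterior has to remove a neighbourhood of the
  origin, the image of infinity. A hole of radius \<delta> costs \<open>C * \<delta>\<close> in the
  quotient, provided that \<open>s * \<delta>^2\<close> is at least 1, so that the density is
  already large in the hole. The last factor compares the density for finite \<open>s\<close> with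
  its limit.\<close>

lemma ext_test_from_disk:
 assumes \<alpha>: "\<alpha> ~= 0" and k: "k >= 1"
 shows "\<exists>C>0. \<forall>s \<delta>. 0 < \<delta> --> \<delta> <= 1/2 --> 1 <= s * \<delta>^2 --> lam (ws s) \<alpha> k / (1 + s)^2 + C * \<delta> < 0 -->
  tstX \<alpha> {..(lam (ws s) \<alpha> k / (1 + s)^2 + C * \<delta>) * (s * \<delta>^2 / (1 + s * \<delta>^2))^2} k"
proof -
 obtain K where K: "K > 0" "!!\<delta> z. \<delta> > 0 ==> norm (dhole \<delta> z) <= K / \<delta>" using dhole_bounded by blast
 \<comment> \<open>\<open>E0\<close> bounds the energy by the mass for functions with negative
   quadratic form, by Garding's inequality; \<open>50 * K^2\<close> is the cost of the gradient of
   the cutoff.\<close>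
 define E0 where "E0 = 2 * \<bar>\<alpha>\<bar> * (2 + 2 * \<bar>\<alpha>\<bar>)"
 define C where "C = E0 + 50 * K^2"
 have E0: "E0 >= 0" by (simp add: E0_def)
 have C: "C > 0" using K E0 by (simp add: C_def add_nonneg_pos)
 show ?thesis
 proof (intro exI[of _ C] conjI C allI impI)
  fix s \<delta> :: real assume \<delta>: "0 < \<delta>" "\<delta> <= 1/2" and sd: "1 <= s * \<delta>^2"
  define G where "G = lam (ws s) \<alpha> k / (1 + s)^2"
  assume "lam (ws s) \<alpha> k / (1 + s)^2 + C * \<delta> < 0"
  then have neg: "G + C * \<delta> < 0" by (simp add: G_def)
  then have G0: "G < 0" using mult_pos_pos[OF C \<delta>(1)] by linarith
  have s0: "s > 0"
  proof (rule ccontr)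
   assume "\<not> s > 0"
   then have "s * \<delta>^2 <= 0" by (intro mult_nonpos_nonneg) auto
   then show False using sd by simp
  qed
  then have s: "s > -1" by simp
  \<comment> \<open>The best constant with \<open>q / t <= s / (1 + s * t)\<close> for all
    \<open>t >= \<delta>^2\<close>. It relates the limiting density \<open>|z|^-4\<close> outside
    the hole to \<open>v\<close>, and tends to 1 as \<open>s\<close> grows with \<delta>
    fixed.\<close>
  define q where "q = s * \<delta>^2 / (1 + s * \<delta>^2)"
  define \<eta> D\<eta> where "\<eta> = hole \<delta>" and "D\<eta> = dhole \<delta>"
  define P where "P y = kel (mul \<eta> D\<eta> y)" for y
  have linP: "linear P" using linear_compose[OF linear_mul linear_kel] by (simp add: P_def[abs_def] o_def)
  have m: "multiplier \<eta> D\<eta>" unfolding \<eta>_def D\<eta>_def by (rule hole) (use \<delta> in auto)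
  have z: "norm z < \<delta> ==> \<eta> z = 0" "norm z < \<delta> ==> D\<eta> z = 0" for z unfolding \<eta>_def D\<eta>_def using \<delta> by (auto intro: hole)
  have b: "\<forall>z\<in>disk. \<bar>\<eta> z\<bar> <= 1" "\<forall>z\<in>disk. norm (D\<eta> z) <= K / \<delta>" using hole(4)[OF \<delta>(1)] K(2)[OF \<delta>(1)] by (auto simp: \<eta>_def D\<eta>_def)
  have PH: "P y \<in> HH ext" if "y \<in> HH disk" for y
   unfolding P_def by (rule kel_mul_HH[OF inverse_domains_disk_ext(1) m \<delta>(1) z b that])
  define v where "v z = (1 + s)^2 * ws s z" for z
  have wv: "weight v disk" unfolding v_def by (intro weight_cmult weight_ws s) simp
  \<comment> \<open>The gradient of the cutoff is at most \<open>K / \<delta>\<close> and lives in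
    \<open>|z| < 2 * \<delta>\<close>, where \<open>1 + s |z|^2 <= 5 \<delta>^2 (1 + s)\<close> and
    hence \<open>v z\<close> is at least \<open>1 / (25 \<delta>^4)\<close>. The product of the two
    bounds gives \<open>25 * K^2 * \<delta>^2\<close>.\<close>
  define c0 where "c0 = 25 * K^2 * \<delta>^2"
  have c0: "c0 >= 0" by (simp add: c0_def)
  have wc: "weight (%z. c0 * v z) disk" by (intro weight_cmult wv c0)
  have Dle: "\<forall>z\<in>disk. (norm (D\<eta> z))^2 <= c0 * v z"
  proof
   fix z assume "z \<in> disk"
   then have nz: "norm z <= 1" by simp
   have v0: "0 <= v z" using ws_bounds(3)[OF s nz] by (simp add: v_def)
   show "(norm (D\<eta> z))^2 <= c0 * v z"
   proof (cases "norm z >= 2 * \<delta>")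
    case True
    then show ?thesis using hole(6)[OF \<delta>(1)] c0 v0 by (simp add: D\<eta>_def)
   next
    case False
    define p where "p = 1 + s * (norm z)^2"
    have p: "p > 0" unfolding p_def by (rule ws_pos[OF s nz])
    have "(norm z)^2 <= (2 * \<delta>)^2" using False by (intro power_mono) auto
    then have "s * (norm z)^2 <= s * (4 * \<delta>^2)" using s0 by (intro mult_left_mono) (auto simp: power_mult_distrib)
    moreover have "5 * \<delta>^2 * (1 + s) = 5 * \<delta>^2 + 5 * (s * \<delta>^2)" by (simp add: algebra_simps)
    moreover have "s * (4 * \<delta>^2) = 4 * (s * \<delta>^2)" by simp
    moreover have "0 <= \<delta>^2" by simp
    ultimately have "p <= 5 * \<delta>^2 * (1 + s)" using sd unfolding p_def by linarith
    then have "p^2 <= (5 * \<delta>^2 * (1 + s))^2" using p by (intro power_mono) auto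
    then have le: "1 <= (5 * \<delta>^2 * (1 + s))^2 / p^2" using p by simp
    have "(norm (D\<eta> z))^2 <= (K / \<delta>)^2" unfolding D\<eta>_def by (intro power_mono K \<delta>) auto
    also have "... <= (K / \<delta>)^2 * ((5 * \<delta>^2 * (1 + s))^2 / p^2)" using le mult_left_mono[OF le, of "(K / \<delta>)^2"] by simp
    also have "... = c0 * v z" unfolding c0_def v_def ws_def p_def[symmetric] using \<delta>(1) by (simp add: power_divide power_mult_distrib power2_eq_square)
    finally show ?thesis .
   qed
  qed
  obtain x where x: "!!i. i < k ==> x i \<in> HH disk"
   "!!c y. (\<exists>i<k. c i ~= 0) ==> y = lcomb k c x ==> y \<in> HH disk \<and> 0 < MD (ws s) y \<and> QQ \<alpha> y <= lam (ws s) \<alpha> k * MD (ws s) y"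
   using lam_family[OF good_weight_ws[OF s] \<alpha> k] by blast
  have main: "0 < M2 one ext (P y) \<and> QX \<alpha> (P y) <= (G + C * \<delta>) * q^2 * M2 one ext (P y)"
   if y: "y \<in> HH disk" and Mp: "0 < MD (ws s) y" and Q: "QQ \<alpha> y <= lam (ws s) \<alpha> k * MD (ws s) y" for y
  proof -
   have yT: "y \<in> T3 disk" using y HH_T3[of disk] by auto
   note pn = NN_parts[OF open_ball yT]
   define M where "M = MD v y"
   have M: "M = (1 + s)^2 * MD (ws s) y" unfolding M_def v_def by (rule MM_cmult)
   have M0: "M > 0" unfolding M using s Mp by simp
   have QG: "QQ \<alpha> y <= G * M" using Q s unfolding G_def M by simp
   have "MD one y <= M" unfolding M_def
   proof (rule MM_mono[OF weight_one wv open_ball yT])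
    fix z assume "z \<in> disk"
    then have nz: "norm z <= 1" by simp
    have "1 / (1 + s)^2 <= ws s z" using ws_bounds(1)[OF s nz] s0 by simp
    then show "one z <= v z" using s by (simp add: v_def field_simps)
   qed
   moreover have "ED y <= E0 * MD one y"
   proof -
    have "B2 y <= (1 / (2 * \<bar>\<alpha>\<bar>)) * ED y + (2 + 1 / (1 / (2 * \<bar>\<alpha>\<bar>))) * MD one y"
     using \<alpha> by (intro trace_epsilon y) simp
    then have "\<bar>\<alpha>\<bar> * B2 y <= \<bar>\<alpha>\<bar> * ((1 / (2 * \<bar>\<alpha>\<bar>)) * ED y + (2 + 1 / (1 / (2 * \<bar>\<alpha>\<bar>))) * MD one y)"
     by (intro mult_left_mono) auto
    also have "... = ED y / 2 + (E0 / 2) * MD one y" using \<alpha> by (simp add: E0_def field_simps)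
    finally have "\<bar>\<alpha>\<bar> * B2 y <= ED y / 2 + (E0 / 2) * MD one y" .
    moreover have "ED y + \<alpha> * B2 y <= 0" using QG mult_neg_pos[OF G0 M0] by (simp add: QQ_def)
    moreover have "- \<bar>\<alpha>\<bar> * B2 y <= \<alpha> * B2 y" using pn by (intro mult_right_mono) auto
    ultimately show ?thesis by simp
   qed
   ultimately have EM: "ED y <= E0 * M" using E0 by (meson mult_left_mono order_trans)
   note mt = mul_T3[OF open_ball m b(1) wc Dle yT]
   have v0: "\<forall>z. norm z < \<delta> --> fst (mul \<eta> D\<eta> y) z = 0 \<and> fst (snd (mul \<eta> D\<eta> y)) z = 0" using z by (simp add: mul_def)
   note kt = kel_T3[OF inverse_domains_disk_ext(1) mt(1) \<delta>(1) v0, folded P_def]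
   \<comment> \<open>Young's inequality with parameter \<delta> balances the errors: both
     \<open>\<delta> * E0\<close> and \<open>(1 + 1 / \<delta>) * c0\<close> are of order
     \<delta>.\<close>
   have EP: "E2 ext (P y) <= ED y + C * \<delta> * M"
   proof -
    have "E2 ext (P y) <= (1 + \<delta>) * ED y + (1 + 1 / \<delta>) * (c0 * M)"
     unfolding kt(2) M_def using mt(2)[OF \<delta>(1)] unfolding MM_cmult .
    moreover have "\<delta> * ED y <= \<delta> * (E0 * M)" using EM \<delta> by (intro mult_left_mono) auto
    moreover have "(1 + 1 / \<delta>) * (c0 * M) <= 50 * K^2 * \<delta> * M"
    proof -
     have "(1 + 1 / \<delta>) * c0 = 25 * K^2 * (\<delta> * \<delta> + \<delta>)" using \<delta>(1) by (simp add: c0_def power2_eq_square field_simps)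
     also have "... <= 25 * K^2 * (2 * \<delta>)" using \<delta> by (intro mult_left_mono) (auto simp: mult_left_le)
     finally show ?thesis using mult_right_mono[of "(1 + 1 / \<delta>) * c0" "50 * K^2 * \<delta>" M] M0 by (simp add: mult.assoc)
    qed
    ultimately show ?thesis unfolding C_def by (simp add: algebra_simps)
   qed
   have BP: "B2 (P y) = B2 y" by (simp add: P_def)
   have "QX \<alpha> (P y) <= QQ \<alpha> y + C * \<delta> * M" using EP by (simp add: QX_def QQ_def BP)
   then have QP: "QX \<alpha> (P y) <= (G + C * \<delta>) * M" using QG by (simp add: distrib_right)
   then have Qneg: "QX \<alpha> (P y) < 0" using mult_neg_pos[OF neg M0] by linarith
   define N where "N = M2 one ext (P y)"
   have PT: "P y \<in> T3 ext" by (rule kt(1))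
   have oe: "open ext" by auto
   note pe = NN_parts[OF oe PT]
   have Npos: "N > 0"
   \<comment> \<open>With zero mass the trace inequality with
     \<open>h = 1 / \<bar>\<alpha>\<bar>\<close> would make the quadratic form nonnegative.\<close>
   proof (rule ccontr)
    assume "\<not> N > 0"
    then have "N = 0" using pe by (simp add: N_def)
    then have "B2 (P y) <= (1 / \<bar>\<alpha>\<bar>) * E2 ext (P y)"
     using trace_ext[OF PH[OF y], of "1 / \<bar>\<alpha>\<bar>"] \<alpha> by (simp add: N_def)
    then have "\<bar>\<alpha>\<bar> * B2 (P y) <= E2 ext (P y)" using \<alpha> by (simp add: field_simps)
    moreover have "- \<bar>\<alpha>\<bar> * B2 (P y) <= \<alpha> * B2 (P y)" using pe by (intro mult_right_mono) auto
    ultimately show False using Qneg by (simp add: QX_def)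
   qed
   have q01: "q > 0" using sd by (simp add: q_def)
   have "q^2 * N <= M"
   proof -
    have N: "N = MD (%z. 1 / (norm z) ^ 4) (mul \<eta> D\<eta> y)" using kt(4)[of one] by (simp add: N_def)
    have "q^2 * N = (\<integral>z. q^2 * (1 / (norm z) ^ 4 * (fst (mul \<eta> D\<eta> y) z * fst (mul \<eta> D\<eta> y) z)) \<partial>leb disk)"
     unfolding N MM_def by (rule integral_mult_right_zero[symmetric])
    also have "... <= (\<integral>z. v z * (fst y z * fst y z) \<partial>leb disk)"
    proof (rule integral_mono')
     show "integrable (leb disk) (%z. v z * (fst y z * fst y z))" using yT by (intro MM_integrable[OF wv]) (auto simp: T3_def)
     fix z assume "z \<in> space (leb disk)"
     then have zd: "z \<in> disk" and nz: "norm z <= 1" by (auto simp: space_restrict_space)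
     have vz: "v z >= 0" using ws_bounds(3)[OF s nz] by (simp add: v_def)
     then show "0 <= v z * (fst y z * fst y z)" by simp
     show "q^2 * (1 / (norm z) ^ 4 * (fst (mul \<eta> D\<eta> y) z * fst (mul \<eta> D\<eta> y) z)) <= v z * (fst y z * fst y z)"
     proof (cases "norm z < \<delta>")
      case True
      then show ?thesis using v0 vz by simp
     next
      case False
      define t where "t = (norm z)^2"
      have t: "\<delta>^2 <= t" "0 < t" using False \<delta> by (auto simp: t_def intro!: power_mono)
      have p: "1 + s * t > 0" using s0 t by (simp add: add_pos_pos)
      have "s * \<delta>^2 <= s * t" using t s0 by (intro mult_left_mono) auto
      then have "q <= s * t / (1 + s * t)" unfolding q_def using sd p by (simp add: divide_simps) (simp add: algebra_simps)
      also have "... <= (1 + s) * t / (1 + s * t)" using p t by (intro divide_right_mono) (auto simp: distrib_right)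
      finally have "q / t <= (1 + s) / (1 + s * t)" using t p by (simp add: field_simps)
      then have "(q / t)^2 <= ((1 + s) / (1 + s * t))^2" using q01 t by (intro power_mono) auto
      then have le: "q^2 / (norm z) ^ 4 <= v z" by (simp add: v_def ws_def t_def power_divide power_mult[symmetric])
      have "(\<eta> z)^2 <= 1" using b(1) zd by (simp add: abs_square_le_1)
      then have e: "(\<eta> z)^2 * (fst y z)^2 <= (fst y z)^2" using mult_right_mono[of "(\<eta> z)^2" 1 "(fst y z)^2"] by simp
      have "q^2 / (norm z) ^ 4 * ((\<eta> z)^2 * (fst y z)^2) <= v z * (fst y z)^2" by (intro mult_mono le e vz) auto
      then show ?thesis by (simp add: mul_def power2_eq_square mult_ac)
     qed
    qed
    also have "... = M" by (simp add: M_def MM_def)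
    finally show ?thesis .
   qed
   then have "(G + C * \<delta>) * M <= (G + C * \<delta>) * (q^2 * N)" using neg by (intro mult_left_mono_neg) auto
   then show ?thesis using QP Npos unfolding N_def by (simp add: mult.assoc)
  qed
  have lP: "lcomb k c (%i. P (x i)) = P (lcomb k c x)" for c
   by (simp add: linear_sum[OF linP] linear_scale[OF linP])
  show "tstX \<alpha> {..(lam (ws s) \<alpha> k / (1 + s)^2 + C * \<delta>) * (s * \<delta>^2 / (1 + s * \<delta>^2))^2} k"
   unfolding tstX_iff[OF \<alpha>] G_def[symmetric] q_def[symmetric]
  proof (intro exI[of _ "%i. P (x i)"] conjI allI impI)
   fix c :: "nat => real" assume c: "\<exists>i<k. c i ~= 0"
   note xc = x(2)[OF c refl]
   have mm: "0 < M2 one ext (P (lcomb k c x)) \<and> QX \<alpha> (P (lcomb k c x)) <= (G + C * \<delta>) * q^2 * M2 one ext (P (lcomb k c x))"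
    by (rule main) (use xc in auto)
   show "0 < M2 one ext (lcomb k c (%i. P (x i)))" unfolding lP using mm by blast
   show "QX \<alpha> (lcomb k c (%i. P (x i))) / M2 one ext (lcomb k c (%i. P (x i))) \<in> {..(G + C * \<delta>) * q^2}"
    unfolding lP using mm by (simp add: divide_le_eq)
  qed (use PH x in auto)
 qed
qed

text \<open>A logarithmic cutoff: in two dimensions it has small Dirichlet energy, and it vanishes to second
 order at the origin.\<close>

definition logcut :: "real => real^2 => real" where "logcut d z = ln (1 + (norm z)^2 / d) / ln (1 + 1 / d)"
definition dlogcut :: "real => real^2 => real^2" where
 "dlogcut d z = (1 / ((d + (norm z)^2) * ln (1 + 1 / d))) \<cdot> 2 \<cdot> z"

text \<open>The integral \<open>4 * pi / L\<close> tends to zero with \<open>d\<close>. The bound by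
  \<open>|z|^2 / (d * L)\<close> is the second-order zero that compensates a density of order
  \<open>|z|^-4\<close>.\<close>

lemma logcut:
 assumes d: "d > 0"
 defines "L \<equiv> ln (1 + 1 / d)"
 shows "multiplier (logcut d) (dlogcut d)" "norm z <= 1 ==> \<bar>logcut d z\<bar> <= 1" "\<bar>logcut d z\<bar> <= (norm z)^2 / (d * L)"
  "(norm (dlogcut d z))^2 <= 4 / ((d + (norm z)^2) * L^2)"
  "weight (%z. 4 / ((d + (norm z)^2) * L^2)) disk" "(\<integral>z. 4 / ((d + (norm z)^2) * L^2) \<partial>leb disk) = 4 * pi / L"
proof -
 have L: "L > 0" unfolding L_def using d by (intro ln_gt_zero) simp
 have pos: "d + (norm z)^2 > 0" "1 + (norm z)^2 / d > 0" for z :: "real^2" using d by (auto simp: add_pos_nonneg)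
 show "multiplier (logcut d) (dlogcut d)"
  unfolding multiplier_def
 proof (intro conjI allI impI)
  fix z :: "real^2"
  have "((%u. ln (1 + u / d) / L) has_real_derivative 1 / ((d + (norm z)^2) * L)) (at ((norm z)^2))"
  proof -
   have "((%u. ln (1 + u / d) / L) has_real_derivative (1 / d) / (1 + (norm z)^2 / d) / L) (at ((norm z)^2))"
    using pos(2)[of z] L d by (auto intro!: derivative_eq_intros)
   also have "(1 / d) / (1 + (norm z)^2 / d) / L = 1 / ((d + (norm z)^2) * L)" using d by (simp add: field_simps)
   finally show ?thesis .
  qed
  from GDERIV_compose[OF GDERIV_norm_sq this] show "GDERIV (logcut d) z :> dlogcut d z"
   unfolding logcut_def[abs_def] dlogcut_def L_def .
  show "norm z = 1 ==> logcut d z = 1" using L by (simp add: logcut_def L_def)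
 next
  show "continuous_on UNIV (dlogcut d)"
   unfolding dlogcut_def[abs_def] L_def[symmetric] using pos(1) L
   by (intro continuous_intros) (auto simp: less_imp_neq[THEN not_sym])
 qed
 have nn: "ln (1 + (norm z)^2 / d) >= 0" using d by simp
 show "\<bar>logcut d z\<bar> <= 1" if "norm z <= 1"
 proof -
  have "(norm z)^2 <= 1" using that by (simp add: power_le_one)
  then have "ln (1 + (norm z)^2 / d) <= L" unfolding L_def using d pos(2)[of z] by (subst ln_le_cancel_iff) (auto simp: divide_right_mono add_pos_pos)
  then show ?thesis using nn L unfolding logcut_def L_def[symmetric] by simp
 qed
 have "ln (1 + (norm z)^2 / d) <= (norm z)^2 / d" using d by (intro ln_add_one_self_le_self) auto
 then have "ln (1 + (norm z)^2 / d) / L <= (norm z)^2 / d / L" using L by (intro divide_right_mono) auto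
 then show "\<bar>logcut d z\<bar> <= (norm z)^2 / (d * L)" using nn L unfolding logcut_def L_def[symmetric] by simp
 show "(norm (dlogcut d z))^2 <= 4 / ((d + (norm z)^2) * L^2)"
 proof -
  define p where "p = d + (norm z)^2"
  have p: "p > 0" "(norm z)^2 <= p" using pos(1)[of z] d by (auto simp: p_def)
  have "(norm (dlogcut d z))^2 = 4 * (norm z)^2 / (p * p * L^2)"
   using p L unfolding dlogcut_def L_def[symmetric] p_def[symmetric] by (simp add: power_divide power_mult_distrib power2_eq_square)
  also have "... <= 4 * p / (p * p * L^2)" using p by (intro divide_right_mono mult_left_mono) auto
  also have "... = 4 / (p * L^2)" using p by simp
  finally show ?thesis unfolding p_def .
 qed
 have bd: "0 <= 4 / ((d + (norm z)^2) * L^2)" "4 / ((d + (norm z)^2) * L^2) <= 4 / (d * L^2)" for z :: "real^2"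
  using pos(1)[of z] d L by (auto intro!: divide_left_mono mult_pos_pos)
 show "weight (%z. 4 / ((d + (norm z)^2) * L^2)) disk" unfolding weight_def
 proof (intro conjI exI ballI)
  show "(%z::real^2. 4 / ((d + (norm z)^2) * L^2)) \<in> meas borel" by measurable
 qed (rule bd)+
 have "(\<integral>z. 4 / ((d + (norm z)^2) * L^2) \<partial>leb disk) = (\<integral>t. (2 / L^2) * ln (d + 1^2) - (2 / L^2) * ln (d + 0^2) \<partial>ang)"
 proof (rule disk_FTC[where C = "4 / (d * L^2)"])
  show "(%z::real^2. 4 / ((d + (norm z)^2) * L^2)) \<in> meas borel" by measurable
  show "\<bar>4 / ((d + (norm z)^2) * L^2)\<bar> <= 4 / (d * L^2)" for z :: "real^2" using bd[of z] by simp
  fix r t :: real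
  have r: "d + r^2 > 0" using d by (simp add: add_pos_nonneg)
  have "((%r. (2 / L^2) * ln (d + r^2)) has_real_derivative (2 / L^2) * (2 * r / (d + r^2))) (at r)"
   using r by (intro DERIV_cmult) (auto intro!: derivative_eq_intros)
  also have "(2 / L^2) * (2 * r / (d + r^2)) = r * (4 / ((d + (norm (cc r t))^2) * L^2))" using L r by (simp add: field_simps)
  finally show "((%r. (2 / L^2) * ln (d + r^2)) has_real_derivative r * (4 / ((d + (norm (cc r t))^2) * L^2))) (at r)" .
  show "isCont (%r. r * (4 / ((d + (norm (cc r t))^2) * L^2))) r"
   using r L by (auto intro!: continuous_intros)
 qed
 also have "... = 2 * pi * ((2 / L^2) * ln (d + 1^2) - (2 / L^2) * ln (d + 0^2))"
  using integral_ang_FTC[of "%t. t" "%_. 1"] by (simp add: integral_mult_right_zero[symmetric] del: integral_mult_right_zero)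
 also have "(2 / L^2) * ln (d + 1^2) - (2 / L^2) * ln (d + 0^2) = (2 / L^2) * L"
 proof -
  have "1 + 1 / d = (d + 1) / d" using d by (simp add: field_simps)
  then have "L = ln (d + 1) - ln d" using d unfolding L_def by (simp add: ln_div)
  then show ?thesis by (simp add: right_diff_distrib)
 qed
 finally show "(\<integral>z. 4 / ((d + (norm z)^2) * L^2) \<partial>leb disk) = 4 * pi / L" using L by (simp add: power2_eq_square)
qed

lemma lcomb_hh_bounded: "\<exists>K\<ge>0. \<forall>c z. (fst (lcomb k c hh) z)^2 <= K * (\<Sum>i<k. (c i)^2)"
proof -
 have "\<forall>i. \<exists>B. \<forall>z. \<bar>fst (hh i) z\<bar> <= B"
 proof
  fix i
  obtain B where "!!z. \<bar>cutoff z * hfun i z\<bar> <= B" using C1_bounded[OF hh_C1[of i]] by metis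
  then show "\<exists>B. \<forall>z. \<bar>fst (hh i) z\<bar> <= B" by (auto simp: hh_def)
 qed
 then obtain B where B: "!!i z. \<bar>fst (hh i) z\<bar> <= B i" by metis
 have "(fst (lcomb k c hh) z)^2 <= (\<Sum>i<k. (B i)^2) * (\<Sum>i<k. (c i)^2)" for c z
 proof -
  have "fst (lcomb k c hh) z = (\<Sum>i<k. c i * fst (hh i) z)" by (simp add: fst_sum sum_fun_apply)
  then have "(fst (lcomb k c hh) z)^2 <= (\<Sum>i<k. (c i)^2) * (\<Sum>i<k. (fst (hh i) z)^2)" by (simp add: Cauchy_Schwarz_ineq_sum)
  also have "... <= (\<Sum>i<k. (c i)^2) * (\<Sum>i<k. (B i)^2)"
  proof (intro mult_left_mono sum_mono sum_nonneg)
   fix i show "(fst (hh i) z)^2 <= (B i)^2" using power_mono[OF B[of i z], of 2] by simp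
  qed auto
  finally show ?thesis by (simp add: mult.commute)
 qed
 then show ?thesis by (intro exI[of _ "\<Sum>i<k. (B i)^2"]) (auto intro: sum_nonneg)
qed

lemma EE_lcomb_hh_le:
 assumes "k <= 2 * m + 1" shows "ED (lcomb k c hh) <= real m * (\<Sum>i<k. (c i)^2)"
 unfolding EE_lcomb_hh sum_distrib_left using assms by (intro sum_mono mult_right_mono) (auto simp: deg_def)

text \<open>Harmonic functions of degree at most \<open>m\<close> have negative quadratic form, but
  their mass with density \<open>(1 + s)^2 * ws s\<close> is unbounded as \<open>s\<close> grows
  when they do not vanish at the origin. Multiplication by the logarithmic cutoff bounds it
  uniformly in \<open>s\<close> and leaves the form negative.\<close>

lemma lam_ws_uniform:
 assumes k: "k >= 1" "k <= 2 * m + 1" and \<alpha>: "\<alpha> < - real m"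
 shows "\<exists>c>0. \<forall>s\<ge>0. lam (ws s) \<alpha> k <= - c * (1 + s)^2"
proof -
 have \<alpha>0: "\<alpha> ~= 0" using \<alpha> by auto
 obtain K where K: "K >= 0" "!!c z. (fst (lcomb k c hh) z)^2 <= K * (\<Sum>i<k. (c i)^2)" using lcomb_hh_bounded[of k] by blast
 \<comment> \<open>The gap between \<alpha> and \<open>- m\<close>. The parameters \<tau> and
   \<open>L\<close> below are chosen so that each of the two errors takes at most a quarter of it,
   which leaves half.\<close>
 define c0 where "c0 = - \<alpha> - real m"
 have c0: "c0 > 0" using \<alpha> by (simp add: c0_def)
 define \<tau> where "\<tau> = c0 / (4 * (real m + 1))"
 have \<tau>: "\<tau> > 0" using c0 by (simp add: \<tau>_def)
 have \<tau>m: "\<tau> * real m <= c0 / 4"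
 proof -
  have "\<tau> * real m <= \<tau> * (real m + 1)" using \<tau> by simp
  also have "... = c0 / 4" by (simp add: \<tau>_def field_simps)
  finally show ?thesis .
 qed
 define X where "X = 4 * pi * (1 + 1 / \<tau>) * (K + 1)"
 have X: "X > 0" using K \<tau> by (simp add: X_def add_pos_pos add_nonneg_pos)
 define L where "L = 4 * X / c0"
 have L: "L > 0" using X c0 by (simp add: L_def)
 \<comment> \<open>The solution of \<open>ln (1 + 1 / d) = L\<close>.\<close>
 define d where "d = 1 / (exp L - 1)"
 have d: "d > 0" using L by (simp add: d_def)
 have Ld: "ln (1 + 1 / d) = L" by (simp add: d_def)
 note lc = logcut[OF d, unfolded Ld]
 define w where "w z = 4 / ((d + (norm z)^2) * L^2)" for z :: "real^2"
 note lw = lc(4-6)[folded w_def]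
 define P where "P = mul (logcut d) (dlogcut d)"
 have linP: "linear P" unfolding P_def by (rule linear_mul)
 define D where "D = (1 + real m) / (d * L)^2"
 have D: "D > 0" using d L by (simp add: D_def add_pos_nonneg)
 define c where "c = c0 / 2 / D"
 have c: "c > 0" using c0 D by (simp add: c_def)
 show ?thesis
 proof (intro exI[of _ c] conjI c allI impI)
  fix s :: real assume s0: "s >= 0"
  then have s: "s > -1" by simp
  have PH: "P (hh i) \<in> HH disk" for i unfolding P_def by (rule mul_HH_smooth[OF lc(1) hh_SM]) simp
  show "lam (ws s) \<alpha> k <= - c * (1 + s)^2"
  proof (rule lam_le[OF good_weight_ws[OF s] \<alpha>0 k(1), of "%i. P (hh i)"])
   fix a y assume a: "\<exists>i<k. a i ~= 0" and y: "y = (\<Sum>i<k. a i \<cdot> P (hh i))" and yH: "y \<in> HH disk"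
   define u where "u = lcomb k a hh"
   have yu: "y = P u" by (simp add: y u_def linear_sum[OF linP] linear_scale[OF linP])
   define S where "S = (\<Sum>i<k. (a i)^2)"
   have S: "S > 0" unfolding S_def by (rule sum_sq_pos[OF a])
   have uSM: "u \<in> SM" unfolding u_def by (rule sum_hh_SM)
   have uH: "u \<in> HH disk" using uSM SM_HH[of disk] by auto
   have uT: "u \<in> T3 disk" using uH HH_T3[of disk] by auto
   have B: "B2 u = S" unfolding u_def S_def by (rule BB_lcomb_hh)
   have E: "ED u <= real m * S" unfolding u_def S_def by (rule EE_lcomb_hh_le[OF k(2)])
   have b: "\<forall>z\<in>disk. \<bar>logcut d z\<bar> <= 1" "\<forall>z\<in>disk. (norm (dlogcut d z))^2 <= w z" using lc(2) lw(1) by auto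
   note mt = mul_T3[OF open_ball lc(1) b(1) lw(2) b(2) uT, folded P_def]
   have Mw: "MD w u <= K * S * (4 * pi / L)"
   proof -
    have "MD w u <= (\<integral>z. K * S * w z \<partial>leb disk)"
     unfolding MM_def
    proof (rule integral_mono')
     have "integrable (leb disk) w"
     proof -
      obtain C where "\<forall>z\<in>disk. 0 <= w z \<and> w z <= C" "w \<in> meas borel" using lw(2) by (auto simp: weight_def)
      then show ?thesis by (intro disk_integrable[of _ C]) auto
     qed
     then show "integrable (leb disk) (%z. K * S * w z)" by simp
     fix z assume "z \<in> space (leb disk)"
     then have w0: "0 <= w z" using lw(2) by (auto simp: weight_def space_restrict_space)
     show "w z * (fst u z * fst u z) <= K * S * w z"
      using mult_left_mono[OF K(2)[of a z] w0] by (simp add: u_def S_def power2_eq_square mult_ac)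
     show "0 <= K * S * w z" using K S w0 by simp
    qed
    also have "... = K * S * (4 * pi / L)" using lw(3) by simp
    finally show ?thesis .
   qed
   have "ED y <= (1 + \<tau>) * ED u + (1 + 1 / \<tau>) * MD w u" unfolding yu by (rule mt(2)[OF \<tau>])
   moreover have "(1 + \<tau>) * ED u <= (1 + \<tau>) * (real m * S)" using E \<tau> by (intro mult_left_mono) auto
   moreover have "(1 + \<tau>) * (real m * S) = real m * S + \<tau> * real m * S" by (simp add: algebra_simps)
   moreover have "\<tau> * real m * S <= c0 / 4 * S" using \<tau>m S by (intro mult_right_mono) auto
   moreover have "(1 + 1 / \<tau>) * MD w u <= c0 / 4 * S"
   proof -
    have "(1 + 1 / \<tau>) * MD w u <= (1 + 1 / \<tau>) * (K * S * (4 * pi / L))" using Mw \<tau> by (intro mult_left_mono) auto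
    also have "... <= (1 + 1 / \<tau>) * ((K + 1) * S * (4 * pi / L))" using \<tau> S L by (intro mult_left_mono mult_right_mono) auto
    also have "... = X / L * S" by (simp add: X_def)
    also have "... = c0 / 4 * S" using X c0 by (simp add: L_def)
    finally show ?thesis .
   qed
   moreover have By: "B2 y = S" unfolding yu mt(3) B ..
   moreover have "\<alpha> * S = - c0 * S - real m * S" by (simp add: c0_def algebra_simps)
   ultimately have Q: "QQ \<alpha> y <= - (c0 / 2) * S" unfolding QQ_def By by linarith
   \<comment> \<open>For nonnegative \<open>s\<close> the density satisfies
     \<open>v z * |z|^4 <= 1\<close> in the unit disk, and the squared cutoff is at most
     \<open>|z|^4 / (d * L)^2\<close>; so the powers of \<open>|z|\<close> cancel and the bound is
     free of \<open>s\<close>.\<close>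
   define v where "v z = (1 + s)^2 * ws s z" for z
   have "MD v y <= (1 / (d * L)^2) * MD one u"
   proof -
    have "MD v y <= (\<integral>z. (1 / (d * L)^2) * (one z * (fst u z * fst u z)) \<partial>leb disk)"
     unfolding MM_def
    proof (rule integral_mono')
     show "integrable (leb disk) (%z. (1 / (d * L)^2) * (one z * (fst u z * fst u z)))"
      using MM_integrable[OF weight_one open_ball, of "fst u" "0::real^2" 1 "fst u"] uT by (auto simp: T3_def)
     fix z assume "z \<in> space (leb disk)"
     then have z: "norm z <= 1" by (simp add: space_restrict_space)
     show "0 <= (1 / (d * L)^2) * (one z * (fst u z * fst u z))" by simp
     define t where "t = (norm z)^2"
     have t: "0 <= t" "t <= 1" using z by (auto simp: t_def power_le_one)
     have p: "1 + s * t > 0" using s0 t by (simp add: add_pos_nonneg)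
     have "(1 + s) * t / (1 + s * t) <= 1" using p t by (simp add: divide_le_eq algebra_simps)
     moreover have "0 <= (1 + s) * t / (1 + s * t)" using p t s0 by simp
     ultimately have "((1 + s) * t / (1 + s * t))^2 <= 1" by (simp add: power_le_one)
     then have vt: "v z * t^2 <= 1" by (simp add: v_def ws_def t_def power_divide power_mult_distrib)
     have v0: "v z >= 0" using ws_bounds(3)[OF s z] by (simp add: v_def)
     have "\<bar>logcut d z\<bar>^2 <= (t / (d * L))^2" using lc(3)[of z] by (intro power_mono) (auto simp: t_def)
     then have "v z * (logcut d z)^2 <= v z * (t^2 / (d * L)^2)" using v0 by (intro mult_left_mono) (auto simp: power_divide)
     also have "... <= 1 / (d * L)^2" using divide_right_mono[OF vt, of "(d * L)^2"] by simp
     finally have "v z * (logcut d z)^2 * (fst u z)^2 <= 1 / (d * L)^2 * (fst u z)^2" by (intro mult_right_mono) auto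
     then show "v z * (fst y z * fst y z) <= (1 / (d * L)^2) * (one z * (fst u z * fst u z))"
      by (simp add: yu P_def mul_def power2_eq_square mult_ac)
    qed
    also have "... = (1 / (d * L)^2) * MD one u" unfolding MM_def by (rule integral_mult_right_zero)
    finally show ?thesis .
   qed
   also have "... <= (1 / (d * L)^2) * ((1 + real m) * S)"
    using Friedrichs[OF uH] E B by (intro mult_left_mono) (auto simp: distrib_right)
   finally have Mv: "MD v y <= D * S" by (simp add: D_def)
   have Mpos: "0 < MD (ws s) y" using By S by (intro MM_pos[OF good_weight_ws[OF s] yH, where \<alpha> = \<alpha>]) auto
   have "c * MD v y <= c * (D * S)" using Mv c by (intro mult_left_mono) auto
   also have "... = c0 / 2 * S" using D by (simp add: c_def)
   finally have "QQ \<alpha> y <= - (c * MD v y)" using Q by simp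
   then show "0 < MD (ws s) y \<and> QQ \<alpha> y <= - c * (1 + s)^2 * MD (ws s) y"
    using Mpos unfolding v_def MM_cmult by (simp add: mult.assoc)
  qed (rule PH)
 qed
qed

text \<open>The uniform bound \<open>- c\<close> for the scaled eigenvalue on the disk survives the
  transplantation if the hole is so small that \<open>C * \<delta>\<close> is at most
  \<open>c / 2\<close>; \<open>s = 1 / \<delta>^2\<close> is the smallest admissible
  parameter.\<close>

lemma tstX_negative:
 assumes k: "k >= 1" "k <= 2 * m + 1" and \<alpha>: "\<alpha> < - real m"
 shows "tstX \<alpha> {..<0} k"
proof -
 have \<alpha>0: "\<alpha> ~= 0" using \<alpha> by auto
 obtain c where c: "c > 0" "!!s. s >= 0 ==> lam (ws s) \<alpha> k <= - c * (1 + s)^2" using lam_ws_uniform[OF assms] by blast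
 obtain C where C: "C > 0" "!!s \<delta>. 0 < \<delta> ==> \<delta> <= 1/2 ==> 1 <= s * \<delta>^2 ==> lam (ws s) \<alpha> k / (1 + s)^2 + C * \<delta> < 0 ==>
  tstX \<alpha> {..(lam (ws s) \<alpha> k / (1 + s)^2 + C * \<delta>) * (s * \<delta>^2 / (1 + s * \<delta>^2))^2} k"
  using ext_test_from_disk[OF \<alpha>0 k(1)] by blast
 define \<delta> where "\<delta> = min (1/2) (c / (2 * C))"
 have \<delta>: "0 < \<delta>" "\<delta> <= 1/2" "C * \<delta> <= c / 2"
 proof -
  show "0 < \<delta>" "\<delta> <= 1/2" using c C unfolding \<delta>_def by (simp_all only: min.cobounded1) simp
  have "C * \<delta> <= C * (c / (2 * C))" using C by (intro mult_left_mono) (auto simp: \<delta>_def)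
  then show "C * \<delta> <= c / 2" using C by simp
 qed
 define s where "s = 1 / \<delta>^2"
 have s: "s > 0" "s * \<delta>^2 = 1" using \<delta> by (auto simp: s_def)
 have "lam (ws s) \<alpha> k / (1 + s)^2 <= - c" using c(2)[of s] s(1) by (simp add: divide_le_eq)
 then have neg: "lam (ws s) \<alpha> k / (1 + s)^2 + C * \<delta> < 0" using \<delta>(3) c(1) by linarith
 then have b: "(lam (ws s) \<alpha> k / (1 + s)^2 + C * \<delta>) * (s * \<delta>^2 / (1 + s * \<delta>^2))^2 < 0"
  unfolding s(2) by (simp add: mult_neg_pos)
 have "tstX \<alpha> {..(lam (ws s) \<alpha> k / (1 + s)^2 + C * \<delta>) * (s * \<delta>^2 / (1 + s * \<delta>^2))^2} k"
  using C(2)[OF \<delta>(1,2) _ neg] s(2) by simp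
 then obtain x where x: "\<forall>i<k. x i \<in> HH ext" "!!c. (\<exists>i<k. c i ~= 0) ==>
   0 < M2 one ext (lcomb k c x) \<and> QX \<alpha> (lcomb k c x) / M2 one ext (lcomb k c x)
    \<in> {..(lam (ws s) \<alpha> k / (1 + s)^2 + C * \<delta>) * (s * \<delta>^2 / (1 + s * \<delta>^2))^2}"
  unfolding tstX_iff[OF \<alpha>0] by blast
 show ?thesis unfolding tstX_iff[OF \<alpha>0]
 proof (intro exI[of _ x] conjI allI impI)
  fix c :: "nat => real" assume c: "\<exists>i<k. c i ~= 0"
  show "0 < M2 one ext (lcomb k c x)" using x(2)[OF c] by blast
  show "QX \<alpha> (lcomb k c x) / M2 one ext (lcomb k c x) \<in> {..<0}"
   using x(2)[OF c] b by (simp only: atMost_iff lessThan_iff) linarith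
 qed (use x(1) in blast)
qed

text \<open>The upper bound is \<open>lam_le_ext\<close>. For the lower bound the hole is fixed and
  \<open>s\<close> tends to infinity, so that the factor \<open>q s\<close> tends to 1 and only the
  error \<open>C * \<delta>\<close> remains.\<close>

lemma lam_ws_tendsto_ext:
 assumes k: "k >= 1" "k <= 2 * m + 1" and \<alpha>: "\<alpha> < - real m"
 shows "((%s. lam (ws s) \<alpha> k / (1 + s)^2) \<longlongrightarrow> lambda_ext k \<alpha>) at_top"
proof -
 define l where "l = lambda_ext k \<alpha>"
 have \<alpha>0: "\<alpha> ~= 0" using \<alpha> by auto
 note t = tstX_negative[OF assms]
 note le = lambda_ext_spec[OF \<alpha>0 k(1) t, folded l_def]
 obtain C where C: "C > 0" "!!s \<delta>. 0 < \<delta> ==> \<delta> <= 1/2 ==> 1 <= s * \<delta>^2 ==> lam (ws s) \<alpha> k / (1 + s)^2 + C * \<delta> < 0 ==>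
  tstX \<alpha> {..(lam (ws s) \<alpha> k / (1 + s)^2 + C * \<delta>) * (s * \<delta>^2 / (1 + s * \<delta>^2))^2} k"
  using ext_test_from_disk[OF \<alpha>0 k(1)] by blast
 have up: "lam (ws s) \<alpha> k / (1 + s)^2 <= l" if "s > 0" for s
  using lam_le_ext[OF \<alpha>0 k(1) t, of s] that unfolding l_def by (simp add: divide_le_eq)
 show ?thesis unfolding l_def[symmetric]
 proof (rule order_tendstoI)
  fix a assume "l < a"
  show "\<forall>\<^sub>F s in at_top. lam (ws s) \<alpha> k / (1 + s)^2 < a"
   using eventually_gt_at_top[of 0] by eventually_elim (use up \<open>l < a\<close> in \<open>force intro: le_less_trans\<close>)
 next
  fix a assume a: "a < l"
  \<comment> \<open>Two losses of size \<open>e\<close> must fit between \<open>a\<close> and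
    \<open>l\<close>, and \<open>l + e\<close> must stay negative for the transplantation to
    apply.\<close>
  define e where "e = min (l - a) (- l) / 2"
  have e: "0 < e" "2 * e <= l - a" "2 * e <= - l" using a le(2) by (auto simp: e_def)
  define \<delta> where "\<delta> = min (1/2) (e / C)"
  have \<delta>: "0 < \<delta>" "\<delta> <= 1/2" "C * \<delta> <= e"
  proof -
   show "0 < \<delta>" "\<delta> <= 1/2" using e C unfolding \<delta>_def by (simp_all only: min.cobounded1) simp
   have "C * \<delta> <= C * (e / C)" using C by (intro mult_left_mono) (auto simp: \<delta>_def)
   then show "C * \<delta> <= e" using C by simp
  qed
  define q where "q s = (s * \<delta>^2 / (1 + s * \<delta>^2))^2" for s
  have "(q \<longlongrightarrow> 1) at_top"
  proof -
   have d2: "\<delta>^2 > 0" using \<delta> by simp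
   then show ?thesis unfolding q_def[abs_def] by real_asymp
  qed
  then have "((%s. (l - e) * q s) \<longlongrightarrow> (l - e) * 1) at_top" by (intro tendsto_intros)
  then have ev: "\<forall>\<^sub>F s in at_top. (l - e) * q s < l" using e by (intro order_tendstoD(2)) auto
  show "\<forall>\<^sub>F s in at_top. a < lam (ws s) \<alpha> k / (1 + s)^2"
   using ev eventually_ge_at_top[of "1 / \<delta>^2"]
  proof eventually_elim
   case (elim s)
   have s: "1 <= s * \<delta>^2" "s > 0" using elim(2) \<delta>(1) by (auto simp: field_simps intro: less_le_trans[of 0 "1 / \<delta>^2"])
   define G where "G = lam (ws s) \<alpha> k / (1 + s)^2"
   have G: "G <= l" unfolding G_def by (rule up[OF s(2)])
   have neg: "G + C * \<delta> < 0" using G \<delta>(3) e by linarith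
   have "tstX \<alpha> {..(G + C * \<delta>) * q s} k" using C(2)[OF \<delta>(1,2) s(1)] neg unfolding G_def q_def .
   then have "l <= (G + C * \<delta>) * q s" using le(3) by simp
   then have "(l - e) * q s < (G + C * \<delta>) * q s" using elim(1) by linarith
   moreover have "0 <= q s" by (simp add: q_def)
   ultimately have "l - e < G + C * \<delta>" by (meson mult_right_mono not_less)
   then show ?case using \<delta>(3) e unfolding G_def by linarith
  qed
 qed
qed

section \<open>Monotonicity in the curvature parameter\<close>

lemma MM_one_pos: assumes "weight w disk" "x \<in> HH disk" "MD w x > 0" shows "MD one x > 0"
proof -
 have xT: "x \<in> T3 disk" using assms HH_T3[of disk] by auto
 obtain C where C: "MD w x <= C * MD one x" using MM_le_NN[OF open_ball assms(1)] xT by blast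
 show ?thesis
 proof (rule ccontr)
  assume "\<not> ?thesis"
  then have "MD one x = 0" using NN_parts(3)[OF open_ball xT] by simp
  then show False using C assms(3) by simp
 qed
qed

text \<open>The origin is exempted because all \<open>ws s\<close> take the value 1 there; a single
  point is a null set.\<close>

lemma MM_strict:
 assumes w: "weight w1 disk" "weight w2 disk" and lt: "!!z. norm z < 1 ==> z ~= 0 ==> w1 z < w2 z"
  and x: "x \<in> HH disk" and pos: "MD one x > 0"
 shows "MD w1 x < MD w2 x"
proof -
 have xT: "x \<in> T3 disk" using x HH_T3[of disk] by auto
 have L: "fst x \<in> L2 (leb disk)" using xT by (auto simp: T3_def)
 note i = MM_integrable[OF w(1) open_ball L L] MM_integrable[OF w(2) open_ball L L]
 let ?d = "%z. w2 z * (fst x z * fst x z) - w1 z * (fst x z * fst x z)"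
 have z0: "AE z in leb disk. z ~= 0"
  using AE_lborel_singleton[of "0::real^2"] by (subst AE_restrict_space_iff) (auto elim: eventually_mono)
 have nn: "AE z in leb disk. 0 <= ?d z"
  using z0 AE_space[of "leb disk"]
 proof eventually_elim
  case (elim z)
  then have "w1 z * (fst x z * fst x z) <= w2 z * (fst x z * fst x z)"
   using lt[of z] by (intro mult_right_mono) (auto simp: space_restrict_space)
  then show ?case by simp
 qed
 have d: "MD w2 x - MD w1 x = (\<integral>z. ?d z \<partial>leb disk)" unfolding MM_def using i by simp
 have "(\<integral>z. ?d z \<partial>leb disk) ~= 0"
 proof
  assume "(\<integral>z. ?d z \<partial>leb disk) = 0"
  moreover have "integrable (leb disk) ?d" using i by auto
  ultimately have "AE z in leb disk. ?d z = 0" using integral_nonneg_eq_0_iff_AE[OF _ nn] by blast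
  then have "AE z in leb disk. fst x z * fst x z = 0"
   using z0 AE_space[of "leb disk"]
  proof eventually_elim
   case (elim z)
   then have "(w2 z - w1 z) * (fst x z * fst x z) = 0" "w1 z < w2 z" using lt[of z] by (auto simp: space_restrict_space left_diff_distrib)
   then show ?case by auto
  qed
  then have "MD one x = 0" unfolding MM_def by (intro integral_eq_zero_AE) auto
  then show False using pos by simp
 qed
 moreover have "0 <= (\<integral>z. ?d z \<partial>leb disk)" by (rule integral_nonneg_AE[OF nn])
 ultimately show ?thesis using d by linarith
qed

text \<open>With \<open>t = |z|^2 < 1\<close>, the quotient \<open>(1 + s) / (1 + s * t)\<close>
  increases in \<open>s\<close> because \<open>(s' - s) * (1 - t)\<close> is positive.\<close>

lemma MM_ws_strict:
 assumes s: "-1 < s" "s < s'" and x: "x \<in> HH disk" and pos: "MD one x > 0"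
 shows "MD (ws s') x < MD (ws s) x"
  "(1 + s)^2 * MD (ws s) x < (1 + s')^2 * MD (ws s') x"
proof -
 have s': "-1 < s'" using s by simp
 show "MD (ws s') x < MD (ws s) x"
 proof (rule MM_strict[OF weight_ws[OF s'] weight_ws[OF s(1)] _ x pos])
  fix z :: "real^2" assume z: "norm z < 1" "z ~= 0"
  have p: "0 < 1 + s * (norm z)^2" using ws_pos[OF s(1), of z] z by simp
  have "s * (norm z)^2 < s' * (norm z)^2" using s z by (intro mult_strict_right_mono) auto
  then have "(1 + s * (norm z)^2)^2 < (1 + s' * (norm z)^2)^2" using p by (intro power_strict_mono) auto
  moreover have "0 < 1 + s' * (norm z)^2" using ws_pos[OF s', of z] z by simp
  ultimately show "ws s' z < ws s z" unfolding ws_def using p by (intro divide_strict_left_mono mult_pos_pos) auto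
 qed
 have "MD (%z. (1 + s)^2 * ws s z) x < MD (%z. (1 + s')^2 * ws s' z) x"
 proof (rule MM_strict[OF weight_cmult[OF weight_ws[OF s(1)]] weight_cmult[OF weight_ws[OF s']] _ x pos])
  fix z :: "real^2" assume z: "norm z < 1" "z ~= 0"
  define t where "t = (norm z)^2"
  have t: "t < 1" using z by (simp add: t_def power_less_one_iff)
  have p: "0 < 1 + s * t" "0 < 1 + s' * t" using ws_pos[OF s(1), of z] ws_pos[OF s', of z] z by (auto simp: t_def)
  have "(s' - s) * (1 - t) > 0" using s t by simp
  then have "(1 + s) * (1 + s' * t) < (1 + s') * (1 + s * t)" by (simp add: algebra_simps)
  then have "(1 + s) / (1 + s * t) < (1 + s') / (1 + s' * t)" using p by (simp add: divide_less_eq less_divide_eq mult.commute)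
  then have "((1 + s) / (1 + s * t))^2 < ((1 + s') / (1 + s' * t))^2" using s p by (intro power_strict_mono) auto
  then show "(1 + s)^2 * ws s z < (1 + s')^2 * ws s' z" by (simp add: ws_def t_def power_divide)
 qed auto
 then show "(1 + s)^2 * MD (ws s) x < (1 + s')^2 * MD (ws s') x" by (simp only: MM_cmult)
qed

text \<open>The optimal trial space for \<open>w\<close> is used for \<open>w'\<close>. Strict
  inequality on every trial function passes to the eigenvalue because the min-max principle holds
  for open half-lines as well.\<close>

lemma lam_compare:
 assumes w: "good_weight w" "good_weight w'" and \<alpha>: "\<alpha> ~= 0" and k: "k >= 1"
  and lt: "!!y. y \<in> HH disk ==> MD one y > 0 ==> lam w \<alpha> k * MD w y < \<mu> * MD w' y"
 shows "lam w' \<alpha> k < \<mu>"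
proof -
 from lam_family[OF w(1) \<alpha> k] obtain x where x: "!!i. i < k ==> x i \<in> HH disk"
  "!!c y. (\<exists>i<k. c i ~= 0) ==> y = lcomb k c x ==> y \<in> HH disk \<and> 0 < MD w y \<and> QQ \<alpha> y <= lam w \<alpha> k * MD w y" by blast
 show ?thesis
 proof (rule lam_less[OF w(2) \<alpha> k x(1)])
  fix c y assume "\<exists>i<k. c i ~= 0" "y = lcomb k c x"
  from x(2)[OF this] have y: "y \<in> HH disk" "0 < MD w y" "QQ \<alpha> y <= lam w \<alpha> k * MD w y" by auto
  have o: "MD one y > 0" using MM_one_pos[OF _ y(1,2)] w(1) by (auto simp: good_weight_def)
  then show "0 < MD w' y \<and> QQ \<alpha> y < \<mu> * MD w' y"
   using MM_pos[OF w(2) y(1)] y(3) lt[OF y(1) o] by auto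
 qed
qed

text \<open>A smaller mass lowers a negative quotient and raises a positive one. In each of the four
  comparisons the trial space belongs to the eigenvalue whose sign is assumed.\<close>

lemma lam_strict:
 assumes \<alpha>: "\<alpha> ~= 0" and k: "k >= 1" and s: "-1 < s" "s < s'"
 shows "lam (ws s) \<alpha> k < 0 ==> lam (ws s') \<alpha> k < lam (ws s) \<alpha> k"
  "lam (ws s') \<alpha> k < 0 ==> lam (ws s) \<alpha> k / (1 + s)^2 < lam (ws s') \<alpha> k / (1 + s')^2"
  "lam (ws s') \<alpha> k > 0 ==> lam (ws s) \<alpha> k < lam (ws s') \<alpha> k"
  "lam (ws s) \<alpha> k > 0 ==> lam (ws s') \<alpha> k / (1 + s')^2 < lam (ws s) \<alpha> k / (1 + s)^2"
proof -
 have s': "-1 < s'" using s by simp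
 note g = good_weight_ws[OF s(1)] good_weight_ws[OF s']
 note st = MM_ws_strict[OF s]
 have p: "(1 + s)^2 > 0" "(1 + s')^2 > 0" using s s' by auto
 show "lam (ws s') \<alpha> k < lam (ws s) \<alpha> k" if "lam (ws s) \<alpha> k < 0"
  by (rule lam_compare[OF g(1) g(2) \<alpha> k]) (use that st(1) in \<open>auto intro: mult_strict_left_mono_neg\<close>)
 show "lam (ws s) \<alpha> k < lam (ws s') \<alpha> k" if "lam (ws s') \<alpha> k > 0"
  by (rule lam_compare[OF g(2) g(1) \<alpha> k]) (use that st(1) in \<open>auto intro: mult_strict_left_mono\<close>)
 show "lam (ws s) \<alpha> k / (1 + s)^2 < lam (ws s') \<alpha> k / (1 + s')^2" if n: "lam (ws s') \<alpha> k < 0"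
 proof -
  define l where "l = lam (ws s') \<alpha> k / (1 + s')^2"
  have l: "l < 0" "lam (ws s') \<alpha> k = l * (1 + s')^2" using n p by (auto simp: l_def divide_neg_pos)
  have "lam (ws s) \<alpha> k < l * (1 + s)^2"
  proof (rule lam_compare[OF g(2) g(1) \<alpha> k])
   fix y assume "y \<in> HH disk" "MD one y > 0"
   from st(2)[OF this] l(1) show "lam (ws s') \<alpha> k * MD (ws s') y < l * (1 + s)^2 * MD (ws s) y"
    unfolding l(2) mult.assoc by (rule mult_strict_left_mono_neg)
  qed
  then show ?thesis using p(1) unfolding l_def[symmetric] by (simp add: divide_less_eq)
 qed
 show "lam (ws s') \<alpha> k / (1 + s')^2 < lam (ws s) \<alpha> k / (1 + s)^2" if n: "lam (ws s) \<alpha> k > 0"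
 proof -
  define l where "l = lam (ws s) \<alpha> k / (1 + s)^2"
  have l: "l > 0" "lam (ws s) \<alpha> k = l * (1 + s)^2" using n p by (auto simp: l_def)
  have "lam (ws s') \<alpha> k < l * (1 + s')^2"
  proof (rule lam_compare[OF g(1) g(2) \<alpha> k])
   fix y assume "y \<in> HH disk" "MD one y > 0"
   from st(2)[OF this] l(1) show "lam (ws s) \<alpha> k * MD (ws s) y < l * (1 + s')^2 * MD (ws s') y"
    unfolding l(2) mult.assoc by (rule mult_strict_left_mono)
  qed
  then show ?thesis using p(2) unfolding l_def[symmetric] by (simp add: divide_less_eq)
 qed
qed

lemma lam_isCont:
 assumes \<alpha>: "\<alpha> ~= 0" and k: "k >= 1" and s0: "s0 > -1"
  and sgn: "(\<forall>s>-1. lam (ws s) \<alpha> k < 0) \<or> (\<forall>s>-1. lam (ws s) \<alpha> k > 0)"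
 shows "isCont (%s. lam (ws s) \<alpha> k) s0"
proof -
 define f where "f s = lam (ws s) \<alpha> k" for s
 \<comment> \<open>\<open>h s\<close> would be the value at \<open>s\<close> if the scaled quantity
   \<open>f s / (1 + s)^2\<close> were constant. By the opposite monotonicities \<open>f s\<close>
   lies between \<open>f s0\<close> and \<open>h s\<close>.\<close>
 define h where "h s = f s0 * ((1 + s) / (1 + s0))^2" for s
 have bet: "\<bar>f s - f s0\<bar> <= \<bar>h s - f s0\<bar>" if s: "s > -1" for s
 proof -
  have p: "(1 + s)^2 > 0" "(1 + s0)^2 > 0" using s s0 by auto
  have h: "f s < h s \<longleftrightarrow> f s / (1 + s)^2 < f s0 / (1 + s0)^2" "h s < f s \<longleftrightarrow> f s0 / (1 + s0)^2 < f s / (1 + s)^2"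
   unfolding h_def power_divide using p by (simp_all add: divide_less_eq less_divide_eq field_simps)
  consider "s = s0" | "s < s0" | "s > s0" by linarith
  then show ?thesis
  proof cases
   case 1
   then show ?thesis by simp
  next
   case 2
   show ?thesis using sgn
   proof
    assume n: "\<forall>s>-1. lam (ws s) \<alpha> k < 0"
    have "f s0 < f s" "f s < h s" unfolding h(1) unfolding f_def
     using lam_strict(1,2)[OF \<alpha> k s 2] n s s0 by auto
    then show ?thesis by simp
   next
    assume n: "\<forall>s>-1. lam (ws s) \<alpha> k > 0"
    have "f s < f s0" "h s < f s" unfolding h(2) unfolding f_def
     using lam_strict(3,4)[OF \<alpha> k s 2] n s s0 by auto
    then show ?thesis by simp
   qed
  next
   case 3
   show ?thesis using sgn
   proof
    assume n: "\<forall>s>-1. lam (ws s) \<alpha> k < 0"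
    have "f s < f s0" "h s < f s" unfolding h(2) unfolding f_def
     using lam_strict(1,2)[OF \<alpha> k s0 3] n s s0 by auto
    then show ?thesis by simp
   next
    assume n: "\<forall>s>-1. lam (ws s) \<alpha> k > 0"
    have "f s0 < f s" "f s < h s" unfolding h(1) unfolding f_def
     using lam_strict(3,4)[OF \<alpha> k s0 3] n s s0 by auto
    then show ?thesis by simp
   qed
  qed
 qed
 have "((%s. \<bar>h s - f s0\<bar>) \<longlongrightarrow> \<bar>f s0 * ((1 + s0) / (1 + s0))^2 - f s0\<bar>) (at s0)"
  unfolding h_def using s0 by (intro tendsto_intros) auto
 then have l: "((%s. \<bar>h s - f s0\<bar>) \<longlongrightarrow> 0) (at s0)" using s0 by simp
 have "\<forall>\<^sub>F s in at s0. s \<in> {-1<..}" using s0 by (intro eventually_at_in_open') auto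
 then have "\<forall>\<^sub>F s in at s0. norm (f s - f s0) <= \<bar>h s - f s0\<bar>"
  by eventually_elim (use bet in auto)
 then have "((%s. f s - f s0) \<longlongrightarrow> 0) (at s0)" using l by (rule Lim_null_comparison)
 then show ?thesis unfolding isCont_def f_def[symmetric] by (simp add: LIM_zero_iff)
qed

section \<open>Signs and limits of the eigenvalues\<close>

lemma hh_HH: "hh i \<in> HH disk" using hh_SM SM_HH[of disk] by auto

text \<open>Upper bounds by harmonic trial functions. The degree bound is handed over for every
  admissible \<open>m\<close>, so that each application may choose its own.\<close>

lemma lam_le_hh:
 assumes w: "good_weight w" and \<alpha>: "\<alpha> ~= 0" and k: "k >= 1"
  and le: "!!y. y \<in> HH disk ==> B2 y > 0 ==> (!!m. k <= 2 * m + 1 ==> ED y <= real m * B2 y) ==> QQ \<alpha> y <= \<mu> * MD w y"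
 shows "lam w \<alpha> k <= \<mu>"
proof (rule lam_le[OF w \<alpha> k, of hh])
 fix c y assume c: "\<exists>i<k. c i ~= 0" and y: "y = lcomb k c hh" and yH: "y \<in> HH disk"
 have B: "B2 y = (\<Sum>i<k. (c i)^2)" unfolding y by (rule BB_lcomb_hh)
 have Bp: "B2 y > 0" unfolding B by (rule sum_sq_pos[OF c])
 have "ED y <= real m * B2 y" if "k <= 2 * m + 1" for m unfolding B unfolding y by (rule EE_lcomb_hh_le[OF that])
 then show "0 < MD w y \<and> QQ \<alpha> y <= \<mu> * MD w y"
  using MM_pos[OF w yH] Bp le[OF yH Bp] by auto
qed (rule hh_HH)

text \<open>For harmonic functions of degree at most \<open>m\<close> the energy is at most
  \<open>m\<close> times the boundary term, which \<alpha> more than outweighs.\<close>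

lemma lam_negative:
 assumes k: "k >= 1" "k <= 2 * m + 1" and \<alpha>: "\<alpha> < - real m" and s: "s > -1"
 shows "lam (ws s) \<alpha> k < 0"
proof (rule lam_less[OF good_weight_ws[OF s] _ k(1), of _ hh])
 fix c y assume c: "\<exists>i<k. c i ~= 0" and y: "y = lcomb k c hh" and yH: "y \<in> HH disk"
 have B: "B2 y = (\<Sum>i<k. (c i)^2)" unfolding y by (rule BB_lcomb_hh)
 have Bp: "B2 y > 0" unfolding B by (rule sum_sq_pos[OF c])
 have E: "ED y <= real m * B2 y" unfolding B unfolding y by (rule EE_lcomb_hh_le[OF k(2)])
 have "(real m + \<alpha>) * B2 y < 0" using \<alpha> Bp by (intro mult_neg_pos) auto
 then have "QQ \<alpha> y < 0" using E by (simp add: QQ_def distrib_right)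
 then show "0 < MD (ws s) y \<and> QQ \<alpha> y < 0 * MD (ws s) y"
  using MM_pos[OF good_weight_ws[OF s] yH] Bp by auto
qed (use \<alpha> hh_HH in auto)

lemma orthogonal_trace:
 assumes y: "y \<in> HH disk" "\<forall>p<2*m+1. BB y (hh p) = 0" and \<alpha>: "\<alpha> <= 0"
 shows "B2 y <= ED y / real (m + 1)" "(1 + \<alpha> / real (m + 1)) * ED y <= QQ \<alpha> y"
proof -
 show *: "B2 y <= ED y / real (m + 1)" using Steklov[OF y(1), of m] y(2) by simp
 have "\<alpha> * (ED y / real (m + 1)) <= \<alpha> * B2 y" using * \<alpha> by (intro mult_left_mono_neg) auto
 then show "(1 + \<alpha> / real (m + 1)) * ED y <= QQ \<alpha> y" by (simp add: QQ_def distrib_right)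
qed

text \<open>At \<open>\<alpha> = - (m + 1)\<close> the form is nonpositive on the
  \<open>2m + 3\<close> harmonic functions of degree up to \<open>m + 1\<close>, and by Steklov's
  inequality nonnegative on functions whose traces are orthogonal to the first
  \<open>2m + 1\<close>.\<close>

lemma lam_zero:
 assumes \<alpha>: "\<alpha> = - real m - 1" and k: "2 * m + 2 <= k" "k <= 2 * m + 3" and s: "s > -1"
 shows "lam (ws s) \<alpha> k = 0"
proof (rule antisym)
 have \<alpha>0: "\<alpha> ~= 0" "\<alpha> <= 0" using \<alpha> by auto
 have k1: "k >= 1" using k by simp
 show "lam (ws s) \<alpha> k <= 0"
 proof (rule lam_le_hh[OF good_weight_ws[OF s] \<alpha>0(1) k1])
  fix y assume "!!n. k <= 2 * n + 1 ==> ED y <= real n * B2 y"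
  from this[of "m + 1"] k have "ED y <= (real m + 1) * B2 y" by (simp add: add.commute)
  then show "QQ \<alpha> y <= 0 * MD (ws s) y" by (simp add: QQ_def \<alpha> algebra_simps)
 qed
 have "2 * m + 1 < k" using k by simp
 from lam_orthogonal[OF good_weight_ws[OF s] \<alpha>0(1) this] obtain y where
  y: "y \<in> HH disk" "\<forall>p<2*m+1. BB y (hh p) = 0" "0 < MD (ws s) y" "QQ \<alpha> y <= lam (ws s) \<alpha> k * MD (ws s) y" by blast
 have "1 + \<alpha> / real (m + 1) = 0" unfolding \<alpha> by (simp add: field_simps)
 then have "0 <= QQ \<alpha> y" using orthogonal_trace(2)[OF y(1,2) \<alpha>0(2)] by simp
 then have "0 <= lam (ws s) \<alpha> k * MD (ws s) y" using y(4) by linarith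
 then show "0 <= lam (ws s) \<alpha> k" using y(3) by (simp add: zero_le_mult_iff)
qed

text \<open>Steklov's inequality on the complement of sufficiently many harmonic functions. The
  estimate by the energy, with \<kappa> independent of \<open>s\<close>, is retained beyond the mere
  sign because the limits of the positive eigenvalues depend on it.\<close>

lemma lam_positive_estimate:
 assumes \<alpha>: "- real m - 1 <= \<alpha>" "\<alpha> < 0" and k: "2 * m + 2 <= k" and ne: "\<not> (k <= 2 * m + 3 \<and> \<alpha> = - real m - 1)"
 shows "\<exists>\<kappa>>0. \<forall>s>-1. \<exists>y\<in>HH disk. 0 < ED y \<and> 0 < MD (ws s) y \<and> B2 y <= ED y \<and>
  \<kappa> * ED y <= lam (ws s) \<alpha> k * MD (ws s) y"
proof -
 \<comment> \<open>In the borderline case degree \<open>m + 1\<close> contributes zero and has to be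
   excluded as well; there \<open>k\<close> is at least \<open>2m + 4\<close>, which leaves room for
   the additional orthogonality conditions.\<close>
 define n where "n = (if \<alpha> = - real m - 1 then m + 1 else m)"
 define \<kappa> where "\<kappa> = 1 + \<alpha> / real (n + 1)"
 have nk: "2 * n + 1 < k" using k ne by (auto simp: n_def)
 have "- \<alpha> < real (n + 1)" using \<alpha> by (auto simp: n_def)
 then have \<kappa>: "\<kappa> > 0" unfolding \<kappa>_def by (simp add: field_simps)
 have \<alpha>0: "\<alpha> ~= 0" "\<alpha> <= 0" using \<alpha> by auto
 show ?thesis
 proof (intro exI[of _ \<kappa>] conjI \<kappa> allI impI)
  fix s :: real assume s: "s > -1"
  from lam_orthogonal[OF good_weight_ws[OF s] \<alpha>0(1) nk] obtain y where
   y: "y \<in> HH disk" "\<forall>p<2*n+1. BB y (hh p) = 0" "0 < MD (ws s) y" "QQ \<alpha> y <= lam (ws s) \<alpha> k * MD (ws s) y" by blast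
  note o = orthogonal_trace[OF y(1,2) \<alpha>0(2), folded \<kappa>_def]
  have yT: "y \<in> T3 disk" using y HH_T3[of disk] by auto
  note pn = NN_parts[OF open_ball yT]
  have "ED y / real (n + 1) <= ED y / 1" using pn(1) by (intro divide_left_mono) auto
  then have B: "B2 y <= ED y" using o(1) by simp
  have "0 < MD one y" by (rule MM_one_pos[OF weight_ws[OF s] y(1,3)])
  then have "0 < ED y" using Friedrichs[OF y(1)] B by linarith
  then show "\<exists>y\<in>HH disk. 0 < ED y \<and> 0 < MD (ws s) y \<and> B2 y <= ED y \<and>
    \<kappa> * ED y <= lam (ws s) \<alpha> k * MD (ws s) y"
   using y o B by (intro bexI[of _ y]) auto
 qed
qed

lemma lam_positive:
 assumes "- real m - 1 <= \<alpha>" "\<alpha> < 0" "2 * m + 2 <= k" "\<not> (k <= 2 * m + 3 \<and> \<alpha> = - real m - 1)" "s > -1"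
 shows "lam (ws s) \<alpha> k > 0"
proof -
 obtain \<kappa> where \<kappa>: "\<kappa> > 0" "\<forall>s>-1. \<exists>y\<in>HH disk. 0 < ED y \<and> 0 < MD (ws s) y \<and> B2 y <= ED y \<and>
  \<kappa> * ED y <= lam (ws s) \<alpha> k * MD (ws s) y" using lam_positive_estimate[OF assms(1-4)] by blast
 then obtain y where y: "0 < ED y" "0 < MD (ws s) y" "\<kappa> * ED y <= lam (ws s) \<alpha> k * MD (ws s) y"
  using assms(5) by blast
 then have "0 < lam (ws s) \<alpha> k * MD (ws s) y" using mult_pos_pos[OF \<kappa>(1) y(1)] by linarith
 then show ?thesis using y(2) by (simp add: zero_less_mult_iff)
qed

text \<open>The estimates at -1 are indexed by the exponent \<open>q\<close> of the multiplier in
  \<open>trace_ws_minus1\<close>, which may grow as \<open>1 + s\<close> shrinks.\<close>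

lemma bound_tendsto_0:
 assumes C: "C > 0" and b: "!!s q. s > -1 ==> real q >= C ==> q >= 1 ==> 1 + s <= 1 / real q ==> \<bar>f s\<bar> <= C / real q"
 shows "(f \<longlongrightarrow> (0::real)) (at_right (-1))"
proof (rule tendstoI)
 fix e :: real assume e: "e > 0"
 obtain q :: nat where q: "real q > max (max C 1) (C / e)" using reals_Archimedean2 by blast
 then have q1: "real q >= C" "q >= 1" "C / e < real q" by auto
 then have "C / real q < e" using e by (simp add: field_simps)
 moreover have "\<forall>\<^sub>F s in at_right (-1). -1 < s \<and> s < - 1 + 1 / real q"
  unfolding eventually_at_right_field using q1 by (intro exI[of _ "-1 + 1 / real q"]) auto
 ultimately show "\<forall>\<^sub>F s in at_right (-1). dist (f s) 0 < e"
 proof (elim eventually_mono, goal_cases)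
  case (1 s)
  then show ?case using b[of s q] q1 by simp
 qed
qed

text \<open>The boundary term is at most \<open>r\<close> times energy plus mass. For
  \<open>r <= 1\<close> the energy absorbs its share and the quotient is at least
  \<open>- r\<close>.\<close>

lemma lam_ws_lower:
 assumes \<alpha>: "\<alpha> < 0" and k: "k >= 1" and s: "s > -1" "1 + s <= 1 / real q" and q: "q >= 1" "real q >= 28 * \<bar>\<alpha>\<bar>"
 shows "- (28 * \<bar>\<alpha>\<bar>) / real q <= lam (ws s) \<alpha> k"
proof -
 have \<alpha>0: "\<alpha> ~= 0" and k0: "0 < k" using \<alpha> k by auto
 from lam_orthogonal[OF good_weight_ws[OF s(1)] \<alpha>0 k0] obtain y where
  y: "y \<in> HH disk" "0 < MD (ws s) y" "QQ \<alpha> y <= lam (ws s) \<alpha> k * MD (ws s) y" by blast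
 have yT: "y \<in> T3 disk" using y HH_T3[of disk] by auto
 note pn = NN_parts[OF open_ball yT]
 define r where "r = 28 * \<bar>\<alpha>\<bar> / real q"
 have r: "r <= 1" "r >= 0" using q by (auto simp: r_def divide_le_eq)
 have "\<bar>\<alpha>\<bar> * B2 y <= \<bar>\<alpha>\<bar> * ((28 / real q) * (ED y + MD (ws s) y))"
  using trace_ws_minus1[OF y(1) s q(1)] by (intro mult_left_mono) auto
 also have "... = r * ED y + r * MD (ws s) y" by (simp add: r_def distrib_left mult_ac)
 also have "r * ED y <= 1 * ED y" using r pn by (intro mult_right_mono) auto
 finally have "- r * MD (ws s) y <= QQ \<alpha> y" using \<alpha> by (simp add: QQ_def)
 then have "- r * MD (ws s) y <= lam (ws s) \<alpha> k * MD (ws s) y" using y(3) by linarith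
 then have "- r <= lam (ws s) \<alpha> k" using y(2) by (simp only: mult_le_cancel_right_pos)
 then show ?thesis by (simp add: r_def)
qed

text \<open>For harmonic trial functions the energy is at most \<open>k\<close> times the trace, and
  \<open>trace_ws_minus1\<close> bounds the trace by the mass; absorbing half of the trace doubles
  the constant 28.\<close>

lemma lam_ws_upper:
 assumes \<alpha>: "\<alpha> < 0" and k: "k >= 1" and s: "s > -1" "1 + s <= 1 / real q" and q: "q >= 1" "real q >= 56 * real k"
 shows "lam (ws s) \<alpha> k <= 56 * real k / real q"
proof -
 have \<alpha>0: "\<alpha> ~= 0" using \<alpha> by auto
 show ?thesis
 proof (rule lam_le_hh[OF good_weight_ws[OF s(1)] \<alpha>0 k])
  fix y assume y: "y \<in> HH disk" and "!!m. k <= 2 * m + 1 ==> ED y <= real m * B2 y"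
  from this(2)[of k] have E: "ED y <= real k * B2 y" by simp
  have yT: "y \<in> T3 disk" using y HH_T3[of disk] by auto
  note pn = NN_parts[OF open_ball yT]
  have "B2 y <= (28 / real q) * (real k * B2 y + MD (ws s) y)"
   using trace_ws_minus1[OF y s q(1)] mult_left_mono[of "ED y + MD (ws s) y" "real k * B2 y + MD (ws s) y" "28 / real q"] E by simp
  also have "... = (28 * real k / real q) * B2 y + (28 / real q) * MD (ws s) y" by (simp add: distrib_left)
  also have "(28 * real k / real q) * B2 y <= (1/2) * B2 y" using q pn by (intro mult_right_mono) (auto simp: divide_le_eq)
  finally have "B2 y <= (56 / real q) * MD (ws s) y" by simp
  then have "real k * B2 y <= real k * ((56 / real q) * MD (ws s) y)" by (intro mult_left_mono) auto
  moreover have "\<alpha> * B2 y <= 0" using \<alpha> pn by (intro mult_nonpos_nonneg) auto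
  ultimately show "QQ \<alpha> y <= 56 * real k / real q * MD (ws s) y" using E by (simp add: QQ_def mult_ac)
 qed
qed

lemma lam_tendsto_minus1:
 assumes \<alpha>: "\<alpha> < 0" and k: "k >= 1" shows "((%s. lam (ws s) \<alpha> k) \<longlongrightarrow> 0) (at_right (-1))"
proof (rule bound_tendsto_0)
 show "28 * \<bar>\<alpha>\<bar> + 56 * real k > 0" using k by (simp add: add_nonneg_pos)
 fix s :: real and q :: nat assume s: "s > -1" and q: "28 * \<bar>\<alpha>\<bar> + 56 * real k <= real q" "q >= 1" "1 + s <= 1 / real q"
 have "- (28 * \<bar>\<alpha>\<bar>) / real q <= lam (ws s) \<alpha> k" "lam (ws s) \<alpha> k <= 56 * real k / real q"
  using lam_ws_lower[OF \<alpha> k s q(3,2)] lam_ws_upper[OF \<alpha> k s q(3,2)] q(1) by auto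
 moreover have "(28 * \<bar>\<alpha>\<bar> + 56 * real k) / real q = 28 * \<bar>\<alpha>\<bar> / real q + 56 * real k / real q" by (rule add_divide_distrib)
 moreover have "0 <= 28 * \<bar>\<alpha>\<bar> / real q" "0 <= 56 * real k / real q" by auto
 moreover have "- (28 * \<bar>\<alpha>\<bar>) / real q = - (28 * \<bar>\<alpha>\<bar> / real q)" by simp
 ultimately show "\<bar>lam (ws s) \<alpha> k\<bar> <= (28 * \<bar>\<alpha>\<bar> + 56 * real k) / real q" unfolding abs_le_iff by linarith
qed

lemma inverse_at_right: "c > 0 ==> filterlim (%s::real. c / (1 + s)) at_top (at_right (-1))"
 by real_asymp

text \<open>On harmonic functions of degree at most \<open>m\<close> the quadratic form is at most
  \<open>(m + \<alpha>)\<close> times the trace, while \<open>(1 + s)^2\<close> times the mass is at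
  most \<open>(1 + s) * (1 + m)\<close> times it. The quotient of the two factors is the rate
  \<open>- c / (1 + s)\<close>.\<close>

lemma g_negative_minus1:
 assumes k: "k >= 1" "k <= 2 * m + 1" and \<alpha>: "\<alpha> < - real m"
 shows "filterlim (%s. lam (ws s) \<alpha> k / (1 + s)^2) at_bot (at_right (-1))"
proof -
 define c where "c = (- \<alpha> - real m) / (1 + real m)"
 have c: "c > 0" unfolding c_def using \<alpha> by (intro divide_pos_pos) auto
 have \<alpha>0: "\<alpha> ~= 0" using \<alpha> by auto
 have le: "lam (ws s) \<alpha> k / (1 + s)^2 <= - (c / (1 + s))" if s: "-1 < s" "s < 0" for s
 proof -
  have s1: "1 + s > 0" using s by simp
  have "lam (ws s) \<alpha> k <= - (c / (1 + s)) * (1 + s)^2"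
  proof (rule lam_le_hh[OF good_weight_ws[OF s(1)] \<alpha>0 k(1)])
   fix y assume y: "y \<in> HH disk" and "!!m. k <= 2 * m + 1 ==> ED y <= real m * B2 y"
   from this(2)[OF k(2)] have E: "ED y <= real m * B2 y" .
   have "(1 + s)^2 * MD (ws s) y <= (1 + s) * (B2 y + ED y)" using s by (intro mass_ws_minus1 y) auto
   also have "... <= (1 + s) * ((1 + real m) * B2 y)" using E s1 by (intro mult_left_mono) (auto simp: distrib_right)
   finally have "c / (1 + s) * ((1 + s)^2 * MD (ws s) y) <= c / (1 + s) * ((1 + s) * ((1 + real m) * B2 y))"
    using c s1 by (intro mult_left_mono) auto
   also have "... = c * (1 + real m) * B2 y" using s1 by simp
   also have "... = (- \<alpha> - real m) * B2 y" by (simp add: c_def)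
   also have "... <= - QQ \<alpha> y" using E by (simp add: QQ_def algebra_simps)
   finally show "QQ \<alpha> y <= - (c / (1 + s)) * (1 + s)^2 * MD (ws s) y" by (simp add: mult.assoc)
  qed
  then show ?thesis using s1 by (simp add: divide_le_eq)
 qed
 show ?thesis unfolding filterlim_uminus_at_bot
 proof (rule filterlim_at_top_mono[OF inverse_at_right[OF c]])
  have "\<forall>\<^sub>F s in at_right (-1). -1 < s \<and> s < (0::real)"
   unfolding eventually_at_right_field by (intro exI[of _ 0]) auto
  then show "\<forall>\<^sub>F s in at_right (-1). c / (1 + s) <= - (lam (ws s) \<alpha> k / (1 + s)^2)"
  proof eventually_elim
   case (elim s)
   then show ?case using le[of s] by linarith
  qed
 qed
qed

lemma f_negative_infinity:
 assumes k: "k >= 1" "k <= 2 * m + 1" and \<alpha>: "\<alpha> < - real m"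
 shows "filterlim (%s. lam (ws s) \<alpha> k) at_bot at_top"
proof -
 obtain c where c: "c > 0" "!!s. s >= 0 ==> lam (ws s) \<alpha> k <= - c * (1 + s)^2" using lam_ws_uniform[OF assms] by blast
 have "filterlim (%s::real. c * (1 + s)^2) at_top at_top" using c(1) by real_asymp
 then show ?thesis unfolding filterlim_uminus_at_bot
 proof (rule filterlim_at_top_mono)
  show "\<forall>\<^sub>F s in at_top. c * (1 + s)^2 <= - lam (ws s) \<alpha> k"
   using eventually_ge_at_top[of 0]
  proof eventually_elim
   case (elim s)
   then show ?case using c(2)[of s] by simp
  qed
 qed
qed

text \<open>Both limits come from \<open>general\<close>: the form is at least \<kappa> times the
  energy, and the scaled mass is at most \<open>r\<close> times twice the energy, with
  \<open>r = 1 + s\<close> at one end and \<open>r = 1 / sqrt s\<close> at the other.\<close>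

lemma positive_limits:
 assumes a: "- real m - 1 <= \<alpha>" "\<alpha> < 0" "2 * m + 2 <= k" "\<not> (k <= 2 * m + 3 \<and> \<alpha> = - real m - 1)"
 shows "filterlim (%s. lam (ws s) \<alpha> k / (1 + s)^2) at_top (at_right (-1))" "filterlim (%s. lam (ws s) \<alpha> k) at_top at_top"
proof -
 obtain \<kappa> where \<kappa>: "\<kappa> > 0" "!!s. s > -1 ==> \<exists>y\<in>HH disk. 0 < ED y \<and> 0 < MD (ws s) y \<and> B2 y <= ED y \<and>
  \<kappa> * ED y <= lam (ws s) \<alpha> k * MD (ws s) y" using lam_positive_estimate[OF a] by blast
 have general: "\<kappa> / (2 * r) <= lam (ws s) \<alpha> k / b"
  if s: "s > -1" and r: "r > 0" and b: "b > 0"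
   and le: "!!y. y \<in> HH disk ==> b * MD (ws s) y <= r * (B2 y + ED y)" for s r b
 proof -
  obtain y where y: "y \<in> HH disk" "0 < ED y" "0 < MD (ws s) y" "B2 y <= ED y"
   "\<kappa> * ED y <= lam (ws s) \<alpha> k * MD (ws s) y" using \<kappa>(2)[OF s] by blast
  have l: "lam (ws s) \<alpha> k > 0" by (rule lam_positive[OF a s])
  have "b * MD (ws s) y <= r * (2 * ED y)"
   using le[OF y(1)] mult_left_mono[of "B2 y + ED y" "2 * ED y" r] y(4) r by linarith
  then have "lam (ws s) \<alpha> k * (b * MD (ws s) y) <= lam (ws s) \<alpha> k * (r * (2 * ED y))" using l by (intro mult_left_mono) auto
  moreover have "b * (\<kappa> * ED y) <= b * (lam (ws s) \<alpha> k * MD (ws s) y)" using y(5) b by (intro mult_left_mono) auto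
  ultimately have "(b * \<kappa>) * ED y <= (lam (ws s) \<alpha> k * (2 * r)) * ED y" by (simp add: mult_ac)
  then have "b * \<kappa> <= lam (ws s) \<alpha> k * (2 * r)" using y(2) by (simp only: mult_le_cancel_right_pos)
  then show ?thesis using r b by (simp add: divide_le_eq le_divide_eq mult_ac)
 qed
 show "filterlim (%s. lam (ws s) \<alpha> k / (1 + s)^2) at_top (at_right (-1))"
 proof (rule filterlim_at_top_mono)
  show "filterlim (%s::real. \<kappa> / 2 / (1 + s)) at_top (at_right (-1))" using \<kappa>(1) by (intro inverse_at_right) auto
  have "\<forall>\<^sub>F s in at_right (-1). -1 < s \<and> s < (0::real)"
   unfolding eventually_at_right_field by (intro exI[of _ 0]) auto
  then show "\<forall>\<^sub>F s in at_right (-1). \<kappa> / 2 / (1 + s) <= lam (ws s) \<alpha> k / (1 + s)^2"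
  proof eventually_elim
   case (elim s)
   then show ?case using general[of s "1 + s" "(1 + s)^2"] mass_ws_minus1[of _ s] by simp
  qed
 qed
 show "filterlim (%s. lam (ws s) \<alpha> k) at_top at_top"
 proof (rule filterlim_at_top_mono)
  show "filterlim (%s::real. \<kappa> / 2 * sqrt s) at_top at_top" using \<kappa>(1) by real_asymp
  show "\<forall>\<^sub>F s in at_top. \<kappa> / 2 * sqrt s <= lam (ws s) \<alpha> k"
   using eventually_ge_at_top[of 1]
  proof eventually_elim
   case (elim s)
   then show ?case using general[of s "1 / sqrt s" 1] mass_ws_infinity[of _ s] by simp
  qed
 qed
qed

section \<open>Functions concentrated at the origin as \<open>s\<close> tends to infinity\<close>

lemma psd_lincomb_le:
 assumes V: "subspace V" and q: "psd V q" and x: "!!i. i < k ==> x i \<in> V"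
 shows "q (\<Sum>i<k. c i \<cdot> x i) (\<Sum>i<k. c i \<cdot> x i) <= (\<Sum>i<k. (c i)^2) * (\<Sum>i<k. q (x i) (x i))"
proof -
 define y where "y = (\<Sum>i<k. c i \<cdot> x i)"
 have y: "y \<in> V" unfolding y_def using x V by (intro subspace_sum subspace_scale) auto
 have n: "q y y >= 0" by (rule psd_nonneg[OF q y])
 have "q y y = (\<Sum>i<k. c i * q (x i) y)" unfolding y_def[of] using symbil_sum[OF V psd_symbil[OF q], of "{..<k}" x y c] x y
  unfolding y_def by simp
 then have "(q y y)^2 <= (\<Sum>i<k. (c i)^2) * (\<Sum>i<k. (q (x i) y)^2)" by (simp add: Cauchy_Schwarz_ineq_sum)
 also have "... <= (\<Sum>i<k. (c i)^2) * (\<Sum>i<k. q (x i) (x i) * q y y)"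
  using psd_Cauchy_Schwarz[OF V q x y] by (intro mult_left_mono sum_mono sum_nonneg) auto
 also have "... = ((\<Sum>i<k. (c i)^2) * (\<Sum>i<k. q (x i) (x i))) * q y y" by (simp add: sum_distrib_right mult.assoc)
 finally have le: "q y y * q y y <= ((\<Sum>i<k. (c i)^2) * (\<Sum>i<k. q (x i) (x i))) * q y y" by (simp add: power2_eq_square)
 have "q y y <= (\<Sum>i<k. (c i)^2) * (\<Sum>i<k. q (x i) (x i))"
 proof (cases "q y y = 0")
  case True
  have "0 <= (\<Sum>i<k. (c i)^2) * (\<Sum>i<k. q (x i) (x i))" using psd_nonneg[OF q x] by (intro mult_nonneg_nonneg sum_nonneg) auto
  then show ?thesis using True by simp
 next
  case False
  then show ?thesis using le n by (simp add: mult_le_cancel_right)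
 qed
 then show ?thesis unfolding y_def .
qed

lemma linear_scl: "linear (scl \<rho>)"
 by (rule linearI) (auto simp: scl_def fun_eq_iff algebra_simps)

text \<open>Dilation by \<open>sqrt s\<close> turns \<open>ws s\<close> into \<open>ws 1\<close>,
  which is at least \<open>1/4\<close> on the disk, and the mass acquires the factor
  \<open>1 / s\<close>. The energy on the disk stays below that of \<open>u\<close> on the plane, by
  scale invariance.\<close>

lemma scl_concentrated:
 assumes u: "u \<in> SM" and s: "s >= 1"
 shows "scl (sqrt s) u \<in> SM" "ED (scl (sqrt s) u) <= EE UNIV u u"
  "MD one u <= 4 * s * MD (ws s) (scl (sqrt s) u)"
proof -
 obtain \<phi> D\<phi> where C1: "C1c \<phi> D\<phi>" and u: "u = (\<phi>, D\<phi>, \<phi>)" using u by (auto simp: SM_def)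
 define \<rho> where "\<rho> = sqrt s"
 have \<rho>: "\<rho> >= 1" "\<rho>^2 = s" "\<rho> > 0" using s by (auto simp: \<rho>_def)
 have s1: "s > -1" using s by simp
 have v: "scl \<rho> u \<in> SM" unfolding SM_def scl_def u using scl_C1[OF C1 \<rho>(3)] by auto
 then show "scl (sqrt s) u \<in> SM" by (simp add: \<rho>_def)
 have vT: "scl \<rho> u \<in> T3 disk" using v SM_T3[of disk] by auto
 have uT: "u \<in> T3 UNIV" using C1 SM_T3[of UNIV] by (auto simp: SM_def u)
 note [measurable] = C1_measurable[OF C1]
 have "ennreal (ED (scl \<rho> u)) = (\<integral>\<^sup>+z. ennreal ((norm (\<rho> \<cdot> D\<phi> (\<rho> \<cdot> z)))^2) \<partial>leb disk)"
  unfolding EE_def power2_norm_eq_inner[symmetric] using vT by (subst L2_nn) (auto simp: T3_def scl_def u)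
 also have "... = (\<integral>\<^sup>+z. ennreal ((norm (\<rho> \<cdot> D\<phi> (\<rho> \<cdot> z)))^2) * indicator disk z \<partial>lborel)"
  by (rule nn_integral_restrict_space) auto
 also have "... <= (\<integral>\<^sup>+z. ennreal (\<rho>^2) * ennreal ((norm (D\<phi> (\<rho> \<cdot> z)))^2) \<partial>lborel)"
  by (intro nn_integral_mono) (auto simp: indicator_def ennreal_mult[symmetric] power_mult_distrib)
 also have "... = ennreal (\<rho>^2) * (\<integral>\<^sup>+z. ennreal ((norm (D\<phi> (\<rho> \<cdot> z)))^2) \<partial>lborel)"
  by (rule nn_integral_cmult) measurable
 also have "... = (\<integral>\<^sup>+z. ennreal ((norm (D\<phi> z))^2) \<partial>lborel)"
  using nn_integral_scale[of "%z. ennreal ((norm (D\<phi> z))^2)", OF _ \<rho>(3)] by simp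
 also have "... = (\<integral>\<^sup>+z. ennreal ((norm (D\<phi> z))^2) \<partial>leb UNIV)"
  by (subst nn_integral_restrict_space) auto
 also have "... = ennreal (EE UNIV u u)"
  using uT by (subst L2_nn) (auto simp: T3_def u EE_def power2_norm_eq_inner)
 finally show "ED (scl (sqrt s) u) <= EE UNIV u u"
  using psd_nonneg[OF EE_psd uT] by (simp add: ennreal_le_iff \<rho>_def)
 have wi: "integrable (leb disk) (%z. ws s z * (\<phi> (\<rho> \<cdot> z))^2)"
  using SM_integrable(2)[OF scl_C1[OF C1 \<rho>(3)] open_ball weight_ws[OF s1]] .
 have "(1 / \<rho>)^2 * (\<integral>z. ws s ((1 / \<rho>) \<cdot> z) * (\<phi> (\<rho> \<cdot> ((1 / \<rho>) \<cdot> z)))^2 \<partial>leb disk) <= (\<integral>z. ws s z * (\<phi> (\<rho> \<cdot> z))^2 \<partial>leb disk)"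
  by (rule integral_scale_le[OF _ _ wi]) (use \<rho> in \<open>auto simp: ws_def\<close>)
 also have "(%z. ws s ((1 / \<rho>) \<cdot> z) * (\<phi> (\<rho> \<cdot> ((1 / \<rho>) \<cdot> z)))^2) = (%z. ws 1 z * (\<phi> z)^2)"
  using \<rho> by (auto simp: ws_def power_divide fun_eq_iff)
 finally have 1: "MD (ws 1) u <= s * MD (ws s) (scl \<rho> u)"
  using \<rho> s by (simp add: MM_def u scl_def power2_eq_square[of "\<phi> _"] power_divide field_simps)
 have uD: "u \<in> T3 disk" using C1 SM_T3[of disk] by (auto simp: SM_def u)
 have "MD (%z. 1/4 * one z) u <= MD (ws 1) u"
  by (rule MM_mono[OF weight_cmult[OF weight_one] weight_ws open_ball uD]) (use ws_bounds(1)[of 1] in auto)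
 then have "MD one u <= 4 * MD (ws 1) u" unfolding MM_cmult by simp
 then show "MD one u <= 4 * s * MD (ws s) (scl (sqrt s) u)" using 1 by (simp add: \<rho>_def)
qed

text \<open>Trial functions at the scale \<open>1 / sqrt s\<close> have bounded energy and mass at
  least of order \<open>1 / s\<close>; the boundary term is nonpositive and is dropped. Linear
  growth is negligible against \<open>(1 + s)^2\<close>.\<close>

lemma lam_ws_linear_growth:
 assumes \<alpha>: "\<alpha> < 0" and k: "k >= 1" shows "\<exists>C. \<forall>s\<ge>1. lam (ws s) \<alpha> k <= C * s"
proof -
 have \<alpha>0: "\<alpha> ~= 0" using \<alpha> by auto
 define A where "A = (\<Sum>i<k. E2 UNIV (hh i))"
 have T: "hh i \<in> T3 UNIV" for i by (rule hh_T3) simp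
 have A: "A >= 0" unfolding A_def by (intro sum_nonneg psd_nonneg[OF EE_psd T])
 have "lam (ws s) \<alpha> k <= A * (16 * (1 + real k)) * s" if s: "s >= 1" for s
 proof -
  have s1: "s > -1" using s by simp
  have SH: "scl (sqrt s) (hh i) \<in> HH disk" for i using scl_concentrated(1)[OF hh_SM s] SM_HH[of disk] by auto
  show ?thesis
  proof (rule lam_le[OF good_weight_ws[OF s1] \<alpha>0 k, of "%i. scl (sqrt s) (hh i)"])
   fix c y assume c: "\<exists>i<k. c i ~= 0" and y: "y = (\<Sum>i<k. c i \<cdot> scl (sqrt s) (hh i))" and yH: "y \<in> HH disk"
   define u where "u = lcomb k c hh"
   have yu: "y = scl (sqrt s) u" by (simp add: y u_def linear_sum[OF linear_scl] linear_scale[OF linear_scl])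
   have uSM: "u \<in> SM" unfolding u_def by (rule sum_hh_SM)
   then have uH: "u \<in> HH disk" using SM_HH[of disk] by auto
   define S where "S = (\<Sum>i<k. (c i)^2)"
   have S: "S > 0" unfolding S_def by (rule sum_sq_pos[OF c])
   have B: "B2 u = S" unfolding u_def S_def by (rule BB_lcomb_hh)
   have E: "ED u <= real k * S" unfolding u_def S_def by (rule EE_lcomb_hh_le) simp
   \<comment> \<open>This value makes the energy term at most half of \<open>S\<close>, so that the
     mass controls the other half.\<close>
   have h: "1 / (2 * real k) > 0" using k by simp
   note sc = scl_concentrated[OF uSM s, folded yu]
   have "S <= (1 / (2 * real k)) * ED u + (2 + 2 * real k) * MD one u"
    using trace_epsilon[OF uH h] B by simp
   moreover have "(1 / (2 * real k)) * ED u <= (1 / (2 * real k)) * (real k * S)" using E by (intro mult_left_mono) auto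
   moreover have "(1 / (2 * real k)) * (real k * S) = S / 2" using k by simp
   ultimately have "S <= 4 * (1 + real k) * MD one u" by (simp add: algebra_simps)
   also have "4 * (1 + real k) * MD one u <= 4 * (1 + real k) * (4 * s * MD (ws s) y)"
    using sc(3) by (intro mult_left_mono) auto
   also have "... = 16 * (1 + real k) * s * MD (ws s) y" by simp
   finally have SM: "S <= 16 * (1 + real k) * s * MD (ws s) y" .
   then have "0 < 16 * (1 + real k) * s * MD (ws s) y" using S by linarith
   then have Mp: "0 < MD (ws s) y" by (rule zero_less_mult_pos) (use s in auto)
   have yT: "y \<in> T3 disk" using yH HH_T3[of disk] by auto
   have "\<alpha> * B2 y <= 0" using \<alpha> NN_parts(2)[OF open_ball yT] by (intro mult_nonpos_nonneg) auto
   then have "QQ \<alpha> y <= EE UNIV u u" using sc(2) by (simp add: QQ_def)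
   also have "... <= S * A" unfolding S_def A_def u_def by (rule psd_lincomb_le[OF T3_subspace EE_psd T])
   also have "... <= (16 * (1 + real k) * s * MD (ws s) y) * A" using SM A by (intro mult_right_mono)
   finally show "0 < MD (ws s) y \<and> QQ \<alpha> y <= A * (16 * (1 + real k)) * s * MD (ws s) y"
    using Mp by (simp add: mult_ac)
  qed (rule SH)
 qed
 then show ?thesis by blast
qed

lemma g_positive_infinity:
 assumes a: "- real m - 1 <= \<alpha>" "\<alpha> < 0" "2 * m + 2 <= k" "\<not> (k <= 2 * m + 3 \<and> \<alpha> = - real m - 1)"
 shows "((%s. lam (ws s) \<alpha> k / (1 + s)^2) \<longlongrightarrow> 0) at_top"
proof -
 have k: "k >= 1" using a(3) by simp
 obtain C where C: "!!s. s >= 1 ==> lam (ws s) \<alpha> k <= C * s" using lam_ws_linear_growth[OF a(2) k] by blast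
 have l: "((%s::real. C * s / (1 + s)^2) \<longlongrightarrow> 0) at_top" by real_asymp
 show ?thesis
 proof (rule tendsto_sandwich[OF _ _ tendsto_const l])
  show "\<forall>\<^sub>F s in at_top. 0 <= lam (ws s) \<alpha> k / (1 + s)^2"
   using eventually_ge_at_top[of 1] by eventually_elim (use lam_positive[OF a] in \<open>auto intro!: divide_nonneg_nonneg less_imp_le\<close>)
  show "\<forall>\<^sub>F s in at_top. lam (ws s) \<alpha> k / (1 + s)^2 <= C * s / (1 + s)^2"
   using eventually_ge_at_top[of 1] by eventually_elim (use C in \<open>auto intro!: divide_right_mono\<close>)
 qed
qed

section \<open>Return to the aperture\<close>

lemma sT_continuous: "continuous_on {..<pi} sT"
proof -
 have "continuous_on {..<pi} (%\<Theta>. if \<Theta> <= 0 then - (tanh (\<Theta>/2))\<^sup>2 else (tan (\<Theta>/2))^2)"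
 proof (rule continuous_on_cases_le)
  show "continuous_on {\<Theta> \<in> {..<pi}. \<Theta> <= 0} (%\<Theta>. - (tanh (\<Theta>/2))\<^sup>2)"
   by (intro continuous_intros) (auto simp: cosh_real_nonzero)
  have "cos (\<Theta>/2) ~= 0" if "0 <= \<Theta>" "\<Theta> < pi" for \<Theta> :: real
   using cos_gt_zero_pi[of "\<Theta>/2"] that by simp
  then show "continuous_on {\<Theta> \<in> {..<pi}. 0 <= \<Theta>} (%\<Theta>. (tan (\<Theta>/2))^2)"
   by (intro continuous_intros) auto
 qed auto
 then show ?thesis by (rule continuous_on_eq) (auto simp: sT_def)
qed

lemma sT_strict_mono: assumes "a < b" "b < pi" shows "sT a < sT b"
proof -
 consider "b < 0" | "a < 0" "0 <= b" | "0 <= a" by linarith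
 then show ?thesis
 proof cases
  case 1
  have "\<bar>tanh (b/2)\<bar> < \<bar>tanh (a/2)\<bar>" using 1 assms(1) by simp
  then have "\<bar>tanh (b/2)\<bar>^2 < \<bar>tanh (a/2)\<bar>^2" by (intro power_strict_mono) auto
  then show ?thesis using 1 assms(1) by (simp add: sT_def)
 next
  case 2
  then have "0 < (tanh (a/2))^2" by simp
  moreover have "0 <= (tan (b/2))^2" by simp
  moreover have "sT a = - (tanh (a/2))\<^sup>2" "sT b = (tan (b/2))^2" using 2 by (simp_all add: sT_def)
  ultimately show ?thesis by linarith
 next
  case 3
  have "tan (a/2) < tan (b/2)" using 3 assms by (intro tan_monotone) auto
  moreover have "0 <= tan (a/2)" using 3 assms tan_gt_zero[of "a/2"] by (cases "a = 0") auto
  ultimately have "(tan (a/2))^2 < (tan (b/2))^2" by (intro power_strict_mono) auto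
  then show ?thesis using 3 assms(1) by (simp add: sT_def)
 qed
qed

lemma sT_at_bot: "filterlim sT (at_right (-1)) at_bot"
 unfolding filterlim_at
proof (intro conjI)
 show "\<forall>\<^sub>F \<Theta> in at_bot. sT \<Theta> \<in> {-1<..} \<and> sT \<Theta> ~= -1" using sT_gt by (auto simp: less_imp_neq[THEN not_sym])
 have "((%\<Theta>::real. - (tanh (\<Theta>/2))\<^sup>2) \<longlongrightarrow> - (-1)\<^sup>2) at_bot"
 proof (intro tendsto_intros)
  have "filterlim (%\<Theta>::real. \<Theta> / 2) at_bot at_bot" by real_asymp
  then show "((%\<Theta>::real. tanh (\<Theta>/2)) \<longlongrightarrow> -1) at_bot" by (rule filterlim_compose[OF tanh_real_at_bot])
 qed
 then have "((%\<Theta>::real. - (tanh (\<Theta>/2))\<^sup>2) \<longlongrightarrow> -1) at_bot" by simp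
 moreover have "\<forall>\<^sub>F \<Theta> in at_bot. - (tanh (\<Theta>/2))\<^sup>2 = sT \<Theta>"
  using eventually_gt_at_bot[of 0] by eventually_elim (simp add: sT_def)
 ultimately show "(sT \<longlongrightarrow> -1) at_bot" by (rule Lim_transform_eventually)
qed

lemma sT_at_pi: "filterlim sT at_top (at_left pi)"
proof -
 have "filterlim (%\<Theta>. \<Theta> / 2) (at_left (pi/2)) (at_left pi)"
  unfolding filterlim_at
 proof (intro conjI tendsto_intros)
  show "\<forall>\<^sub>F \<Theta> in at_left pi. \<Theta> / 2 \<in> {..<pi/2} \<and> \<Theta> / 2 ~= pi/2"
   by (auto simp: eventually_at_filter)
 qed auto
 from filterlim_compose[OF filterlim_tan_at_left this] have t: "filterlim (%\<Theta>. tan (\<Theta>/2)) at_top (at_left pi)" .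
 have "filterlim (%\<Theta>. (tan (\<Theta>/2))^2) at_top (at_left pi)" by (rule filterlim_pow_at_top[OF _ t]) simp
 moreover have "\<forall>\<^sub>F \<Theta> in at_left pi. 0 < \<Theta>"
  unfolding eventually_at_left_field by (intro exI[of _ 0]) auto
 then have e: "\<forall>\<^sub>F \<Theta> in at_left pi. (tan (\<Theta>/2))^2 = sT \<Theta>" by eventually_elim (simp add: sT_def)
 ultimately show ?thesis by (simp only: filterlim_cong[OF refl refl e])
qed

text \<open>The target filter is arbitrary, so that finite limits and divergence are covered
  together.\<close>

lemma aperture_filterlim:
 assumes eq: "!!\<Theta>. \<Theta> < pi ==> H \<Theta> = h (sT \<Theta>)"
 shows "filterlim h L (at_right (-1)) ==> filterlim H L at_bot" "filterlim h L at_top ==> filterlim H L (at_left pi)"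
proof -
 have e: "\<forall>\<^sub>F \<Theta> in at_bot. h (sT \<Theta>) = H \<Theta>" "\<forall>\<^sub>F \<Theta> in at_left pi. h (sT \<Theta>) = H \<Theta>"
  using eq unfolding eventually_at_bot_dense by (auto simp: eventually_at_filter intro!: exI[of _ pi])
 show "filterlim h L (at_right (-1)) ==> filterlim H L at_bot"
  unfolding filterlim_cong[OF refl refl e(1), symmetric] by (rule filterlim_compose[OF _ sT_at_bot])
 show "filterlim h L at_top ==> filterlim H L (at_left pi)"
  unfolding filterlim_cong[OF refl refl e(2), symmetric] by (rule filterlim_compose[OF _ sT_at_pi])
qed

lemma aperture_continuous:
 assumes "!!\<Theta>. \<Theta> < pi ==> H \<Theta> = h (sT \<Theta>)" "!!s. s > -1 ==> isCont h s"
 shows "continuous_on {..<pi} H"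
proof -
 have "continuous_on {-1<..} h" using assms(2) by (intro continuous_at_imp_continuous_on) auto
 then have "continuous_on {..<pi} (%\<Theta>. h (sT \<Theta>))" by (rule continuous_on_compose2[OF _ sT_continuous]) (auto simp: sT_gt)
 then show ?thesis by (rule continuous_on_eq) (use assms(1) in auto)
qed

theorem theorem1p2:
  fixes k m :: nat and \<alpha> :: real
  assumes "k \<ge> 1"
    and "\<alpha> \<in> {- real m - 1 ..< - real m}"
  shows
    "((k \<le> 2*m + 1 \<longrightarrow>
         (\<forall>\<Theta><pi. F_fun k \<alpha> \<Theta> < 0) \<and>
         continuous_on {..<pi} (F_fun k \<alpha>) \<and>
         strict_antimono_on {..<pi} (F_fun k \<alpha>) \<and>
         (F_fun k \<alpha> \<longlongrightarrow> 0) at_bot \<and>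
         filterlim (F_fun k \<alpha>) at_bot (at_left pi)) \<and>
      (k \<in> {2*m + 2, 2*m + 3} \<and> \<alpha> = - real m - 1 \<longrightarrow>
         (\<forall>\<Theta><pi. scaled_lambda k \<alpha> \<Theta> = 0 \<and> F_fun k \<alpha> \<Theta> = 0)) \<and>
      (\<not> k \<le> 2*m + 1 \<and> \<not> (k \<in> {2*m + 2, 2*m + 3} \<and> \<alpha> = - real m - 1) \<longrightarrow>
         (\<forall>\<Theta><pi. scaled_lambda k \<alpha> \<Theta> > 0) \<and>
         continuous_on {..<pi} (F_fun k \<alpha>) \<and>
         strict_mono_on {..<pi} (F_fun k \<alpha>) \<and>
         (F_fun k \<alpha> \<longlongrightarrow> 0) at_bot \<and>
         filterlim (F_fun k \<alpha>) at_top (at_left pi)))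
     \<and>
     ((k \<le> 2*m + 1 \<longrightarrow>
         (\<forall>\<Theta><pi. G_fun k \<alpha> \<Theta> < 0) \<and>
         continuous_on {..<pi} (G_fun k \<alpha>) \<and>
         strict_mono_on {..<pi} (G_fun k \<alpha>) \<and>
         filterlim (G_fun k \<alpha>) at_bot at_bot \<and>
         robin_count_ge flat_metric (- cball 0 1) 1 \<alpha> {..<0} k \<and>
         (G_fun k \<alpha> \<longlongrightarrow> lambda_ext k \<alpha>) (at_left pi)) \<and>
      (k \<in> {2*m + 2, 2*m + 3} \<and> \<alpha> = - real m - 1 \<longrightarrow>
         (\<forall>\<Theta><pi. scaled_lambda k \<alpha> \<Theta> = 0 \<and> G_fun k \<alpha> \<Theta> = 0)) \<and>
      (\<not> k \<le> 2*m + 1 \<and> \<not> (k \<in> {2*m + 2, 2*m + 3} \<and> \<alpha> = - real m - 1) \<longrightarrow>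
         (\<forall>\<Theta><pi. scaled_lambda k \<alpha> \<Theta> > 0) \<and>
         continuous_on {..<pi} (G_fun k \<alpha>) \<and>
         strict_antimono_on {..<pi} (G_fun k \<alpha>) \<and>
         filterlim (G_fun k \<alpha>) at_top at_bot \<and>
         (G_fun k \<alpha> \<longlongrightarrow> 0) (at_left pi)))"
proof -
 \<comment> \<open>The pattern picks the conclusions for negative and for positive eigenvalues out
   of the goal, so that they can be cited below.\<close>
 let "((_ --> ?NF) \<and> _ \<and> (_ --> ?PF)) \<and> ((_ --> ?NG) \<and> _ \<and> (_ --> ?PG))" = ?thesis
 have k: "k >= 1" and \<alpha>: "- real m - 1 <= \<alpha>" "\<alpha> < - real m" using assms by auto
 have \<alpha>0: "\<alpha> < 0" "\<alpha> ~= 0" using \<alpha> by auto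
 define f where "f s = lam (ws s) \<alpha> k" for s
 define g where "g s = f s / (1 + s)^2" for s
 note FG = F_G_lam[OF \<alpha>0(2) k, folded f_def, folded g_def]
 note lf = aperture_filterlim[of "F_fun k \<alpha>" f, OF FG(1)] and lg = aperture_filterlim[of "G_fun k \<alpha>" g, OF FG(2)]
 have mono: "sT a < sT b" "-1 < sT a" "-1 < sT b" if "a < b" "b < pi" for a b using sT_strict_mono[OF that] sT_gt by auto
 note st = lam_strict[OF \<alpha>0(2) k, folded f_def, folded g_def]
 have cont: "continuous_on {..<pi} (F_fun k \<alpha>)" "continuous_on {..<pi} (G_fun k \<alpha>)" if "(\<forall>s>-1. f s < 0) \<or> (\<forall>s>-1. f s > 0)"
 proof -
  have c: "isCont f s" if "s > -1" for s
   using lam_isCont[OF \<alpha>0(2) k that] \<open>(\<forall>s>-1. f s < 0) \<or> (\<forall>s>-1. f s > 0)\<close> unfolding f_def[abs_def] .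
  show "continuous_on {..<pi} (F_fun k \<alpha>)" by (rule aperture_continuous[of _ f]) (use FG(1) c in auto)
  have "isCont g s" if "s > -1" for s unfolding g_def[abs_def] using that by (intro continuous_intros c) auto
  then show "continuous_on {..<pi} (G_fun k \<alpha>)" by (intro aperture_continuous[of _ g]) (use FG(2) in auto)
 qed
 have gsgn: "f s < 0 ==> g s < 0" if "s > -1" for s using that by (simp add: g_def divide_neg_pos)
 have f0: "(f \<longlongrightarrow> 0) (at_right (-1))" unfolding f_def[abs_def] by (rule lam_tendsto_minus1[OF \<alpha>0(1) k])
 have neg: "?NF"
  "?NG" if km: "k <= 2 * m + 1"
 proof -
  have n: "f s < 0" if "s > -1" for s unfolding f_def by (rule lam_negative[OF k km \<alpha>(2) that])
  have "strict_antimono_on {..<pi} (F_fun k \<alpha>)"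
   by (rule monotone_onI) (use FG(1) st(1)[OF mono(2,1)] n[OF mono(2)] in auto)
  moreover have "strict_mono_on {..<pi} (G_fun k \<alpha>)"
   by (rule monotone_onI) (use FG(2) st(2)[OF mono(2,1)] n[OF mono(3)] in auto)
  moreover have "filterlim f at_bot at_top" unfolding f_def[abs_def] by (rule f_negative_infinity[OF k km \<alpha>(2)])
  moreover have "filterlim g at_bot (at_right (-1))" unfolding g_def[abs_def] f_def by (rule g_negative_minus1[OF k km \<alpha>(2)])
  moreover have "(g \<longlongrightarrow> lambda_ext k \<alpha>) at_top" unfolding g_def[abs_def] f_def by (rule lam_ws_tendsto_ext[OF k km \<alpha>(2)])
  \<comment> \<open>The existence of \<open>k\<close> negative exterior eigenvalues, without which
    the \<open>LEAST\<close> in \<open>lambda_ext\<close> would have no meaning.\<close>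
  moreover have "robin_count_ge flat_metric (- cball 0 1) 1 \<alpha> {..<0} k"
   by (rule lambda_ext_spec(1)[OF \<alpha>0(2) k tstX_negative[OF k km \<alpha>(2)]])
  ultimately show "?NF"
   "?NG"
   using lf lg f0 FG(1,2) n[OF sT_gt] gsgn[OF sT_gt] cont n by auto
 qed
 have zero: "\<forall>\<Theta><pi. scaled_lambda k \<alpha> \<Theta> = 0 \<and> F_fun k \<alpha> \<Theta> = 0 \<and> G_fun k \<alpha> \<Theta> = 0"
  if z: "k \<in> {2*m + 2, 2*m + 3}" "\<alpha> = - real m - 1"
 proof (intro allI impI)
  fix \<Theta> assume t: "\<Theta> < pi"
  have "f (sT \<Theta>) = 0" unfolding f_def by (rule lam_zero[OF z(2) _ _ sT_gt]) (use z(1) in auto)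
  then show "scaled_lambda k \<alpha> \<Theta> = 0 \<and> F_fun k \<alpha> \<Theta> = 0 \<and> G_fun k \<alpha> \<Theta> = 0"
   using FG[OF t] by (simp add: g_def sgn_zero_iff)
 qed
 have pos: "?PF"
  "?PG"
  if p: "\<not> k <= 2*m + 1" "\<not> (k \<in> {2*m + 2, 2*m + 3} \<and> \<alpha> = - real m - 1)"
 proof -
  have a: "2 * m + 2 <= k" "\<not> (k <= 2 * m + 3 \<and> \<alpha> = - real m - 1)" using p by auto
  have n: "f s > 0" if "s > -1" for s unfolding f_def by (rule lam_positive[OF \<alpha>(1) \<alpha>0(1) a that])
  have "scaled_lambda k \<alpha> \<Theta> > 0" if "\<Theta> < pi" for \<Theta>
   using FG(3)[OF that] n[OF sT_gt[of \<Theta>]] by (simp add: sgn_1_pos)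
  moreover have "strict_mono_on {..<pi} (F_fun k \<alpha>)"
   by (rule monotone_onI) (use FG(1) st(3)[OF mono(2,1)] n[OF mono(3)] in auto)
  moreover have "strict_antimono_on {..<pi} (G_fun k \<alpha>)"
   by (rule monotone_onI) (use FG(2) st(4)[OF mono(2,1)] n[OF mono(2)] in auto)
  moreover have "filterlim f at_top at_top" unfolding f_def[abs_def] by (rule positive_limits(2)[OF \<alpha>(1) \<alpha>0(1) a])
  moreover have "filterlim g at_top (at_right (-1))" unfolding g_def[abs_def] f_def by (rule positive_limits(1)[OF \<alpha>(1) \<alpha>0(1) a])
  moreover have "(g \<longlongrightarrow> 0) at_top" unfolding g_def[abs_def] f_def by (rule g_positive_infinity[OF \<alpha>(1) \<alpha>0(1) a])
  ultimately show "?PF"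
   "?PG"
   using lf lg f0 cont n by auto
 qed
 show ?thesis
 proof (intro conjI[of "_ \<and> _ \<and> _" "_ \<and> _ \<and> _"] conjI[of "_ --> _"] impI)
 qed (use neg pos zero in \<open>blast+\<close>)
qed

end
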